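(* Let $T>0$, let $X_0\in(0,r)$ be deterministic, and suppose that the functions $\sigma,b,h,g$ satisfy the following conditions. (1) $h\in\mathcal H\cap C^4((0,r),(0,\infty))$ and there are constants $K_h$ and $p\in[0,\frac12]$ such that $\frac{|h^{(k)}|}{h}<\frac{K_h}{h^{p+k-2}}$ on $(0,r)$ for $k\in\{2,3,4\}$. (2) $\sigma\in C^2_b((0,r),(0,\infty))$ is bounded away from $0$. (3) $b\in C^2_b((0,r),\mathbb R)$. (4) $g\in C((0,r),\mathbb R)$ is of polynomial growth with $g(0)=0$ (and $g(r)=0$ if $r<\infty$). (5) The function $v$ defined for $t\in[0,T]$, $x\in(0,r)$ by $$v(T-t,x):=E^{h,x}\left[\frac{g(X_t)}{h(X_t)}\exp\left(\int_0^t\sigma^2(X_s)\Big\{b(X_s)+\frac{h''(X_s)}{2h(X_s)}\Big\}ds\right)\right]$$ is of class $C^{1,4}$ (once continuously differentiable in $t$, four times in $x$), satisfies $$v_t+\frac{\sigma^2}{2}v_{xx}+\sigma^2\frac{h'}{h}v_x=-\sigma^2 v\Big(b+\frac{h''}{2h}\Big),$$ and, for some constant $K_v$ and some integer $m\ge 0$, $$\sup_{t\le T}\Big|\frac{\partial^k}{\partial x^k}v_t(t,x)\Big|+\sup_{t\le T}\Big|\frac{\partial^k}{\partial x^k}v(t,x)\Big|\le K_v(1+x^m)h^{2-p-k}(x),\qquad k\in\{1,2\},\ x\in(0,r).$$ For an integer $N>1$ let $\widehat X$ be the backward Euler–Maruyama (BEM) scheme with $N$ steps on $[0,T]$ associated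 with $h$, started at $X_0$, with grid $t_n=nT/N$, and set $$e(N):=\frac{g(X_T)}{h(X_T)}\exp\left(\int_0^T\sigma^2(X_t)\Big\{b(X_t)+\frac{h''(X_t)}{2h(X_t)}\Big\}dt\right)-\frac{g(\widehat X_T)}{h(\widehat X_T)}\exp\left(\sum_{n=0}^{N-1}\frac TN\sigma^2(\widehat X_{t_n})\Big\{b(\widehat X_{t_n})+\frac{h''(\widehat X_{t_n})}{2h(\widehat X_{t_n})}\Big\}\right).$$ Then there is a constant $K$ independent of $N$ such that $$\big|E^{h,X_0}[e(N)]\big|\le\frac{KT}{N}.$$
   Context: Standing setting. Let $r\in(0,\infty]$. Under $P^x$, $X$ is a regular one-dimensional diffusion on $(0,r)$ with $X_0=x$ and $X_t=X_0+\int_0^t\sigma(X_s)dB_s$ for $t<\zeta$, $B$ a Brownian motion, killed at $\zeta=\inf\{t>0:X_t\notin(0,r)\}$. Standing assumptions: $\sigma:(0,r)\to(0,\infty)$ is continuously differentiable with bounded derivative; $\sigma(0+)$ exists and is finite, and so does $\sigma(r-)$ if $r<\infty$; $P^x(\zeta<\infty)>0$ for all $x\in(0,r)$; the boundary $0$ is accessible (reached in finite time with positive probability). Speed measure: $m(dx)=2\sigma^{-2}(x)dx$. Potential density: $u(x,y)=(x\wedge y)(1-\frac{x\vee y}{r})$ if $r<\infty$, $u(x,y)=x\wedge y$ if $r=\infty$. $\mathcal H_0$ is the set of functions $h(x)=\int_{(0,r)}u(x,y)f(y)m(dy)$, where $f:(0,r)\to(0,\infty)$ is continuous with $\int_{(0,r)}f\,dm<\infty$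 and $\int_{(0,r)}yf(y)m(dy)<\infty$; such $h$ is concave, $C^2$, and $\frac12\sigma^2h''=-f$. If $r<\infty$, $\mathcal H:=\mathcal H_0$; if $r=\infty$, $\mathcal H:=\mathcal H_0\cup\{x\mapsto x\}$. For $h\in\mathcal H$ and $x\in(0,r)$, $Q^{h,x}$ (with expectation $E^{h,x}$) is the probability measure under which $X_0=x$, $X$ stays in $(0,r)$ for all times, and $dX_t=\sigma(X_t)dW_t+\sigma^2(X_t)\frac{h'(X_t)}{h(X_t)}dt$, with $W$ a $Q^{h,x}$-Brownian motion with respect to the filtration $(\mathcal F_t)$. BEM scheme: for an integer $N>1$, $t_n:=nT/N$, $\widehat X_0=X_0$, and for $n=0,\dots,N-1$ and $t\in(t_n,t_{n+1}]$, $\widehat X_t\in(0,r)$ is the unique solution of $$\widehat X_t=\widehat X_{t_n}+\sigma(\widehat X_{t_n})(W_t-W_{t_n})+(t-t_n)\sigma^2(\widehat X_{t_n})\frac{h'(\widehat X_t)}{h(\widehat X_t)}$$ (unique solvability holds because for every $z>0$ the map $x\mapsto x-z\,h'(x)/h(x)$ is a strictly increasing bijection from $(0,r)$ onto $\mathbb R$). $C^k_b$ denotes $C^k$ functions that are bounded together with their derivatives up to order $k$. Boundary values such as $g(0)$, $g(r)$ are understood as limits. *)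

theory Defs
  imports "HOL-Probability.Probability"
begin

section \<open>Function spaces on the state interval\<close>

text \<open>The right end point \<open>r\<close> ranges over \<open>(0, \<infinity>]\<close>. Functions on the state interval are total
  functions \<open>real \<Rightarrow> real\<close> about which nothing is assumed outside the interval.\<close>

definition ival :: "ereal \<Rightarrow> real set" where
  "ival r = {x. 0 < x \<and> ereal x < r}"

text \<open>For open \<open>S\<close>, \<open>(deriv ^^ j) f\<close> is on \<open>S\<close> the classical \<open>j\<close>-th derivative of \<open>f\<close>.\<close>

definition Ck_on :: "nat \<Rightarrow> real set \<Rightarrow> (real \<Rightarrow> real) \<Rightarrow> bool" where
  "Ck_on k S f \<longleftrightarrow>
     (\<forall>j<k. (deriv ^^ j) f differentiable_on S) \<and>
     (\<forall>j\<le>k. continuous_on S ((deriv ^^ j) f))"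

definition Ckb_on :: "nat \<Rightarrow> real set \<Rightarrow> (real \<Rightarrow> real) \<Rightarrow> bool" where
  "Ckb_on k S f \<longleftrightarrow> Ck_on k S f \<and> (\<forall>j\<le>k. bounded ((deriv ^^ j) f ` S))"

definition poly_growth_on :: "real set \<Rightarrow> (real \<Rightarrow> real) \<Rightarrow> bool" where
  "poly_growth_on S g \<longleftrightarrow> (\<exists>C. \<exists>q::nat. \<forall>x\<in>S. \<bar>g x\<bar> \<le> C * (1 + x ^ q))"

text \<open>\<open>v\<close> is of class \<open>C\<^sup>1\<^sup>,\<^sup>4\<close> on \<open>[0,T] \<times> S\<close> with time derivative \<open>vt\<close>
  (one-sided at the end points of \<open>[0,T]\<close>).\<close>

definition C14_on :: "real \<Rightarrow> real set \<Rightarrow> (real \<Rightarrow> real \<Rightarrow> real) \<Rightarrow> (real \<Rightarrow> real \<Rightarrow> real) \<Rightarrow> bool" where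
  "C14_on T S v vt \<longleftrightarrow>
     (\<forall>t\<in>{0..T}. \<forall>x\<in>S. ((\<lambda>s. v s x) has_real_derivative vt t x) (at t within {0..T})) \<and>
     continuous_on ({0..T} \<times> S) (\<lambda>(t, x). vt t x) \<and>
     (\<forall>t\<in>{0..T}. \<forall>j<4. (deriv ^^ j) (v t) differentiable_on S) \<and>
     (\<forall>j\<le>4. continuous_on ({0..T} \<times> S) (\<lambda>(t, x). (deriv ^^ j) (v t) x))"


section \<open>Brownian motion and the Ito integral\<close>

text \<open>Processes are indexed by \<open>real\<close>; only times \<open>t \<ge> 0\<close> matter.\<close>

definition brownian_motion :: "'w measure \<Rightarrow> (real \<Rightarrow> 'w measure) \<Rightarrow> (real \<Rightarrow> 'w \<Rightarrow> real) \<Rightarrow> bool" where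
  "brownian_motion M F W \<longleftrightarrow>
     (\<forall>t\<ge>0. W t \<in> borel_measurable (F t)) \<and>
     (AE \<omega> in M. W 0 \<omega> = 0) \<and>
     (AE \<omega> in M. continuous_on {0..} (\<lambda>t. W t \<omega>)) \<and>
     (\<forall>s t. 0 \<le> s \<and> s < t \<longrightarrow>
        distributed M lborel (\<lambda>\<omega>. W t \<omega> - W s \<omega>)
          (\<lambda>x. ennreal (normal_density 0 (sqrt (t - s)) x)) \<and>
        prob_space.indep_set M (sets (F s))
          (sets (vimage_algebra (space M) (\<lambda>\<omega>. W t \<omega> - W s \<omega>) borel)))"

text \<open>Simple predictable integrands \<open>\<Sum>i<n. \<xi> i * indicator {\<tau> i<..\<tau> (Suc i)}\<close> and their integrals.\<close>

definition simple_integrand ::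
  "(real \<Rightarrow> 'w measure) \<Rightarrow> nat \<Rightarrow> (nat \<Rightarrow> real) \<Rightarrow> (nat \<Rightarrow> 'w \<Rightarrow> real) \<Rightarrow> bool" where
  "simple_integrand F n \<tau> \<xi> \<longleftrightarrow>
     0 \<le> \<tau> 0 \<and>
     (\<forall>i<n. \<tau> i \<le> \<tau> (Suc i) \<and> \<xi> i \<in> borel_measurable (F (\<tau> i)) \<and>
        (\<exists>C. \<forall>\<omega>\<in>space (F (\<tau> i)). \<bar>\<xi> i \<omega>\<bar> \<le> C))"

definition simple_value :: "nat \<Rightarrow> (nat \<Rightarrow> real) \<Rightarrow> (nat \<Rightarrow> 'w \<Rightarrow> real) \<Rightarrow> real \<Rightarrow> 'w \<Rightarrow> real" where
  "simple_value n \<tau> \<xi> s \<omega> = (\<Sum>i<n. \<xi> i \<omega> * indicator {\<tau> i<..\<tau> (Suc i)} s)"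

definition simple_integral ::
  "(real \<Rightarrow> 'w \<Rightarrow> real) \<Rightarrow> nat \<Rightarrow> (nat \<Rightarrow> real) \<Rightarrow> (nat \<Rightarrow> 'w \<Rightarrow> real) \<Rightarrow> real \<Rightarrow> 'w \<Rightarrow> real" where
  "simple_integral W n \<tau> \<xi> t \<omega> =
     (\<Sum>i<n. \<xi> i \<omega> * (W (min t (\<tau> (Suc i))) \<omega> - W (min t (\<tau> i)) \<omega>))"

text \<open>\<open>I\<close> is (a version with continuous paths of) the stochastic integral \<open>\<integral>\<^sub>0 H dW\<close> of the
  progressively measurable process \<open>H\<close>: for simple processes \<open>H\<^sub>k\<close> with
  \<open>\<integral>\<^sub>0\<^sup>t (H\<^sub>k - H)\<^sup>2 ds \<longrightarrow> 0\<close> in probability, \<open>\<integral>\<^sub>0\<^sup>t H\<^sub>k dW \<longrightarrow> I\<^sub>t\<close> in probability, for all \<open>t\<close>.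
  As simple processes are bounded, this entails \<open>\<integral>\<^sub>0\<^sup>t H\<^sup>2 ds < \<infinity>\<close> almost surely; and the limit
  does not depend on the approximating sequence.\<close>

definition has_ito_integral ::
  "'w measure \<Rightarrow> (real \<Rightarrow> 'w measure) \<Rightarrow> (real \<Rightarrow> 'w \<Rightarrow> real) \<Rightarrow> (real \<Rightarrow> 'w \<Rightarrow> real) \<Rightarrow>
   (real \<Rightarrow> 'w \<Rightarrow> real) \<Rightarrow> bool" where
  "has_ito_integral M F W H I \<longleftrightarrow>
     (\<forall>t\<ge>0. (\<lambda>(s, \<omega>). H s \<omega>) \<in> borel_measurable (restrict_space borel {0..t} \<Otimes>\<^sub>M F t)) \<and>
     (\<forall>t\<ge>0. I t \<in> borel_measurable M) \<and>
     (AE \<omega> in M. continuous_on {0..} (\<lambda>t. I t \<omega>)) \<and>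
     (\<exists>n \<tau> \<xi>. (\<forall>k::nat. simple_integrand F (n k) (\<tau> k) (\<xi> k)) \<and>
        (\<forall>t\<ge>0. \<forall>\<epsilon>>0.
           (\<lambda>k. measure M {\<omega> \<in> space M. ennreal \<epsilon> <
              (\<integral>\<^sup>+s\<in>{0..t}. ennreal ((simple_value (n k) (\<tau> k) (\<xi> k) s \<omega> - H s \<omega>)\<^sup>2) \<partial>lborel)})
             \<longlonglongrightarrow> 0 \<and>
           (\<lambda>k. measure M {\<omega> \<in> space M.
              \<epsilon> < \<bar>simple_integral W (n k) (\<tau> k) (\<xi> k) t \<omega> - I t \<omega>\<bar>})
             \<longlonglongrightarrow> 0))"


section \<open>The diffusion, its lifetime, and the standing assumptions\<close>

text \<open>Paths are killed on leaving \<open>(0,r)\<close>. The cemetery is encoded by the boundary point through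
  which the path leaves: paths are continuous on \<open>[0,\<infinity>)\<close> and frozen from the exit time on.
  (When \<open>r = \<infinity>\<close>, the growth of \<open>\<sigma>\<close> is at most linear and there is no explosion.)\<close>

definition path_space ::
  "ereal \<Rightarrow> 'w set \<Rightarrow> (real \<Rightarrow> 'w measure) \<Rightarrow> (real \<Rightarrow> 'w \<Rightarrow> real) \<Rightarrow> bool" where
  "path_space r \<Omega> F X \<longleftrightarrow>
     filtration \<Omega> F \<and>
     (\<forall>t\<ge>0. X t \<in> borel_measurable (F t)) \<and>
     (\<forall>\<omega>\<in>\<Omega>. continuous_on {0..} (\<lambda>t. X t \<omega>) \<and>
        (\<forall>t\<ge>0. X t \<omega> \<notin> ival r \<longrightarrow> (\<forall>s\<ge>t. X s \<omega> = X t \<omega>)))"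

definition lifetime :: "ereal \<Rightarrow> (real \<Rightarrow> 'w \<Rightarrow> real) \<Rightarrow> 'w \<Rightarrow> ereal" where
  "lifetime r X \<omega> = Inf {ereal t | t. 0 < t \<and> X t \<omega> \<notin> ival r}"

text \<open>The integrand \<open>\<sigma>(X\<^sub>s)\<close>, which is only meaningful while the path is alive.\<close>

definition alive_coeff ::
  "ereal \<Rightarrow> (real \<Rightarrow> real) \<Rightarrow> (real \<Rightarrow> 'w \<Rightarrow> real) \<Rightarrow> real \<Rightarrow> 'w \<Rightarrow> real" where
  "alive_coeff r \<sigma> X s \<omega> = (if X s \<omega> \<in> ival r then \<sigma> (X s \<omega>) else 0)"

definition filtered_prob :: "'w measure \<Rightarrow> 'w set \<Rightarrow> (real \<Rightarrow> 'w measure) \<Rightarrow> bool" where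
  "filtered_prob M \<Omega> F \<longleftrightarrow> prob_space M \<and> space M = \<Omega> \<and> (\<forall>t. subalgebra M (F t))"

text \<open>\<open>M\<close> plays the role of \<open>P\<^sup>x\<close>.\<close>

definition killed_diffusion ::
  "ereal \<Rightarrow> (real \<Rightarrow> real) \<Rightarrow> real \<Rightarrow> 'w set \<Rightarrow> (real \<Rightarrow> 'w measure) \<Rightarrow> (real \<Rightarrow> 'w \<Rightarrow> real) \<Rightarrow>
   'w measure \<Rightarrow> (real \<Rightarrow> 'w \<Rightarrow> real) \<Rightarrow> bool" where
  "killed_diffusion r \<sigma> x \<Omega> F X M B \<longleftrightarrow>
     filtered_prob M \<Omega> F \<and> brownian_motion M F B \<and>
     (AE \<omega> in M. X 0 \<omega> = x) \<and>
     (\<exists>I. has_ito_integral M F B (alive_coeff r \<sigma> X) I \<and>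
        (AE \<omega> in M. \<forall>t\<ge>0. ereal t < lifetime r X \<omega> \<longrightarrow> X t \<omega> = X 0 \<omega> + I t \<omega>))"

definition standing_setting ::
  "ereal \<Rightarrow> (real \<Rightarrow> real) \<Rightarrow> 'w set \<Rightarrow> (real \<Rightarrow> 'w measure) \<Rightarrow> (real \<Rightarrow> 'w \<Rightarrow> real) \<Rightarrow>
   (real \<Rightarrow> 'w measure) \<Rightarrow> (real \<Rightarrow> real \<Rightarrow> 'w \<Rightarrow> real) \<Rightarrow> bool" where
  "standing_setting r \<sigma> \<Omega> F X P B \<longleftrightarrow>
     0 < r \<and>
     (\<forall>x\<in>ival r. 0 < \<sigma> x) \<and> Ck_on 1 (ival r) \<sigma> \<and> bounded (deriv \<sigma> ` ival r) \<and>
     (\<exists>L. (\<sigma> \<longlongrightarrow> L) (at_right 0)) \<and>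
     (r < \<infinity> \<longrightarrow> (\<exists>L. (\<sigma> \<longlongrightarrow> L) (at_left (real_of_ereal r)))) \<and>
     path_space r \<Omega> F X \<and>
     (\<forall>x\<in>ival r. killed_diffusion r \<sigma> x \<Omega> F X (P x) (B x)) \<and>
     \<comment> \<open>regularity: every state is reached from every state\<close>
     (\<forall>x\<in>ival r. \<forall>y\<in>ival r. 0 < measure (P x) {\<omega>\<in>\<Omega>. \<exists>t\<ge>0. X t \<omega> = y}) \<and>
     (\<forall>x\<in>ival r. 0 < measure (P x) {\<omega>\<in>\<Omega>. lifetime r X \<omega> < \<infinity>}) \<and>
     \<comment> \<open>the boundary point \<open>0\<close> is accessible\<close>
     (\<forall>x\<in>ival r. 0 < measure (P x) {\<omega>\<in>\<Omega>. \<exists>t\<ge>0. X t \<omega> = 0})"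


section \<open>The class \<open>\<H>\<close> and the measures \<open>Q\<close>\<close>

definition speed_measure :: "ereal \<Rightarrow> (real \<Rightarrow> real) \<Rightarrow> real measure" where
  "speed_measure r \<sigma> = density lborel (\<lambda>x. ennreal (2 / (\<sigma> x)\<^sup>2) * indicator (ival r) x)"

definition potential_density :: "ereal \<Rightarrow> real \<Rightarrow> real \<Rightarrow> real" where
  "potential_density r x y =
     (if r = \<infinity> then min x y else min x y * (1 - max x y / real_of_ereal r))"

definition class_H0 :: "ereal \<Rightarrow> (real \<Rightarrow> real) \<Rightarrow> (real \<Rightarrow> real) \<Rightarrow> bool" where
  "class_H0 r \<sigma> h \<longleftrightarrow>
     (\<exists>f. continuous_on (ival r) f \<and> (\<forall>y\<in>ival r. 0 < f y) \<and>
        set_integrable (speed_measure r \<sigma>) (ival r) f \<and>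
        set_integrable (speed_measure r \<sigma>) (ival r) (\<lambda>y. y * f y) \<and>
        (\<forall>x\<in>ival r. h x = (LINT y:ival r|speed_measure r \<sigma>. potential_density r x y * f y)))"

definition class_H :: "ereal \<Rightarrow> (real \<Rightarrow> real) \<Rightarrow> (real \<Rightarrow> real) \<Rightarrow> bool" where
  "class_H r \<sigma> h \<longleftrightarrow> class_H0 r \<sigma> h \<or> (r = \<infinity> \<and> (\<forall>x\<in>ival r. h x = x))"

text \<open>\<open>M\<close> plays the role of \<open>Q\<^sup>h\<^sup>,\<^sup>x\<close>. Completeness of \<open>M\<close> (which does not affect the filtration)
  makes random variables that are only specified on the almost sure event that the path stays
  in \<open>(0,r)\<close> measurable.\<close>

definition transformed_diffusion ::
  "ereal \<Rightarrow> (real \<Rightarrow> real) \<Rightarrow> (real \<Rightarrow> real) \<Rightarrow> real \<Rightarrow> 'w set \<Rightarrow> (real \<Rightarrow> 'w measure) \<Rightarrow>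
   (real \<Rightarrow> 'w \<Rightarrow> real) \<Rightarrow> 'w measure \<Rightarrow> (real \<Rightarrow> 'w \<Rightarrow> real) \<Rightarrow> bool" where
  "transformed_diffusion r \<sigma> h x \<Omega> F X M W \<longleftrightarrow>
     filtered_prob M \<Omega> F \<and> complete_measure M \<and> brownian_motion M F W \<and>
     (AE \<omega> in M. X 0 \<omega> = x) \<and>
     (AE \<omega> in M. \<forall>t\<ge>0. X t \<omega> \<in> ival r) \<and>
     (\<exists>I. has_ito_integral M F W (alive_coeff r \<sigma> X) I \<and>
        (AE \<omega> in M. \<forall>t\<ge>0. X t \<omega> = X 0 \<omega> + I t \<omega> +
           (LBINT s:{0..t}. (\<sigma> (X s \<omega>))\<^sup>2 * (deriv h (X s \<omega>) / h (X s \<omega>)))))"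


section \<open>The backward Euler--Maruyama scheme\<close>

text \<open>One implicit step from \<open>y\<close> over a time \<open>s\<close> with Brownian increment \<open>d\<close>.\<close>

definition bem_step :: "ereal \<Rightarrow> (real \<Rightarrow> real) \<Rightarrow> (real \<Rightarrow> real) \<Rightarrow> real \<Rightarrow> real \<Rightarrow> real \<Rightarrow> real" where
  "bem_step r \<sigma> h y d s =
     (THE x. x \<in> ival r \<and> x = y + \<sigma> y * d + s * (\<sigma> y)\<^sup>2 * (deriv h x / h x))"

primrec bem_grid ::
  "ereal \<Rightarrow> (real \<Rightarrow> real) \<Rightarrow> (real \<Rightarrow> real) \<Rightarrow> real \<Rightarrow> nat \<Rightarrow> real \<Rightarrow> (real \<Rightarrow> real) \<Rightarrow> nat \<Rightarrow> real" where
  "bem_grid r \<sigma> h T N x0 w 0 = x0"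
| "bem_grid r \<sigma> h T N x0 w (Suc n) =
     bem_step r \<sigma> h (bem_grid r \<sigma> h T N x0 w n)
       (w (real (Suc n) * T / real N) - w (real n * T / real N))
       (real (Suc n) * T / real N - real n * T / real N)"

text \<open>The scheme in continuous time, driven by the path \<open>w\<close>. For \<open>t > 0\<close> the index \<open>n\<close> is the one
  with \<open>t\<^sub>n < t \<le> t\<^sub>n\<^sub>+\<^sub>1\<close>; the two lemmas below recover the recursion.\<close>

definition bem ::
  "ereal \<Rightarrow> (real \<Rightarrow> real) \<Rightarrow> (real \<Rightarrow> real) \<Rightarrow> real \<Rightarrow> nat \<Rightarrow> real \<Rightarrow> (real \<Rightarrow> real) \<Rightarrow> real \<Rightarrow> real" where
  "bem r \<sigma> h T N x0 w t =
     (if t \<le> 0 then x0 else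
        let n = nat (\<lceil>t * real N / T\<rceil> - 1); tn = real n * T / real N
        in bem_step r \<sigma> h (bem_grid r \<sigma> h T N x0 w n) (w t - w tn) (t - tn))"

lemma bem_at_grid:
  assumes "0 < T" "0 < N"
  shows "bem r \<sigma> h T N x0 w (real n * T / real N) = bem_grid r \<sigma> h T N x0 w n"
proof (cases n)
  case 0
  then show ?thesis by (simp add: bem_def)
next
  case (Suc k)
  have "\<lceil>real (Suc k) * T / real N * real N / T\<rceil> = int (Suc k)"
    using assms by (simp del: of_nat_Suc)
  then have "nat (\<lceil>real (Suc k) * T / real N * real N / T\<rceil> - 1) = k" by simp
  moreover have "\<not> real (Suc k) * T / real N \<le> 0"
    using assms by (simp add: not_le del: of_nat_Suc)
  ultimately show ?thesis
    unfolding Suc bem_def Let_def by (simp del: of_nat_Suc)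
qed

lemma bem_between_grid:
  assumes "0 < T" "0 < N"
    and t: "real n * T / real N < t" "t \<le> real (Suc n) * T / real N"
  shows "bem r \<sigma> h T N x0 w t =
    bem_step r \<sigma> h (bem r \<sigma> h T N x0 w (real n * T / real N))
      (w t - w (real n * T / real N)) (t - real n * T / real N)"
proof -
  have "real n < t * real N / T" "t * real N / T \<le> real (Suc n)"
    using assms by (simp_all add: field_simps)
  then have "\<lceil>t * real N / T\<rceil> = int (Suc n)"
    by (intro ceiling_unique) auto
  then have "nat (\<lceil>t * real N / T\<rceil> - 1) = n" by simp
  moreover have "0 < t"
    by (rule order.strict_trans1[OF _ t(1)]) (use assms in simp)
  ultimately show ?thesis
    using bem_at_grid[OF assms(1,2), of r \<sigma> h x0 w n] unfolding bem_def[of r \<sigma> h T N x0 w t]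
    by (simp add: Let_def)
qed


section \<open>The Feynman--Kac functional and its discretisation\<close>

definition fk_rate :: "(real \<Rightarrow> real) \<Rightarrow> (real \<Rightarrow> real) \<Rightarrow> (real \<Rightarrow> real) \<Rightarrow> real \<Rightarrow> real" where
  "fk_rate \<sigma> b h x = (\<sigma> x)\<^sup>2 * (b x + (deriv ^^ 2) h x / (2 * h x))"

definition fk_functional ::
  "(real \<Rightarrow> real) \<Rightarrow> (real \<Rightarrow> real) \<Rightarrow> (real \<Rightarrow> real) \<Rightarrow> (real \<Rightarrow> real) \<Rightarrow>
   (real \<Rightarrow> 'w \<Rightarrow> real) \<Rightarrow> real \<Rightarrow> 'w \<Rightarrow> real" where
  "fk_functional \<sigma> b h g X t \<omega> =
     g (X t \<omega>) / h (X t \<omega>) * exp (LBINT s:{0..t}. fk_rate \<sigma> b h (X s \<omega>))"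

definition fk_functional_discrete ::
  "(real \<Rightarrow> real) \<Rightarrow> (real \<Rightarrow> real) \<Rightarrow> (real \<Rightarrow> real) \<Rightarrow> (real \<Rightarrow> real) \<Rightarrow>
   real \<Rightarrow> nat \<Rightarrow> (real \<Rightarrow> 'w \<Rightarrow> real) \<Rightarrow> 'w \<Rightarrow> real" where
  "fk_functional_discrete \<sigma> b h g T N Y \<omega> =
     g (Y T \<omega>) / h (Y T \<omega>) *
       exp (\<Sum>n<N. T / real N * fk_rate \<sigma> b h (Y (real n * T / real N) \<omega>))"

definition bem_error ::
  "ereal \<Rightarrow> (real \<Rightarrow> real) \<Rightarrow> (real \<Rightarrow> real) \<Rightarrow> (real \<Rightarrow> real) \<Rightarrow> (real \<Rightarrow> real) \<Rightarrow>
   real \<Rightarrow> real \<Rightarrow> (real \<Rightarrow> 'w \<Rightarrow> real) \<Rightarrow> (real \<Rightarrow> 'w \<Rightarrow> real) \<Rightarrow> nat \<Rightarrow> 'w \<Rightarrow> real" where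
  "bem_error r \<sigma> b h g T x0 X W N \<omega> =
     fk_functional \<sigma> b h g X T \<omega> -
     fk_functional_discrete \<sigma> b h g T N (\<lambda>t \<omega>. bem r \<sigma> h T N x0 (\<lambda>s. W s \<omega>) t) \<omega>"

end

theory Submission
  imports Defs
begin

text \<open>The diffusion itself enters only through \<open>v\<close>: the expectation of the continuous functional is
  \<open>v(0,x\<^sub>0)\<close>, and \<open>v(T,\<cdot>) = g/h\<close>, so the error is a telescoping sum of the one-step errors of \<open>v\<close>
  along the scheme. Given the current state \<open>y\<close>, one step leads to \<open>J(\<theta>\<^sup>2, y + \<theta> \<xi>)\<close> with
  \<open>\<theta> = \<sigma>(y) \<surd>\<Delta>\<close>, \<open>\<xi>\<close> standard normal, and \<open>x = J(s,z)\<close> the solution of \<open>x - s h'(x)/h(x) = z\<close>. The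
  fundamental theorem of calculus in \<open>\<theta>\<close> and Gaussian integration by parts in \<open>\<xi>\<close> give a Dynkin
  formula for the step. Its generator is that of the \<open>h\<close>-transform damped by powers of \<open>1/D\<close>,
  \<open>D = 1 - s (h'/h)' \<ge> 1\<close>; together with the equation for \<open>v\<close>, two applications of the formula bound
  the one-step error by \<open>\<Delta>\<close> times the integral of \<open>h\<^sup>-\<^sup>2\<^sup>-\<^sup>p/D\<close> along the step. Because \<open>p \<le> 1/2\<close>, this is
  controlled by the dissipation of the Lyapunov function \<open>h\<^sup>-\<^sup>3\<^sup>/\<^sup>4 + (1+x)\<^sup>M\<close>, which telescopes as well.\<close>

section \<open>Gaussian integrals\<close>

text \<open>At a finite end point \<open>h\<close> is comparable to the distance from the boundary,
  so up to a time change the \<open>h\<close>-transform looks there like a three-dimensional Bessel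
  process, for which \<open>h powr (- a)\<close> has negative drift only if
  \<open>0 < a < 1\<close>. Two applications of the generator to \<open>v\<close>, however, produce
  a singularity of order \<open>2 + p\<close>, too strong for such a function to bound it at a fixed
  time. The way out is that the negative drift of \<open>h powr (- 3/4)\<close> is itself of order
  \<open>11/4\<close>, more than \<open>5/2\<close>: the singularity is controlled after integration
  in time. A local error of the form step size times time integral over the step then suffices,
  since the sum of these integrals stays bounded in \<open>N\<close>. For the scheme the negative
  drift carries the factor \<open>1 / D\<close>, so the errors must carry it too, or be of a size
  that \<open>Psi\<close> itself bounds. The same factor tames the third derivative of the logarithm
  of \<open>h\<close> that the implicit equation creates: \<open>s / h^2\<close> is at most a
  constant times \<open>D\<close>, because concavity keeps \<open>h'\<close> away from 0 where
  \<open>h\<close> is small.\<close>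

definition gauss :: "real measure" where
  "gauss = density lborel (\<lambda>x. ennreal (std_normal_density x))"

lemma sets_gauss [simp, measurable_cong]: "sets gauss = sets borel"
  and space_gauss [simp]: "space gauss = UNIV"
  by (simp_all add: gauss_def)

interpretation gauss: prob_space gauss
  unfolding gauss_def by (rule prob_space_normal_density) simp

lemma gauss_integrable_iff:
  assumes "f \<in> borel_measurable borel"
  shows "integrable gauss f \<longleftrightarrow> integrable lborel (\<lambda>x. std_normal_density x * f x)"
  using assms unfolding gauss_def by (subst integrable_density) (auto simp del: std_normal_density_def)

lemma gauss_integral_eq:
  fixes f :: "real \<Rightarrow> real"
  assumes "f \<in> borel_measurable borel"
  shows "integral\<^sup>L gauss f = (\<integral>x. std_normal_density x * f x \<partial>lborel)"
  using assms unfolding gauss_def by (subst integral_density) auto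

lemma gauss_integrable_poly: "integrable gauss (\<lambda>x. (1 + \<bar>x\<bar>) ^ k)"
proof -
  have "integrable lborel (\<lambda>x. \<Sum>i\<le>k. of_nat (k choose i) * (std_normal_density x * \<bar>x\<bar> ^ (k - i)))"
    by (intro Bochner_Integration.integrable_sum integrable_mult_right integrable_std_normal_moment_abs)
  then have "integrable lborel (\<lambda>x. std_normal_density x * (1 + \<bar>x\<bar>) ^ k)"
    by (rule Bochner_Integration.integrable_cong[THEN iffD1, rotated 2])
       (simp_all add: binomial_ring sum_distrib_left mult_ac)
  then show ?thesis by (subst gauss_integrable_iff) auto
qed

lemma gauss_integrableI:
  fixes f :: "real \<Rightarrow> real"
  assumes "f \<in> borel_measurable borel" "\<And>x. \<bar>f x\<bar> \<le> C * (1 + \<bar>x\<bar>) ^ k"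
  shows "integrable gauss f"
proof (rule Bochner_Integration.integrable_bound)
  show "integrable gauss (\<lambda>x. C * (1 + \<bar>x\<bar>) ^ k)"
    using gauss_integrable_poly by (rule integrable_mult_right)
  show "AE x in gauss. norm (f x) \<le> norm (C * (1 + \<bar>x\<bar>) ^ k)"
    using assms(2) by (auto intro: order_trans[OF _ abs_ge_self])
qed (use assms in simp)

lemma poly_mult_std_normal_density_tendsto:
  assumes "\<And>x. \<bar>g x\<bar> \<le> C * (1 + \<bar>x\<bar>) ^ k" "F = at_top \<or> F = at_bot"
  shows "((\<lambda>x. g x * std_normal_density x) \<longlongrightarrow> 0) F"
proof (rule Lim_null_comparison)
  show "\<forall>\<^sub>F x in F. norm (g x * std_normal_density x) \<le> C * (1 + \<bar>x\<bar>) ^ k * std_normal_density x"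
    using assms(1) by (auto intro!: always_eventually simp: abs_mult mult_right_mono)
  have A: "((\<lambda>x::real. C * (1 + x) ^ k * (1 / sqrt (2 * pi) * exp (- x\<^sup>2 / 2))) \<longlongrightarrow> 0) at_top"
    by real_asymp
  have 1: "((\<lambda>x::real. C * (1 + \<bar>x\<bar>) ^ k * std_normal_density x) \<longlongrightarrow> 0) at_top"
    by (rule Lim_transform_eventually[OF A])
       (use eventually_ge_at_top[of 0] in eventually_elim, simp add: std_normal_density_def)
  have 2: "((\<lambda>x::real. C * (1 + \<bar>x\<bar>) ^ k * std_normal_density x) \<longlongrightarrow> 0) at_bot"
    using 1 by (simp add: filterlim_at_bot_mirror std_normal_density_def)
  show "((\<lambda>x::real. C * (1 + \<bar>x\<bar>) ^ k * std_normal_density x) \<longlongrightarrow> 0) F"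
    using 1 2 assms(2) by auto
qed

text \<open>Since the density satisfies \<open>d' = - x * d\<close>, the difference of the two
  integrands against it is the derivative of \<open>g * d\<close>, and this product vanishes at both
  ends. In Dynkin's formula the identity turns the factor \<xi> left by the chain rule into the
  second-order part of the generator.\<close>

lemma gauss_integration_by_parts:
  fixes g g' :: "real \<Rightarrow> real"
  assumes g: "\<And>x. (g has_real_derivative g' x) (at x)" and g': "continuous_on UNIV g'"
    and bd: "\<And>x. \<bar>g x\<bar> \<le> C * (1 + \<bar>x\<bar>) ^ k" and bd': "\<And>x. \<bar>g' x\<bar> \<le> C * (1 + \<bar>x\<bar>) ^ k"
  shows "(\<integral>x. x * g x \<partial>gauss) = (\<integral>x. g' x \<partial>gauss)"
proof -
  have cont: "continuous_on UNIV g"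
    using g by (intro DERIV_continuous_on) (auto intro: has_field_derivative_at_within)
  have meas [measurable]: "g \<in> borel_measurable borel" "g' \<in> borel_measurable borel"
    using cont g' by (auto intro: borel_measurable_continuous_onI)
  have I1: "integrable gauss (\<lambda>x. x * g x)"
  proof (rule gauss_integrableI)
    fix x :: real
    have "\<bar>x * g x\<bar> \<le> (1 + \<bar>x\<bar>) * (C * (1 + \<bar>x\<bar>) ^ k)"
      unfolding abs_mult by (intro mult_mono bd) auto
    then show "\<bar>x * g x\<bar> \<le> C * (1 + \<bar>x\<bar>) ^ Suc k" by (simp add: mult_ac)
  qed simp
  have I2: "integrable gauss g'" by (rule gauss_integrableI[OF _ bd']) simp
  define d where "d = std_normal_density"
  have dd: "(d has_real_derivative - x * d x) (at x)" for x
  proof -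
    define c :: real where "c = 1 / sqrt (2 * pi)"
    show ?thesis
      unfolding d_def std_normal_density_def c_def[symmetric]
      by (auto intro!: derivative_eq_intros simp: power2_eq_square)
  qed
  have dcont: "continuous_on UNIV d"
    using dd by (intro DERIV_continuous_on) (auto intro: has_field_derivative_at_within)
  define f where "f x = d x * g' x - d x * (x * g x)" for x
  have "(LBINT x=-\<infinity>..\<infinity>. f x) = 0 - 0"
  proof (rule interval_integral_FTC_integrable)
    show "((\<lambda>x. g x * d x) has_vector_derivative f x) (at x)" for x
      unfolding has_real_derivative_iff_has_vector_derivative[symmetric] f_def
      using g dd by (auto intro!: derivative_eq_intros simp: algebra_simps)
    show "isCont f x" for x
    proof -
      have "continuous_on UNIV f"
        unfolding f_def by (intro continuous_intros dcont g' cont)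
      then show ?thesis by (simp add: continuous_on_eq_continuous_at)
    qed
    show "set_integrable lborel (einterval (- \<infinity>) \<infinity>) f"
      using I1 I2 unfolding f_def d_def set_integrable_def
      by (auto simp: gauss_integrable_iff)
    have "((\<lambda>x. g x * d x) \<longlongrightarrow> 0) at_bot" "((\<lambda>x. g x * d x) \<longlongrightarrow> 0) at_top"
      unfolding d_def by (auto intro!: poly_mult_std_normal_density_tendsto[OF bd])
    then show "(((\<lambda>x. g x * d x) \<circ> real_of_ereal) \<longlongrightarrow> 0) (at_right (- \<infinity>))"
      "(((\<lambda>x. g x * d x) \<circ> real_of_ereal) \<longlongrightarrow> 0) (at_left \<infinity>)"
      by (simp_all add: ereal_tendsto_simps)
  qed simp
  then have "(\<integral>x. f x \<partial>lborel) = 0"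
    by (simp add: interval_lebesgue_integral_def set_lebesgue_integral_def)
  moreover have "(\<integral>x. f x \<partial>lborel) = (\<integral>x. g' x \<partial>gauss) - (\<integral>x. x * g x \<partial>gauss)"
    unfolding f_def d_def using I1 I2
    by (simp add: gauss_integral_eq gauss_integrable_iff)
  ultimately show ?thesis by simp
qed

section \<open>The implicit step as a resolvent\<close>

text \<open>Everything the one-step analysis uses about \<open>h\<close>, separated from the class
  that \<open>h\<close> comes from. One constant \<open>A\<close> serves all bounds.
  \<open>R\<close> and \<delta> say that \<open>h\<close> can be small only at bounded
  \<open>x\<close>, which excludes a singularity at infinity. The last three derivative bounds are
  the growth condition on the derivatives of \<open>h\<close>, multiplied by \<open>h\<close>.
  \<open>resolvent_surj\<close> makes the implicit step solvable for every Gaussian input.\<close>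

locale concave_weight =
  fixes I :: "real set" and h h1 h2 h3 h4 :: "real \<Rightarrow> real" and A p R \<delta> :: real
  assumes open_I: "open I" and convex_I: "convex I" and pos_I: "x \<in> I \<Longrightarrow> 0 < x"
    and dh: "x \<in> I \<Longrightarrow> (h has_real_derivative h1 x) (at x)"
    and dh1: "x \<in> I \<Longrightarrow> (h1 has_real_derivative h2 x) (at x)"
    and dh2: "x \<in> I \<Longrightarrow> (h2 has_real_derivative h3 x) (at x)"
    and dh3: "x \<in> I \<Longrightarrow> (h3 has_real_derivative h4 x) (at x)"
    and cont_h4: "continuous_on I h4"
    and h_pos: "x \<in> I \<Longrightarrow> 0 < h x"
    and h2_nonpos: "x \<in> I \<Longrightarrow> h2 x \<le> 0"
    and h1_bound: "x \<in> I \<Longrightarrow> \<bar>h1 x\<bar> \<le> A"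
    \<comment> \<open>\<open>h1\<close> is bounded away from \<open>0\<close> where \<open>h\<close> is small\<close>
    and nondegenerate: "x \<in> I \<Longrightarrow> 1 \<le> A * ((h x)\<^sup>2 + (h1 x)\<^sup>2)"
    and x_h1_le: "x \<in> I \<Longrightarrow> x * h1 x \<le> h x"
    and h_linear: "x \<in> I \<Longrightarrow> h x \<le> A * (1 + x)"
    and \<delta>_pos: "0 < \<delta>" and R_nonneg: "0 \<le> R"
    and h_far: "x \<in> I \<Longrightarrow> R < x \<Longrightarrow> \<delta> \<le> h x"
    and p: "0 \<le> p" "p \<le> 1 / 2"
    and h2_bound: "x \<in> I \<Longrightarrow> \<bar>h2 x\<bar> \<le> A * h x powr (1 - p)"
    and h3_bound: "x \<in> I \<Longrightarrow> \<bar>h3 x\<bar> \<le> A * h x powr (- p)"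
    and h4_bound: "x \<in> I \<Longrightarrow> \<bar>h4 x\<bar> \<le> A * h x powr (- 1 - p)"
    and resolvent_surj: "0 < s \<Longrightarrow> \<exists>x\<in>I. x - s * (h1 x / h x) = z"
begin

text \<open>In \<open>Y\<close> the parameter \<open>\<theta>\<close> is the square root of the time \<open>s\<close>, which makes the paths smooth up
  to time \<open>0\<close>. On \<open>V\<close> the resolvent equation is uniquely solvable; elsewhere \<open>J\<close> is junk.\<close>

definition L :: "real \<Rightarrow> real" where "L x = h1 x / h x"
definition L1 :: "real \<Rightarrow> real" where "L1 x = h2 x / h x - (L x)\<^sup>2"
definition L2 :: "real \<Rightarrow> real" where "L2 x = h3 x / h x - 3 * L x * (h2 x / h x) + 2 * (L x) ^ 3"
definition D :: "real \<Rightarrow> real \<Rightarrow> real" where "D s x = 1 - s * L1 x"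
definition J :: "real \<Rightarrow> real \<Rightarrow> real" where "J s z = (THE x. x \<in> I \<and> x - s * L x = z)"
definition V :: "(real \<times> real) set" where "V = {(s, z). 0 < s \<or> s = 0 \<and> z \<in> I}"
definition Y :: "real \<Rightarrow> real \<Rightarrow> real \<Rightarrow> real" where "Y y \<theta> \<xi> = J (\<theta>\<^sup>2) (y + \<theta> * \<xi>)"
text \<open>Growth towards infinity and towards the zeros of \<open>h\<close> at the boundary is
  measured by powers of this single function.\<close>

definition wt :: "real \<Rightarrow> real" where "wt x = 1 + x + 1 / h x"

lemma dL: "x \<in> I \<Longrightarrow> (L has_real_derivative L1 x) (at x)"
  unfolding L_def [abs_def] L1_def using h_pos[of x]
  by (auto intro!: derivative_eq_intros dh dh1 simp: field_simps power2_eq_square)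

lemma dL1: "x \<in> I \<Longrightarrow> (L1 has_real_derivative L2 x) (at x)"
  unfolding L1_def [abs_def] L2_def using h_pos[of x]
  by (auto intro!: derivative_eq_intros dh dh1 dh2 dL simp: L_def L1_def field_simps eval_nat_numeral)

lemma cont_imp: "(\<And>x. x \<in> I \<Longrightarrow> (f has_real_derivative f' x) (at x)) \<Longrightarrow> continuous_on I f"
  by (rule DERIV_continuous_on) (auto intro: has_field_derivative_at_within)

lemma cont_h: "continuous_on I h" and cont_h2: "continuous_on I h2"
  and cont_h3: "continuous_on I h3" and cont_L: "continuous_on I L" and cont_L1: "continuous_on I L1"
  by (blast intro: cont_imp dh dh2 dh3 dL dL1)+

lemma h_nz: "x \<in> I \<Longrightarrow> h x \<noteq> 0" using h_pos[of x] by auto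

lemma cont_L2: "continuous_on I L2"
  unfolding L2_def [abs_def]
  by (intro continuous_intros cont_h cont_h2 cont_h3 cont_L) (use h_nz in auto)

lemma L1_le: "x \<in> I \<Longrightarrow> L1 x \<le> - (L x)\<^sup>2"
  using h2_nonpos[of x] h_pos[of x] by (simp add: L1_def divide_nonpos_pos)

lemma L1_nonpos: "x \<in> I \<Longrightarrow> L1 x \<le> 0"
  using L1_le[of x] by (smt (verit) zero_le_power2)

lemma D_ge: "x \<in> I \<Longrightarrow> 0 \<le> s \<Longrightarrow> 1 \<le> D s x"
  using L1_nonpos[of x] by (simp add: D_def mult_nonneg_nonpos)

lemma Icc_subset_I: "x \<in> I \<Longrightarrow> x' \<in> I \<Longrightarrow> {x..x'} \<subseteq> I"
  using convex_I by (meson interval_subset_is_interval is_interval_convex_1 atLeastAtMost_iff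
      is_interval_1 subsetI)

lemma L_antimono: "x \<in> I \<Longrightarrow> x' \<in> I \<Longrightarrow> x \<le> x' \<Longrightarrow> L x' \<le> L x"
  by (rule DERIV_nonpos_imp_nonincreasing[of x x' L])
     (use Icc_subset_I[of x x'] dL L1_nonpos in \<open>auto simp: subset_iff\<close>)

text \<open>As \<open>L\<close> is decreasing, subtracting \<open>s * L\<close> can only increase
  distances. This gives uniqueness of the implicit step and makes \<open>J s\<close>
  nonexpansive.\<close>

lemma resolvent_expands:
  assumes "x \<in> I" "x' \<in> I" "0 \<le> s"
  shows "\<bar>x - x'\<bar> \<le> \<bar>(x - s * L x) - (x' - s * L x')\<bar>"
proof (cases "x \<le> x'")
  case True
  then have "s * L x' \<le> s * L x" using assms by (intro mult_left_mono L_antimono) auto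
  with True show ?thesis by simp
next
  case False
  then have "s * L x \<le> s * L x'" using assms by (intro mult_left_mono L_antimono) auto
  with False show ?thesis by simp
qed

lemma J_unique: "x \<in> I \<Longrightarrow> 0 \<le> s \<Longrightarrow> x - s * L x = z \<Longrightarrow> J s z = x"
  unfolding J_def using resolvent_expands[of _ x s] by (intro the_equality) fastforce+

lemma J_props:
  assumes "(s, z) \<in> V"
  shows J_in: "J s z \<in> I" and J_eq: "J s z - s * L (J s z) = z" and V_nonneg: "0 \<le> s"
proof -
  from assms have s: "0 < s \<or> s = 0 \<and> z \<in> I" by (simp add: V_def)
  then have "\<exists>x\<in>I. x - s * L x = z"
    using resolvent_surj[of s z] by (auto simp: L_def)
  then obtain x where "x \<in> I" "x - s * L x = z" by blast
  moreover have "J s z = x" by (rule J_unique) (use calculation s in auto)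
  ultimately show "J s z \<in> I" "J s z - s * L (J s z) = z" by auto
  show "0 \<le> s" using s by auto
qed

lemma J_0: "z \<in> I \<Longrightarrow> J 0 z = z"
  by (rule J_unique) auto

text \<open>Inserting the second point into the equation with the parameter \<open>s\<close> of the
  first leaves the residual \<open>(s - s') * L\<close>. Only \<open>L\<close> at the second point
  occurs, so comparing with \<open>s' = 0\<close> bounds the displacement of a step by data at its
  starting point.\<close>

lemma J_lipschitz:
  assumes "(s, z) \<in> V" "(s', z') \<in> V"
  shows "\<bar>J s z - J s' z'\<bar> \<le> \<bar>z - z'\<bar> + \<bar>s - s'\<bar> * \<bar>L (J s' z')\<bar>"
proof -
  note a = J_props[OF assms(1)] and b = J_props[OF assms(2)]
  have "\<bar>J s z - J s' z'\<bar> \<le> \<bar>(J s z - s * L (J s z)) - (J s' z' - s * L (J s' z'))\<bar>"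
    using a b by (intro resolvent_expands)
  also have "\<dots> = \<bar>(z - z') + (s - s') * L (J s' z')\<bar>"
    using a b by (simp add: algebra_simps)
  also have "\<dots> \<le> \<bar>z - z'\<bar> + \<bar>s - s'\<bar> * \<bar>L (J s' z')\<bar>"
    by (metis abs_mult abs_triangle_ineq)
  finally show ?thesis .
qed

lemma J_tendsto:
  assumes "(sf \<longlongrightarrow> s) F" "(zf \<longlongrightarrow> z) F" "(s, z) \<in> V" "\<forall>\<^sub>F t in F. (sf t, zf t) \<in> V"
  shows "((\<lambda>t. J (sf t) (zf t)) \<longlongrightarrow> J s z) F"
proof -
  have "((\<lambda>t. \<bar>zf t - z\<bar> + \<bar>sf t - s\<bar> * \<bar>L (J s z)\<bar>) \<longlongrightarrow> \<bar>z - z\<bar> + \<bar>s - s\<bar> * \<bar>L (J s z)\<bar>) F"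
    by (intro tendsto_intros assms)
  then have "((\<lambda>t. \<bar>zf t - z\<bar> + \<bar>sf t - s\<bar> * \<bar>L (J s z)\<bar>) \<longlongrightarrow> 0) F" by simp
  moreover have "\<forall>\<^sub>F t in F. norm (J (sf t) (zf t) - J s z) \<le> \<bar>zf t - z\<bar> + \<bar>sf t - s\<bar> * \<bar>L (J s z)\<bar>"
    using assms(4) by eventually_elim (use J_lipschitz assms(3) in auto)
  ultimately have "((\<lambda>t. J (sf t) (zf t) - J s z) \<longlongrightarrow> 0) F"
    by (rule Lim_null_comparison[rotated])
  then show ?thesis by (rule LIM_zero_cancel)
qed

lemma continuous_on_J: "continuous_on V (\<lambda>(s, z). J s z)"
  unfolding continuous_on_def
proof safe
  fix s z assume V: "(s, z) \<in> V"
  have "((\<lambda>w. J (fst w) (snd w)) \<longlongrightarrow> J s z) (at (s, z) within V)"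
  proof (rule J_tendsto)
    show "\<forall>\<^sub>F t in at (s, z) within V. (fst t, snd t) \<in> V" by (simp add: eventually_at_filter)
  qed (use V in \<open>auto intro!: tendsto_eq_intros\<close>)
  then show "((\<lambda>(s, z). J s z) \<longlongrightarrow> J s z) (at (s, z) within V)" by (simp add: case_prod_beta')
qed

text \<open>With \<open>L w - L x = q w * (w - x)\<close> in Caratheodory form, the resolvent equation yields the
  difference quotient of \<open>J\<close> upon division by \<open>1 - s * q \<ge> 1\<close>.\<close>

lemma J_has_derivative:
  assumes s: "(sf has_real_derivative s') (at t)" and z: "(zf has_real_derivative z') (at t)"
    and pos: "0 < sf t"
  shows "((\<lambda>t. J (sf t) (zf t)) has_real_derivative
    (L (J (sf t) (zf t)) * s' + z') / D (sf t) (J (sf t) (zf t))) (at t)"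
proof -
  define x where "x t = J (sf t) (zf t)" for t
  have "isCont sf t" using s by (rule DERIV_isCont)
  then have ev: "\<forall>\<^sub>F u in at t. 0 < sf u"
    using pos by (simp add: isCont_def order_tendstoD)
  have evV: "\<forall>\<^sub>F u in at t. (sf u, zf u) \<in> V" using ev by eventually_elim (simp add: V_def)
  have Vt: "(sf t, zf t) \<in> V" using pos by (simp add: V_def)
  have xt: "x t \<in> I" using J_in[OF Vt] by (simp add: x_def)
  have lim: "(x \<longlongrightarrow> x t) (at t)" unfolding x_def
    by (rule J_tendsto[OF _ _ Vt evV]) (use s z in \<open>auto dest!: DERIV_isCont simp: isCont_def\<close>)
  define q where "q w = (if w = x t then L1 (x t) else (L w - L (x t)) / (w - x t))" for w
  have q_lim: "(q \<longlongrightarrow> L1 (x t)) (at (x t))"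
  proof -
    have "((\<lambda>w. (L w - L (x t)) / (w - x t)) \<longlongrightarrow> L1 (x t)) (at (x t))"
      using dL[OF xt] by (simp add: has_field_derivative_iff)
    then show ?thesis
      by (rule Lim_transform_eventually) (auto simp: q_def eventually_at_filter)
  qed
  have q_eq: "L w - L (x t) = q w * (w - x t)" for w by (simp add: q_def)
  have q_le: "q w \<le> 0" if "w \<in> I" for w
    using L_antimono[of w "x t"] L_antimono[of "x t" w] that xt L1_nonpos[OF xt]
    by (cases "w \<le> x t") (auto simp: q_def divide_le_0_iff)
  have "isCont q (x t)" using q_lim by (simp add: isCont_def q_def)
  then have lim_q: "((\<lambda>u. q (x u)) \<longlongrightarrow> L1 (x t)) (at t)"
    using isCont_tendsto_compose[OF _ lim, of q] by (simp add: q_def)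
  have quot: "\<forall>\<^sub>F u in at t. ((zf u - zf t) / (u - t) + (sf u - sf t) / (u - t) * L (x t)) /
      (1 - sf u * q (x u)) = (x u - x t) / (u - t)"
    using evV ev
  proof eventually_elim
    case (elim u)
    have xu: "x u \<in> I" using J_in[OF elim(1)] by (simp add: x_def)
    have e1: "x u - sf u * L (x u) = zf u" using J_eq[OF elim(1)] by (simp add: x_def)
    have e2: "x t - sf t * L (x t) = zf t" using J_eq[OF Vt] by (simp add: x_def)
    have e3: "sf u * L (x u) = sf u * L (x t) + sf u * q (x u) * (x u - x t)"
    proof -
      have "L (x u) = L (x t) + q (x u) * (x u - x t)" using q_eq[of "x u"] by simp
      then show ?thesis by (simp only: distrib_left mult.assoc)
    qed
    have "(x u - x t) * (1 - sf u * q (x u)) = (zf u - zf t) + (sf u - sf t) * L (x t)"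
      using e1 e2 e3 by (simp add: algebra_simps)
    moreover have "1 - sf u * q (x u) \<noteq> 0"
      using mult_nonneg_nonpos[of "sf u" "q (x u)"] q_le[OF xu] elim(2) by auto
    ultimately have "x u - x t = ((zf u - zf t) + (sf u - sf t) * L (x t)) / (1 - sf u * q (x u))"
      by (simp add: field_simps)
    then show ?case by (simp add: add_divide_distrib mult.commute)
  qed
  have "((\<lambda>u. ((zf u - zf t) / (u - t) + (sf u - sf t) / (u - t) * L (x t)) / (1 - sf u * q (x u)))
      \<longlongrightarrow> (z' + s' * L (x t)) / (1 - sf t * L1 (x t))) (at t)"
  proof (intro tendsto_intros lim_q)
    show "((\<lambda>u. (zf u - zf t) / (u - t)) \<longlongrightarrow> z') (at t)" "((\<lambda>u. (sf u - sf t) / (u - t)) \<longlongrightarrow> s') (at t)"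
      using s z by (simp_all add: has_field_derivative_iff)
    show "(sf \<longlongrightarrow> sf t) (at t)" using \<open>isCont sf t\<close> by (simp add: isCont_def)
    show "1 - sf t * L1 (x t) \<noteq> 0" using D_ge[OF xt, of "sf t"] pos by (simp add: D_def)
  qed
  then have "((\<lambda>u. (x u - x t) / (u - t)) \<longlongrightarrow> (z' + s' * L (x t)) / (1 - sf t * L1 (x t))) (at t)"
    by (rule Lim_transform_eventually[OF _ quot])
  then show ?thesis
    by (simp add: has_field_derivative_iff x_def D_def algebra_simps)
qed

lemma Y_V: "y \<in> I \<Longrightarrow> 0 \<le> \<theta> \<Longrightarrow> (\<theta>\<^sup>2, y + \<theta> * \<xi>) \<in> V"
  by (auto simp: V_def)

lemma Y_in: "y \<in> I \<Longrightarrow> 0 \<le> \<theta> \<Longrightarrow> Y y \<theta> \<xi> \<in> I"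
  unfolding Y_def by (rule J_in[OF Y_V])

lemma Y_0: "y \<in> I \<Longrightarrow> Y y 0 \<xi> = y"
  by (simp add: Y_def J_0)

lemma continuous_on_Y: "y \<in> I \<Longrightarrow> continuous_on ({0..} \<times> UNIV) (\<lambda>(\<theta>, \<xi>). Y y \<theta> \<xi>)"
proof -
  assume y: "y \<in> I"
  have "continuous_on ({0..} \<times> UNIV) (\<lambda>w. (\<lambda>(s, z). J s z) ((fst w)\<^sup>2, y + fst w * snd w))"
    by (rule continuous_on_compose2[OF continuous_on_J]) (auto intro!: continuous_intros Y_V y)
  then show ?thesis by (simp add: Y_def case_prod_beta')
qed

lemma dY_time:
  assumes "0 < \<theta>"
  shows "((\<lambda>\<theta>. Y y \<theta> \<xi>) has_real_derivative
    (2 * \<theta> * L (Y y \<theta> \<xi>) + \<xi>) / D (\<theta>\<^sup>2) (Y y \<theta> \<xi>)) (at \<theta>)"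
  unfolding Y_def using assms
  by (intro DERIV_cong[OF J_has_derivative])
     (auto intro!: derivative_eq_intros simp: mult_ac)

lemma dY_space:
  assumes "0 < \<theta>"
  shows "(Y y \<theta> has_real_derivative \<theta> / D (\<theta>\<^sup>2) (Y y \<theta> \<xi>)) (at \<xi>)"
  unfolding Y_def [abs_def] using assms
  by (intro DERIV_cong[OF J_has_derivative])
     (auto intro!: derivative_eq_intros simp: mult_ac)

lemma A_pos: "I \<noteq> {} \<Longrightarrow> 0 < A"
proof -
  assume "I \<noteq> {}"
  then obtain x where "x \<in> I" by blast
  then have "0 < A * (1 + x)" using h_linear[of x] h_pos[of x] by linarith
  then show "0 < A" using pos_I[OF \<open>x \<in> I\<close>] by (simp add: zero_less_mult_iff)
qed

lemma L_upper: "x \<in> I \<Longrightarrow> L x \<le> 1 / x"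
  using x_h1_le[of x] h_pos[of x] pos_I[of x] by (simp add: L_def field_simps)

lemma L_abs: "x \<in> I \<Longrightarrow> \<bar>L x\<bar> \<le> A / h x"
  using h1_bound[of x] h_pos[of x] by (simp add: L_def abs_divide divide_right_mono)

text \<open>This is \<open>nondegenerate\<close> divided by the square of \<open>h\<close>: near the
  boundary the drift \<open>L\<close> alone controls \<open>1 / h\<close>, and estimates on
  \<open>L\<close>, which the resolvent equation provides, become estimates on
  \<open>1 / h\<close>.\<close>

lemma h_inv_sq: "x \<in> I \<Longrightarrow> 1 / (h x)\<^sup>2 \<le> A * (1 + (L x)\<^sup>2)"
  using nondegenerate[of x] h_pos[of x] by (simp add: L_def field_simps)

lemma h_inv: "x \<in> I \<Longrightarrow> 1 / h x \<le> (1 + A) * (1 + \<bar>L x\<bar>)"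
proof -
  assume x: "x \<in> I"
  then have A: "0 < A" using A_pos by auto
  have "(1 / h x)\<^sup>2 \<le> A * (1 + (L x)\<^sup>2)" using h_inv_sq[OF x] by (simp add: power_divide)
  also have "\<dots> \<le> (1 + A)\<^sup>2 * (1 + \<bar>L x\<bar>)\<^sup>2"
    by (rule mult_mono) (use A in \<open>auto simp: power2_eq_square algebra_simps\<close>)
  also have "\<dots> = ((1 + A) * (1 + \<bar>L x\<bar>))\<^sup>2" by (simp add: power_mult_distrib)
  finally show ?thesis
    by (rule power2_le_imp_le) (use A in auto)
qed

lemma h_lipschitz: "x \<in> I \<Longrightarrow> y \<in> I \<Longrightarrow> \<bar>h x - h y\<bar> \<le> A * \<bar>x - y\<bar>"
  using field_differentiable_bound[of I h h1 A x y] convex_I dh h1_bound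
  by (auto intro: has_field_derivative_at_within)

lemma wt_ge: "x \<in> I \<Longrightarrow> 1 \<le> wt x"
  using pos_I[of x] h_pos[of x] by (simp add: wt_def)

text \<open>Both bounds are uniform down to \<theta> = 0, although the equation by itself only gives
  an \<open>L\<close> of size \<open>\<bar>\<xi>\<bar> / \<theta>\<close>. The upper bound holds
  because the drift is at most 1 beyond \<open>x = 1\<close>.\<close>

lemma Y_bounds:
  assumes y: "y \<in> I" and \<theta>: "0 \<le> \<theta>" "\<theta> \<le> \<theta>1"
  shows "Y y \<theta> \<xi> \<le> 1 + y + \<theta>1\<^sup>2 + \<theta>1 * \<bar>\<xi>\<bar>"
    and "1 / h (Y y \<theta> \<xi>) \<le> 2 / h y + (1 + A) * (1 + \<bar>L y\<bar> + 4 * A * (\<bar>\<xi>\<bar> + \<theta>1 * \<bar>L y\<bar>) / h y * \<bar>\<xi>\<bar>)"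
proof -
  define x where "x = Y y \<theta> \<xi>"
  have x: "x \<in> I" using Y_in y \<theta> by (simp add: x_def)
  have x0: "0 < x" using pos_I x by auto
  have eq: "x - \<theta>\<^sup>2 * L x = y + \<theta> * \<xi>" using J_eq[OF Y_V[OF y \<theta>(1)]] by (simp add: x_def Y_def)
  have t\<xi>: "\<theta> * \<bar>\<xi>\<bar> \<le> \<theta>1 * \<bar>\<xi>\<bar>" using \<theta> by (intro mult_right_mono) auto
  have t2: "\<theta>\<^sup>2 \<le> \<theta>1\<^sup>2" using \<theta> by (intro power_mono) auto
  have t\<xi>': "\<theta> * \<xi> \<le> \<theta> * \<bar>\<xi>\<bar>" "- (\<theta> * \<bar>\<xi>\<bar>) \<le> \<theta> * \<xi>"
    using mult_left_mono[of \<xi> "\<bar>\<xi>\<bar>" \<theta>] mult_left_mono[of "- \<bar>\<xi>\<bar>" \<xi> \<theta>] \<theta> by auto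
  show "Y y \<theta> \<xi> \<le> 1 + y + \<theta>1\<^sup>2 + \<theta>1 * \<bar>\<xi>\<bar>"
  proof (cases "x \<le> 1")
    case True
    then show ?thesis using pos_I[OF y] \<theta> by (simp add: x_def[symmetric] add_increasing2)
  next
    case False
    then have "\<theta>\<^sup>2 * L x \<le> \<theta>\<^sup>2 * 1"
      using L_upper[OF x] by (intro mult_left_mono) (auto intro: order_trans simp: divide_le_eq_1)
    then have "x \<le> y + \<theta> * \<bar>\<xi>\<bar> + \<theta>\<^sup>2" using eq t\<xi>' by linarith
    then show ?thesis using t2 t\<xi> by (simp add: x_def)
  qed
  have A: "0 < A" using A_pos y by auto
  have hx: "0 < h x" "0 < h y" using h_pos x y by auto
  show "1 / h (Y y \<theta> \<xi>) \<le> 2 / h y + (1 + A) * (1 + \<bar>L y\<bar> + 4 * A * (\<bar>\<xi>\<bar> + \<theta>1 * \<bar>L y\<bar>) / h y * \<bar>\<xi>\<bar>)"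
    (is "_ \<le> _ + ?rest")
  proof (cases "h y / 2 \<le> h x")
    case True
    have "1 / h x \<le> 2 / h y" using True hx by (simp add: field_simps)
    moreover have "0 \<le> ?rest" using A hx \<theta> by auto
    ultimately show ?thesis by (simp add: x_def)
  next
    case False
    \<comment> \<open>If \<open>h\<close> has dropped below half of \<open>h y\<close>, the point
      has moved by at least \<open>h y / (2 * A)\<close>. A displacement of order \<theta> can be
      that large only if \<open>1 / \<theta>\<close> is bounded, and this replaces the
      \<open>1 / \<theta>\<close> in the bound for \<open>L x\<close>.\<close>
    have xy: "\<bar>x - y\<bar> \<le> \<theta> * \<bar>\<xi>\<bar> + \<theta>\<^sup>2 * \<bar>L y\<bar>"
      using J_lipschitz[OF Y_V[OF y \<theta>(1), of \<xi>], of 0 y] y \<theta>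
      by (auto simp: x_def Y_def V_def J_0 abs_mult)
    have pos: "0 < \<theta>"
    proof (rule ccontr)
      assume "\<not> 0 < \<theta>" then have "\<theta> = 0" using \<theta> by auto
      then show False using False Y_0[OF y] hx by (simp add: x_def)
    qed
    have "h y / 2 \<le> \<bar>h x - h y\<bar>" using False by linarith
    also have "\<dots> \<le> A * (\<theta> * \<bar>\<xi>\<bar> + \<theta>\<^sup>2 * \<bar>L y\<bar>)"
      using h_lipschitz[OF x y] xy A by (meson mult_left_mono order_trans less_imp_le)
    also have "\<dots> \<le> A * (\<theta> * (\<bar>\<xi>\<bar> + \<theta>1 * \<bar>L y\<bar>))"
      using A \<theta> by (auto simp: power2_eq_square algebra_simps intro!: mult_mono)
    finally have inv: "1 / \<theta> \<le> 2 * A * (\<bar>\<xi>\<bar> + \<theta>1 * \<bar>L y\<bar>) / h y"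
      using pos hx by (simp add: field_simps)
    have "\<theta>\<^sup>2 * \<bar>L x\<bar> = \<bar>x - y - \<theta> * \<xi>\<bar>"
    proof -
      have "\<theta>\<^sup>2 * L x = x - y - \<theta> * \<xi>" using eq by linarith
      then show ?thesis by (metis abs_mult abs_power2)
    qed
    also have "\<dots> \<le> 2 * \<theta> * \<bar>\<xi>\<bar> + \<theta>\<^sup>2 * \<bar>L y\<bar>" using xy t\<xi>' by linarith
    finally have *: "\<theta>\<^sup>2 * \<bar>L x\<bar> \<le> 2 * \<theta> * \<bar>\<xi>\<bar> + \<theta>\<^sup>2 * \<bar>L y\<bar>" .
    have "\<theta>\<^sup>2 * \<bar>L x\<bar> \<le> \<theta>\<^sup>2 * (2 * (1 / \<theta>) * \<bar>\<xi>\<bar> + \<bar>L y\<bar>)"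
    proof -
      have "\<theta>\<^sup>2 * (2 * (1 / \<theta>) * \<bar>\<xi>\<bar> + \<bar>L y\<bar>) = 2 * \<theta> * \<bar>\<xi>\<bar> + \<theta>\<^sup>2 * \<bar>L y\<bar>"
        using pos by (simp add: power2_eq_square algebra_simps)
      with * show ?thesis by simp
    qed
    then have "\<bar>L x\<bar> \<le> 2 * (1 / \<theta>) * \<bar>\<xi>\<bar> + \<bar>L y\<bar>" using pos by simp
    also have "\<dots> \<le> 2 * (2 * A * (\<bar>\<xi>\<bar> + \<theta>1 * \<bar>L y\<bar>) / h y) * \<bar>\<xi>\<bar> + \<bar>L y\<bar>"
      using inv by (intro add_mono mult_right_mono mult_left_mono) auto
    finally have Lx: "\<bar>L x\<bar> \<le> \<bar>L y\<bar> + 4 * A * (\<bar>\<xi>\<bar> + \<theta>1 * \<bar>L y\<bar>) / h y * \<bar>\<xi>\<bar>" by simp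
    have "1 / h x \<le> (1 + A) * (1 + \<bar>L x\<bar>)" by (rule h_inv[OF x])
    also have "\<dots> \<le> ?rest" using Lx A by (intro mult_left_mono) auto
    also have "\<dots> \<le> 2 / h y + ?rest" using hx by simp
    finally show ?thesis by (simp add: x_def)
  qed
qed

lemma wt_Y_bound:
  assumes y: "y \<in> I" and "0 \<le> \<theta>1"
  obtains C where "0 \<le> C" "\<And>\<theta> \<xi>. 0 \<le> \<theta> \<Longrightarrow> \<theta> \<le> \<theta>1 \<Longrightarrow> wt (Y y \<theta> \<xi>) \<le> C * (1 + \<bar>\<xi>\<bar>)\<^sup>2"
proof
  define c1 where "c1 = 1 + (1 + y + \<theta>1\<^sup>2) + \<theta>1 + 2 / h y"
  define c2 where "c2 = (1 + A) * (1 + \<bar>L y\<bar>)"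
  define c3 where "c3 = (1 + A) * (4 * A / h y)"
  define c4 where "c4 = (1 + A) * (4 * A * \<theta>1 * \<bar>L y\<bar> / h y)"
  have A: "0 < A" and hy: "0 < h y" and y0: "0 < y" using A_pos h_pos pos_I y by auto
  have nn: "0 \<le> c1" "0 \<le> c2" "0 \<le> c3" "0 \<le> c4"
    using A hy y0 assms by (auto simp: c1_def c2_def c3_def c4_def)
  show "0 \<le> c1 + c2 + c3 + c4" using nn by simp
  fix \<theta> \<xi> :: real assume \<theta>: "0 \<le> \<theta>" "\<theta> \<le> \<theta>1"
  define e where "e = (1 + \<bar>\<xi>\<bar>)\<^sup>2"
  have e: "1 \<le> e" "\<bar>\<xi>\<bar> \<le> e" "\<bar>\<xi>\<bar> * \<bar>\<xi>\<bar> \<le> e" by (auto simp: e_def power2_eq_square algebra_simps)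
  have "wt (Y y \<theta> \<xi>) \<le> 1 + (1 + y + \<theta>1\<^sup>2 + \<theta>1 * \<bar>\<xi>\<bar>) +
      (2 / h y + (1 + A) * (1 + \<bar>L y\<bar> + 4 * A * (\<bar>\<xi>\<bar> + \<theta>1 * \<bar>L y\<bar>) / h y * \<bar>\<xi>\<bar>))"
    unfolding wt_def using Y_bounds[OF y \<theta>, of \<xi>] by linarith
  also have "\<dots> = (1 + (1 + y + \<theta>1\<^sup>2) + 2 / h y) * 1 + \<theta>1 * \<bar>\<xi>\<bar> + c2 * 1 + c3 * (\<bar>\<xi>\<bar> * \<bar>\<xi>\<bar>) + c4 * \<bar>\<xi>\<bar>"
    unfolding c2_def c3_def c4_def using hy by (simp add: field_simps)
  also have "\<dots> \<le> (1 + (1 + y + \<theta>1\<^sup>2) + 2 / h y) * e + \<theta>1 * e + c2 * e + c3 * e + c4 * e"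
    by (intro add_mono mult_left_mono e nn) (use A hy y0 assms in auto)
  also have "\<dots> = (c1 + c2 + c3 + c4) * e" by (simp add: c1_def algebra_simps)
  finally show "wt (Y y \<theta> \<xi>) \<le> (c1 + c2 + c3 + c4) * (1 + \<bar>\<xi>\<bar>)\<^sup>2" by (simp add: e_def)
qed

end

section \<open>Dynkin's formula for one step\<close>

text \<open>Continuity of the space derivative upgrades the two partial derivatives to a total one.
  The time derivative may be one-sided at the ends of \<open>{0..S}\<close>, since the chain rule is
  applied at interior times.\<close>

lemma has_real_derivative_two_variables:
  fixes f ft fx :: "real \<Rightarrow> real \<Rightarrow> real"
  assumes I: "open I" "convex I"
    and dt: "\<And>s x. s \<in> {0..S} \<Longrightarrow> x \<in> I \<Longrightarrow> ((\<lambda>s. f s x) has_real_derivative ft s x) (at s within {0..S})"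
    and dx: "\<And>s x. s \<in> {0..S} \<Longrightarrow> x \<in> I \<Longrightarrow> (f s has_real_derivative fx s x) (at x)"
    and cont: "continuous_on ({0..S} \<times> I) (\<lambda>(s, x). fx s x)"
    and sf: "(sf has_real_derivative s') (at t)" and xf: "(xf has_real_derivative x') (at t)"
    and in_dom: "0 < sf t" "sf t < S" "xf t \<in> I"
  shows "((\<lambda>t. f (sf t) (xf t)) has_real_derivative
    ft (sf t) (xf t) * s' + fx (sf t) (xf t) * x') (at t)"
proof -
  have "((\<lambda>(s, x). f s x) has_derivative (\<lambda>(a, b). ft (sf t) (xf t) * a + blinfun_scaleR_left (fx (sf t) (xf t)) b))
      (at (sf t, xf t) within {0..S} \<times> I)"
  proof (rule has_derivative_partialsI)
    show "((\<lambda>s. f s (xf t)) has_derivative (*) (ft (sf t) (xf t))) (at (sf t) within {0..S})"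
      using dt[of "sf t" "xf t"] in_dom by (simp add: has_field_derivative_def)
    show "((\<lambda>y. f s y) has_derivative blinfun_apply (blinfun_scaleR_left (fx s y))) (at y within I)"
      if "s \<in> {0..S}" "y \<in> I" for s y
      using has_derivative_at_withinI[OF dx[OF that, unfolded has_field_derivative_def]]
      by (rule has_derivative_eq_rhs) (simp add: fun_eq_iff)
    have "continuous_on ({0..S} \<times> I) (\<lambda>w. blinfun_scaleR_left ((\<lambda>(s, x). fx s x) w) :: real \<Rightarrow>\<^sub>L real)"
      by (intro continuous_intros cont)
    then show "continuous (at (sf t, xf t) within {0..S} \<times> I)
        (\<lambda>(s, x). blinfun_scaleR_left (fx s x) :: real \<Rightarrow>\<^sub>L real)"
      using in_dom by (auto simp: continuous_on_eq_continuous_within case_prod_beta')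
  qed (use in_dom I in auto)
  then have "((\<lambda>(s, x). f s x) has_derivative (\<lambda>(a, b). ft (sf t) (xf t) * a + fx (sf t) (xf t) * b))
      (at (sf t, xf t) within {0<..<S} \<times> I)"
    by (rule has_derivative_subset[THEN has_derivative_eq_rhs]) (auto simp: mult.commute)
  then have "((\<lambda>(s, x). f s x) has_derivative (\<lambda>(a, b). ft (sf t) (xf t) * a + fx (sf t) (xf t) * b))
      (at (sf t, xf t))"
    by (subst (asm) at_within_open) (use in_dom I in \<open>auto intro: open_Times\<close>)
  moreover have "((\<lambda>t. (sf t, xf t)) has_derivative (\<lambda>d. (s' * d, x' * d))) (at t)"
    using sf xf unfolding has_field_derivative_def by (intro has_derivative_Pair)
  ultimately have "((\<lambda>t. (\<lambda>(s, x). f s x) (sf t, xf t)) has_derivative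
      (\<lambda>d. (\<lambda>(a, b). ft (sf t) (xf t) * a + fx (sf t) (xf t) * b) (s' * d, x' * d))) (at t)"
    by (rule has_derivative_compose[rotated])
  from has_derivative_eq_rhs[OF this, of "(*) (ft (sf t) (xf t) * s' + fx (sf t) (xf t) * x')"]
  show ?thesis
    unfolding has_field_derivative_def by (simp add: fun_eq_iff algebra_simps)
qed

text \<open>A class of integrands closed under sums and products for which the Gaussian expectation
  exists, depends continuously on the parameter and commutes with integration over it. The
  polynomial bound is uniform in the parameter so that it serves as the dominating function.\<close>

definition dominated :: "real \<Rightarrow> (real \<Rightarrow> real \<Rightarrow> real) \<Rightarrow> bool" where
  "dominated a H \<longleftrightarrow> continuous_on ({0..a} \<times> UNIV) (\<lambda>(t, x). H t x) \<and>
     (\<exists>C k. \<forall>t\<in>{0..a}. \<forall>x. \<bar>H t x\<bar> \<le> C * (1 + \<bar>x\<bar>) ^ k)"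

lemma dominatedI:
  assumes "continuous_on ({0..a} \<times> UNIV) (\<lambda>w. H (fst w) (snd w))"
    and "\<And>t x. t \<in> {0..a} \<Longrightarrow> \<bar>H t x\<bar> \<le> C * (1 + \<bar>x\<bar>) ^ k"
  shows "dominated a H"
  using assms unfolding dominated_def case_prod_beta' by blast

lemma dominated_cont: "dominated a H \<Longrightarrow> continuous_on ({0..a} \<times> UNIV) (\<lambda>(t, x). H t x)"
  by (simp add: dominated_def)

lemma dominated_cont_snd:
  assumes "dominated a H" "t \<in> {0..a}"
  shows "continuous_on UNIV (H t)"
proof -
  have "continuous_on UNIV (\<lambda>x. (\<lambda>(t, x). H t x) (t, x))"
    by (rule continuous_on_compose2[OF dominated_cont[OF assms(1)]])
       (use assms in \<open>auto intro!: continuous_intros\<close>)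
  then show ?thesis by simp
qed

lemma dominated_cont_fst:
  assumes "dominated a H"
  shows "continuous_on {0..a} (\<lambda>t. H t x)"
proof -
  have "continuous_on {0..a} (\<lambda>t. (\<lambda>(t, x). H t x) (t, x))"
    by (rule continuous_on_compose2[OF dominated_cont[OF assms(1)]])
       (use assms in \<open>auto intro!: continuous_intros\<close>)
  then show ?thesis by simp
qed

lemma dominated_boundE:
  assumes "dominated a H"
  obtains C k where "0 \<le> C" "\<And>t x. t \<in> {0..a} \<Longrightarrow> \<bar>H t x\<bar> \<le> C * (1 + \<bar>x\<bar>) ^ k"
proof -
  from assms obtain C k where b: "\<And>t x. t \<in> {0..a} \<Longrightarrow> \<bar>H t x\<bar> \<le> C * (1 + \<bar>x\<bar>) ^ k"
    unfolding dominated_def by blast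
  show thesis
  proof (rule that[of "\<bar>C\<bar>"])
    fix t x assume "t \<in> {0..a}"
    then have "\<bar>H t x\<bar> \<le> C * (1 + \<bar>x\<bar>) ^ k" by (rule b)
    also have "\<dots> \<le> \<bar>C\<bar> * (1 + \<bar>x\<bar>) ^ k" by (intro mult_right_mono) auto
    finally show "\<bar>H t x\<bar> \<le> \<bar>C\<bar> * (1 + \<bar>x\<bar>) ^ k" .
  qed simp
qed

lemma dominated_gauss_integrable:
  assumes "dominated a H" "t \<in> {0..a}"
  shows "integrable gauss (H t)"
proof -
  obtain C k where b: "\<And>t x. t \<in> {0..a} \<Longrightarrow> \<bar>H t x\<bar> \<le> C * (1 + \<bar>x\<bar>) ^ k"
    using dominated_boundE[OF assms(1)] by metis
  show ?thesis
    by (rule gauss_integrableI[OF _ b[OF assms(2)]])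
       (rule borel_measurable_continuous_onI[OF dominated_cont_snd[OF assms]])
qed

lemma dominated_expectation_continuous:
  assumes H: "dominated a H"
  shows "continuous_on {0..a} (\<lambda>t. \<integral>x. H t x \<partial>gauss)"
  unfolding continuous_on_sequentially
proof safe
  obtain C k where b: "\<And>t x. t \<in> {0..a} \<Longrightarrow> \<bar>H t x\<bar> \<le> C * (1 + \<bar>x\<bar>) ^ k"
    using dominated_boundE[OF assms(1)] by metis
  fix u t assume t: "t \<in> {0..a}" and u: "\<forall>n. u n \<in> {0..a}" "u \<longlonglongrightarrow> t"
  have "(\<lambda>n. \<integral>x. H (u n) x \<partial>gauss) \<longlonglongrightarrow> (\<integral>x. H t x \<partial>gauss)"
  proof (rule integral_dominated_convergence)
    show "integrable gauss (\<lambda>x. C * (1 + \<bar>x\<bar>) ^ k)"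
      using gauss_integrable_poly by (rule integrable_mult_right)
    show "AE x in gauss. (\<lambda>n. H (u n) x) \<longlonglongrightarrow> H t x"
      using dominated_cont_fst[OF H] t u unfolding continuous_on_sequentially comp_def by blast
    show "AE x in gauss. norm (H (u n) x) \<le> C * (1 + \<bar>x\<bar>) ^ k" for n
      using b u by auto
    show "H t \<in> borel_measurable gauss" "H (u n) \<in> borel_measurable gauss" for n
      using dominated_gauss_integrable[OF H] t u by (auto intro: borel_measurable_integrable)
  qed
  then show "((\<lambda>t. \<integral>x. H t x \<partial>gauss) \<circ> u) \<longlonglongrightarrow> (\<integral>x. H t x \<partial>gauss)"
    by (simp add: comp_def)
qed

text \<open>The integral over \<open>t\<close> is the gauge integral, because the fundamental
  theorem of calculus delivers that one; continuity in \<open>t\<close> identifies it with the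
  Lebesgue integral, to which Fubini's theorem applies.\<close>

lemma dominated_Fubini:
  assumes H: "dominated a H"
  shows "(\<integral>x. integral {0..a} (\<lambda>t. H t x) \<partial>gauss) = integral {0..a} (\<lambda>t. \<integral>x. H t x \<partial>gauss)"
proof -
  obtain C k where C: "0 \<le> C" and b: "\<And>t x. t \<in> {0..a} \<Longrightarrow> \<bar>H t x\<bar> \<le> C * (1 + \<bar>x\<bar>) ^ k"
    using dominated_boundE[OF H] by metis
  interpret pair_sigma_finite lborel gauss by standard
  define f where "f w = indicator ({0..a} \<times> UNIV) w *\<^sub>R (\<lambda>(t, x). H t x) w" for w :: "real \<times> real"
  have meas: "f \<in> borel_measurable (lborel \<Otimes>\<^sub>M gauss)"
  proof -
    have "f \<in> borel_measurable borel"
      unfolding f_def by (intro borel_measurable_continuous_on_indicator dominated_cont[OF H])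
        (intro borel_closed closed_Times closed_UNIV closed_atLeastAtMost)
    then show ?thesis
      by (simp add: borel_prod[symmetric] cong: measurable_cong_sets sets_pair_measure_cong)
  qed
  have fe: "f (t, x) = indicator {0..a} t *\<^sub>R H t x" for t x
    by (auto simp: f_def indicator_def)
  have int1: "integrable lborel (\<lambda>t. indicator {0..a} t * c)" for c :: real
    by (intro integrable_mult_left integrable_real_indicator) (auto simp: emeasure_lborel_Icc_eq)
  have "integrable (lborel \<Otimes>\<^sub>M gauss) f"
  proof (rule Bochner_Integration.integrable_bound)
    show "integrable (lborel \<Otimes>\<^sub>M gauss) (\<lambda>(t, x). indicator {0..a} t * (C * (1 + \<bar>x\<bar>) ^ k))"
    proof (rule Fubini_integrable)
      show "integrable lborel (\<lambda>t. \<integral>x. norm (case (t, x) of (t, x) \<Rightarrow> indicator {0..a} t * (C * (1 + \<bar>x\<bar>) ^ k)) \<partial>gauss)"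
        using int1 C by (simp add: abs_mult)
      show "AE t in lborel. integrable gauss (\<lambda>x. case (t, x) of (t, x) \<Rightarrow> indicator {0..a} t * (C * (1 + \<bar>x\<bar>) ^ k))"
        by (simp add: gauss_integrable_poly)
    qed measurable
    show "AE w in lborel \<Otimes>\<^sub>M gauss. norm (f w) \<le> norm (case w of (t, x) \<Rightarrow> indicator {0..a} t * (C * (1 + \<bar>x\<bar>) ^ k))"
      using b C by (auto simp: f_def abs_mult split: split_indicator)
  qed (rule meas)
  then have int: "integrable (lborel \<Otimes>\<^sub>M gauss) (\<lambda>(t, x). f (t, x))" by (simp add: case_prod_beta')
  have eq: "(\<integral>x. (\<integral>t. f (t, x) \<partial>lborel) \<partial>gauss) = (\<integral>t. (\<integral>x. f (t, x) \<partial>gauss) \<partial>lborel)"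
    by (rule Fubini_integral[OF int])
  have si: "set_integrable lborel {0..a} g" if "continuous_on {0..a} g" for g :: "real \<Rightarrow> real"
    using that by (rule borel_integrable_atLeastAtMost')
  have "(\<integral>t. f (t, x) \<partial>lborel) = integral {0..a} (\<lambda>t. H t x)" for x
    using set_borel_integral_eq_integral(2)[OF si[OF dominated_cont_fst[OF H]], of x]
    by (simp add: fe set_lebesgue_integral_def)
  moreover have "(\<integral>t. (\<integral>x. f (t, x) \<partial>gauss) \<partial>lborel) = integral {0..a} (\<lambda>t. \<integral>x. H t x \<partial>gauss)"
    using set_borel_integral_eq_integral(2)[OF si[OF dominated_expectation_continuous[OF H]]]
    by (simp add: fe set_lebesgue_integral_def)
  ultimately show ?thesis using eq by simp
qed

lemma dominated_mult:
  assumes "dominated a H" "dominated a K"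
  shows "dominated a (\<lambda>t x. H t x * K t x)"
proof -
  obtain C k where C: "0 \<le> C" "\<And>t x. t \<in> {0..a} \<Longrightarrow> \<bar>H t x\<bar> \<le> C * (1 + \<bar>x\<bar>) ^ k"
    using dominated_boundE[OF assms(1)] by metis
  obtain C' k' where C': "0 \<le> C'" "\<And>t x. t \<in> {0..a} \<Longrightarrow> \<bar>K t x\<bar> \<le> C' * (1 + \<bar>x\<bar>) ^ k'"
    using dominated_boundE[OF assms(2)] by metis
  have "\<bar>H t x * K t x\<bar> \<le> C * C' * (1 + \<bar>x\<bar>) ^ (k + k')" if "t \<in> {0..a}" for t x
  proof -
    have "\<bar>H t x * K t x\<bar> \<le> (C * (1 + \<bar>x\<bar>) ^ k) * (C' * (1 + \<bar>x\<bar>) ^ k')"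
      unfolding abs_mult using C C' that by (intro mult_mono) auto
    then show ?thesis by (simp add: power_add mult_ac)
  qed
  moreover have "continuous_on ({0..a} \<times> UNIV) (\<lambda>w. (\<lambda>(t, x). H t x) w * (\<lambda>(t, x). K t x) w)"
    by (intro continuous_on_mult dominated_cont assms)
  ultimately show ?thesis by (intro dominatedI) (auto simp: case_prod_beta')
qed

lemma dominated_add:
  assumes "dominated a H" "dominated a K"
  shows "dominated a (\<lambda>t x. H t x + K t x)"
proof -
  obtain C k where C: "0 \<le> C" "\<And>t x. t \<in> {0..a} \<Longrightarrow> \<bar>H t x\<bar> \<le> C * (1 + \<bar>x\<bar>) ^ k"
    using dominated_boundE[OF assms(1)] by metis
  obtain C' k' where C': "0 \<le> C'" "\<And>t x. t \<in> {0..a} \<Longrightarrow> \<bar>K t x\<bar> \<le> C' * (1 + \<bar>x\<bar>) ^ k'"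
    using dominated_boundE[OF assms(2)] by metis
  have "\<bar>H t x + K t x\<bar> \<le> (C + C') * (1 + \<bar>x\<bar>) ^ (k + k')" if "t \<in> {0..a}" for t x
  proof -
    have "\<bar>H t x + K t x\<bar> \<le> C * (1 + \<bar>x\<bar>) ^ k + C' * (1 + \<bar>x\<bar>) ^ k'"
      using abs_triangle_ineq[of "H t x" "K t x"] C(2)[OF that, of x] C'(2)[OF that, of x] by linarith
    also have "\<dots> \<le> C * (1 + \<bar>x\<bar>) ^ (k + k') + C' * (1 + \<bar>x\<bar>) ^ (k + k')"
      using C C' by (intro add_mono mult_left_mono power_increasing) auto
    finally show ?thesis by (simp add: distrib_right)
  qed
  moreover have "continuous_on ({0..a} \<times> UNIV) (\<lambda>w. (\<lambda>(t, x). H t x) w + (\<lambda>(t, x). K t x) w)"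
    by (intro continuous_on_add dominated_cont assms)
  ultimately show ?thesis by (intro dominatedI) (auto simp: case_prod_beta')
qed

lemma dominated_fst: "continuous_on {0..a} c \<Longrightarrow> dominated a (\<lambda>t x. c t)"
proof -
  assume c: "continuous_on {0..a} c"
  then have "bounded (c ` {0..a})" by (intro compact_imp_bounded compact_continuous_image) auto
  then obtain B where "\<forall>u\<in>c ` {0..a}. norm u \<le> B" unfolding bounded_iff by blast
  then have "\<And>t x. t \<in> {0..a} \<Longrightarrow> \<bar>c t\<bar> \<le> B * (1 + \<bar>x\<bar>) ^ 0" by simp
  moreover have "continuous_on ({0..a} \<times> UNIV) (\<lambda>w. c (fst w))"
    by (rule continuous_on_compose2[OF c]) (auto intro!: continuous_intros)
  ultimately show ?thesis by (intro dominatedI)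
qed

lemma dominated_snd: "dominated a (\<lambda>t x. x)"
  by (rule dominatedI[where C = 1 and k = 1]) (auto intro!: continuous_intros)

section \<open>Growth classes on the state interval and Dynkin's formula\<close>

context concave_weight
begin

text \<open>The counterpart of \<open>dominated\<close> for functions of time and state: composition
  with a step turns a \<open>tempered\<close> function into a \<open>dominated\<close> one. It
  serves only to justify integrals and limits; the exact strength of a singularity is recorded by
  \<open>orders\<close>.\<close>

definition tempered :: "real \<Rightarrow> (real \<Rightarrow> real \<Rightarrow> real) \<Rightarrow> bool" where
  "tempered S f \<longleftrightarrow> continuous_on ({0..S} \<times> I) (\<lambda>(s, x). f s x) \<and>
     (\<exists>C k. \<forall>s\<in>{0..S}. \<forall>x\<in>I. \<bar>f s x\<bar> \<le> C * wt x ^ k)"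

lemma temperedI:
  assumes "continuous_on ({0..S} \<times> I) (\<lambda>w. f (fst w) (snd w))"
    and "\<And>s x. s \<in> {0..S} \<Longrightarrow> x \<in> I \<Longrightarrow> \<bar>f s x\<bar> \<le> C * wt x ^ k"
  shows "tempered S f"
  using assms unfolding tempered_def case_prod_beta' by blast

lemma tempered_cont: "tempered S f \<Longrightarrow> continuous_on ({0..S} \<times> I) (\<lambda>(s, x). f s x)"
  by (simp add: tempered_def)

lemma wt_pos: "x \<in> I \<Longrightarrow> 0 < wt x" using wt_ge[of x] by simp

lemma tempered_boundE:
  assumes "tempered S f"
  obtains C k where "0 \<le> C" "\<And>s x. s \<in> {0..S} \<Longrightarrow> x \<in> I \<Longrightarrow> \<bar>f s x\<bar> \<le> C * wt x ^ k"
proof -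
  from assms obtain C k where b: "\<And>s x. s \<in> {0..S} \<Longrightarrow> x \<in> I \<Longrightarrow> \<bar>f s x\<bar> \<le> C * wt x ^ k"
    unfolding tempered_def by blast
  show thesis
  proof (rule that[of "\<bar>C\<bar>"])
    fix s x assume a: "s \<in> {0..S}" "x \<in> I"
    then have "\<bar>f s x\<bar> \<le> C * wt x ^ k" by (rule b)
    also have "\<dots> \<le> \<bar>C\<bar> * wt x ^ k" using less_imp_le[OF wt_pos] a by (intro mult_right_mono) auto
    finally show "\<bar>f s x\<bar> \<le> \<bar>C\<bar> * wt x ^ k" .
  qed simp
qed

lemma tempered_mult [intro]:
  assumes "tempered S f" "tempered S g"
  shows "tempered S (\<lambda>s x. f s x * g s x)"
proof -
  obtain C k where C: "0 \<le> C" "\<And>s x. s \<in> {0..S} \<Longrightarrow> x \<in> I \<Longrightarrow> \<bar>f s x\<bar> \<le> C * wt x ^ k"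
    using tempered_boundE[OF assms(1)] by metis
  obtain C' k' where C': "0 \<le> C'" "\<And>s x. s \<in> {0..S} \<Longrightarrow> x \<in> I \<Longrightarrow> \<bar>g s x\<bar> \<le> C' * wt x ^ k'"
    using tempered_boundE[OF assms(2)] by metis
  have "\<bar>f s x * g s x\<bar> \<le> C * C' * wt x ^ (k + k')" if "s \<in> {0..S}" "x \<in> I" for s x
  proof -
    have "\<bar>f s x * g s x\<bar> \<le> (C * wt x ^ k) * (C' * wt x ^ k')"
      unfolding abs_mult using C C' that wt_pos[of x] by (intro mult_mono) auto
    then show ?thesis by (simp add: power_add mult_ac)
  qed
  moreover have "continuous_on ({0..S} \<times> I) (\<lambda>w. (\<lambda>(t, x). f t x) w * (\<lambda>(t, x). g t x) w)"
    by (intro continuous_on_mult tempered_cont assms)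
  ultimately show ?thesis by (intro temperedI) (auto simp: case_prod_beta')
qed

lemma tempered_add [intro]:
  assumes "tempered S f" "tempered S g"
  shows "tempered S (\<lambda>s x. f s x + g s x)"
proof -
  obtain C k where C: "0 \<le> C" "\<And>s x. s \<in> {0..S} \<Longrightarrow> x \<in> I \<Longrightarrow> \<bar>f s x\<bar> \<le> C * wt x ^ k"
    using tempered_boundE[OF assms(1)] by metis
  obtain C' k' where C': "0 \<le> C'" "\<And>s x. s \<in> {0..S} \<Longrightarrow> x \<in> I \<Longrightarrow> \<bar>g s x\<bar> \<le> C' * wt x ^ k'"
    using tempered_boundE[OF assms(2)] by metis
  have "\<bar>f s x + g s x\<bar> \<le> (C + C') * wt x ^ (k + k')" if a: "s \<in> {0..S}" "x \<in> I" for s x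
  proof -
    have "\<bar>f s x + g s x\<bar> \<le> C * wt x ^ k + C' * wt x ^ k'"
      using abs_triangle_ineq[of "f s x" "g s x"] C(2)[OF a] C'(2)[OF a] by linarith
    also have "\<dots> \<le> C * wt x ^ (k + k') + C' * wt x ^ (k + k')"
      using C C' wt_ge[OF a(2)] by (intro add_mono mult_left_mono power_increasing) auto
    finally show ?thesis by (simp add: distrib_right)
  qed
  moreover have "continuous_on ({0..S} \<times> I) (\<lambda>w. (\<lambda>(t, x). f t x) w + (\<lambda>(t, x). g t x) w)"
    by (intro continuous_on_add tempered_cont assms)
  ultimately show ?thesis by (intro temperedI) (auto simp: case_prod_beta')
qed

lemma tempered_space:
  assumes "continuous_on I f" "\<And>x. x \<in> I \<Longrightarrow> \<bar>f x\<bar> \<le> C * wt x ^ k"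
  shows "tempered S (\<lambda>s x. f x)"
proof -
  have "continuous_on ({0..S} \<times> I) (\<lambda>w. f (snd w))"
    by (rule continuous_on_compose2[OF assms(1)]) (auto intro!: continuous_intros)
  then show ?thesis unfolding tempered_def using assms(2) by (auto simp: case_prod_beta')
qed

lemma tempered_time:
  assumes "continuous_on {0..S} c"
  shows "tempered S (\<lambda>s x. c s)"
proof -
  have "bounded (c ` {0..S})" using assms by (intro compact_imp_bounded compact_continuous_image) auto
  then obtain B where "\<forall>u\<in>c ` {0..S}. norm u \<le> B" unfolding bounded_iff by blast
  then have "\<And>s x. s \<in> {0..S} \<Longrightarrow> x \<in> I \<Longrightarrow> \<bar>c s\<bar> \<le> B * wt x ^ 0" by simp
  moreover have "continuous_on ({0..S} \<times> I) (\<lambda>w. c (fst w))"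
    by (rule continuous_on_compose2[OF assms]) (auto intro!: continuous_intros)
  ultimately show ?thesis by (intro temperedI)
qed

lemma tempered_const: "tempered S (\<lambda>s x. c)"
  by (rule tempered_time) (rule continuous_on_const)

lemma tempered_minus: "tempered S f \<Longrightarrow> tempered S (\<lambda>s x. - f s x)"
  using tempered_mult[OF tempered_const[of S "-1"], of f] by simp

lemma tempered_diff: "tempered S f \<Longrightarrow> tempered S g \<Longrightarrow> tempered S (\<lambda>s x. f s x - g s x)"
  using tempered_add[OF _ tempered_minus[of S g], of f] by simp

lemma tempered_power: "tempered S f \<Longrightarrow> tempered S (\<lambda>s x. f s x ^ n)"
  by (induction n) (auto intro: tempered_const)

lemma h_powr_wt: "x \<in> I \<Longrightarrow> 0 \<le> q \<Longrightarrow> q \<le> real k \<Longrightarrow> h x powr (- q) \<le> wt x ^ k"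
proof -
  assume x: "x \<in> I" and q: "0 \<le> q" "q \<le> real k"
  have "h x powr (- q) = (1 / h x) powr q"
    using h_pos[OF x] by (simp add: powr_minus powr_divide inverse_eq_divide)
  also have "\<dots> \<le> wt x powr q"
    using h_pos[OF x] pos_I[OF x] q by (intro powr_mono2) (auto simp: wt_def)
  also have "\<dots> \<le> wt x powr real k" using wt_ge[OF x] q by (intro powr_mono) auto
  also have "\<dots> = wt x ^ k" using wt_pos[OF x] by (simp add: powr_realpow)
  finally show ?thesis .
qed

lemma tempered_h_powr: "0 \<le> q \<Longrightarrow> tempered S (\<lambda>s x. h x powr (- q))"
proof (rule tempered_space)
  assume q: "0 \<le> q"
  show "continuous_on I (\<lambda>x. h x powr (- q))"
    by (intro continuous_intros cont_h) (use h_nz in auto)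
  show "\<bar>h x powr (- q)\<bar> \<le> 1 * wt x ^ nat \<lceil>q\<rceil>" if "x \<in> I" for x
    using h_powr_wt[OF that q, of "nat \<lceil>q\<rceil>"] q by simp
qed

lemma tempered_x: "tempered S (\<lambda>s x. x)"
  by (rule tempered_space[of _ 1 1]) (use pos_I h_pos in \<open>auto simp: wt_def less_imp_le\<close>)

lemma tempered_s: "tempered S (\<lambda>s x. s)"
  by (rule tempered_time) (rule continuous_on_id)

lemma tempered_cmult: "tempered S f \<Longrightarrow> tempered S (\<lambda>s x. c * f s x)"
  by (intro tempered_mult tempered_const)

lemma tempered_bounded_by:
  assumes "tempered S g" "continuous_on ({0..S} \<times> I) (\<lambda>(s, x). f s x)"
    "\<And>s x. s \<in> {0..S} \<Longrightarrow> x \<in> I \<Longrightarrow> \<bar>f s x\<bar> \<le> g s x"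
  shows "tempered S f"
proof -
  obtain C k where "\<And>s x. s \<in> {0..S} \<Longrightarrow> x \<in> I \<Longrightarrow> \<bar>g s x\<bar> \<le> C * wt x ^ k"
    using tempered_boundE[OF assms(1)] by metis
  then have "\<forall>s\<in>{0..S}. \<forall>x\<in>I. \<bar>f s x\<bar> \<le> C * wt x ^ k"
    using assms(3) by (meson abs_ge_self order_trans)
  then show ?thesis unfolding tempered_def using assms(2) by blast
qed

lemma tempered_space_bounded_by:
  assumes "tempered S (\<lambda>s x. g x)" "continuous_on I f" "\<And>x. x \<in> I \<Longrightarrow> \<bar>f x\<bar> \<le> g x"
  shows "tempered S (\<lambda>s x. f x)"
proof -
  have "continuous_on ({0..S} \<times> I) (\<lambda>w. f (snd w))"
    by (rule continuous_on_compose2[OF assms(2)]) (auto intro!: continuous_intros)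
  then show ?thesis
    by (intro tempered_bounded_by[OF assms(1)]) (use assms(3) in \<open>auto simp: case_prod_beta'\<close>)
qed

lemma h2_quot: "x \<in> I \<Longrightarrow> \<bar>h2 x / h x\<bar> \<le> A * h x powr (- p)"
  using h2_bound[of x] h_pos[of x] by (simp add: powr_diff powr_minus field_simps)

lemma h3_quot: "x \<in> I \<Longrightarrow> \<bar>h3 x / h x\<bar> \<le> A * h x powr (- (1 + p))"
  using h3_bound[of x] h_pos[of x] by (simp add: powr_add powr_minus powr_diff field_simps)

lemma h4_quot: "x \<in> I \<Longrightarrow> \<bar>h4 x / h x\<bar> \<le> A * h x powr (- (2 + p))"
proof -
  assume x: "x \<in> I"
  have "h x powr (-1 - p) / h x = h x powr (- (2 + p))"
    using h_pos[OF x] powr_diff[of "h x" "-1 - p" 1] by (simp add: algebra_simps)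
  then show ?thesis
    using divide_right_mono[OF h4_bound[OF x], of "h x"] h_pos[OF x]
    by (simp add: times_divide_eq_right[symmetric] del: times_divide_eq_right)
qed

lemma tempered_h2_quot: "tempered S (\<lambda>s x. h2 x / h x)"
  by (rule tempered_space_bounded_by[OF tempered_cmult[OF tempered_h_powr], OF _ _ h2_quot])
     (use p h_nz in \<open>auto intro!: continuous_intros cont_h cont_h2\<close>)

lemma tempered_h3_quot: "tempered S (\<lambda>s x. h3 x / h x)"
  by (rule tempered_space_bounded_by[OF tempered_cmult[OF tempered_h_powr], OF _ _ h3_quot])
     (use p h_nz in \<open>auto intro!: continuous_intros cont_h cont_h3\<close>)

lemma tempered_L: "tempered S (\<lambda>s x. L x)"
proof (rule tempered_space_bounded_by[OF _ cont_L])
  show "tempered S (\<lambda>s x. A * h x powr (- 1))" by (rule tempered_cmult[OF tempered_h_powr]) simp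
  show "\<bar>L x\<bar> \<le> A * h x powr (- 1)" if "x \<in> I" for x
    using L_abs[OF that] h_pos[OF that] by (simp add: powr_minus inverse_eq_divide)
qed

lemma tempered_L1: "tempered S (\<lambda>s x. L1 x)"
  unfolding L1_def by (intro tempered_diff tempered_power tempered_L tempered_h2_quot)

lemma tempered_L2: "tempered S (\<lambda>s x. L2 x)"
  unfolding L2_def
  by (intro tempered_diff tempered_add tempered_mult tempered_const tempered_power tempered_L
      tempered_h2_quot tempered_h3_quot)

lemma tempered_inv_D: "tempered S (\<lambda>s x. 1 / D s x)"
proof (rule tempered_bounded_by[OF tempered_const[of S 1]])
  have "continuous_on ({0..S} \<times> I) (\<lambda>w. 1 / (\<lambda>(s, x). D s x) w)"
  proof (intro continuous_intros ballI)
    show "continuous_on ({0..S} \<times> I) (\<lambda>(s, x). D s x)"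
      unfolding D_def
      by (rule tempered_cont) (intro tempered_diff tempered_const tempered_mult tempered_s tempered_L1)
    show "(case w of (s, x) \<Rightarrow> D s x) \<noteq> 0" if "w \<in> {0..S} \<times> I" for w
      using that D_ge[of "snd w" "fst w"] by auto
  qed
  then show "continuous_on ({0..S} \<times> I) (\<lambda>(s, x). 1 / D s x)" by (simp add: case_prod_beta')
  show "\<bar>1 / D s x\<bar> \<le> 1" if "s \<in> {0..S}" "x \<in> I" for s x
    using D_ge[of x s] that by simp
qed

lemma d_inv_D:
  assumes x: "x \<in> I" and s: "0 \<le> s"
  shows "((\<lambda>x. 1 / D s x) has_real_derivative s * L2 x / (D s x)\<^sup>2) (at x)"
proof -
  have "(D s has_real_derivative - (s * L2 x)) (at x)"
    unfolding D_def [abs_def] by (auto intro!: derivative_eq_intros dL1[OF x])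
  then show ?thesis
    using D_ge[OF x s] by (auto intro!: derivative_eq_intros simp: power2_eq_square)
qed

text \<open>The generator of \<open>s \<mapsto> J s (y + W\<^sub>s)\<close>, applied to a function with derivatives \<open>a\<close>, \<open>b\<close> at \<open>x\<close>.\<close>

definition gen :: "real \<Rightarrow> real \<Rightarrow> real \<Rightarrow> real \<Rightarrow> real" where
  "gen s x a b = L x * a / D s x + b / (2 * (D s x)\<^sup>2) + s * L2 x * a / (2 * (D s x) ^ 3)"

lemma tempered_gen:
  assumes "tempered S a" "tempered S b"
  shows "tempered S (\<lambda>s x. gen s x (a s x) (b s x))"
proof -
  have "gen s x (a s x) (b s x) = L x * a s x * (1 / D s x) + (1/2) * (b s x * (1 / D s x) ^ 2)
      + (1/2) * (s * L2 x * a s x * (1 / D s x) ^ 3)" for s x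
    by (simp add: gen_def power_divide)
  then show ?thesis
    by (simp only:)
       (intro tempered_add tempered_mult tempered_power tempered_inv_D tempered_const tempered_s
        tempered_L tempered_L2 assms)
qed

text \<open>Along a step \<open>wt\<close> grows at most quadratically in \<xi>, uniformly in
  \<theta>, so a bound by \<open>wt ^ k\<close> becomes one of degree \<open>2 * k\<close> in
  \<xi>.\<close>

lemma dominated_Y:
  assumes y: "y \<in> I" and f: "tempered (\<theta>1\<^sup>2) f" and "0 \<le> \<theta>1"
  shows "dominated \<theta>1 (\<lambda>\<theta> \<xi>. f (\<theta>\<^sup>2) (Y y \<theta> \<xi>))"
  unfolding dominated_def
proof
  have sub: "\<theta>\<^sup>2 \<in> {0..\<theta>1\<^sup>2}" if "\<theta> \<in> {0..\<theta>1}" for \<theta>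
    using that by (auto intro: power_mono)
  have Yc: "continuous_on ({0..\<theta>1} \<times> UNIV) (\<lambda>w. Y y (fst w) (snd w))"
    using continuous_on_subset[OF continuous_on_Y[OF y], of "{0..\<theta>1} \<times> UNIV"]
    by (simp add: case_prod_beta' Sigma_mono)
  have "continuous_on ({0..\<theta>1} \<times> UNIV) (\<lambda>w. (\<lambda>(s, x). f s x) ((fst w)\<^sup>2, Y y (fst w) (snd w)))"
    by (rule continuous_on_compose2[OF tempered_cont[OF f]])
       (use sub in \<open>auto intro!: continuous_intros Yc Y_in y\<close>)
  then show "continuous_on ({0..\<theta>1} \<times> UNIV) (\<lambda>(\<theta>, \<xi>). f (\<theta>\<^sup>2) (Y y \<theta> \<xi>))"
    by (simp add: case_prod_beta')
  obtain C k where C: "0 \<le> C" "\<And>s x. s \<in> {0..\<theta>1\<^sup>2} \<Longrightarrow> x \<in> I \<Longrightarrow> \<bar>f s x\<bar> \<le> C * wt x ^ k"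
    using tempered_boundE[OF f] by metis
  obtain B where B: "0 \<le> B" "\<And>\<theta> \<xi>. 0 \<le> \<theta> \<Longrightarrow> \<theta> \<le> \<theta>1 \<Longrightarrow> wt (Y y \<theta> \<xi>) \<le> B * (1 + \<bar>\<xi>\<bar>)\<^sup>2"
    using wt_Y_bound[OF y \<open>0 \<le> \<theta>1\<close>] by metis
  have "\<bar>f (\<theta>\<^sup>2) (Y y \<theta> \<xi>)\<bar> \<le> C * B ^ k * (1 + \<bar>\<xi>\<bar>) ^ (2 * k)" if "\<theta> \<in> {0..\<theta>1}" for \<theta> \<xi>
  proof -
    have x: "Y y \<theta> \<xi> \<in> I" using that by (intro Y_in y) auto
    have "\<bar>f (\<theta>\<^sup>2) (Y y \<theta> \<xi>)\<bar> \<le> C * wt (Y y \<theta> \<xi>) ^ k" using C(2)[OF sub[OF that] x] .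
    also have "\<dots> \<le> C * (B * (1 + \<bar>\<xi>\<bar>)\<^sup>2) ^ k"
      using C B that wt_pos[OF x] by (intro mult_left_mono power_mono) auto
    finally show ?thesis by (simp add: power_mult_distrib power_mult)
  qed
  then show "\<exists>C k. \<forall>t\<in>{0..\<theta>1}. \<forall>x. \<bar>f (t\<^sup>2) (Y y t x)\<bar> \<le> C * (1 + \<bar>x\<bar>) ^ k" by blast
qed

text \<open>For fixed \<xi> this is the fundamental theorem of calculus for
  \<open>f (\<theta>^2) (Y y \<theta> \<xi>)\<close> in \<theta>. The summand with the factor \<xi>
  plays the role of the stochastic integral in Ito's formula; integration by parts converts its mean
  into the second-order terms. In the variable \<open>s = \<theta>^2\<close> the weight
  \<open>2 * \<theta>\<close> is the time element.\<close>

lemma Y_dynkin: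
  assumes y: "y \<in> I" and \<theta>1: "0 < \<theta>1" and S: "S = \<theta>1\<^sup>2"
    and dt: "\<And>s x. s \<in> {0..S} \<Longrightarrow> x \<in> I \<Longrightarrow> ((\<lambda>s. f s x) has_real_derivative ft s x) (at s within {0..S})"
    and dx: "\<And>s x. s \<in> {0..S} \<Longrightarrow> x \<in> I \<Longrightarrow> (f s has_real_derivative fx s x) (at x)"
    and dxx: "\<And>s x. s \<in> {0..S} \<Longrightarrow> x \<in> I \<Longrightarrow> (fx s has_real_derivative fxx s x) (at x)"
    and f: "tempered S f" and ft: "tempered S ft" and fx: "tempered S fx" and fxx: "tempered S fxx"
  shows "(\<integral>\<xi>. f S (Y y \<theta>1 \<xi>) \<partial>gauss) - f 0 y =
    integral {0..\<theta>1} (\<lambda>\<theta>. 2 * \<theta> * (\<integral>\<xi>. ft (\<theta>\<^sup>2) (Y y \<theta> \<xi>) +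
      gen (\<theta>\<^sup>2) (Y y \<theta> \<xi>) (fx (\<theta>\<^sup>2) (Y y \<theta> \<xi>)) (fxx (\<theta>\<^sup>2) (Y y \<theta> \<xi>)) \<partial>gauss))"
proof -
  note [simp] = S
  define g where "g \<theta> \<xi> = fx (\<theta>\<^sup>2) (Y y \<theta> \<xi>) * (1 / D (\<theta>\<^sup>2) (Y y \<theta> \<xi>))" for \<theta> \<xi>
  define k where "k \<theta> \<xi> = ft (\<theta>\<^sup>2) (Y y \<theta> \<xi>) + g \<theta> \<xi> * L (Y y \<theta> \<xi>)" for \<theta> \<xi>
  define H where "H \<theta> \<xi> = (2 * \<theta>) * k \<theta> \<xi> + \<xi> * g \<theta> \<xi>" for \<theta> \<xi>
  note domY = dominated_Y[OF y _ less_imp_le[OF \<theta>1]]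
  have dom_g: "dominated \<theta>1 g"
    unfolding g_def using fx by (intro domY[of "\<lambda>s x. fx s x * (1 / D s x)"] tempered_mult tempered_inv_D) simp
  have dom_k: "dominated \<theta>1 k"
    unfolding k_def using ft dom_g
    by (intro dominated_add dominated_mult domY[of ft] domY[of "\<lambda>s x. L x"] tempered_L) simp_all
  have dom_H: "dominated \<theta>1 H"
    unfolding H_def
    by (intro dominated_add dominated_mult dominated_fst dominated_snd dom_g dom_k continuous_intros)
  have dom_f: "dominated \<theta>1 (\<lambda>\<theta> \<xi>. f (\<theta>\<^sup>2) (Y y \<theta> \<xi>))" using f by (intro domY) simp
  have path: "integral {0..\<theta>1} (\<lambda>\<theta>. H \<theta> \<xi>) = f S (Y y \<theta>1 \<xi>) - f 0 y" for \<xi>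
  proof -
    have "((\<lambda>\<theta>. H \<theta> \<xi>) has_integral (f (\<theta>1\<^sup>2) (Y y \<theta>1 \<xi>) - f (0\<^sup>2) (Y y 0 \<xi>))) {0..\<theta>1}"
    proof (rule fundamental_theorem_of_calculus_interior)
      show "continuous_on {0..\<theta>1} (\<lambda>\<theta>. f (\<theta>\<^sup>2) (Y y \<theta> \<xi>))" by (rule dominated_cont_fst[OF dom_f])
      fix \<theta> assume \<theta>: "\<theta> \<in> {0<..<\<theta>1}"
      have "((\<lambda>\<theta>. f (\<theta>\<^sup>2) (Y y \<theta> \<xi>)) has_real_derivative ft (\<theta>\<^sup>2) (Y y \<theta> \<xi>) * (2 * \<theta>) +
          fx (\<theta>\<^sup>2) (Y y \<theta> \<xi>) * ((2 * \<theta> * L (Y y \<theta> \<xi>) + \<xi>) / D (\<theta>\<^sup>2) (Y y \<theta> \<xi>))) (at \<theta>)"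
      proof (rule has_real_derivative_two_variables[OF open_I convex_I dt dx tempered_cont[OF fx]])
        show "((\<lambda>\<theta>. \<theta>\<^sup>2) has_real_derivative 2 * \<theta>) (at \<theta>)"
          by (auto intro!: derivative_eq_intros)
        show "((\<lambda>a. Y y a \<xi>) has_real_derivative (2 * \<theta> * L (Y y \<theta> \<xi>) + \<xi>) / D (\<theta>\<^sup>2) (Y y \<theta> \<xi>)) (at \<theta>)"
          by (rule dY_time) (use \<theta> in simp)
        show "\<theta>\<^sup>2 < S" using \<theta> by (simp add: power_strict_mono)
        show "Y y \<theta> \<xi> \<in> I" using Y_in[OF y, of \<theta>] \<theta> by simp
      qed (use \<theta> in auto)
      then show "((\<lambda>\<theta>. f (\<theta>\<^sup>2) (Y y \<theta> \<xi>)) has_vector_derivative H \<theta> \<xi>) (at \<theta>)"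
        unfolding has_real_derivative_iff_has_vector_derivative[symmetric]
        by (rule DERIV_cong) (simp add: H_def k_def g_def algebra_simps add_divide_distrib)
    qed (use \<theta>1 in auto)
    then show ?thesis using Y_0[OF y] by (simp add: integral_unique)
  qed
  have expect: "(\<integral>\<xi>. H \<theta> \<xi> \<partial>gauss) = 2 * \<theta> * (\<integral>\<xi>. ft (\<theta>\<^sup>2) (Y y \<theta> \<xi>) +
      gen (\<theta>\<^sup>2) (Y y \<theta> \<xi>) (fx (\<theta>\<^sup>2) (Y y \<theta> \<xi>)) (fxx (\<theta>\<^sup>2) (Y y \<theta> \<xi>)) \<partial>gauss)"
    if \<theta>: "\<theta> \<in> {0..\<theta>1}" for \<theta>
  proof -
    \<comment> \<open>\<open>\<theta> * g'\<close> is the derivative of \<open>g \<theta>\<close> in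
      \<xi>: the space derivative of \<open>fx / D\<close>, times the derivative
      \<open>\<theta> / D\<close> of the step. Half of \<open>g'\<close> supplies the last two terms
      of \<open>gen\<close>.\<close>
    define g' where "g' s x = fxx s x * (1 / D s x) ^ 2 + s * L2 x * fx s x * (1 / D s x) ^ 3" for s x
    have temp': "tempered S g'" unfolding g'_def
      by (intro tempered_add tempered_mult tempered_power tempered_inv_D fx fxx tempered_s tempered_L2)
    then have dom': "dominated \<theta>1 (\<lambda>\<theta> \<xi>. g' (\<theta>\<^sup>2) (Y y \<theta> \<xi>))" by (intro domY) simp
    have dom'': "dominated \<theta>1 (\<lambda>\<theta> \<xi>. \<theta> * g' (\<theta>\<^sup>2) (Y y \<theta> \<xi>))"
      by (intro dominated_mult dom' dominated_fst continuous_intros)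
    have dom_xg: "dominated \<theta>1 (\<lambda>\<theta> \<xi>. \<xi> * g \<theta> \<xi>)" by (intro dominated_mult dom_g dominated_snd)
    have ibp: "(\<integral>\<xi>. \<xi> * g \<theta> \<xi> \<partial>gauss) = (\<integral>\<xi>. \<theta> * g' (\<theta>\<^sup>2) (Y y \<theta> \<xi>) \<partial>gauss)"
    proof (cases "\<theta> = 0")
      case True
      have "(\<integral>\<xi>. \<xi> * (fx 0 y * (1 / D 0 y)) \<partial>gauss) = (\<integral>\<xi>. 0 \<partial>gauss)"
        by (rule gauss_integration_by_parts[of _ _ "\<bar>fx 0 y * (1 / D 0 y)\<bar>" 0]) auto
      then show ?thesis using True by (simp add: g_def Y_0[OF y])
    next
      case False
      with \<theta> have pos: "0 < \<theta>" by simp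
      have s: "\<theta>\<^sup>2 \<in> {0..S}" using \<theta> by (auto intro: power_mono)
      obtain C1 k1 where b1: "0 \<le> C1" "\<And>\<xi>. \<bar>g \<theta> \<xi>\<bar> \<le> C1 * (1 + \<bar>\<xi>\<bar>) ^ k1"
        using dominated_boundE[OF dom_g] \<theta> by metis
      obtain C2 k2 where b2: "0 \<le> C2" "\<And>\<xi>. \<bar>\<theta> * g' (\<theta>\<^sup>2) (Y y \<theta> \<xi>)\<bar> \<le> C2 * (1 + \<bar>\<xi>\<bar>) ^ k2"
        using dominated_boundE[OF dom''] \<theta> by metis
      have up: "c * (1 + \<bar>\<xi>\<bar>) ^ k \<le> (C1 + C2) * (1 + \<bar>\<xi>\<bar>) ^ (k1 + k2)"
        if "0 \<le> c" "c \<le> C1 + C2" "k \<le> k1 + k2" for c \<xi> k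
        using that b1(1) b2(1) by (intro mult_mono power_increasing) auto
      show ?thesis
      proof (rule gauss_integration_by_parts[where C = "C1 + C2" and k = "k1 + k2"])
        fix \<xi>
        have x: "Y y \<theta> \<xi> \<in> I" using Y_in[OF y, of \<theta>] \<theta> by simp
        have Dnz: "D (\<theta>\<^sup>2) (Y y \<theta> \<xi>) \<noteq> 0" using D_ge[OF x, of "\<theta>\<^sup>2"] by simp
        have "((\<lambda>x. fx (\<theta>\<^sup>2) x * (1 / D (\<theta>\<^sup>2) x)) has_real_derivative
            fxx (\<theta>\<^sup>2) (Y y \<theta> \<xi>) * (1 / D (\<theta>\<^sup>2) (Y y \<theta> \<xi>)) +
            fx (\<theta>\<^sup>2) (Y y \<theta> \<xi>) * (\<theta>\<^sup>2 * L2 (Y y \<theta> \<xi>) / (D (\<theta>\<^sup>2) (Y y \<theta> \<xi>))\<^sup>2)) (at (Y y \<theta> \<xi>))"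
          by (rule DERIV_cong[OF DERIV_mult[OF dxx[OF s x] d_inv_D[OF x]]]) (simp_all add: mult_ac)
        from DERIV_chain2[OF this dY_space[OF pos, of y \<xi>]]
        show "(g \<theta> has_real_derivative \<theta> * g' (\<theta>\<^sup>2) (Y y \<theta> \<xi>)) (at \<xi>)"
          unfolding g_def
          by (rule DERIV_cong) (use Dnz in \<open>simp add: g'_def divide_simps power2_eq_square power3_eq_cube\<close>)
        show "\<bar>g \<theta> \<xi>\<bar> \<le> (C1 + C2) * (1 + \<bar>\<xi>\<bar>) ^ (k1 + k2)"
          using b1 b2(1) up[of C1 k1 \<xi>] by (auto intro: order_trans[OF b1(2)])
        show "\<bar>\<theta> * g' (\<theta>\<^sup>2) (Y y \<theta> \<xi>)\<bar> \<le> (C1 + C2) * (1 + \<bar>\<xi>\<bar>) ^ (k1 + k2)"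
          using b1 b2(1) up[of C2 k2 \<xi>] by (auto intro: order_trans[OF b2(2)])
      next
        show "continuous_on UNIV (\<lambda>\<xi>. \<theta> * g' (\<theta>\<^sup>2) (Y y \<theta> \<xi>))"
          using dominated_cont_snd[OF dom'' \<theta>] .
      qed
    qed
    have "(\<integral>\<xi>. H \<theta> \<xi> \<partial>gauss) = 2 * \<theta> * (\<integral>\<xi>. k \<theta> \<xi> \<partial>gauss) + (\<integral>\<xi>. \<xi> * g \<theta> \<xi> \<partial>gauss)"
      unfolding H_def
      using dominated_gauss_integrable[OF dom_k \<theta>] dominated_gauss_integrable[OF dom_xg \<theta>] by simp
    also have "\<dots> = 2 * \<theta> * (\<integral>\<xi>. k \<theta> \<xi> + (1/2) * g' (\<theta>\<^sup>2) (Y y \<theta> \<xi>) \<partial>gauss)"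
      unfolding ibp
      using dominated_gauss_integrable[OF dom_k \<theta>] dominated_gauss_integrable[OF dom' \<theta>]
      by (simp add: algebra_simps)
    also have "(\<lambda>\<xi>. k \<theta> \<xi> + (1/2) * g' (\<theta>\<^sup>2) (Y y \<theta> \<xi>)) = (\<lambda>\<xi>. ft (\<theta>\<^sup>2) (Y y \<theta> \<xi>) +
      gen (\<theta>\<^sup>2) (Y y \<theta> \<xi>) (fx (\<theta>\<^sup>2) (Y y \<theta> \<xi>)) (fxx (\<theta>\<^sup>2) (Y y \<theta> \<xi>)))"
      by (simp add: k_def g_def g'_def gen_def power_divide add_divide_distrib ac_simps)
    finally show ?thesis .
  qed
  have int_f: "integrable gauss (\<lambda>\<xi>. f S (Y y \<theta>1 \<xi>))"
    using dominated_gauss_integrable[OF dom_f, of \<theta>1] \<theta>1 by simp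
  have "(\<integral>\<xi>. f S (Y y \<theta>1 \<xi>) \<partial>gauss) - f 0 y = (\<integral>\<xi>. f S (Y y \<theta>1 \<xi>) - f 0 y \<partial>gauss)"
    using int_f by (simp add: gauss.prob_space[simplified])
  also have "\<dots> = (\<integral>\<xi>. integral {0..\<theta>1} (\<lambda>\<theta>. H \<theta> \<xi>) \<partial>gauss)" by (simp only: path)
  also have "\<dots> = integral {0..\<theta>1} (\<lambda>\<theta>. \<integral>\<xi>. H \<theta> \<xi> \<partial>gauss)" by (rule dominated_Fubini[OF dom_H])
  also have "\<dots> = integral {0..\<theta>1} (\<lambda>\<theta>. 2 * \<theta> * (\<integral>\<xi>. ft (\<theta>\<^sup>2) (Y y \<theta> \<xi>) +
      gen (\<theta>\<^sup>2) (Y y \<theta> \<xi>) (fx (\<theta>\<^sup>2) (Y y \<theta> \<xi>)) (fxx (\<theta>\<^sup>2) (Y y \<theta> \<xi>)) \<partial>gauss))"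
    by (rule integral_cong) (rule expect)
  finally show ?thesis .
qed

end

section \<open>The Lyapunov function\<close>

context concave_weight
begin

section \<open>Expectations along one step and orders of singularity\<close>

abbreviation expect :: "(real \<Rightarrow> real \<Rightarrow> real) \<Rightarrow> real \<Rightarrow> real \<Rightarrow> real" where
  "expect f y \<theta> \<equiv> (\<integral>\<xi>. f (\<theta>\<^sup>2) (Y y \<theta> \<xi>) \<partial>gauss)"

lemma sq_in: "\<theta> \<in> {0..\<theta>1} \<Longrightarrow> \<theta>\<^sup>2 \<in> {0..(\<theta>1::real)\<^sup>2}"
  by (auto intro: power_mono)

lemma expect_integrable:
  assumes "y \<in> I" "tempered (\<theta>1\<^sup>2) f" "\<theta> \<in> {0..\<theta>1}"
  shows "integrable gauss (\<lambda>\<xi>. f (\<theta>\<^sup>2) (Y y \<theta> \<xi>))"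
  using dominated_gauss_integrable[OF dominated_Y[OF assms(1,2)], of \<theta>] assms(3) by simp

lemma expect_continuous:
  assumes "y \<in> I" "tempered (\<theta>1\<^sup>2) f" "0 \<le> \<theta>1"
  shows "continuous_on {0..\<theta>1} (expect f y)"
  using dominated_expectation_continuous[OF dominated_Y[OF assms]] .

lemma expect_mono:
  assumes "y \<in> I" "tempered (\<theta>1\<^sup>2) f" "tempered (\<theta>1\<^sup>2) g" "\<theta> \<in> {0..\<theta>1}"
    and "\<And>s x. s \<in> {0..\<theta>1\<^sup>2} \<Longrightarrow> x \<in> I \<Longrightarrow> f s x \<le> g s x"
  shows "expect f y \<theta> \<le> expect g y \<theta>"
proof (intro integral_mono expect_integrable[of y \<theta>1] assms(1-4))
  show "f (\<theta>\<^sup>2) (Y y \<theta> \<xi>) \<le> g (\<theta>\<^sup>2) (Y y \<theta> \<xi>)" for \<xi>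
    using assms(1,4) by (intro assms(5) sq_in Y_in) auto
qed

lemma expect_abs_le:
  assumes "y \<in> I" "tempered (\<theta>1\<^sup>2) f" "tempered (\<theta>1\<^sup>2) g" "\<theta> \<in> {0..\<theta>1}"
    and "\<And>s x. s \<in> {0..\<theta>1\<^sup>2} \<Longrightarrow> x \<in> I \<Longrightarrow> \<bar>f s x\<bar> \<le> g s x"
  shows "\<bar>expect f y \<theta>\<bar> \<le> expect g y \<theta>"
proof -
  have "expect f y \<theta> \<le> expect g y \<theta>"
    by (rule expect_mono[OF assms(1-4)]) (use assms(5) in \<open>fastforce simp: abs_le_iff\<close>)
  moreover have "expect (\<lambda>s x. - f s x) y \<theta> \<le> expect g y \<theta>"
    by (rule expect_mono[OF assms(1) tempered_minus[OF assms(2)] assms(3,4)])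
       (use assms(5) in \<open>fastforce simp: abs_le_iff\<close>)
  ultimately show ?thesis by simp
qed

lemma weighted_integral_mono:
  fixes f g :: "real \<Rightarrow> real"
  assumes "continuous_on {0..a} f" "continuous_on {0..a} g" "\<And>\<theta>. \<theta> \<in> {0..a} \<Longrightarrow> f \<theta> \<le> g \<theta>"
  shows "integral {0..a} (\<lambda>\<theta>. 2 * \<theta> * f \<theta>) \<le> integral {0..a} (\<lambda>\<theta>. 2 * \<theta> * g \<theta>)"
  using assms
  by (intro integral_le integrable_continuous_real continuous_intros mult_left_mono) auto

lemma weighted_integral_const:
  fixes c :: real
  assumes "0 \<le> a"
  shows "integral {0..a} (\<lambda>\<theta>. 2 * \<theta> * c) = a\<^sup>2 * c"
proof -
  have "((\<lambda>\<theta>. 2 * \<theta> * c) has_integral (a\<^sup>2 * c - 0\<^sup>2 * c)) {0..a}"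
    using assms
    by (intro fundamental_theorem_of_calculus)
       (auto intro!: derivative_eq_intros simp: has_real_derivative_iff_has_vector_derivative[symmetric])
  from integral_unique[OF this] show ?thesis by (simp del: integral_mult_left)
qed

definition orders :: "'p set \<Rightarrow> real \<Rightarrow> ('p \<Rightarrow> real \<Rightarrow> real) \<Rightarrow> bool" where
  "orders P q f \<longleftrightarrow> (\<exists>C M. 0 \<le> C \<and> (\<forall>a\<in>P. \<forall>x\<in>I. \<bar>f a x\<bar> \<le> C * (1 + x) ^ M * h x powr (- q)))"

lemma ordersI:
  assumes "\<And>a x. a \<in> P \<Longrightarrow> x \<in> I \<Longrightarrow> \<bar>f a x\<bar> \<le> C * (1 + x) ^ M * h x powr (- q)"
  shows "orders P q f"
proof -
  have "\<bar>f a x\<bar> \<le> \<bar>C\<bar> * (1 + x) ^ M * h x powr (- q)" if "a \<in> P" "x \<in> I" for a x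
  proof -
    have "C * (1 + x) ^ M * h x powr (- q) \<le> \<bar>C\<bar> * (1 + x) ^ M * h x powr (- q)"
      using pos_I[OF that(2)] by (intro mult_right_mono) auto
    then show ?thesis using assms[OF that] by linarith
  qed
  then show ?thesis unfolding orders_def by (meson abs_ge_zero)
qed

lemma ordersE:
  assumes "orders P q f"
  obtains C M where "0 \<le> C" "\<And>a x. a \<in> P \<Longrightarrow> x \<in> I \<Longrightarrow> \<bar>f a x\<bar> \<le> C * (1 + x) ^ M * h x powr (- q)"
  using assms unfolding orders_def by blast

lemma one_le_1x: "x \<in> I \<Longrightarrow> 1 \<le> (1 + x) ^ M"
  using pos_I[of x] by simp

text \<open>Since \<open>h\<close> grows at most linearly, the surplus factor
  \<open>h powr (q' - q)\<close> disappears in the polynomial factor. Without this an order could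
  not be raised where \<open>h\<close> is large.\<close>

lemma orders_mono:
  assumes "orders P q f" "q \<le> q'"
  shows "orders P q' f"
proof -
  obtain C M where C: "0 \<le> C" "\<And>a x. a \<in> P \<Longrightarrow> x \<in> I \<Longrightarrow> \<bar>f a x\<bar> \<le> C * (1 + x) ^ M * h x powr (- q)"
    using ordersE[OF assms(1)] by metis
  define d where "d = q' - q"
  define N where "N = nat \<lceil>d\<rceil>"
  have d: "0 \<le> d" "d \<le> real N" using assms(2) by (auto simp: d_def N_def)
  show ?thesis
  proof (rule ordersI[where C = "C * A powr d" and M = "M + N"])
    fix a x assume a: "a \<in> P" "x \<in> I"
    have A: "0 < A" using A_pos a by auto
    have x: "0 < x" "0 < h x" using pos_I h_pos a by auto
    have "h x powr d \<le> (A * (1 + x)) powr d" using h_linear[OF a(2)] x d by (intro powr_mono2) auto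
    also have "\<dots> = A powr d * (1 + x) powr d" using A x by (simp add: powr_mult)
    also have "\<dots> \<le> A powr d * (1 + x) powr real N" using d x by (intro mult_left_mono powr_mono) auto
    also have "\<dots> = A powr d * (1 + x) ^ N" using x by (simp add: powr_realpow)
    finally have hd: "h x powr d \<le> A powr d * (1 + x) ^ N" .
    have "\<bar>f a x\<bar> \<le> C * (1 + x) ^ M * h x powr (- q)" using C a by blast
    also have "h x powr (- q) = h x powr d * h x powr (- q')" by (simp add: powr_add[symmetric] d_def)
    also have "C * (1 + x) ^ M * \<dots> \<le> C * (1 + x) ^ M * (A powr d * (1 + x) ^ N * h x powr (- q'))"
      using C hd x by (intro mult_left_mono mult_right_mono) auto
    finally show "\<bar>f a x\<bar> \<le> C * A powr d * (1 + x) ^ (M + N) * h x powr (- q')"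
      by (simp add: power_add mult_ac)
  qed
qed

lemma orders_mult:
  assumes "orders P q f" "orders P q' g" "q + q' \<le> r"
  shows "orders P r (\<lambda>a x. f a x * g a x)"
proof (rule orders_mono[OF _ assms(3)])
  obtain C M where C: "0 \<le> C" "\<And>a x. a \<in> P \<Longrightarrow> x \<in> I \<Longrightarrow> \<bar>f a x\<bar> \<le> C * (1 + x) ^ M * h x powr (- q)"
    using ordersE[OF assms(1)] by metis
  obtain C' M' where C': "0 \<le> C'" "\<And>a x. a \<in> P \<Longrightarrow> x \<in> I \<Longrightarrow> \<bar>g a x\<bar> \<le> C' * (1 + x) ^ M' * h x powr (- q')"
    using ordersE[OF assms(2)] by metis
  show "orders P (q + q') (\<lambda>a x. f a x * g a x)"
  proof (rule ordersI[where C = "C * C'" and M = "M + M'"])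
    fix a x assume a: "a \<in> P" "x \<in> I"
    have "\<bar>f a x * g a x\<bar> \<le> (C * (1 + x) ^ M * h x powr (- q)) * (C' * (1 + x) ^ M' * h x powr (- q'))"
      unfolding abs_mult using C C' a pos_I[of x] by (intro mult_mono) auto
    also have "\<dots> = C * C' * (1 + x) ^ (M + M') * h x powr (- (q + q'))"
      using powr_add[of "h x" "- q" "- q'"] by (simp add: power_add mult_ac)
    finally show "\<bar>f a x * g a x\<bar> \<le> C * C' * (1 + x) ^ (M + M') * h x powr (- (q + q'))" .
  qed
qed

lemma orders_add:
  assumes "orders P q f" "orders P q g"
  shows "orders P q (\<lambda>a x. f a x + g a x)"
proof -
  obtain C M where C: "0 \<le> C" "\<And>a x. a \<in> P \<Longrightarrow> x \<in> I \<Longrightarrow> \<bar>f a x\<bar> \<le> C * (1 + x) ^ M * h x powr (- q)"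
    using ordersE[OF assms(1)] by metis
  obtain C' M' where C': "0 \<le> C'" "\<And>a x. a \<in> P \<Longrightarrow> x \<in> I \<Longrightarrow> \<bar>g a x\<bar> \<le> C' * (1 + x) ^ M' * h x powr (- q)"
    using ordersE[OF assms(2)] by metis
  show ?thesis
  proof (rule ordersI[where C = "C + C'" and M = "M + M'"])
    fix a x assume a: "a \<in> P" "x \<in> I"
    have "\<bar>f a x + g a x\<bar> \<le> C * (1 + x) ^ M * h x powr (- q) + C' * (1 + x) ^ M' * h x powr (- q)"
      using abs_triangle_ineq[of "f a x" "g a x"] C(2)[OF a] C'(2)[OF a] by linarith
    also have "\<dots> \<le> C * (1 + x) ^ (M + M') * h x powr (- q) + C' * (1 + x) ^ (M + M') * h x powr (- q)"
      using C C' pos_I[OF a(2)] by (intro add_mono mult_left_mono mult_right_mono power_increasing) auto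
    finally show "\<bar>f a x + g a x\<bar> \<le> (C + C') * (1 + x) ^ (M + M') * h x powr (- q)"
      by (simp add: distrib_right)
  qed
qed

lemma orders_bounded: "(\<And>a x. a \<in> P \<Longrightarrow> x \<in> I \<Longrightarrow> \<bar>f a x\<bar> \<le> C) \<Longrightarrow> orders P 0 f"
  using h_nz by (intro ordersI[where C = C and M = 0]) auto

lemma orders_const: "orders P 0 (\<lambda>a x. c)"
  by (rule orders_bounded[of _ _ "\<bar>c\<bar>"]) simp

lemma orders_cmult: "orders P q f \<Longrightarrow> orders P q (\<lambda>a x. c * f a x)"
  by (rule orders_mult[OF orders_const]) auto

lemma orders_minus: "orders P q f \<Longrightarrow> orders P q (\<lambda>a x. - f a x)"
  using orders_cmult[of P q f "-1"] by simp

lemma orders_diff: "orders P q f \<Longrightarrow> orders P q g \<Longrightarrow> orders P q (\<lambda>a x. f a x - g a x)"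
  using orders_add[OF _ orders_minus[of P q g], of f] by simp

lemma orders_abs: "orders P q f \<Longrightarrow> orders P q (\<lambda>a x. \<bar>f a x\<bar>)"
  by (simp add: orders_def)

lemma orders_reindex: "orders P q f \<Longrightarrow> (\<And>a. a \<in> P' \<Longrightarrow> i a \<in> P) \<Longrightarrow> orders P' q (\<lambda>a. f (i a))"
  unfolding orders_def by blast

lemma orders_h_powr: "orders P q (\<lambda>a x. h x powr (- q))"
  by (rule ordersI[where C = 1 and M = 0]) auto

lemma orders_inv_h: "orders P (real n) (\<lambda>a x. 1 / h x ^ n)"
  by (rule ordersI[where C = 1 and M = 0])
     (use h_pos in \<open>auto simp: powr_minus powr_realpow inverse_eq_divide less_imp_le\<close>)

lemma orders_one_plus_inv_h: "orders P (real n) (\<lambda>a x. 1 + 1 / h x ^ n)"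
  by (intro orders_add orders_mono[OF orders_const] orders_inv_h) auto

lemma orders_tempered:
  assumes "orders P q f" "continuous_on ({0..S} \<times> I) (\<lambda>(s, x). f (i s) x)" "\<And>s. s \<in> {0..S} \<Longrightarrow> i s \<in> P"
  shows "tempered S (\<lambda>s x. f (i s) x)"
proof -
  have "orders P (max q 0) f" by (rule orders_mono[OF assms(1)]) simp
  then obtain C M where C: "0 \<le> C"
    "\<And>a x. a \<in> P \<Longrightarrow> x \<in> I \<Longrightarrow> \<bar>f a x\<bar> \<le> C * (1 + x) ^ M * h x powr (- max q 0)"
    using ordersE by metis
  have "tempered S (\<lambda>s x. C * (1 + x) ^ M * h x powr (- max q 0))"
    by (intro tempered_mult tempered_const tempered_power tempered_add tempered_x tempered_h_powr) simp
  then show ?thesis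
    by (rule tempered_bounded_by) (use assms C in auto)
qed

text \<open>Large \<open>x\<close> and small \<open>h x\<close> exclude each other, so products of the two weights can be
  split; this is what allows a single additive Lyapunov function.\<close>

lemma weight_trade:
  assumes "q < Q" "0 \<le> q" "0 < \<epsilon>"
  obtains C where "0 \<le> C" "\<And>x. x \<in> I \<Longrightarrow> (1 + x) ^ M * h x powr (- q) \<le> \<epsilon> * h x powr (- Q) + C * (1 + x) ^ M"
proof
  \<comment> \<open>Below the level \<open>d\<close> two things hold: the point is at most
    \<open>R\<close>, because \<open>d \<le> \<delta>\<close>, and the gain
    \<open>h powr (Q - q)\<close> outweighs both \<open>(1 + R) ^ M\<close> and
    \<open>1 / \<epsilon>\<close>. Above it \<open>h powr (- q)\<close> is bounded.\<close>
  define d where "d = min \<delta> ((\<epsilon> / (1 + R) ^ M) powr (1 / (Q - q)))"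
  have R1: "0 < (1 + R) ^ M" using R_nonneg by (intro zero_less_power) auto
  then have "0 < \<epsilon> / (1 + R) ^ M" using assms by (intro divide_pos_pos)
  then have "0 < (\<epsilon> / (1 + R) ^ M) powr (1 / (Q - q))" by (metis powr_gt_zero less_irrefl)
  then have d: "0 < d" "d \<le> \<delta>" using \<delta>_pos by (simp_all only: d_def min_less_iff_conj min.cobounded1)
  have "d powr (Q - q) \<le> ((\<epsilon> / (1 + R) ^ M) powr (1 / (Q - q))) powr (Q - q)"
    using d assms by (intro powr_mono2) (auto simp: d_def)
  also have "\<dots> = \<epsilon> / (1 + R) ^ M" using assms R1 by (simp add: powr_powr)
  finally have dQ: "(1 + R) ^ M * d powr (Q - q) \<le> \<epsilon>" using R1 by (simp add: field_simps)
  show "0 \<le> d powr (- q)" by simp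
  fix x assume x: "x \<in> I"
  have x0: "0 < x" "0 < h x" using pos_I h_pos x by auto
  show "(1 + x) ^ M * h x powr (- q) \<le> \<epsilon> * h x powr (- Q) + d powr (- q) * (1 + x) ^ M"
  proof (cases "d \<le> h x")
    case True
    then have "h x powr (- q) \<le> d powr (- q)" using d assms by (intro powr_mono2') auto
    then have "(1 + x) ^ M * h x powr (- q) \<le> d powr (- q) * (1 + x) ^ M"
      using x0 by (simp add: mult.commute mult_left_mono)
    moreover have "0 \<le> \<epsilon> * h x powr (- Q)" using assms by simp
    ultimately show ?thesis by linarith
  next
    case False
    then have xR: "x \<le> R" using h_far[OF x] d by fastforce
    have "(1 + x) ^ M * h x powr (- q) = (1 + x) ^ M * h x powr (Q - q) * h x powr (- Q)"
      by (simp add: powr_add[symmetric] mult.assoc)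
    also have "\<dots> \<le> ((1 + R) ^ M * d powr (Q - q)) * h x powr (- Q)"
      using False x0 xR assms by (intro mult_right_mono mult_mono power_mono powr_mono2) auto
    also have "\<dots> \<le> \<epsilon> * h x powr (- Q)" using dQ by (intro mult_right_mono) auto
    moreover have "0 \<le> d powr (- q) * (1 + x) ^ M" using x0 by simp
    ultimately show ?thesis by linarith
  qed
qed

text \<open>\<open>11/4\<close> is the order of the dissipation in \<open>Theta\<close>; every
  smaller order splits into this singularity and a polynomial by \<open>weight_trade\<close>.
  Negative orders are first raised to 0.\<close>

lemma orders_trade:
  assumes "orders P q f" "q < 11/4"
  obtains C M where "0 \<le> C"
    "\<And>a x. a \<in> P \<Longrightarrow> x \<in> I \<Longrightarrow> \<bar>f a x\<bar> \<le> C * (h x powr (- 11/4) + (1 + x) ^ M)"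
proof -
  define q' where "q' = max q 0"
  have "orders P q' f" by (rule orders_mono[OF assms(1)]) (simp add: q'_def)
  then obtain C M where C: "0 \<le> C"
    "\<And>a x. a \<in> P \<Longrightarrow> x \<in> I \<Longrightarrow> \<bar>f a x\<bar> \<le> C * (1 + x) ^ M * h x powr (- q')"
    using ordersE by metis
  obtain B where B: "0 \<le> B"
    "\<And>x. x \<in> I \<Longrightarrow> (1 + x) ^ M * h x powr (- q') \<le> 1 * h x powr (- (11/4)) + B * (1 + x) ^ M"
    by (rule weight_trade[of q' "11/4" 1 M]) (use assms in \<open>auto simp: q'_def\<close>)
  show thesis
  proof (rule that[of "C * (1 + B)" M])
    show "0 \<le> C * (1 + B)" using B C by simp
    fix a x assume a: "a \<in> P" "x \<in> I"
    have "\<bar>f a x\<bar> \<le> C * ((1 + x) ^ M * h x powr (- q'))" using C(2)[OF a] by (simp add: mult.assoc)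
    also have "\<dots> \<le> C * (1 * h x powr (- (11/4)) + B * (1 + x) ^ M)"
      using B(2)[OF a(2)] C by (intro mult_left_mono)
    also have "\<dots> \<le> C * ((1 + B) * h x powr (- (11/4)) + (1 + B) * (1 + x) ^ M)"
      using B C pos_I[OF a(2)] by (intro mult_left_mono add_mono mult_right_mono) auto
    finally show "\<bar>f a x\<bar> \<le> C * (1 + B) * (h x powr (- 11/4) + (1 + x) ^ M)"
      by (simp add: algebra_simps)
  qed
qed

section \<open>Damping of the generator by \<open>1 / D\<close>\<close>

lemma D_ge_L: "x \<in> I \<Longrightarrow> 0 \<le> s \<Longrightarrow> 1 + s * (L x)\<^sup>2 \<le> D s x"
  using mult_left_mono[OF L1_le, of x s] by (simp add: D_def)

text \<open>\<open>h_inv_sq\<close> bounds \<open>1 / h^2\<close> by \<open>A * (1 + L^2)\<close>,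
  and \<open>D\<close> contains \<open>s * L^2\<close>. Hence one factor \<open>s / D\<close> pays
  for two powers of \<open>1 / h\<close>, which is the stabilising effect of the implicit
  step.\<close>

lemma s_h_le_D:
  assumes x: "x \<in> I" and s: "0 \<le> s" "s \<le> Sm"
  shows "s / (h x)\<^sup>2 \<le> A * (1 + Sm) * D s x"
proof -
  have A: "0 < A" using A_pos x by auto
  have "s / (h x)\<^sup>2 = s * (1 / (h x)\<^sup>2)" by simp
  also have "\<dots> \<le> s * (A * (1 + (L x)\<^sup>2))" using h_inv_sq[OF x] s by (intro mult_left_mono)
  also have "\<dots> = A * (s + s * (L x)\<^sup>2)" by (simp add: algebra_simps)
  also have "\<dots> \<le> A * (Sm * D s x + D s x)"
  proof (intro mult_left_mono add_mono)
    have "s * 1 \<le> Sm * D s x" using s D_ge[OF x s(1)] by (intro mult_mono) auto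
    then show "s \<le> Sm * D s x" by simp
    show "s * (L x)\<^sup>2 \<le> D s x" using D_ge_L[OF x s(1)] by simp
  qed (use A in simp)
  finally show ?thesis by (simp add: algebra_simps)
qed

lemma h_powr_le_one_plus:
  assumes "x \<in> I" "0 \<le> q" "q \<le> real n"
  shows "h x powr (- q) \<le> 1 + 1 / h x ^ n"
proof (cases "1 \<le> h x")
  case True
  then have "h x powr (- q) \<le> 1" using assms powr_mono[of "- q" 0 "h x"] by simp
  then show ?thesis using h_pos[OF assms(1)] by (simp add: add_increasing2)
next
  case False
  then have "h x powr (- q) \<le> h x powr (- real n)" using assms h_pos[of x] by (intro powr_mono') auto
  then show ?thesis using h_pos[OF assms(1)] by (simp add: powr_minus powr_realpow inverse_eq_divide)
qed

lemma L1_abs: "x \<in> I \<Longrightarrow> \<bar>L1 x\<bar> \<le> (A + A\<^sup>2) * (1 + 1 / (h x)\<^sup>2)"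
proof -
  assume x: "x \<in> I"
  have A: "0 < A" using A_pos x by auto
  have "\<bar>L1 x\<bar> \<le> \<bar>h2 x / h x\<bar> + (L x)\<^sup>2" unfolding L1_def
    using abs_triangle_ineq4[of "h2 x / h x" "(L x)\<^sup>2"] by (simp only: abs_power2)
  also have "\<dots> \<le> A * (1 + 1 / (h x)\<^sup>2) + A\<^sup>2 * (1 + 1 / (h x)\<^sup>2)"
  proof (rule add_mono)
    show "\<bar>h2 x / h x\<bar> \<le> A * (1 + 1 / (h x)\<^sup>2)"
      using order_trans[OF h2_quot[OF x] mult_left_mono[OF h_powr_le_one_plus[OF x, of p 2], of A]] p A
      by simp
    have "(L x)\<^sup>2 \<le> (A / h x)\<^sup>2" using power_mono[OF L_abs[OF x], of 2] by simp
    then show "(L x)\<^sup>2 \<le> A\<^sup>2 * (1 + 1 / (h x)\<^sup>2)"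
      by (simp add: power_divide algebra_simps add_increasing)
  qed
  finally show ?thesis by (simp add: distrib_right)
qed

lemma L2_abs: "x \<in> I \<Longrightarrow> \<bar>L2 x\<bar> \<le> (A + 3 * A\<^sup>2 + 2 * A ^ 3) * (1 + 1 / h x ^ 3)"
proof -
  assume x: "x \<in> I"
  have A: "0 < A" using A_pos x by auto
  have hx: "0 < h x" using h_pos x by auto
  have "\<bar>L2 x\<bar> \<le> \<bar>h3 x / h x\<bar> + \<bar>3 * L x * (h2 x / h x)\<bar> + \<bar>2 * L x ^ 3\<bar>" unfolding L2_def by linarith
  also have "\<dots> \<le> A * (1 + 1 / h x ^ 3) + 3 * A\<^sup>2 * (1 + 1 / h x ^ 3) + 2 * A ^ 3 * (1 + 1 / h x ^ 3)"
  proof (intro add_mono)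
    show "\<bar>h3 x / h x\<bar> \<le> A * (1 + 1 / h x ^ 3)"
      using order_trans[OF h3_quot[OF x] mult_left_mono[OF h_powr_le_one_plus[OF x, of "1 + p" 3], of A]] p A
      by simp
    have "\<bar>3 * L x * (h2 x / h x)\<bar> \<le> 3 * (A / h x) * (A * h x powr (- p))"
      unfolding abs_mult using L_abs[OF x] h2_quot[OF x] A hx by (intro mult_mono) auto
    also have "\<dots> = 3 * A\<^sup>2 * h x powr (- (1 + p))"
    proof -
      have "h x powr (- (1 + p)) = h x powr (- p) / h x"
        using hx powr_diff[of "h x" "- p" 1] by (simp add: minus_diff_commute)
      then show ?thesis by (simp add: power2_eq_square)
    qed
    also have "\<dots> \<le> 3 * A\<^sup>2 * (1 + 1 / h x ^ 3)"
      using A p by (intro mult_left_mono h_powr_le_one_plus[OF x]) auto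
    finally show "\<bar>3 * L x * (h2 x / h x)\<bar> \<le> 3 * A\<^sup>2 * (1 + 1 / h x ^ 3)" .
    have "\<bar>2 * L x ^ 3\<bar> \<le> 2 * (A / h x) ^ 3"
      using power_mono[OF L_abs[OF x], of 3] by (simp add: power_abs abs_mult)
    also have "\<dots> \<le> 2 * A ^ 3 * (1 + 1 / h x ^ 3)" using A by (simp add: power_divide algebra_simps)
    finally show "\<bar>2 * L x ^ 3\<bar> \<le> 2 * A ^ 3 * (1 + 1 / h x ^ 3)" .
  qed
  finally show ?thesis by (simp add: algebra_simps)
qed

text \<open>\<open>L2\<close> has order 3; \<open>s_h_le_D\<close> takes away two of the three
  powers at the price of one \<open>D\<close>, and a single \<open>1 / h\<close> remains.\<close>

lemma s_L2_le_D:
  assumes "I \<noteq> {}" "0 \<le> Sm"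
  obtains C where "0 \<le> C" "\<And>s x. 0 \<le> s \<Longrightarrow> s \<le> Sm \<Longrightarrow> x \<in> I \<Longrightarrow> s * \<bar>L2 x\<bar> \<le> C * (1 + 1 / h x) * D s x"
proof
  define K where "K = A + 3 * A\<^sup>2 + 2 * A ^ 3"
  have A: "0 < A" using A_pos assms by auto
  have K: "0 \<le> K" using A by (simp add: K_def)
  show "0 \<le> K * (Sm + A * (1 + Sm))" using A K assms by simp
  fix s x assume s: "0 \<le> s" "s \<le> Sm" and x: "x \<in> I"
  have hx: "0 < h x" using h_pos x by auto
  have D: "1 \<le> D s x" by (rule D_ge[OF x s(1)])
  have "s * \<bar>L2 x\<bar> \<le> s * (K * (1 + 1 / h x ^ 3))"
    using L2_abs[OF x] s by (intro mult_left_mono) (auto simp: K_def)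
  also have "\<dots> = K * (s * 1 + (s / (h x)\<^sup>2) * (1 / h x))"
    by (simp add: power2_eq_square power3_eq_cube algebra_simps)
  also have "\<dots> \<le> K * (Sm * D s x + (A * (1 + Sm) * D s x) * (1 / h x))"
    using s_h_le_D[OF x s] s D hx K assms by (intro mult_left_mono add_mono mult_mono mult_right_mono) auto
  also have "\<dots> \<le> K * (Sm * D s x * (1 + 1 / h x) + (A * (1 + Sm) * D s x) * (1 + 1 / h x))"
    using K A D hx assms by (intro mult_left_mono add_mono) (auto simp: algebra_simps)
  also have "\<dots> = K * (Sm + A * (1 + Sm)) * (1 + 1 / h x) * D s x" by (simp add: algebra_simps)
  finally show "s * \<bar>L2 x\<bar> \<le> K * (Sm + A * (1 + Sm)) * (1 + 1 / h x) * D s x" .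
qed

text \<open>The third term of \<open>gen\<close> has \<open>D\<close> to the third power in its
  denominator: one factor compensates \<open>s * L2\<close>, and at least one is left. So all terms
  stay damped by \<open>1 / D\<close>, and the first derivative is charged one power of
  \<open>1 / h\<close>, as by the drift alone.\<close>

lemma gen_bound:
  assumes "I \<noteq> {}" "0 \<le> Sm"
  obtains C where "0 \<le> C" "\<And>s x a b. 0 \<le> s \<Longrightarrow> s \<le> Sm \<Longrightarrow> x \<in> I \<Longrightarrow>
    \<bar>gen s x a b\<bar> \<le> (C * ((1 + 1 / h x) * \<bar>a\<bar>) + \<bar>b\<bar>) / D s x"
proof -
  obtain C where C: "0 \<le> C" "\<And>s x. 0 \<le> s \<Longrightarrow> s \<le> Sm \<Longrightarrow> x \<in> I \<Longrightarrow> s * \<bar>L2 x\<bar> \<le> C * (1 + 1 / h x) * D s x"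
    using s_L2_le_D[OF assms] by metis
  have A: "0 < A" using A_pos assms by auto
  show thesis
  proof (rule that[of "A + C"])
    show "0 \<le> A + C" using A C by simp
    fix s x a b :: real assume s: "0 \<le> s" "s \<le> Sm" and x: "x \<in> I"
    have hx: "0 < h x" using h_pos x by auto
    have D: "1 \<le> D s x" by (rule D_ge[OF x s(1)])
    have D2: "D s x \<le> 2 * (D s x)\<^sup>2" "D s x * D s x \<le> 2 * (D s x) ^ 3"
      using D by (auto simp: power2_eq_square power3_eq_cube mult_le_cancel_left)
    have "\<bar>gen s x a b\<bar> \<le> \<bar>L x * a / D s x\<bar> + \<bar>b / (2 * (D s x)\<^sup>2)\<bar> + \<bar>s * L2 x * a / (2 * (D s x) ^ 3)\<bar>"
      unfolding gen_def by (intro order_trans[OF abs_triangle_ineq] add_mono order_refl abs_triangle_ineq)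
    also have "\<dots> \<le> A * ((1 + 1 / h x) * \<bar>a\<bar>) / D s x + \<bar>b\<bar> / D s x + C * ((1 + 1 / h x) * \<bar>a\<bar>) / D s x"
    proof (intro add_mono)
      have "\<bar>L x\<bar> * \<bar>a\<bar> \<le> (A * (1 + 1 / h x)) * \<bar>a\<bar>"
        using L_abs[OF x] A by (intro mult_right_mono) (auto simp: algebra_simps)
      then show "\<bar>L x * a / D s x\<bar> \<le> A * ((1 + 1 / h x) * \<bar>a\<bar>) / D s x"
        using D by (simp add: abs_mult divide_right_mono mult.assoc)
      show "\<bar>b / (2 * (D s x)\<^sup>2)\<bar> \<le> \<bar>b\<bar> / D s x"
        using D D2(1) by (simp add: frac_le)
      have "\<bar>s * L2 x * a / (2 * (D s x) ^ 3)\<bar> = s * \<bar>L2 x\<bar> * \<bar>a\<bar> / (2 * (D s x) ^ 3)"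
        using s D by (simp add: abs_mult)
      also have "\<dots> \<le> (C * (1 + 1 / h x) * D s x) * \<bar>a\<bar> / (D s x * D s x)"
        using C(2)[OF s x] C(1) D D2(2) hx s by (intro frac_le mult_right_mono) auto
      also have "\<dots> = C * ((1 + 1 / h x) * \<bar>a\<bar>) / D s x" using D by simp
      finally show "\<bar>s * L2 x * a / (2 * (D s x) ^ 3)\<bar> \<le> C * ((1 + 1 / h x) * \<bar>a\<bar>) / D s x" .
    qed
    also have "\<dots> = ((A + C) * ((1 + 1 / h x) * \<bar>a\<bar>) + \<bar>b\<bar>) / D s x"
      by (simp add: add_divide_distrib distrib_right)
    finally show "\<bar>gen s x a b\<bar> \<le> ((A + C) * ((1 + 1 / h x) * \<bar>a\<bar>) + \<bar>b\<bar>) / D s x" .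
  qed
qed

text \<open>Compared with the generator of the \<open>h\<close>-transform, two terms differ by
  \<open>1 - 1 / D = s * \<bar>L1\<bar> / D\<close> up to bounded factors, and the third carries
  \<open>s\<close> explicitly. The factor \<open>s\<close> will give the step size, and
  \<open>1 / D\<close> the damping that the dissipation requires.\<close>

lemma gen_deviation:
  assumes x: "x \<in> I" and s: "0 \<le> s"
  shows "\<bar>gen s x a b - (L x * a + b / 2)\<bar> \<le>
    s / D s x * (\<bar>L x\<bar> * \<bar>L1 x\<bar> * \<bar>a\<bar> + \<bar>L1 x\<bar> * \<bar>b\<bar> + \<bar>L2 x\<bar> * \<bar>a\<bar>)"
proof -
  define E where "E = 1 / D s x"
  have D: "1 \<le> D s x" by (rule D_ge[OF x s])
  have E: "0 < E" "E \<le> 1" using D by (auto simp: E_def)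
  have E1: "1 - E = s * \<bar>L1 x\<bar> * E"
    using D L1_nonpos[OF x] by (simp add: E_def D_def field_simps)
  have "gen s x a b - (L x * a + b / 2) = - (L x * a * (1 - E)) - (b / 2) * (1 - E) * (1 + E)
      + (1/2) * s * L2 x * a * E ^ 3"
    using D by (simp add: gen_def E_def power_divide field_simps power2_eq_square)
  then have "\<bar>gen s x a b - (L x * a + b / 2)\<bar> \<le> \<bar>L x * a * (1 - E)\<bar> + \<bar>(b / 2) * (1 - E) * (1 + E)\<bar>
      + \<bar>(1/2) * s * L2 x * a * E ^ 3\<bar>" by linarith
  also have "\<dots> \<le> \<bar>L x\<bar> * \<bar>a\<bar> * (1 - E) + \<bar>b\<bar> * (1 - E) + s * \<bar>L2 x\<bar> * \<bar>a\<bar> * E"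
  proof (intro add_mono)
    show "\<bar>L x * a * (1 - E)\<bar> \<le> \<bar>L x\<bar> * \<bar>a\<bar> * (1 - E)" using E by (simp add: abs_mult)
    have "\<bar>(b / 2) * (1 - E) * (1 + E)\<bar> = \<bar>b\<bar> * (1 - E) * ((1 + E) / 2)" using E by (simp add: abs_mult)
    also have "\<dots> \<le> \<bar>b\<bar> * (1 - E) * 1" using E by (intro mult_left_mono) auto
    finally show "\<bar>(b / 2) * (1 - E) * (1 + E)\<bar> \<le> \<bar>b\<bar> * (1 - E)" by simp
    have E3: "E ^ 3 \<le> E" using E power_decreasing[of 1 3 E] by simp
    have "\<bar>(1/2) * s * L2 x * a * E ^ 3\<bar> = (1/2) * (s * \<bar>L2 x\<bar> * \<bar>a\<bar>) * E ^ 3" using E s by (simp add: abs_mult)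
    also have "\<dots> \<le> 1 * (s * \<bar>L2 x\<bar> * \<bar>a\<bar>) * E" using E3 s E by (intro mult_mono) auto
    finally show "\<bar>(1/2) * s * L2 x * a * E ^ 3\<bar> \<le> s * \<bar>L2 x\<bar> * \<bar>a\<bar> * E" by simp
  qed
  also have "\<dots> = s / D s x * (\<bar>L x\<bar> * \<bar>L1 x\<bar> * \<bar>a\<bar> + \<bar>L1 x\<bar> * \<bar>b\<bar> + \<bar>L2 x\<bar> * \<bar>a\<bar>)"
    unfolding E1 by (simp add: E_def algebra_simps add_divide_distrib)
  finally show ?thesis .
qed

lemma orders_L: "orders P 1 (\<lambda>a. L)"
  by (rule ordersI[where C = A and M = 0])
     (use L_abs h_pos in \<open>simp add: powr_minus inverse_eq_divide less_imp_le\<close>)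

lemma orders_le: "orders P q g \<Longrightarrow> (\<And>a x. a \<in> P \<Longrightarrow> x \<in> I \<Longrightarrow> \<bar>f a x\<bar> \<le> \<bar>g a x\<bar>) \<Longrightarrow> orders P q f"
  unfolding orders_def by (meson order_trans)

lemma orders_L1: "orders P 2 (\<lambda>a. L1)"
  by (rule orders_le[OF orders_cmult[OF orders_one_plus_inv_h[of P 2]], simplified, of _ "A + A\<^sup>2"])
     (use L1_abs in \<open>auto intro: order_trans[OF _ abs_ge_self]\<close>)

lemma orders_L2: "orders P 3 (\<lambda>a. L2)"
  by (rule orders_le[OF orders_cmult[OF orders_one_plus_inv_h[of P 3]], simplified, of _ "A + 3 * A\<^sup>2 + 2 * A ^ 3"])
     (use L2_abs in \<open>auto intro: order_trans[OF _ abs_ge_self]\<close>)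

text \<open>An exponent below \<open>1\<close> makes \<open>h powr (- a)\<close> dissipative at the boundary, with dissipation of
  order \<open>a + 2\<close>; the value \<open>a = 3/4\<close> leaves room for errors of order \<open>p + 2 \<le> 5/2\<close>.\<close>

definition Psi :: "nat \<Rightarrow> real \<Rightarrow> real" where
  "Psi M x = h x powr (- (3/4)) + (1 + x) ^ M"

text \<open>The first summand is what \<open>Psi\<close> loses along a step, with
  \<open>11/4 = 3/4 + 2\<close>; the second takes up the polynomial terms of the error
  bounds.\<close>

definition Theta :: "nat \<Rightarrow> real \<Rightarrow> real \<Rightarrow> real" where
  "Theta M s x = h x powr (- 11/4) * (1 / D s x) + Psi M x"

lemma Psi_ge: "x \<in> I \<Longrightarrow> 1 \<le> Psi M x"
  using one_le_1x[of x M] by (simp add: Psi_def add_increasing)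

lemma tempered_Psi: "tempered S (\<lambda>s x. Psi M x)"
  unfolding Psi_def
  by (intro tempered_add tempered_h_powr tempered_power tempered_const tempered_x) simp

lemma tempered_Theta: "tempered S (Theta M)"
  unfolding Theta_def
  using tempered_h_powr[of "11/4" S]
  by (intro tempered_add tempered_mult tempered_inv_D tempered_Psi) simp

lemma Theta_ge: "x \<in> I \<Longrightarrow> 0 \<le> s \<Longrightarrow> 1 \<le> Theta M s x"
  using Psi_ge[of x M] D_ge[of x s] by (simp add: Theta_def add_increasing)

section \<open>The generator applied to the Lyapunov function\<close>

definition Psi1 :: "nat \<Rightarrow> real \<Rightarrow> real" where
  "Psi1 M x = - (3/4) * (h x powr (- (3/4)) * L x) + M * (1 + x) ^ (M - 1)"

definition Psi2 :: "nat \<Rightarrow> real \<Rightarrow> real" where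
  "Psi2 M x = (3/4) * (h x powr (- (3/4)) * ((3/4) * (L x)\<^sup>2 - L1 x)) + real M * (real (M - 1) * (1 + x) ^ (M - 2))"

lemma d_h_powr: "x \<in> I \<Longrightarrow> ((\<lambda>x. h x powr (- (3/4))) has_real_derivative - (3/4) * (h x powr (- (3/4)) * L x)) (at x)"
proof -
  assume x: "x \<in> I"
  have "((\<lambda>x. h x powr (- (3/4))) has_real_derivative - (3/4) * h x powr (- (3/4) - 1) * h1 x) (at x)"
    using h_pos[OF x] by (auto intro!: derivative_eq_intros dh[OF x])
  then show ?thesis
    by (rule DERIV_cong) (use h_pos[OF x] powr_diff[of "h x" "- (3/4)" 1] in \<open>simp add: L_def\<close>)
qed

lemma d_Psi: "x \<in> I \<Longrightarrow> (Psi M has_real_derivative Psi1 M x) (at x)"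
  unfolding Psi_def [abs_def] Psi1_def
  by (rule DERIV_add[OF d_h_powr]) (auto intro!: derivative_eq_intros)

lemma d_Psi1: "x \<in> I \<Longrightarrow> (Psi1 M has_real_derivative Psi2 M x) (at x)"
proof -
  assume x: "x \<in> I"
  have "((\<lambda>x. real M * (1 + x) ^ (M - 1)) has_real_derivative real M * (real (M - 1) * (1 + x) ^ (M - 2))) (at x)"
    by (auto intro!: derivative_eq_intros simp: numeral_2_eq_2)
  moreover have "((\<lambda>x. - (3/4) * (h x powr (- (3/4)) * L x)) has_real_derivative
      (3/4) * (h x powr (- (3/4)) * ((3/4) * (L x)\<^sup>2 - L1 x))) (at x)"
    by (rule DERIV_cong[OF DERIV_cmult[OF DERIV_mult[OF d_h_powr[OF x] dL[OF x]]]])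
       (simp add: power2_eq_square algebra_simps)
  ultimately show ?thesis
    unfolding Psi1_def [abs_def] Psi2_def by (intro DERIV_add)
qed

lemma tempered_Psi1: "tempered S (\<lambda>s x. Psi1 M x)"
  unfolding Psi1_def
  by (intro tempered_add tempered_mult tempered_h_powr tempered_power tempered_const tempered_x tempered_L) simp

lemma tempered_Psi2: "tempered S (\<lambda>s x. Psi2 M x)"
  unfolding Psi2_def
  by (intro tempered_add tempered_mult tempered_diff tempered_h_powr tempered_power tempered_const
      tempered_x tempered_L tempered_L1) simp

lemma gen_add: "gen s x (a + a') (b + b') = gen s x a b + gen s x a' b'"
  by (simp add: gen_def add_divide_distrib distrib_left)

lemma gen_scale: "gen s x (c * a) (c * b) = c * gen s x a b"
  by (simp add: gen_def algebra_simps)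

text \<open>Without damping the coefficient of \<open>L^2\<close> is \<open>- 1 + 7/8\<close>,
  negative because the exponent \<open>3/4\<close> is below 1 and \<open>7/4 = 1 + 3/4\<close>.
  Damping preserves the sign: the negative drift term carries \<open>E = 1 / D\<close>, the positive
  second-order term only \<open>E^2\<close>, which is smaller.\<close>

lemma gen_h_powr:
  assumes x: "x \<in> I" and s: "0 \<le> s" "s \<le> Sm"
  shows "gen s x (- (3/4) * (h x powr (- (3/4)) * L x)) ((3/4) * (h x powr (- (3/4)) * ((3/4) * (L x)\<^sup>2 - L1 x)))
    \<le> (1 / D s x) * (- (3/(32 * A)) * h x powr (- 11/4) + h x powr (- (3/4))
       + (A + A\<^sup>2 * (A * (1 + Sm))) * h x powr (- (3/4 + p)))"
proof -
  define a where "a = h x powr (- (3/4))"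
  define k where "k = h2 x / h x"
  define E where "E = 1 / D s x"
  have A: "0 < A" using A_pos x by auto
  have hx: "0 < h x" using h_pos x by auto
  have D: "1 \<le> D s x" by (rule D_ge[OF x s(1)])
  have E: "0 < E" "E \<le> 1" using D by (auto simp: E_def)
  have E2: "E\<^sup>2 \<le> E" "E ^ 3 \<le> E\<^sup>2" using E power_decreasing[of 1 2 E] power_decreasing[of 2 3 E] by auto
  have a: "0 < a" using hx by (simp add: a_def)
  have k: "k \<le> 0" "\<bar>k\<bar> \<le> A * h x powr (- p)"
    using h2_nonpos[OF x] h2_quot[OF x] hx by (auto simp: k_def divide_nonpos_pos)
  define Z where "Z = - (L x)\<^sup>2 * E + ((7/4) * (L x)\<^sup>2 - k) / 2 * E\<^sup>2 - s * L2 x * L x / 2 * E ^ 3"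
  have "gen s x (- (3/4) * (a * L x)) ((3/4) * (a * ((3/4) * (L x)\<^sup>2 - L1 x))) = (3/4) * a * Z"
    using D by (simp add: gen_def Z_def E_def k_def L1_def power_divide field_simps power2_eq_square)
  also have "Z \<le> E * (- (1/8) * (L x)\<^sup>2 + (A + A\<^sup>2 * (A * (1 + Sm))) * h x powr (- p))"
  proof -
    have t1: "(7/8) * (L x)\<^sup>2 * E\<^sup>2 \<le> (7/8) * (L x)\<^sup>2 * E" using E2 by (intro mult_left_mono) auto
    have "- k / 2 * E\<^sup>2 \<le> (A * h x powr (- p)) * E" using k E2 E A by (intro mult_mono) auto
    then have t2: "- k / 2 * E\<^sup>2 \<le> E * (A * h x powr (- p))" by (simp add: mult.commute)
    \<comment> \<open>The damping term of the implicit step contributes a fourth power of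
      \<open>L\<close> and a product with \<open>k\<close>, both with the favourable sign. Only the
      product with \<open>h3\<close> remains, and \<open>s_h_le_D\<close> reduces it to order
      \<open>p\<close>.\<close>
    have "- (s * L2 x * L x) = - (s * L x * (h3 x / h x)) + 3 * s * (L x)\<^sup>2 * k - 2 * s * (L x) ^ 4"
      by (simp add: L2_def k_def algebra_simps eval_nat_numeral)
    also have "\<dots> \<le> - (s * L x * (h3 x / h x))"
    proof -
      have "3 * s * (L x)\<^sup>2 * k \<le> 0" using s k by (intro mult_nonneg_nonpos) auto
      moreover have "0 \<le> 2 * s * (L x) ^ 4" using s by simp
      ultimately show ?thesis by linarith
    qed
    also have "\<dots> \<le> s * \<bar>L x\<bar> * \<bar>h3 x / h x\<bar>"
      using abs_ge_minus_self[of "s * L x * (h3 x / h x)"] s by (simp only: abs_mult abs_of_nonneg)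
    also have "\<dots> \<le> s * (A / h x) * (A * h x powr (- (1 + p)))"
      using s L_abs[OF x] h3_quot[OF x] A hx by (intro mult_mono) auto
    also have "\<dots> = A\<^sup>2 * (s / (h x)\<^sup>2) * h x powr (- p)"
      using hx by (simp add: powr_diff power2_eq_square powr_minus field_simps)
    also have "\<dots> \<le> A\<^sup>2 * (A * (1 + Sm) * D s x) * h x powr (- p)"
      using s_h_le_D[OF x s] A by (intro mult_right_mono mult_left_mono) auto
    finally have "- (s * L2 x * L x) / 2 \<le> A\<^sup>2 * (A * (1 + Sm) * D s x) * h x powr (- p)"
      using s A D by (smt (verit, best) field_sum_of_halves mult_nonneg_nonneg powr_ge_zero zero_le_power2)
    then have "- (s * L2 x * L x) / 2 * E ^ 3 \<le> (A\<^sup>2 * (A * (1 + Sm) * D s x) * h x powr (- p)) * E\<^sup>2"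
      using E2 E A D s by (intro mult_mono) auto
    also have "\<dots> = E * (A\<^sup>2 * (A * (1 + Sm)) * h x powr (- p))"
      using D by (simp add: E_def power2_eq_square)
    finally have t3: "- (s * L2 x * L x) / 2 * E ^ 3 \<le> E * (A\<^sup>2 * (A * (1 + Sm)) * h x powr (- p))" .
    have "Z = - (L x)\<^sup>2 * E + (7/8) * (L x)\<^sup>2 * E\<^sup>2 + (- k / 2 * E\<^sup>2) + (- (s * L2 x * L x) / 2 * E ^ 3)"
      by (simp add: Z_def algebra_simps diff_divide_distrib)
    then show ?thesis using t1 t2 t3 by (simp add: algebra_simps)
  qed
  \<comment> \<open>Here the dissipation in \<open>L\<close> becomes dissipation in
    \<open>1 / h\<close>: together with the factor \<open>a\<close> it has order
    \<open>3/4 + 2\<close>.\<close>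
  also have "- (1/8) * (L x)\<^sup>2 \<le> - (1/(8*A)) * (1 / (h x)\<^sup>2) + 1/8"
    using h_inv_sq[OF x] A hx by (simp add: field_simps)
  finally have "gen s x (- (3/4) * (a * L x)) ((3/4) * (a * ((3/4) * (L x)\<^sup>2 - L1 x))) \<le>
     (3/4) * a * (E * (- (1/(8*A)) * (1 / (h x)\<^sup>2) + 1/8 + (A + A\<^sup>2 * (A * (1 + Sm))) * h x powr (- p)))"
    using a E by (auto simp: mult_left_mono)
  also have "\<dots> = E * (- (3/(32 * A)) * (a * (1 / (h x)\<^sup>2)) + (3/32) * a
       + (3/4) * ((A + A\<^sup>2 * (A * (1 + Sm))) * (a * h x powr (- p))))"
    by (simp add: algebra_simps)
  also have "a * (1 / (h x)\<^sup>2) = h x powr (- 11/4)"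
  proof -
    have "h x powr (- 11/4) = h x powr (- (3/4)) * h x powr (- 2)" by (simp add: powr_add[symmetric])
    then show ?thesis using hx by (simp add: a_def powr_minus inverse_eq_divide)
  qed
  also have "a * h x powr (- p) = h x powr (- (3/4 + p))"
    by (simp add: a_def powr_add[symmetric])
  also have "E * (- (3/(32 * A)) * h x powr (- 11/4) + (3/32) * a
       + (3/4) * ((A + A\<^sup>2 * (A * (1 + Sm))) * h x powr (- (3/4 + p)))) \<le>
      E * (- (3/(32 * A)) * h x powr (- 11/4) + a
       + (A + A\<^sup>2 * (A * (1 + Sm))) * h x powr (- (3/4 + p)))"
  proof (intro order_refl mult_left_mono add_mono)
    have "0 \<le> (A + A\<^sup>2 * (A * (1 + Sm))) * h x powr (- (3/4 + p))" using A s by auto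
    then show "(3/4) * ((A + A\<^sup>2 * (A * (1 + Sm))) * h x powr (- (3/4 + p))) \<le>
        (A + A\<^sup>2 * (A * (1 + Sm))) * h x powr (- (3/4 + p))" by linarith
  qed (use a E in auto)
  finally show ?thesis by (simp only: a_def E_def)
qed

text \<open>All terms other than the dissipation have an order below \<open>11/4\<close>:
  \<open>3/4\<close>, \<open>3/4 + p\<close>, and 1 from the drift acting on the polynomial. They
  are traded against a small part of the dissipation and a multiple of \<open>(1 + x) ^ M\<close>
  with the same exponent.\<close>

lemma gen_Psi:
  assumes "I \<noteq> {}" "0 \<le> Sm"
  obtains c C where "0 < c" "0 \<le> C" "\<And>s x. 0 \<le> s \<Longrightarrow> s \<le> Sm \<Longrightarrow> x \<in> I \<Longrightarrow>
    gen s x (Psi1 M x) (Psi2 M x) \<le> - c * (h x powr (- 11/4) * (1 / D s x)) + C * (1 + x) ^ M"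
proof -
  have A: "0 < A" using A_pos assms by auto
  obtain B where B: "0 \<le> B" "\<And>s x a b. 0 \<le> s \<Longrightarrow> s \<le> Sm \<Longrightarrow> x \<in> I \<Longrightarrow>
    \<bar>gen s x a b\<bar> \<le> (B * ((1 + 1 / h x) * \<bar>a\<bar>) + \<bar>b\<bar>) / D s x"
    using gen_bound[OF assms] by metis
  define K1 where "K1 = A + A\<^sup>2 * (A * (1 + Sm))"
  define K2 where "K2 = (B + 1) * (real M + real M * real M)"
  define c0 where "c0 = 3 / (32 * A)"
  have c0: "0 < c0" and K: "0 \<le> K1" "0 \<le> K2" using A B assms by (auto simp: c0_def K1_def K2_def)
  \<comment> \<open>The three traded terms cost \<open>(1 + K1 + K2) * e = c0 / 6\<close> of the
    dissipation, so more than half of \<open>c0\<close> survives.\<close>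
  define e where "e = c0 / (6 * (1 + K1 + K2))"
  have e: "0 < e" using c0 K by (simp add: e_def)
  have e3: "(1 + K1 + K2) * e = c0 / 6"
  proof -
    have "u * (c0 / (6 * u)) = c0 / 6" if "u \<noteq> 0" for u :: real using that by simp
    from this[of "1 + K1 + K2"] show ?thesis using K unfolding e_def by linarith
  qed
  obtain C1 where C1: "0 \<le> C1" "\<And>x. x \<in> I \<Longrightarrow> (1 + x) ^ M * h x powr (- (3/4)) \<le> e * h x powr (- (11/4)) + C1 * (1 + x) ^ M"
    using weight_trade[of "3/4" "11/4" e M] e by auto
  obtain C2 where C2: "0 \<le> C2" "\<And>x. x \<in> I \<Longrightarrow> (1 + x) ^ M * h x powr (- (3/4 + p)) \<le> e * h x powr (- (11/4)) + C2 * (1 + x) ^ M"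
    using weight_trade[of "3/4 + p" "11/4" e M] e p by auto
  obtain C3 where C3: "0 \<le> C3" "\<And>x. x \<in> I \<Longrightarrow> (1 + x) ^ M * h x powr (- 1) \<le> e * h x powr (- (11/4)) + C3 * (1 + x) ^ M"
    using weight_trade[of 1 "11/4" e M] e by auto
  define C where "C = C1 + K1 * C2 + K2 * (C3 + 1)"
  have C: "0 \<le> C" using C1 C2 C3 K by (simp add: C_def)
  show thesis
  proof (rule that[of "c0 / 2" C])
    fix s x assume s: "0 \<le> s" "s \<le> Sm" and x: "x \<in> I"
    have hx: "0 < h x" and x0: "0 < x" using h_pos pos_I x by auto
    define E where "E = 1 / D s x"
    define w where "w = h x powr (- (11/4))"
    define m where "m = (1 + x) ^ M"
    have E: "0 < E" "E \<le> 1" using D_ge[OF x s(1)] by (auto simp: E_def)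
    have m: "1 \<le> m" using one_le_1x[OF x] by (simp add: m_def)
    have w: "0 \<le> w" by (simp add: w_def)
    have P1: "(1 + x) ^ (M - 1) \<le> m" "(1 + x) ^ (M - 2) \<le> m"
      unfolding m_def using x0 by (auto intro!: power_increasing)
    define a b where "a = real M * (1 + x) ^ (M - 1)" and "b = real M * (real (M - 1) * (1 + x) ^ (M - 2))"
    have ab: "0 \<le> a" "a \<le> real M * m" "0 \<le> b" "b \<le> real M * (real M * m)"
      unfolding a_def b_def using P1 x0 m by (auto intro!: mult_left_mono mult_mono)
    have "gen s x a b \<le> \<bar>gen s x a b\<bar>" by simp
    also have "\<dots> \<le> (B * ((1 + 1 / h x) * \<bar>a\<bar>) + \<bar>b\<bar>) / D s x" by (rule B(2)[OF s x])
    also have "\<dots> = E * (B * ((1 + 1 / h x) * a) + b)" using ab by (simp add: E_def)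
    also have "\<dots> \<le> E * (K2 * (m * (1 + 1 / h x)))"
    proof (rule mult_left_mono)
      have "B * ((1 + 1 / h x) * a) + b \<le> B * ((1 + 1 / h x) * (real M * m)) + real M * (real M * m) * (1 + 1 / h x)"
        using ab B(1) hx m
        by (intro add_mono mult_left_mono) (auto intro: order_trans[OF ab(4)] simp: mult_le_cancel_left1)
      also have "\<dots> = (B * real M + real M * real M) * (m * (1 + 1 / h x))" by (simp add: algebra_simps)
      also have "\<dots> \<le> K2 * (m * (1 + 1 / h x))"
        using B hx m by (intro mult_right_mono) (auto simp: K2_def algebra_simps)
      finally show "B * ((1 + 1 / h x) * a) + b \<le> K2 * (m * (1 + 1 / h x))" .
    qed (use E in simp)
    also have "m * (1 + 1 / h x) \<le> e * w + (C3 + 1) * m"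
      using C3(2)[OF x] hx by (simp add: m_def w_def algebra_simps powr_minus inverse_eq_divide)
    finally have g2: "gen s x a b \<le> E * (K2 * (e * w + (C3 + 1) * m))"
      using E K by (auto simp: mult_left_mono)
    have "gen s x (- (3/4) * (h x powr (- (3/4)) * L x)) ((3/4) * (h x powr (- (3/4)) * ((3/4) * (L x)\<^sup>2 - L1 x)))
      \<le> E * (- c0 * w + h x powr (- (3/4)) + K1 * h x powr (- (3/4 + p)))"
      using gen_h_powr[OF x s] by (simp add: E_def c0_def w_def K1_def)
    also have "\<dots> \<le> E * (- c0 * w + (e * w + C1 * m) + K1 * (e * w + C2 * m))"
    proof (intro order_refl mult_left_mono add_mono)
      have *: "u \<le> m * u" if "0 \<le> u" for u using m that by (simp add: mult_le_cancel_right1)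
      show "h x powr (- (3/4)) \<le> e * w + C1 * m"
        using C1(2)[OF x] *[of "h x powr (- (3/4))"] by (simp add: m_def w_def)
      show "h x powr (- (3/4 + p)) \<le> e * w + C2 * m"
        using C2(2)[OF x] *[of "h x powr (- (3/4 + p))"] by (simp add: m_def w_def)
    qed (use E K in auto)
    finally have g1: "gen s x (- (3/4) * (h x powr (- (3/4)) * L x)) ((3/4) * (h x powr (- (3/4)) * ((3/4) * (L x)\<^sup>2 - L1 x)))
      \<le> E * (- c0 * w + (e * w + C1 * m) + K1 * (e * w + C2 * m))" .
    have "gen s x (Psi1 M x) (Psi2 M x) \<le> E * (- c0 * w + (e * w + C1 * m) + K1 * (e * w + C2 * m)) + E * (K2 * (e * w + (C3 + 1) * m))"
      unfolding Psi1_def Psi2_def gen_add a_def[symmetric] b_def[symmetric] using g1 g2 by linarith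
    also have "\<dots> = E * (- c0 * w + ((1 + K1 + K2) * e) * w + C * m)"
      by (simp add: C_def algebra_simps)
    also have "\<dots> \<le> - (c0 / 2) * (w * E) + C * m"
    proof -
      have "E * (C * m) \<le> 1 * (C * m)" using E C m by (intro mult_right_mono) auto
      moreover have "0 \<le> c0 * (w * E)" using c0 w E by simp
      ultimately show ?thesis unfolding e3 by (simp add: algebra_simps)
    qed
    finally show "gen s x (Psi1 M x) (Psi2 M x) \<le> - (c0 / 2) * (h x powr (- 11/4) * (1 / D s x)) + C * (1 + x) ^ M"
      by (simp add: w_def E_def m_def)
  qed (use c0 C in auto)
qed

text \<open>Dynkin's formula for the discounted function \<open>exp (- \<Lambda> * s) * Psi\<close>.
  The part \<open>C\<close> of \<Lambda> = \<open>C + 1\<close> absorbs the polynomial term of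
  \<open>gen_Psi\<close>, and the extra 1 leaves a multiple of \<open>Psi\<close>, the second
  summand of \<open>Theta\<close>. The right-hand side has the shape that telescopes from step to
  step.\<close>

lemma lyapunov:
  assumes "I \<noteq> {}" "0 \<le> Sm"
  obtains c \<Lambda> where "0 < c" "0 \<le> \<Lambda>" "\<And>y \<theta>1. y \<in> I \<Longrightarrow> 0 < \<theta>1 \<Longrightarrow> \<theta>1\<^sup>2 \<le> Sm \<Longrightarrow>
    c * integral {0..\<theta>1} (\<lambda>\<theta>. 2 * \<theta> * expect (Theta M) y \<theta>) \<le>
      exp (\<Lambda> * \<theta>1\<^sup>2) * Psi M y - expect (\<lambda>s. Psi M) y \<theta>1"
proof -
  obtain c C where c: "0 < c" "0 \<le> C" "\<And>s x. 0 \<le> s \<Longrightarrow> s \<le> Sm \<Longrightarrow> x \<in> I \<Longrightarrow>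
    gen s x (Psi1 M x) (Psi2 M x) \<le> - c * (h x powr (- 11/4) * (1 / D s x)) + C * (1 + x) ^ M"
    using gen_Psi[OF assms] by metis
  define k where "k = min c 1"
  define \<Lambda> where "\<Lambda> = C + 1"
  have k: "0 < k" "k \<le> c" "k \<le> 1" using c by (auto simp: k_def)
  show thesis
  proof (rule that[of k \<Lambda>])
    fix y \<theta>1 assume y: "y \<in> I" and \<theta>1: "0 < \<theta>1" "\<theta>1\<^sup>2 \<le> Sm"
    define S where "S = \<theta>1\<^sup>2"
    define ex where "ex s = exp (- (\<Lambda> * s))" for s
    have temp_ex: "tempered S' (\<lambda>s x. ex s)" for S'
      unfolding ex_def by (intro tempered_time continuous_intros)
    have dy: "expect (\<lambda>s x. ex S * Psi M x) y \<theta>1 - ex 0 * Psi M y =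
      integral {0..\<theta>1} (\<lambda>\<theta>. 2 * \<theta> * (\<integral>\<xi>. (- \<Lambda> * (ex (\<theta>\<^sup>2) * Psi M (Y y \<theta> \<xi>))) +
        gen (\<theta>\<^sup>2) (Y y \<theta> \<xi>) (ex (\<theta>\<^sup>2) * Psi1 M (Y y \<theta> \<xi>)) (ex (\<theta>\<^sup>2) * Psi2 M (Y y \<theta> \<xi>)) \<partial>gauss))"
    proof (rule Y_dynkin[OF y \<theta>1(1) S_def, of "\<lambda>s x. ex s * Psi M x" "\<lambda>s x. - \<Lambda> * (ex s * Psi M x)"
          "\<lambda>s x. ex s * Psi1 M x" "\<lambda>s x. ex s * Psi2 M x"])
      show "((\<lambda>s. ex s * Psi M x) has_real_derivative - \<Lambda> * (ex s * Psi M x)) (at s within {0..S})" for s x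
        unfolding ex_def by (auto intro!: derivative_eq_intros)
      show "((\<lambda>x. ex s * Psi M x) has_real_derivative ex s * Psi1 M x) (at x)" if "x \<in> I" for s x
        by (rule DERIV_cmult[OF d_Psi[OF that]])
      show "((\<lambda>x. ex s * Psi1 M x) has_real_derivative ex s * Psi2 M x) (at x)" if "x \<in> I" for s x
        by (rule DERIV_cmult[OF d_Psi1[OF that]])
    qed (intro tempered_mult tempered_const temp_ex tempered_Psi tempered_Psi1 tempered_Psi2)+
    define F where "F s x = (- \<Lambda> * (ex s * Psi M x)) + gen s x (ex s * Psi1 M x) (ex s * Psi2 M x)" for s x
    have temp_F: "tempered S F" unfolding F_def
      by (intro tempered_add tempered_mult tempered_const temp_ex tempered_Psi tempered_gen tempered_Psi1 tempered_Psi2)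
    have F_le: "F s x \<le> - (k * ex S) * Theta M s x" if s: "s \<in> {0..S}" and x: "x \<in> I" for s x
    proof -
      have Sm: "0 \<le> s" "s \<le> Sm" using s \<theta>1 by (auto simp: S_def)
      have exs: "ex S \<le> ex s" "0 < ex s" using s c by (auto simp: ex_def \<Lambda>_def intro!: mult_left_mono)
      have nn: "0 \<le> h x powr (- 11/4) * (1 / D s x)" using D_ge[OF x Sm(1)] by simp
      have x0: "0 < x" using pos_I x by auto
      have "F s x = ex s * (- \<Lambda> * Psi M x + gen s x (Psi1 M x) (Psi2 M x))"
        unfolding F_def gen_scale by (simp add: algebra_simps)
      also have "\<dots> \<le> ex s * (- (k * Theta M s x))"
      proof (rule mult_left_mono)
        have "k * (h x powr (- 11/4) * (1 / D s x)) \<le> c * (h x powr (- 11/4) * (1 / D s x))"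
          using k nn by (intro mult_right_mono) auto
        moreover have "C * (1 + x) ^ M \<le> C * Psi M x"
          using c by (intro mult_left_mono) (auto simp: Psi_def)
        moreover have "k * Psi M x \<le> 1 * Psi M x"
          using k Psi_ge[OF x, of M] by (intro mult_right_mono) auto
        ultimately show "- \<Lambda> * Psi M x + gen s x (Psi1 M x) (Psi2 M x) \<le> - (k * Theta M s x)"
          using c(3)[OF Sm x] by (simp add: Theta_def \<Lambda>_def algebra_simps)
      qed (use exs in simp)
      also have "\<dots> \<le> - (k * ex S) * Theta M s x"
        using exs k Theta_ge[OF x Sm(1), of M] by (simp add: mult_right_mono mult_left_mono mult_ac)
      finally show ?thesis .
    qed
    have temp_T: "tempered S (\<lambda>s x. - (k * ex S) * Theta M s x)"
      by (intro tempered_cmult tempered_Theta)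
    have cont_T: "continuous_on {0..\<theta>1} (expect (Theta M) y)"
      using \<theta>1 by (intro expect_continuous[OF y] tempered_Theta) auto
    have "expect (\<lambda>s x. ex S * Psi M x) y \<theta>1 - ex 0 * Psi M y = integral {0..\<theta>1} (\<lambda>\<theta>. 2 * \<theta> * expect F y \<theta>)"
      unfolding dy F_def ..
    also have "\<dots> \<le> integral {0..\<theta>1} (\<lambda>\<theta>. 2 * \<theta> * (- (k * ex S) * expect (Theta M) y \<theta>))"
    proof (rule weighted_integral_mono)
      show "continuous_on {0..\<theta>1} (expect F y)"
        using \<theta>1 temp_F by (intro expect_continuous[OF y]) (auto simp: S_def)
      show "continuous_on {0..\<theta>1} (\<lambda>\<theta>. - (k * ex S) * expect (Theta M) y \<theta>)"
        by (intro continuous_intros cont_T)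
      show "expect F y \<theta> \<le> - (k * ex S) * expect (Theta M) y \<theta>" if "\<theta> \<in> {0..\<theta>1}" for \<theta>
        using expect_mono[OF y temp_F[unfolded S_def] temp_T[unfolded S_def] that] F_le by (simp add: S_def)
    qed
    also have "\<dots> = - (k * ex S) * integral {0..\<theta>1} (\<lambda>\<theta>. 2 * \<theta> * expect (Theta M) y \<theta>)"
      unfolding integral_mult_right[symmetric] by (rule integral_cong) simp
    finally have "ex S * (k * integral {0..\<theta>1} (\<lambda>\<theta>. 2 * \<theta> * expect (Theta M) y \<theta>)) \<le>
        Psi M y - ex S * expect (\<lambda>s. Psi M) y \<theta>1"
      by (simp add: ex_def algebra_simps)
    also have "\<dots> = ex S * (exp (\<Lambda> * S) * Psi M y - expect (\<lambda>s. Psi M) y \<theta>1)"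
      by (simp add: ex_def algebra_simps exp_minus)
    finally show "k * integral {0..\<theta>1} (\<lambda>\<theta>. 2 * \<theta> * expect (Theta M) y \<theta>) \<le>
      exp (\<Lambda> * \<theta>1\<^sup>2) * Psi M y - expect (\<lambda>s. Psi M) y \<theta>1"
      by (simp add: ex_def S_def)
  qed (use k c in \<open>auto simp: \<Lambda>_def\<close>)
qed

end

section \<open>The local error\<close>

lemma young_cube:
  fixes w z :: real
  assumes "0 \<le> w" "0 \<le> z"
  shows "w\<^sup>2 * z \<le> w ^ 3 + z ^ 3"
proof (cases "z \<le> w")
  case True
  then have "w\<^sup>2 * z \<le> w\<^sup>2 * w" using assms by (intro mult_left_mono) auto
  moreover have "0 \<le> z ^ 3" using assms by simp
  ultimately show ?thesis by (simp add: power2_eq_square power3_eq_cube)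
next
  case False
  then have "w\<^sup>2 * z \<le> z\<^sup>2 * z" using assms by (intro mult_right_mono power_mono) auto
  moreover have "0 \<le> w ^ 3" using assms by simp
  ultimately show ?thesis by (simp add: power2_eq_square power3_eq_cube)
qed

text \<open>\<rho> is the inverse square of \<sigma>, and \<kappa> stands for the potential
  \<open>b + h'' / (2 * h)\<close>. The equation is divided by the square of \<sigma>, because in
  the time scale of \<open>J\<close> the noise has unit intensity. \<kappa> is bounded above, as
  \<open>h''\<close> is not positive, which keeps the exponentials bounded, but near the boundary it
  is only of order \<open>p\<close>. The unit type is the parameter set of functions without a
  parameter.\<close>

locale bem_coefficients = concave_weight +
  fixes \<sigma> \<rho> \<rho>1 \<rho>2 \<kappa> \<kappa>1 \<kappa>2 :: "real \<Rightarrow> real" and v vt vx vxx vtx vtxx :: "real \<Rightarrow> real \<Rightarrow> real"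
    and T B :: real
  assumes T_pos: "0 < T"
    and \<sigma>_pos: "x \<in> I \<Longrightarrow> 0 < \<sigma> x" and \<sigma>_bound: "x \<in> I \<Longrightarrow> (\<sigma> x)\<^sup>2 \<le> B"
    and \<rho>_eq: "x \<in> I \<Longrightarrow> \<rho> x = 1 / (\<sigma> x)\<^sup>2"
    and d\<rho>: "x \<in> I \<Longrightarrow> (\<rho> has_real_derivative \<rho>1 x) (at x)"
    and d\<rho>1: "x \<in> I \<Longrightarrow> (\<rho>1 has_real_derivative \<rho>2 x) (at x)"
    and cont_\<rho>2: "continuous_on I \<rho>2"
    and \<rho>_bounds: "x \<in> I \<Longrightarrow> \<bar>\<rho> x\<bar> \<le> B" "x \<in> I \<Longrightarrow> \<bar>\<rho>1 x\<bar> \<le> B" "x \<in> I \<Longrightarrow> \<bar>\<rho>2 x\<bar> \<le> B"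
    and d\<kappa>: "x \<in> I \<Longrightarrow> (\<kappa> has_real_derivative \<kappa>1 x) (at x)"
    and d\<kappa>1: "x \<in> I \<Longrightarrow> (\<kappa>1 has_real_derivative \<kappa>2 x) (at x)"
    and cont_\<kappa>2: "continuous_on I \<kappa>2"
    and \<kappa>_upper: "x \<in> I \<Longrightarrow> \<kappa> x \<le> B" and \<kappa>_abs: "x \<in> I \<Longrightarrow> \<bar>\<kappa> x\<bar> \<le> B * (1 + h x powr (- p))"
    and \<kappa>1_orders: "orders (UNIV :: unit set) (p + 1) (\<lambda>_. \<kappa>1)"
    and \<kappa>2_orders: "orders (UNIV :: unit set) (p + 2) (\<lambda>_. \<kappa>2)"
    and dv: "t \<in> {0..T} \<Longrightarrow> x \<in> I \<Longrightarrow> ((\<lambda>t. v t x) has_real_derivative vt t x) (at t within {0..T})"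
    and dvx: "t \<in> {0..T} \<Longrightarrow> x \<in> I \<Longrightarrow> (v t has_real_derivative vx t x) (at x)"
    and dvxx: "t \<in> {0..T} \<Longrightarrow> x \<in> I \<Longrightarrow> (vx t has_real_derivative vxx t x) (at x)"
    and dvtx: "t \<in> {0..T} \<Longrightarrow> x \<in> I \<Longrightarrow> (vt t has_real_derivative vtx t x) (at x)"
    and dvtxx: "t \<in> {0..T} \<Longrightarrow> x \<in> I \<Longrightarrow> (vtx t has_real_derivative vtxx t x) (at x)"
    and cont_v: "continuous_on ({0..T} \<times> I) (\<lambda>(t, x). v t x)"
    and cont_vt: "continuous_on ({0..T} \<times> I) (\<lambda>(t, x). vt t x)"
    and cont_vx: "continuous_on ({0..T} \<times> I) (\<lambda>(t, x). vx t x)"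
    and cont_vxx: "continuous_on ({0..T} \<times> I) (\<lambda>(t, x). vxx t x)"
    and cont_vtxx: "t \<in> {0..T} \<Longrightarrow> continuous_on I (vtxx t)"
    and v_orders: "orders {0..T} 0 v" and vt_orders: "orders {0..T} 0 vt"
    and vx_orders: "orders {0..T} (p - 1) vx" and vxx_orders: "orders {0..T} p vxx"
    and vtx_orders: "orders {0..T} (p - 1) vtx" and vtxx_orders: "orders {0..T} p vtxx"
    and pde: "t \<in> {0..T} \<Longrightarrow> x \<in> I \<Longrightarrow>
      L x * vx t x + vxx t x / 2 = - \<rho> x * vt t x - \<kappa> x * v t x"
begin

lemma B_nonneg: "I \<noteq> {} \<Longrightarrow> 0 \<le> B"
  using \<rho>_bounds(1) by force

text \<open>The singular part keeps its factor \<open>1 / D\<close>; for the polynomial part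
  \<open>1 \<le> D\<close> is enough.\<close>

lemma theta_absorb:
  assumes "x \<in> I" "0 \<le> s"
  shows "(h x powr (- 11/4) + (1 + x) ^ M) / D s x \<le> Theta M s x"
proof -
  have D: "1 \<le> D s x" using D_ge assms by blast
  have "(1 + x) ^ M / D s x \<le> (1 + x) ^ M / 1"
    using D pos_I[OF assms(1)] by (intro divide_left_mono) auto
  then show ?thesis
    by (simp add: Theta_def Psi_def add_divide_distrib add_increasing)
qed

lemma Psi_mono: "x \<in> I \<Longrightarrow> M \<le> M' \<Longrightarrow> Psi M x \<le> Psi M' x"
  using pos_I[of x] by (auto simp: Psi_def intro!: power_increasing)

lemma Theta_mono: "x \<in> I \<Longrightarrow> M \<le> M' \<Longrightarrow> Theta M s x \<le> Theta M' s x"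
  by (auto simp: Theta_def intro!: Psi_mono)

text \<open>Every product in \<open>gen_deviation\<close> has order \<open>p + 2\<close>:
  \<open>1 + 2 + (p - 1)\<close>, \<open>2 + p\<close> and \<open>3 + (p - 1)\<close>. As
  \<open>p \<le> 1/2\<close>, this is at most \<open>5/2\<close>, below the order
  \<open>11/4\<close> of the dissipation.\<close>

lemma deviation_bound:
  obtains C M where "0 \<le> C" "\<And>u s x. u \<in> {0..T} \<Longrightarrow> 0 \<le> s \<Longrightarrow> x \<in> I \<Longrightarrow>
    \<bar>gen s x (vx u x) (vxx u x) - (L x * vx u x + vxx u x / 2)\<bar> \<le> s * C * Theta M s x"
proof -
  have "orders {0..T} (p + 2) (\<lambda>u x. \<bar>L x\<bar> * \<bar>L1 x\<bar> * \<bar>vx u x\<bar> + \<bar>L1 x\<bar> * \<bar>vxx u x\<bar> + \<bar>L2 x\<bar> * \<bar>vx u x\<bar>)"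
  proof (intro orders_add)
    show "orders {0..T} (p + 2) (\<lambda>u x. \<bar>L x\<bar> * \<bar>L1 x\<bar> * \<bar>vx u x\<bar>)"
      by (intro orders_mult[OF orders_mult[of _ 1 _ 2 _ 3] orders_abs[OF vx_orders]] orders_abs orders_L orders_L1) auto
    show "orders {0..T} (p + 2) (\<lambda>u x. \<bar>L1 x\<bar> * \<bar>vxx u x\<bar>)"
      by (rule orders_mult[OF orders_abs[OF orders_L1] orders_abs[OF vxx_orders]]) simp
    show "orders {0..T} (p + 2) (\<lambda>u x. \<bar>L2 x\<bar> * \<bar>vx u x\<bar>)"
      by (rule orders_mult[OF orders_abs[OF orders_L2] orders_abs[OF vx_orders]]) simp
  qed
  then obtain C M where C: "0 \<le> C" "\<And>u x. u \<in> {0..T} \<Longrightarrow> x \<in> I \<Longrightarrow>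
      \<bar>\<bar>L x\<bar> * \<bar>L1 x\<bar> * \<bar>vx u x\<bar> + \<bar>L1 x\<bar> * \<bar>vxx u x\<bar> + \<bar>L2 x\<bar> * \<bar>vx u x\<bar>\<bar> \<le> C * (h x powr (- 11/4) + (1 + x) ^ M)"
    by (rule orders_trade) (use p in auto)
  show thesis
  proof (rule that[OF C(1), of M])
    fix u s x :: real assume u: "u \<in> {0..T}" and s: "0 \<le> s" and x: "x \<in> I"
    have D: "1 \<le> D s x" using D_ge x s by blast
    have "\<bar>gen s x (vx u x) (vxx u x) - (L x * vx u x + vxx u x / 2)\<bar> \<le>
      s / D s x * (\<bar>L x\<bar> * \<bar>L1 x\<bar> * \<bar>vx u x\<bar> + \<bar>L1 x\<bar> * \<bar>vxx u x\<bar> + \<bar>L2 x\<bar> * \<bar>vx u x\<bar>)"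
      by (rule gen_deviation[OF x s])
    also have "\<dots> \<le> s / D s x * (C * (h x powr (- 11/4) + (1 + x) ^ M))"
      using C(2)[OF u x] s D by (intro mult_left_mono) auto
    also have "\<dots> = s * C * ((h x powr (- 11/4) + (1 + x) ^ M) / D s x)" by simp
    also have "\<dots> \<le> s * C * Theta M s x"
      using s C by (intro mult_left_mono theta_absorb x) auto
    finally show "\<bar>gen s x (vx u x) (vxx u x) - (L x * vx u x + vxx u x / 2)\<bar> \<le> s * C * Theta M s x" .
  qed
qed

text \<open>\<open>Phi y u\<close> is the defect in the equation for \<open>v\<close> at time \<open>u\<close> when the coefficients are frozen
  at \<open>y\<close>. It vanishes at \<open>y\<close>, so that a second use of Dynkin's formula gains a factor of the
  step size.\<close>

definition Phi :: "real \<Rightarrow> real \<Rightarrow> real \<Rightarrow> real" where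
  "Phi y u x = (\<rho> y - \<rho> x) * vt u x + (\<kappa> y - \<kappa> x) * v u x"
text \<open>The space derivatives of \<open>Phi\<close> with the summands
  \<open>\<kappa> y * vx\<close> and \<open>\<kappa> y * vxx\<close> left out: \<kappa> may be
  unbounded in the starting point \<open>y\<close>, so these have no order uniform in
  \<open>y\<close> and are estimated separately.\<close>

definition phi1 :: "real \<Rightarrow> real \<Rightarrow> real \<Rightarrow> real" where
  "phi1 y u x = (\<rho> y - \<rho> x) * vtx u x - \<rho>1 x * vt u x - \<kappa>1 x * v u x - \<kappa> x * vx u x"
definition phi2 :: "real \<Rightarrow> real \<Rightarrow> real \<Rightarrow> real" where
  "phi2 y u x = (\<rho> y - \<rho> x) * vtxx u x - 2 * (\<rho>1 x * vtx u x) - \<rho>2 x * vt u x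
     - \<kappa>2 x * v u x - 2 * (\<kappa>1 x * vx u x) - \<kappa> x * vxx u x"

lemma d_Phi:
  assumes "u \<in> {0..T}" "x \<in> I"
  shows "(Phi y u has_real_derivative phi1 y u x + \<kappa> y * vx u x) (at x)"
  unfolding Phi_def [abs_def] phi1_def
  by (rule derivative_eq_intros d\<rho> d\<kappa> dvx dvtx assms refl)+ (simp add: algebra_simps)

lemma d_Phi1:
  assumes "u \<in> {0..T}" "x \<in> I"
  shows "((\<lambda>x. phi1 y u x + \<kappa> y * vx u x) has_real_derivative phi2 y u x + \<kappa> y * vxx u x) (at x)"
  unfolding phi1_def [abs_def] phi2_def
  by (rule derivative_eq_intros d\<rho> d\<rho>1 d\<kappa> d\<kappa>1 dvx dvxx dvtx dvtxx assms refl)+ (simp add: algebra_simps)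

lemma \<kappa>_orders: "orders P p (\<lambda>a. \<kappa>)"
proof (rule orders_le)
  show "orders P p (\<lambda>a x. B * (1 + h x powr (- p)))"
    by (intro orders_cmult orders_add orders_h_powr orders_mono[OF orders_const]) (rule p)
qed (use \<kappa>_abs in \<open>auto intro: order_trans[OF _ abs_ge_self]\<close>)

lemma orders_from_unit: "orders (UNIV :: unit set) q (\<lambda>_. f) \<Longrightarrow> orders P q (\<lambda>a. f)"
  using orders_reindex[of "UNIV :: unit set" q "\<lambda>_. f" P "\<lambda>_. ()"] by simp

text \<open>Uniformity in \<open>y\<close> holds because \<open>y\<close> enters only through
  \<open>\<rho> y\<close>, which is bounded. The highest orders come from
  \<open>\<kappa>1 * v\<close> and \<open>\<kappa>2 * v\<close>.\<close>

lemma phi_orders: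
  shows "orders (I \<times> {0..T}) (p + 1) (\<lambda>a. phi1 (fst a) (snd a))"
    and "orders (I \<times> {0..T}) (p + 2) (\<lambda>a. phi2 (fst a) (snd a))"
proof -
  let ?P = "I \<times> {0..T}"
  have snd: "\<And>a. a \<in> ?P \<Longrightarrow> snd a \<in> {0..T}" by auto
  note o = orders_reindex[where i = snd, OF _ snd]
  have \<rho>\<rho>: "orders ?P 0 (\<lambda>a x. \<rho> (fst a) - \<rho> x)"
  proof (rule orders_bounded[where C = "B + B"])
    fix a x assume "a \<in> ?P" "x \<in> I"
    then show "\<bar>\<rho> (fst a) - \<rho> x\<bar> \<le> B + B"
      using \<rho>_bounds(1)[of "fst a"] \<rho>_bounds(1)[of x] by auto
  qed
  have \<rho>12: "orders ?P 0 (\<lambda>a. \<rho>1)" "orders ?P 0 (\<lambda>a. \<rho>2)"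
    by (rule orders_bounded[where C = B], use \<rho>_bounds in auto)+
  note \<kappa>s = \<kappa>_orders[of ?P] orders_from_unit[OF \<kappa>1_orders, of ?P] orders_from_unit[OF \<kappa>2_orders, of ?P]
  show "orders ?P (p + 1) (\<lambda>a. phi1 (fst a) (snd a))"
    unfolding phi1_def using p
    by (intro orders_diff orders_mult[OF \<rho>\<rho> o[OF vtx_orders]] orders_mult[OF \<rho>12(1) o[OF vt_orders]]
        orders_mult[OF \<kappa>s(2) o[OF v_orders]] orders_mult[OF \<kappa>s(1) o[OF vx_orders]]) auto
  show "orders ?P (p + 2) (\<lambda>a. phi2 (fst a) (snd a))"
    unfolding phi2_def using p
    by (intro orders_diff orders_cmult orders_mult[OF \<rho>\<rho> o[OF vtxx_orders]] orders_mult[OF \<rho>12(1) o[OF vtx_orders]]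
        orders_mult[OF \<rho>12(2) o[OF vt_orders]] orders_mult[OF \<kappa>s(3) o[OF v_orders]]
        orders_mult[OF \<kappa>s(2) o[OF vx_orders]] orders_mult[OF \<kappa>s(1) o[OF vxx_orders]]) auto
qed

text \<open>The frozen value \<open>\<kappa> y\<close> is not damped by \<open>1/D\<close>; Young's inequality with exponents \<open>3/2\<close> and \<open>3\<close>
  splits its products with functions of order \<open>p\<close> into \<open>Psi M y\<close> and a term of order \<open>3 * p\<close>.\<close>

lemma \<kappa>_quartic:
  assumes y: "y \<in> I"
  shows "\<bar>\<kappa> y\<bar> \<le> 2 * B * (1 + h y powr (- (1/4)))\<^sup>2" "(1 + h y powr (- (1/4))) ^ 3 \<le> 4 * Psi M y"
proof -
  \<comment> \<open>The square of \<open>w\<close> has order \<open>1/2\<close>, enough for \<kappa>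
    because \<open>p \<le> 1/2\<close>; its cube has order \<open>3/4\<close>, exactly the exponent
    in \<open>Psi\<close>.\<close>
  define w where "w = h y powr (- (1/4))"
  have w: "0 \<le> w" by (simp add: w_def)
  have w2: "w\<^sup>2 = h y powr (- (1/2))" "w ^ 3 = h y powr (- (3/4))"
    using h_pos[OF y] by (simp_all add: w_def powr_power)
  have "h y powr (- p) \<le> (1 + w)\<^sup>2"
  proof (cases "1 \<le> h y")
    case True
    then have "h y powr (- p) \<le> 1" using p powr_mono[of "- p" 0 "h y"] by simp
    also have "1 \<le> (1 + w)\<^sup>2" using w by simp
    finally show ?thesis .
  next
    case False
    then have "h y powr (- p) \<le> h y powr (- (1/2))" using p h_pos[OF y] by (intro powr_mono') auto
    also have "\<dots> \<le> (1 + w)\<^sup>2" unfolding w2[symmetric] using w by (intro power_mono) auto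
    finally show ?thesis .
  qed
  moreover have "1 \<le> (1 + w)\<^sup>2" using w by simp
  ultimately have "1 + h y powr (- p) \<le> 2 * (1 + w)\<^sup>2" by simp
  then have "B * (1 + h y powr (- p)) \<le> B * (2 * (1 + w)\<^sup>2)"
    using B_nonneg y by (intro mult_left_mono) auto
  then show "\<bar>\<kappa> y\<bar> \<le> 2 * B * (1 + h y powr (- (1/4)))\<^sup>2"
    using \<kappa>_abs[OF y] by (simp add: w_def)
  have "(1 + w) ^ 3 \<le> 4 * (w ^ 3 + 1)"
  proof -
    have "4 * (w ^ 3 + 1) - (1 + w) ^ 3 = 3 * (w + 1) * (w - 1)\<^sup>2" by (simp add: eval_nat_numeral algebra_simps)
    moreover have "0 \<le> 3 * (w + 1) * (w - 1)\<^sup>2" using w by simp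
    ultimately show ?thesis by linarith
  qed
  also have "\<dots> \<le> 4 * Psi M y" using one_le_1x[OF y, of M] by (simp add: Psi_def w2)
  finally show "(1 + h y powr (- (1/4))) ^ 3 \<le> 4 * Psi M y" by (simp add: w_def)
qed

text \<open>The aim is a sum of one function of the running point and one of the starting point,
  because both can be integrated over the step. The part uniform in \<open>y\<close> has order
  \<open>p + 2\<close> and goes into \<open>Theta\<close>. For the rest, the product of
  \<open>\<kappa> y\<close> with a singularity at \<open>x\<close> is decoupled; the cube of
  \<open>q2\<close> has order \<open>3 * p\<close>, at most \<open>3/2\<close>.\<close>

lemma Phi_gen_bound:
  assumes "I \<noteq> {}" "0 \<le> Sm"
  obtains C M where "0 \<le> C" "\<And>y u s x. y \<in> I \<Longrightarrow> u \<in> {0..T} \<Longrightarrow> 0 \<le> s \<Longrightarrow> s \<le> Sm \<Longrightarrow> x \<in> I \<Longrightarrow>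
    \<bar>gen s x (phi1 y u x + \<kappa> y * vx u x) (phi2 y u x + \<kappa> y * vxx u x)\<bar> \<le> C * (Theta M s x + Psi M y)"
proof -
  let ?P = "I \<times> {0..T}"
  have B: "0 \<le> B" by (rule B_nonneg[OF assms(1)])
  obtain K where K: "0 \<le> K" "\<And>s x a b. 0 \<le> s \<Longrightarrow> s \<le> Sm \<Longrightarrow> x \<in> I \<Longrightarrow>
    \<bar>gen s x a b\<bar> \<le> (K * ((1 + 1 / h x) * \<bar>a\<bar>) + \<bar>b\<bar>) / D s x"
    using gen_bound[OF assms] by metis
  have i: "orders P 1 (\<lambda>a x. 1 + 1 / h x)" for P :: "'p set" using orders_one_plus_inv_h[of P 1] by simp
  define q1 where "q1 a x = K * ((1 + 1 / h x) * \<bar>phi1 (fst a) (snd a) x\<bar>) + \<bar>phi2 (fst a) (snd a) x\<bar>" for a x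
  have "orders ?P (p + 2) q1"
    unfolding q1_def
    by (intro orders_add orders_cmult orders_abs phi_orders(2) orders_mult[OF i orders_abs[OF phi_orders(1)]]) simp
  then obtain C1 M1 where C1: "0 \<le> C1" "\<And>a x. a \<in> ?P \<Longrightarrow> x \<in> I \<Longrightarrow> \<bar>q1 a x\<bar> \<le> C1 * (h x powr (- 11/4) + (1 + x) ^ M1)"
    by (rule orders_trade) (use p in auto)
  define q2 where "q2 u x = K * ((1 + 1 / h x) * \<bar>vx u x\<bar>) + \<bar>vxx u x\<bar>" for u x
  have q2o: "orders {0..T} p q2"
    unfolding q2_def
    by (intro orders_add orders_cmult orders_abs vxx_orders orders_mult[OF i orders_abs[OF vx_orders]]) simp
  have "orders {0..T} (3 * p) (\<lambda>u x. q2 u x ^ 3)"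
    unfolding power3_eq_cube
    by (rule orders_mult[OF orders_mult[OF q2o q2o order_refl] q2o]) simp
  then obtain C2 M2 where C2: "0 \<le> C2" "\<And>u x. u \<in> {0..T} \<Longrightarrow> x \<in> I \<Longrightarrow> \<bar>q2 u x ^ 3\<bar> \<le> C2 * (h x powr (- 11/4) + (1 + x) ^ M2)"
    by (rule orders_trade) (use p in auto)
  define M where "M = max M1 M2"
  define C where "C = C1 + 2 * B * (4 + C2)"
  have C: "0 \<le> C" using B C1 C2 by (simp add: C_def)
  show thesis
  proof (rule that[OF C, of M])
    fix y u s x assume y: "y \<in> I" and u: "u \<in> {0..T}" and s: "0 \<le> s" "s \<le> Sm" and x: "x \<in> I"
    have hx: "0 < h x" using h_pos x by auto
    have D: "1 \<le> D s x" using D_ge x s by blast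
    have T1: "Theta M1 s x \<le> Theta M s x" "Theta M2 s x \<le> Theta M s x"
      by (auto intro!: Theta_mono x simp: M_def)
    have T0: "0 \<le> Theta M s x" "0 \<le> Psi M y" using Theta_ge[OF x s(1), of M] Psi_ge[OF y, of M] by auto
    have q2: "0 \<le> q2 u x" using K hx by (simp add: q2_def)
    define w where "w = 1 + h y powr (- (1/4))"
    have w: "0 \<le> w" by (simp add: w_def)
    have "\<bar>gen s x (phi1 y u x) (phi2 y u x)\<bar> \<le> q1 (y, u) x / D s x"
      using K(2)[OF s x] by (simp add: q1_def)
    also have "\<dots> \<le> C1 * (h x powr (- 11/4) + (1 + x) ^ M1) / D s x"
      using C1(2)[of "(y, u)" x] y u x D by (intro divide_right_mono) auto
    also have "\<dots> = C1 * ((h x powr (- 11/4) + (1 + x) ^ M1) / D s x)" by simp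
    also have "\<dots> \<le> C1 * Theta M s x"
      using theta_absorb[OF x s(1), of M1] T1 C1 by (intro mult_left_mono) auto
    finally have g1: "\<bar>gen s x (phi1 y u x) (phi2 y u x)\<bar> \<le> C1 * Theta M s x" .
    have "\<bar>\<kappa> y\<bar> * \<bar>gen s x (vx u x) (vxx u x)\<bar> \<le> (2 * B * w\<^sup>2) * (q2 u x / D s x)"
      using \<kappa>_quartic(1)[OF y] K(2)[OF s x, of "vx u x" "vxx u x"] B
      by (intro mult_mono) (auto simp: q2_def w_def)
    also have "\<dots> = 2 * B * ((w\<^sup>2 * q2 u x) / D s x)" by simp
    also have "\<dots> \<le> 2 * B * ((w ^ 3 + q2 u x ^ 3) / D s x)"
      using young_cube[OF w q2] B D by (intro mult_left_mono divide_right_mono) auto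
    also have "(w ^ 3 + q2 u x ^ 3) / D s x \<le> 4 * Psi M y + C2 * Theta M s x"
    proof -
      have "w ^ 3 / D s x \<le> w ^ 3" using D w by (simp add: divide_le_eq mult_le_cancel_left1)
      also have "\<dots> \<le> 4 * Psi M y" using \<kappa>_quartic(2)[OF y, of M] by (simp add: w_def)
      finally have a: "w ^ 3 / D s x \<le> 4 * Psi M y" .
      have "q2 u x ^ 3 / D s x \<le> C2 * (h x powr (- 11/4) + (1 + x) ^ M2) / D s x"
        using C2(2)[OF u x] D by (intro divide_right_mono) auto
      also have "\<dots> = C2 * ((h x powr (- 11/4) + (1 + x) ^ M2) / D s x)" by simp
      also have "\<dots> \<le> C2 * Theta M s x"
        using theta_absorb[OF x s(1), of M2] T1 C2 by (intro mult_left_mono) auto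
      finally show ?thesis using a by (simp add: add_divide_distrib)
    qed
    finally have g2: "\<bar>\<kappa> y\<bar> * \<bar>gen s x (vx u x) (vxx u x)\<bar> \<le> 2 * B * (4 * Psi M y + C2 * Theta M s x)"
      using B by (auto simp: mult_left_mono)
    have "\<bar>gen s x (phi1 y u x + \<kappa> y * vx u x) (phi2 y u x + \<kappa> y * vxx u x)\<bar> \<le>
        \<bar>gen s x (phi1 y u x) (phi2 y u x)\<bar> + \<bar>\<kappa> y\<bar> * \<bar>gen s x (vx u x) (vxx u x)\<bar>"
      unfolding gen_add gen_scale abs_mult[symmetric] by (rule abs_triangle_ineq)
    also have "\<dots> \<le> C1 * Theta M s x + 2 * B * (4 * Psi M y + C2 * Theta M s x)" using g1 g2 by linarith
    also have "\<dots> \<le> C1 * (Theta M s x + Psi M y) + 2 * B * ((4 + C2) * (Theta M s x + Psi M y))"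
      using T0 C1 C2 B by (intro add_mono mult_left_mono) (auto simp: algebra_simps)
    also have "\<dots> = C * (Theta M s x + Psi M y)" by (simp add: C_def algebra_simps)
    finally show "\<bar>gen s x (phi1 y u x + \<kappa> y * vx u x) (phi2 y u x + \<kappa> y * vxx u x)\<bar> \<le> C * (Theta M s x + Psi M y)" .
  qed
qed

lemma tempered_at:
  assumes "orders {0..T} q f" "u \<in> {0..T}" "continuous_on I (f u)"
  shows "tempered S (\<lambda>s x. f u x)"
proof (rule orders_tempered[OF assms(1)])
  have "continuous_on ({0..S} \<times> I) (\<lambda>w. f u (snd w))"
    by (rule continuous_on_compose2[OF assms(3)]) (auto intro!: continuous_intros)
  then show "continuous_on ({0..S} \<times> I) (\<lambda>(s, x). f u x)" by (simp add: case_prod_beta')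
qed (rule assms(2))

lemma tempered_coefficient:
  assumes "orders (UNIV :: unit set) q (\<lambda>_. f)" "continuous_on I f"
  shows "tempered S (\<lambda>s x. f x)"
  using tempered_at[of q "\<lambda>_. f" 0] orders_from_unit[OF assms(1), of "{0..T}"] assms(2) T_pos by simp

lemma tempered_Phi:
  assumes u: "u \<in> {0..T}"
  shows "tempered S (\<lambda>s x. Phi y u x)" "tempered S (\<lambda>s x. phi1 y u x + \<kappa> y * vx u x)"
    "tempered S (\<lambda>s x. phi2 y u x + \<kappa> y * vxx u x)"
proof -
  note c = cont_imp[OF d\<rho>] cont_imp[OF d\<rho>1] cont_\<rho>2
  have t\<rho>: "tempered S (\<lambda>s x. \<rho> x)" "tempered S (\<lambda>s x. \<rho>1 x)" "tempered S (\<lambda>s x. \<rho>2 x)"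
    by (rule tempered_space[where C = B and k = 0]; use c \<rho>_bounds in simp)+
  have t\<kappa>: "tempered S (\<lambda>s x. \<kappa> x)" "tempered S (\<lambda>s x. \<kappa>1 x)" "tempered S (\<lambda>s x. \<kappa>2 x)"
    using tempered_coefficient[OF \<kappa>_orders cont_imp[OF d\<kappa>]]
      tempered_coefficient[OF \<kappa>1_orders cont_imp[OF d\<kappa>1]] tempered_coefficient[OF \<kappa>2_orders cont_\<kappa>2] by blast+
  have cvxx: "continuous_on I (vxx u)"
  proof -
    have "continuous_on I (\<lambda>x. (\<lambda>(t, x). vxx t x) (u, x))"
      by (rule continuous_on_compose2[OF cont_vxx]) (use u in \<open>auto intro!: continuous_intros\<close>)
    then show ?thesis by simp
  qed
  note tv = tempered_at[OF v_orders u cont_imp[OF dvx[OF u]], of S]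
    tempered_at[OF vx_orders u cont_imp[OF dvxx[OF u]], of S] tempered_at[OF vxx_orders u cvxx, of S]
    tempered_at[OF vt_orders u cont_imp[OF dvtx[OF u]], of S]
    tempered_at[OF vtx_orders u cont_imp[OF dvtxx[OF u]], of S] tempered_at[OF vtxx_orders u cont_vtxx[OF u], of S]
  show "tempered S (\<lambda>s x. Phi y u x)"
    unfolding Phi_def by (intro tempered_add tempered_diff tempered_mult tempered_const t\<rho> t\<kappa> tv)
  show "tempered S (\<lambda>s x. phi1 y u x + \<kappa> y * vx u x)"
    unfolding phi1_def by (intro tempered_add tempered_diff tempered_mult tempered_const t\<rho> t\<kappa> tv)
  show "tempered S (\<lambda>s x. phi2 y u x + \<kappa> y * vxx u x)"
    unfolding phi2_def by (intro tempered_add tempered_diff tempered_mult tempered_const t\<rho> t\<kappa> tv)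
qed

text \<open>In the variable \<open>s = \<theta>^2\<close> this is the expected time integral of
  \<open>Theta\<close> over a step of length \<open>a^2\<close>, the quantity that
  \<open>lyapunov\<close> bounds by the decrease of \<open>Psi\<close>.\<close>

definition dissipation :: "nat \<Rightarrow> real \<Rightarrow> real \<Rightarrow> real" where
  "dissipation M y a = integral {0..a} (\<lambda>\<theta>. 2 * \<theta> * expect (Theta M) y \<theta>)"

lemma expect_Theta_ge:
  assumes "y \<in> I" "0 \<le> \<theta>"
  shows "1 \<le> expect (Theta M) y \<theta>"
  using expect_mono[OF assms(1) tempered_const tempered_Theta, of \<theta> \<theta> 1 M] assms Theta_ge
  by (simp add: gauss.prob_space[simplified])

lemma cont_expect_Theta: "y \<in> I \<Longrightarrow> 0 \<le> a \<Longrightarrow> continuous_on {0..a} (expect (Theta M) y)"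
  by (rule expect_continuous[OF _ tempered_Theta])

lemma dissipation_mono:
  assumes y: "y \<in> I" and a: "0 \<le> a" "a \<le> b"
  shows "dissipation M y a \<le> dissipation M y b"
  unfolding dissipation_def
proof (rule integral_subset_le)
  show "(\<lambda>\<theta>. 2 * \<theta> * expect (Theta M) y \<theta>) integrable_on {0..a}"
    "(\<lambda>\<theta>. 2 * \<theta> * expect (Theta M) y \<theta>) integrable_on {0..b}"
    using a by (intro integrable_continuous_real continuous_intros cont_expect_Theta y; simp)+
  show "\<forall>\<theta>\<in>{0..b}. 0 \<le> 2 * \<theta> * expect (Theta M) y \<theta>"
  proof
    show "0 \<le> 2 * \<theta> * expect (Theta M) y \<theta>" if "\<theta> \<in> {0..b}" for \<theta>
      using expect_Theta_ge[OF y, of \<theta> M] that by simp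
  qed
qed (use a in auto)

lemma dissipation_nonneg: "y \<in> I \<Longrightarrow> 0 \<le> a \<Longrightarrow> 0 \<le> dissipation M y a"
  using dissipation_mono[of y 0 a M] by (simp add: dissipation_def)

lemma dissipation_mono_exponent:
  assumes "y \<in> I" "0 \<le> a" "M \<le> M'"
  shows "dissipation M y a \<le> dissipation M' y a"
  unfolding dissipation_def
proof (rule weighted_integral_mono)
  show "expect (Theta M) y \<theta> \<le> expect (Theta M') y \<theta>" if "\<theta> \<in> {0..a}" for \<theta>
    by (rule expect_mono[OF assms(1) tempered_Theta tempered_Theta that]) (auto intro!: Theta_mono assms)
qed (use assms in \<open>auto intro!: cont_expect_Theta\<close>)

text \<open>Dynkin's formula is applied with \<open>u\<close> fixed while the state moves. Hence no
  second time derivative of \<open>v\<close> appears, only space derivatives of \<open>v\<close> and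
  \<open>vt\<close> up to order two.\<close>

lemma Phi_expectation:
  assumes "I \<noteq> {}" "0 \<le> Sm"
  obtains C M where "0 \<le> C" "\<And>y u \<theta>. y \<in> I \<Longrightarrow> u \<in> {0..T} \<Longrightarrow> 0 \<le> \<theta> \<Longrightarrow> \<theta>\<^sup>2 \<le> Sm \<Longrightarrow>
    \<bar>expect (\<lambda>s. Phi y u) y \<theta>\<bar> \<le> C * (dissipation M y \<theta> + \<theta>\<^sup>2 * Psi M y)"
proof -
  obtain C M where C: "0 \<le> C" "\<And>y u s x. y \<in> I \<Longrightarrow> u \<in> {0..T} \<Longrightarrow> 0 \<le> s \<Longrightarrow> s \<le> Sm \<Longrightarrow> x \<in> I \<Longrightarrow>
    \<bar>gen s x (phi1 y u x + \<kappa> y * vx u x) (phi2 y u x + \<kappa> y * vxx u x)\<bar> \<le> C * (Theta M s x + Psi M y)"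
    using Phi_gen_bound[OF assms] by metis
  show thesis
  proof (rule that[OF C(1), of M])
    fix y u \<theta> assume y: "y \<in> I" and u: "u \<in> {0..T}" and \<theta>: "0 \<le> \<theta>" "\<theta>\<^sup>2 \<le> Sm"
    have Phi0: "Phi y u y = 0" by (simp add: Phi_def)
    show "\<bar>expect (\<lambda>s. Phi y u) y \<theta>\<bar> \<le> C * (dissipation M y \<theta> + \<theta>\<^sup>2 * Psi M y)"
    proof (cases "\<theta> = 0")
      case True
      then show ?thesis using Phi0 by (simp add: Y_0[OF y] dissipation_def)
    next
      case False
      then have pos: "0 < \<theta>" using \<theta> by simp
      let ?G = "\<lambda>s x. gen s x (phi1 y u x + \<kappa> y * vx u x) (phi2 y u x + \<kappa> y * vxx u x)"
      have "expect (\<lambda>s. Phi y u) y \<theta> - Phi y u y = integral {0..\<theta>} (\<lambda>\<omega>. 2 * \<omega> * (\<integral>\<xi>. 0 + ?G (\<omega>\<^sup>2) (Y y \<omega> \<xi>) \<partial>gauss))"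
        by (rule Y_dynkin[OF y pos refl, of "\<lambda>s. Phi y u" "\<lambda>s x. 0" "\<lambda>s x. phi1 y u x + \<kappa> y * vx u x"
              "\<lambda>s x. phi2 y u x + \<kappa> y * vxx u x"])
           (auto intro!: derivative_eq_intros d_Phi[OF u] d_Phi1[OF u] tempered_Phi[OF u] tempered_const)
      then have eq: "expect (\<lambda>s. Phi y u) y \<theta> = integral {0..\<theta>} (\<lambda>\<omega>. 2 * \<omega> * expect ?G y \<omega>)"
        by (simp add: Phi0)
      have temp_G: "tempered S ?G" for S by (intro tempered_gen tempered_Phi[OF u])
      have temp_R: "tempered S (\<lambda>s x. C * (Theta M s x + Psi M y))" for S
        by (intro tempered_cmult tempered_add tempered_Theta tempered_const)
      have "norm (integral {0..\<theta>} (\<lambda>\<omega>. 2 * \<omega> * expect ?G y \<omega>)) \<le>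
          integral {0..\<theta>} (\<lambda>\<omega>. 2 * \<omega> * expect (\<lambda>s x. C * (Theta M s x + Psi M y)) y \<omega>)"
      proof (rule integral_norm_bound_integral)
        show "(\<lambda>\<omega>. 2 * \<omega> * expect ?G y \<omega>) integrable_on {0..\<theta>}"
          using \<theta> by (intro integrable_continuous_real continuous_intros expect_continuous[OF y temp_G])
        show "(\<lambda>\<omega>. 2 * \<omega> * expect (\<lambda>s x. C * (Theta M s x + Psi M y)) y \<omega>) integrable_on {0..\<theta>}"
          by (intro integrable_continuous_real continuous_intros expect_continuous[OF y temp_R] \<theta>)
        fix \<omega> assume \<omega>: "\<omega> \<in> {0..\<theta>}"
        have "\<bar>expect ?G y \<omega>\<bar> \<le> expect (\<lambda>s x. C * (Theta M s x + Psi M y)) y \<omega>"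
          by (rule expect_abs_le[OF y temp_G temp_R \<omega>]) (use \<theta> C(2)[OF y u] in auto)
        then have "2 * \<omega> * \<bar>expect ?G y \<omega>\<bar> \<le> 2 * \<omega> * expect (\<lambda>s x. C * (Theta M s x + Psi M y)) y \<omega>"
          using \<omega> by (intro mult_left_mono) auto
        then show "norm (2 * \<omega> * expect ?G y \<omega>) \<le> 2 * \<omega> * expect (\<lambda>s x. C * (Theta M s x + Psi M y)) y \<omega>"
          using \<omega> by (simp add: abs_mult)
      qed
      also have "\<dots> = integral {0..\<theta>} (\<lambda>\<omega>. C * (2 * \<omega> * expect (Theta M) y \<omega>) + 2 * \<omega> * (C * Psi M y))"
      proof (rule integral_cong)
        fix \<omega> assume \<omega>: "\<omega> \<in> {0..\<theta>}"
        show "2 * \<omega> * expect (\<lambda>s x. C * (Theta M s x + Psi M y)) y \<omega> =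
            C * (2 * \<omega> * expect (Theta M) y \<omega>) + 2 * \<omega> * (C * Psi M y)"
          using expect_integrable[OF y tempered_Theta \<omega>, of M]
          by (simp add: gauss.prob_space[simplified] algebra_simps)
      qed
      also have "\<dots> = C * dissipation M y \<theta> + \<theta>\<^sup>2 * (C * Psi M y)"
      proof -
        have 1: "(\<lambda>\<omega>. C * (2 * \<omega> * expect (Theta M) y \<omega>)) integrable_on {0..\<theta>}"
          using \<theta> by (intro integrable_continuous_real continuous_intros cont_expect_Theta y)
        have 2: "(\<lambda>\<omega>. 2 * \<omega> * (C * Psi M y)) integrable_on {0..\<theta>}"
          by (intro integrable_continuous_real continuous_intros)
        have "integral {0..\<theta>} (\<lambda>\<omega>. C * (2 * \<omega> * expect (Theta M) y \<omega>)) = C * dissipation M y \<theta>"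
          unfolding dissipation_def by (rule integral_mult_right)
        then show ?thesis
          by (simp only: Henstock_Kurzweil_Integration.integral_add[OF 1 2] weighted_integral_const[OF \<theta>(1)])
      qed
      finally show ?thesis unfolding eq by (simp add: algebra_simps)
    qed
  qed
qed

text \<open>Dynkin's formula for \<open>exp (s * \<kappa> y) * v (t + s * \<rho> y) x\<close>, with
  the coefficients frozen at \<open>y\<close>. The equation for \<open>v\<close> cancels the leading
  part of the integrand and leaves \<open>Phi\<close> and the deviation of \<open>gen\<close>. The
  mean of \<open>Phi\<close> is at most an integral over the step, and the deviation has a factor
  \<open>s\<close>, so the outer integration adds one factor \<open>\<theta>1^2\<close> to the time
  integral of \<open>Theta\<close>.\<close>

lemma one_step_local_error:
  assumes "I \<noteq> {}"
  obtains C M where "0 \<le> C" "\<And>y t \<Delta> \<theta>1. y \<in> I \<Longrightarrow> 0 \<le> t \<Longrightarrow> 0 < \<Delta> \<Longrightarrow> t + \<Delta> \<le> T \<Longrightarrow> \<theta>1 = \<sigma> y * sqrt \<Delta> \<Longrightarrow>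
    \<bar>exp (\<theta>1\<^sup>2 * \<kappa> y) * expect (\<lambda>s. v (t + \<Delta>)) y \<theta>1 - v t y\<bar> \<le>
      C * \<theta>1\<^sup>2 * (dissipation M y \<theta>1 + \<theta>1\<^sup>2 * Psi M y)"
proof -
  define Sm where "Sm = B * T"
  have B: "0 \<le> B" by (rule B_nonneg[OF assms])
  have Sm: "0 \<le> Sm" using B T_pos by (simp add: Sm_def)
  obtain C1 M1 where C1: "0 \<le> C1" "\<And>y u \<theta>. y \<in> I \<Longrightarrow> u \<in> {0..T} \<Longrightarrow> 0 \<le> \<theta> \<Longrightarrow> \<theta>\<^sup>2 \<le> Sm \<Longrightarrow>
    \<bar>expect (\<lambda>s. Phi y u) y \<theta>\<bar> \<le> C1 * (dissipation M1 y \<theta> + \<theta>\<^sup>2 * Psi M1 y)"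
    using Phi_expectation[OF assms Sm] by metis
  obtain C2 M2 where C2: "0 \<le> C2" "\<And>u s x. u \<in> {0..T} \<Longrightarrow> 0 \<le> s \<Longrightarrow> x \<in> I \<Longrightarrow>
    \<bar>gen s x (vx u x) (vxx u x) - (L x * vx u x + vxx u x / 2)\<bar> \<le> s * C2 * Theta M2 s x"
    using deviation_bound by metis
  define M where "M = max M1 M2"
  define EB where "EB = exp (Sm * B)"
  have EB: "0 < EB" by (simp add: EB_def)
  show thesis
  proof (rule that[of "EB * (C1 + C2)" M])
    show "0 \<le> EB * (C1 + C2)" using EB C1 C2 by simp
    fix y t \<Delta> \<theta>1 :: real
    assume y: "y \<in> I" and t: "0 \<le> t" "0 < \<Delta>" "t + \<Delta> \<le> T" and \<theta>1_eq: "\<theta>1 = \<sigma> y * sqrt \<Delta>"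
    define S where "S = \<theta>1\<^sup>2"
    have \<sigma>y: "0 < \<sigma> y" using \<sigma>_pos y by auto
    have \<theta>1: "0 < \<theta>1" using \<sigma>y t by (simp add: \<theta>1_eq)
    have S_eq: "S = (\<sigma> y)\<^sup>2 * \<Delta>" using t by (simp add: S_def \<theta>1_eq power_mult_distrib)
    have S: "0 \<le> S" "S \<le> Sm"
      unfolding Sm_def S_eq using \<sigma>_bound[OF y] t B by (auto intro!: mult_mono)
    have \<rho>y: "\<rho> y = 1 / (\<sigma> y)\<^sup>2" "0 < \<rho> y" using \<rho>_eq[OF y] \<sigma>y by auto
    have S\<rho>: "S * \<rho> y = \<Delta>" using \<sigma>y by (simp add: S_eq \<rho>y)
    \<comment> \<open>\<open>i\<close> converts the time scale of \<open>J\<close> into the time of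
      the scheme: as \<open>s\<close> runs up to \<open>S\<close>, \<open>i\<close> runs from
      \<open>t\<close> to \<open>t + \<Delta>\<close>.\<close>
    define i where "i s = t + s * \<rho> y" for s
    have i: "i s \<in> {0..T}" if "s \<in> {0..S}" for s
    proof -
      have "s * \<rho> y \<le> S * \<rho> y" using that \<rho>y by (intro mult_right_mono) auto
      then have "s * \<rho> y \<le> \<Delta>" unfolding S\<rho> .
      moreover have "0 \<le> s * \<rho> y" using that \<rho>y(2) by simp
      ultimately show ?thesis using t by (simp add: i_def)
    qed
    have i0: "i 0 = t" "i S = t + \<Delta>" by (auto simp: i_def S\<rho>)
    define ex where "ex s = exp (s * \<kappa> y)" for s
    have ex: "0 < ex s" "ex s \<le> EB" if "s \<in> {0..S}" for s
    proof -
      have "s * \<kappa> y \<le> s * B" using that \<kappa>_upper[OF y] by (intro mult_left_mono) auto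
      also have "\<dots> \<le> Sm * B" using that S B by (intro mult_right_mono) auto
      finally show "ex s \<le> EB" by (simp add: ex_def EB_def)
    qed (simp add: ex_def)
    have temp_ex: "tempered S (\<lambda>s x. ex s)"
      unfolding ex_def by (intro tempered_time continuous_intros)
    have temp_i: "tempered S (\<lambda>s x. f (i s) x)"
      if "orders {0..T} q f" "continuous_on ({0..T} \<times> I) (\<lambda>(t, x). f t x)" for f q
    proof (rule orders_tempered[OF that(1) _ i])
      have "continuous_on ({0..S} \<times> I) (\<lambda>w. (\<lambda>(t, x). f t x) (i (fst w), snd w))"
        by (rule continuous_on_compose2[OF that(2)]) (use i in \<open>auto intro!: continuous_intros simp: i_def\<close>)
      then show "continuous_on ({0..S} \<times> I) (\<lambda>(s, x). f (i s) x)" by (simp add: case_prod_beta')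
    qed
    note temps = temp_i[OF v_orders cont_v] temp_i[OF vt_orders cont_vt]
      temp_i[OF vx_orders cont_vx] temp_i[OF vxx_orders cont_vxx]
    define G where "G s x = ex s * (\<kappa> y * v (i s) x + vt (i s) x * \<rho> y) + gen s x (ex s * vx (i s) x) (ex s * vxx (i s) x)" for s x
    have temp_G: "tempered S G" unfolding G_def
      by (intro tempered_add tempered_mult tempered_gen tempered_const temp_ex temps)
    have dy: "expect (\<lambda>s x. ex S * v (i S) x) y \<theta>1 - ex 0 * v (i 0) y =
       integral {0..\<theta>1} (\<lambda>\<theta>. 2 * \<theta> * expect G y \<theta>)"
      unfolding G_def
    proof (rule Y_dynkin[OF y \<theta>1 S_def, of "\<lambda>s x. ex s * v (i s) x" "\<lambda>s x. ex s * (\<kappa> y * v (i s) x + vt (i s) x * \<rho> y)"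
          "\<lambda>s x. ex s * vx (i s) x" "\<lambda>s x. ex s * vxx (i s) x"])
      fix s x assume s: "s \<in> {0..S}" and x: "x \<in> I"
      show "((\<lambda>x. ex s * v (i s) x) has_real_derivative ex s * vx (i s) x) (at x)"
        by (rule DERIV_cmult[OF dvx[OF i[OF s] x]])
      show "((\<lambda>x. ex s * vx (i s) x) has_real_derivative ex s * vxx (i s) x) (at x)"
        by (rule DERIV_cmult[OF dvxx[OF i[OF s] x]])
      have "((\<lambda>t. v t x) has_real_derivative vt (i s) x) (at (i s) within i ` {0..S})"
        by (rule DERIV_subset[OF dv[OF i[OF s] x]]) (use i in auto)
      moreover have "(i has_real_derivative \<rho> y) (at s within {0..S})"
        unfolding i_def by (auto intro!: derivative_eq_intros)
      ultimately have d1: "((\<lambda>s. v (i s) x) has_real_derivative vt (i s) x * \<rho> y) (at s within {0..S})"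
        using DERIV_image_chain[of "\<lambda>t. v t x" _ i s "{0..S}"] by (simp add: comp_def)
      have d2: "(ex has_real_derivative ex s * \<kappa> y) (at s within {0..S})"
        unfolding ex_def by (auto intro!: derivative_eq_intros)
      show "((\<lambda>s. ex s * v (i s) x) has_real_derivative ex s * (\<kappa> y * v (i s) x + vt (i s) x * \<rho> y)) (at s within {0..S})"
        by (rule DERIV_cong[OF DERIV_mult[OF d2 d1]]) (simp add: algebra_simps)
    qed (intro tempered_add tempered_mult tempered_const temp_ex temps)+
    define dev where "dev s x = gen s x (vx (i s) x) (vxx (i s) x) - (L x * vx (i s) x + vxx (i s) x / 2)" for s x
    have temp_dev: "tempered S dev" unfolding dev_def
    proof (intro tempered_diff tempered_gen temps)
      show "tempered S (\<lambda>s x. L x * vx (i s) x + vxx (i s) x / 2)"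
        using tempered_add[OF tempered_mult[OF tempered_L temps(3)] tempered_cmult[OF temps(4), of "1/2"]] by simp
    qed
    have temp_dev_bound: "tempered S (\<lambda>s x. S * C2 * Theta M s x)"
      by (intro tempered_cmult tempered_Theta)
    \<comment> \<open>The equation at the running point \<open>x\<close> is subtracted. What remains
      is the difference of the coefficients between \<open>y\<close> and \<open>x\<close>, which is
      \<open>Phi\<close>, and the difference between the two generators, which is
      \<open>dev\<close>.\<close>
    have G_eq: "G s x = ex s * (Phi y (i s) x + dev s x)" if "s \<in> {0..S}" "x \<in> I" for s x
    proof -
      have "G s x = ex s * ((\<kappa> y * v (i s) x + vt (i s) x * \<rho> y) + (L x * vx (i s) x + vxx (i s) x / 2) + dev s x)"
        unfolding G_def gen_scale dev_def by (simp add: algebra_simps)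
      also have "\<dots> = ex s * (Phi y (i s) x + dev s x)"
        unfolding pde[OF i[OF that(1)] that(2)] Phi_def by (simp add: algebra_simps)
      finally show ?thesis .
    qed
    have expG: "\<bar>expect G y \<theta>\<bar> \<le> EB * (C1 * (dissipation M y \<theta>1 + S * Psi M y)) + EB * (S * C2) * expect (Theta M) y \<theta>"
      if \<theta>: "\<theta> \<in> {0..\<theta>1}" for \<theta>
    proof -
      have s: "\<theta>\<^sup>2 \<in> {0..S}" using sq_in[OF \<theta>] by (simp add: S_def)
      have \<theta>S: "\<theta>\<^sup>2 \<le> S" "0 \<le> \<theta>" using s \<theta> by auto
      have u: "i (\<theta>\<^sup>2) \<in> {0..T}" by (rule i[OF s])
      have xin: "Y y \<theta> \<xi> \<in> I" for \<xi> using Y_in[OF y] \<theta> by auto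
      have int1: "integrable gauss (\<lambda>\<xi>. Phi y (i (\<theta>\<^sup>2)) (Y y \<theta> \<xi>))"
        by (rule expect_integrable[OF y tempered_Phi(1)[OF u] \<theta>])
      have int2: "integrable gauss (\<lambda>\<xi>. dev (\<theta>\<^sup>2) (Y y \<theta> \<xi>))"
        by (rule expect_integrable[OF y temp_dev[unfolded S_def] \<theta>])
      have "expect G y \<theta> = (\<integral>\<xi>. ex (\<theta>\<^sup>2) * (Phi y (i (\<theta>\<^sup>2)) (Y y \<theta> \<xi>) + dev (\<theta>\<^sup>2) (Y y \<theta> \<xi>)) \<partial>gauss)"
        by (rule Bochner_Integration.integral_cong) (use G_eq[OF s xin] in auto)
      also have "\<dots> = ex (\<theta>\<^sup>2) * (expect (\<lambda>s. Phi y (i (\<theta>\<^sup>2))) y \<theta> + expect dev y \<theta>)"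
        using int1 int2 by simp
      finally have "\<bar>expect G y \<theta>\<bar> = ex (\<theta>\<^sup>2) * \<bar>expect (\<lambda>s. Phi y (i (\<theta>\<^sup>2))) y \<theta> + expect dev y \<theta>\<bar>"
        using ex(1)[OF s] by (simp add: abs_mult)
      also have "\<dots> \<le> EB * (C1 * (dissipation M y \<theta>1 + S * Psi M y) + S * C2 * expect (Theta M) y \<theta>)"
      proof (rule mult_mono)
        have "\<bar>expect (\<lambda>s. Phi y (i (\<theta>\<^sup>2))) y \<theta>\<bar> \<le> C1 * (dissipation M1 y \<theta> + \<theta>\<^sup>2 * Psi M1 y)"
          using \<theta>S S by (intro C1(2)[OF y u]) auto
        \<comment> \<open>Enlarging the inner integral to the whole step removes the dependence on
          \<theta>, so integration over the step just multiplies the bound by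
          \<open>S\<close>.\<close>
        also have "\<dots> \<le> C1 * (dissipation M y \<theta>1 + S * Psi M y)"
        proof (intro mult_left_mono add_mono mult_mono C1(1))
          have "dissipation M1 y \<theta> \<le> dissipation M1 y \<theta>1" using \<theta> by (intro dissipation_mono[OF y]) auto
          also have "\<dots> \<le> dissipation M y \<theta>1"
            using \<theta>1 by (intro dissipation_mono_exponent y) (auto simp: M_def)
          finally show "dissipation M1 y \<theta> \<le> dissipation M y \<theta>1" .
          show "Psi M1 y \<le> Psi M y" by (rule Psi_mono[OF y]) (simp add: M_def)
          show "0 \<le> Psi M1 y" using Psi_ge[OF y, of M1] by simp
        qed (use \<theta>S S in auto)
        finally have a: "\<bar>expect (\<lambda>s. Phi y (i (\<theta>\<^sup>2))) y \<theta>\<bar> \<le> C1 * (dissipation M y \<theta>1 + S * Psi M y)" .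
        have "\<bar>expect dev y \<theta>\<bar> \<le> expect (\<lambda>s x. S * C2 * Theta M s x) y \<theta>"
        proof (rule expect_abs_le[OF y temp_dev[unfolded S_def] temp_dev_bound[unfolded S_def] \<theta>, folded S_def])
          fix s x assume sx: "s \<in> {0..S}" "x \<in> I"
          have "\<bar>dev s x\<bar> \<le> s * C2 * Theta M2 s x"
            unfolding dev_def using sx i by (intro C2(2)) auto
          also have "\<dots> \<le> S * C2 * Theta M s x"
            using sx C2(1) S Theta_ge[of x s M2] by (intro mult_mono Theta_mono) (auto simp: M_def)
          finally show "\<bar>dev s x\<bar> \<le> S * C2 * Theta M s x" .
        qed
        also have "\<dots> = S * C2 * expect (Theta M) y \<theta>" by simp
        finally show "\<bar>expect (\<lambda>s. Phi y (i (\<theta>\<^sup>2))) y \<theta> + expect dev y \<theta>\<bar> \<le>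
            C1 * (dissipation M y \<theta>1 + S * Psi M y) + S * C2 * expect (Theta M) y \<theta>"
          using a abs_triangle_ineq[of "expect (\<lambda>s. Phi y (i (\<theta>\<^sup>2))) y \<theta>" "expect dev y \<theta>"] by linarith
      qed (use ex[OF s] EB in auto)
      finally show ?thesis by (simp add: algebra_simps)
    qed
    let ?K = "EB * (C1 * (dissipation M y \<theta>1 + S * Psi M y))"
    have "norm (integral {0..\<theta>1} (\<lambda>\<theta>. 2 * \<theta> * expect G y \<theta>)) \<le>
        integral {0..\<theta>1} (\<lambda>\<theta>. 2 * \<theta> * ?K + EB * (S * C2) * (2 * \<theta> * expect (Theta M) y \<theta>))"
    proof (rule integral_norm_bound_integral)
      show "(\<lambda>\<theta>. 2 * \<theta> * expect G y \<theta>) integrable_on {0..\<theta>1}"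
        using \<theta>1 temp_G unfolding S_def
        by (intro integrable_continuous_real continuous_intros expect_continuous[OF y]) auto
      show "(\<lambda>\<theta>. 2 * \<theta> * ?K + EB * (S * C2) * (2 * \<theta> * expect (Theta M) y \<theta>)) integrable_on {0..\<theta>1}"
        using \<theta>1 by (intro integrable_continuous_real continuous_intros cont_expect_Theta[OF y]) auto
      fix \<theta> assume \<theta>: "\<theta> \<in> {0..\<theta>1}"
      have "2 * \<theta> * \<bar>expect G y \<theta>\<bar> \<le> 2 * \<theta> * (?K + EB * (S * C2) * expect (Theta M) y \<theta>)"
        using expG[OF \<theta>] \<theta> by (intro mult_left_mono) auto
      then show "norm (2 * \<theta> * expect G y \<theta>) \<le> 2 * \<theta> * ?K + EB * (S * C2) * (2 * \<theta> * expect (Theta M) y \<theta>)"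
        using \<theta> by (simp add: abs_mult algebra_simps)
    qed
    also have "\<dots> = \<theta>1\<^sup>2 * ?K + EB * (S * C2) * dissipation M y \<theta>1"
    proof -
      have 1: "(\<lambda>\<theta>. 2 * \<theta> * ?K) integrable_on {0..\<theta>1}"
        by (intro integrable_continuous_real continuous_intros)
      have 2: "(\<lambda>\<theta>. EB * (S * C2) * (2 * \<theta> * expect (Theta M) y \<theta>)) integrable_on {0..\<theta>1}"
        using \<theta>1 by (intro integrable_continuous_real continuous_intros cont_expect_Theta[OF y]) auto
      have "integral {0..\<theta>1} (\<lambda>\<theta>. EB * (S * C2) * (2 * \<theta> * expect (Theta M) y \<theta>)) = EB * (S * C2) * dissipation M y \<theta>1"
        unfolding dissipation_def by (rule integral_mult_right)
      then show ?thesis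
        by (simp only: Henstock_Kurzweil_Integration.integral_add[OF 1 2] weighted_integral_const[OF less_imp_le[OF \<theta>1]])
    qed
    also have "\<dots> \<le> EB * (C1 + C2) * S * (dissipation M y \<theta>1 + S * Psi M y)"
    proof -
      have "0 \<le> EB * C2 * S * (S * Psi M y)" using EB C2 S Psi_ge[OF y, of M] by simp
      then show ?thesis by (simp add: S_def[symmetric] algebra_simps)
    qed
    finally have "\<bar>expect (\<lambda>s x. ex S * v (i S) x) y \<theta>1 - ex 0 * v (i 0) y\<bar> \<le>
        EB * (C1 + C2) * S * (dissipation M y \<theta>1 + S * Psi M y)"
      unfolding dy by simp
    then show "\<bar>exp (\<theta>1\<^sup>2 * \<kappa> y) * expect (\<lambda>s. v (t + \<Delta>)) y \<theta>1 - v t y\<bar> \<le>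
      EB * (C1 + C2) * \<theta>1\<^sup>2 * (dissipation M y \<theta>1 + \<theta>1\<^sup>2 * Psi M y)"
      by (simp add: i0 ex_def S_def[symmetric])
  qed
qed

end

section \<open>Convergence of the scheme\<close>

context bem_coefficients
begin

text \<open>The dissipation in the local error is replaced by the decrease of \<open>Psi\<close>
  from \<open>lyapunov\<close>, with one factor \<Delta> kept in front. In this form the errors of
  successive steps can be summed without a bound for the singularity at any single time. The
  exponent \<open>M\<close> is large enough for the local error and for the growth of
  \<open>v\<close>.\<close>

lemma one_step:
  assumes "I \<noteq> {}"
  obtains C M where "0 \<le> C"
    "\<And>t x. t \<in> {0..T} \<Longrightarrow> x \<in> I \<Longrightarrow> \<bar>v t x\<bar> \<le> C * Psi M x"
    "\<And>y \<Delta>. y \<in> I \<Longrightarrow> 0 < \<Delta> \<Longrightarrow> \<Delta> \<le> T \<Longrightarrow>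
      expect (\<lambda>s. Psi M) y (\<sigma> y * sqrt \<Delta>) \<le> exp (C * \<Delta>) * Psi M y"
    "\<And>y t \<Delta>. y \<in> I \<Longrightarrow> 0 \<le> t \<Longrightarrow> 0 < \<Delta> \<Longrightarrow> t + \<Delta> \<le> T \<Longrightarrow>
      \<bar>exp (\<Delta> * ((\<sigma> y)\<^sup>2 * \<kappa> y)) * expect (\<lambda>s. v (t + \<Delta>)) y (\<sigma> y * sqrt \<Delta>) - v t y\<bar> \<le>
        C * \<Delta> * (exp (C * \<Delta>) * Psi M y - expect (\<lambda>s. Psi M) y (\<sigma> y * sqrt \<Delta>))"
proof -
  have B: "0 \<le> B" by (rule B_nonneg[OF assms])
  obtain C1 M1 where C1: "0 \<le> C1"
    "\<And>y t \<Delta> \<theta>1. y \<in> I \<Longrightarrow> 0 \<le> t \<Longrightarrow> 0 < \<Delta> \<Longrightarrow> t + \<Delta> \<le> T \<Longrightarrow> \<theta>1 = \<sigma> y * sqrt \<Delta> \<Longrightarrow>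
    \<bar>exp (\<theta>1\<^sup>2 * \<kappa> y) * expect (\<lambda>s. v (t + \<Delta>)) y \<theta>1 - v t y\<bar> \<le>
      C1 * \<theta>1\<^sup>2 * (dissipation M1 y \<theta>1 + \<theta>1\<^sup>2 * Psi M1 y)"
    using one_step_local_error[OF assms] by metis
  obtain C2 M2 where C2: "0 \<le> C2" "\<And>t x. t \<in> {0..T} \<Longrightarrow> x \<in> I \<Longrightarrow> \<bar>v t x\<bar> \<le> C2 * (1 + x) ^ M2 * h x powr (- 0)"
    using ordersE[OF v_orders] by metis
  define M where "M = max M1 M2"
  obtain c \<Lambda> where c: "0 < c" "0 \<le> \<Lambda>" "\<And>y \<theta>1. y \<in> I \<Longrightarrow> 0 < \<theta>1 \<Longrightarrow> \<theta>1\<^sup>2 \<le> B * T \<Longrightarrow>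
    c * dissipation M y \<theta>1 \<le> exp (\<Lambda> * \<theta>1\<^sup>2) * Psi M y - expect (\<lambda>s. Psi M) y \<theta>1"
  proof -
    have "0 \<le> B * T" using B T_pos by simp
    from lyapunov[OF assms this, of M] that show ?thesis unfolding dissipation_def by blast
  qed
  define K where "K = C1 * (1 / c + 1)"
  define C where "C = K * B + (\<Lambda> + 1) * B + C2"
  have K: "0 \<le> K" using C1 c by (simp add: K_def)
  have C: "0 \<le> C" "K * B \<le> C" "(\<Lambda> + 1) * B \<le> C" "C2 \<le> C" using K B c C2 by (auto simp: C_def)
  have step: "0 \<le> exp (C * \<Delta>) * Psi M y - expect (\<lambda>s. Psi M) y (\<sigma> y * sqrt \<Delta>)"
    "0 \<le> t \<Longrightarrow> t + \<Delta> \<le> T \<Longrightarrow> \<bar>exp (\<Delta> * ((\<sigma> y)\<^sup>2 * \<kappa> y)) * expect (\<lambda>s. v (t + \<Delta>)) y (\<sigma> y * sqrt \<Delta>) - v t y\<bar> \<le>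
        C * \<Delta> * (exp (C * \<Delta>) * Psi M y - expect (\<lambda>s. Psi M) y (\<sigma> y * sqrt \<Delta>))"
    if y: "y \<in> I" and \<Delta>: "0 < \<Delta>" "\<Delta> \<le> T" for y \<Delta> t
  proof -
    define \<theta>1 where "\<theta>1 = \<sigma> y * sqrt \<Delta>"
    define S where "S = \<theta>1\<^sup>2"
    define P where "P = expect (\<lambda>s. Psi M) y \<theta>1"
    have \<sigma>y: "0 < \<sigma> y" using \<sigma>_pos y by auto
    have \<theta>1: "0 < \<theta>1" using \<sigma>y \<Delta> by (simp add: \<theta>1_def)
    have S_eq: "S = (\<sigma> y)\<^sup>2 * \<Delta>" using \<Delta> by (simp add: S_def \<theta>1_def power_mult_distrib)
    have S: "0 \<le> S" "S \<le> B * \<Delta>"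
      unfolding S_eq using \<sigma>_bound[OF y] \<Delta> by (auto intro!: mult_right_mono)
    have "B * \<Delta> \<le> B * T" using \<Delta> B by (intro mult_left_mono) auto
    then have ST: "S \<le> B * T" using S by linarith
    have psi: "1 \<le> Psi M y" by (rule Psi_ge[OF y])
    have d: "0 \<le> dissipation M y \<theta>1" using \<theta>1 by (intro dissipation_nonneg y) auto
    define X where "X = exp (\<Lambda> * S) * Psi M y - P"
    have lyap: "c * dissipation M y \<theta>1 \<le> X"
      using c(3)[OF y \<theta>1] ST by (simp add: X_def P_def S_def)
    have X: "0 \<le> X" using lyap d c by (meson less_imp_le mult_nonneg_nonneg order_trans)
    \<comment> \<open>The term \<open>S * Psi M y\<close> of the local error must also fit into the
      telescoping expression; raising \<Lambda> by 1 makes room for it, since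
      \<open>exp S - 1\<close> is at least \<open>S\<close>.\<close>
    have ex: "exp (\<Lambda> * S) + S \<le> exp (C * \<Delta>)"
    proof -
      have "exp (\<Lambda> * S) * 1 + 1 * S \<le> exp (\<Lambda> * S) * 1 + exp (\<Lambda> * S) * (exp S - 1)"
        using c S exp_ge_add_one_self[of S] by (intro add_mono mult_mono) (auto simp: le_diff_eq add.commute)
      also have "\<dots> = exp ((\<Lambda> + 1) * S)" by (simp add: algebra_simps exp_add)
      also have "(\<Lambda> + 1) * S \<le> (\<Lambda> + 1) * (B * \<Delta>)" using S c by (intro mult_left_mono) auto
      also have "\<dots> \<le> C * \<Delta>" using mult_right_mono[OF C(3), of \<Delta>] \<Delta> by (simp add: mult_ac)
      finally show ?thesis by simp
    qed
    have XS: "X + S * Psi M y \<le> exp (C * \<Delta>) * Psi M y - P"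
      using mult_right_mono[OF ex, of "Psi M y"] psi by (simp add: X_def algebra_simps)
    have XS0: "0 \<le> X + S * Psi M y" using X S psi by simp
    show "0 \<le> exp (C * \<Delta>) * Psi M y - expect (\<lambda>s. Psi M) y (\<sigma> y * sqrt \<Delta>)"
      using XS XS0 unfolding P_def \<theta>1_def by linarith
    assume t: "0 \<le> t" "t + \<Delta> \<le> T"
    have "exp (\<Delta> * ((\<sigma> y)\<^sup>2 * \<kappa> y)) = exp (S * \<kappa> y)" by (simp add: S_eq mult_ac)
    then have "\<bar>exp (\<Delta> * ((\<sigma> y)\<^sup>2 * \<kappa> y)) * expect (\<lambda>s. v (t + \<Delta>)) y \<theta>1 - v t y\<bar> \<le>
        C1 * S * (dissipation M1 y \<theta>1 + S * Psi M1 y)"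
      using C1(2)[OF y t(1) \<Delta>(1) t(2) \<theta>1_def] by (simp only: S_def)
    also have "\<dots> \<le> C1 * S * ((1 / c + 1) * (X + S * Psi M y))"
    proof (intro mult_left_mono)
      have "dissipation M1 y \<theta>1 \<le> dissipation M y \<theta>1"
        using \<theta>1 by (intro dissipation_mono_exponent y) (auto simp: M_def)
      also have "\<dots> \<le> (1 / c) * X" using lyap c by (simp add: field_simps)
      finally have 1: "dissipation M1 y \<theta>1 \<le> (1 / c) * X" .
      have "S * Psi M1 y \<le> S * Psi M y" using S by (intro mult_left_mono Psi_mono y) (auto simp: M_def)
      moreover have "0 \<le> (1 / c) * (S * Psi M y)" using c S psi by simp
      ultimately show "dissipation M1 y \<theta>1 + S * Psi M1 y \<le> (1 / c + 1) * (X + S * Psi M y)"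
        using 1 X by (simp add: distrib_left distrib_right)
    qed (use C1 S in auto)
    also have "\<dots> = K * S * (X + S * Psi M y)" by (simp add: K_def)
    also have "\<dots> \<le> C * \<Delta> * (exp (C * \<Delta>) * Psi M y - P)"
    proof (rule mult_mono)
      have "K * S \<le> K * (B * \<Delta>)" using S K by (intro mult_left_mono)
      also have "\<dots> \<le> C * \<Delta>" using mult_right_mono[OF C(2), of \<Delta>] \<Delta> by (simp add: mult_ac)
      finally show "K * S \<le> C * \<Delta>" .
    qed (use XS XS0 C \<Delta> in auto)
    finally show "\<bar>exp (\<Delta> * ((\<sigma> y)\<^sup>2 * \<kappa> y)) * expect (\<lambda>s. v (t + \<Delta>)) y (\<sigma> y * sqrt \<Delta>) - v t y\<bar> \<le>
        C * \<Delta> * (exp (C * \<Delta>) * Psi M y - expect (\<lambda>s. Psi M) y (\<sigma> y * sqrt \<Delta>))"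
      by (simp only: \<theta>1_def P_def)
  qed
  show thesis
  proof (rule that[OF C(1), of M])
    fix t x assume t: "t \<in> {0..T}" and x: "x \<in> I"
    have "\<bar>v t x\<bar> \<le> C2 * (1 + x) ^ M2" using C2(2)[OF t x] h_nz[OF x] by simp
    also have "\<dots> \<le> C * Psi M x"
    proof (rule mult_mono)
      have "(1 + x) ^ M2 \<le> (1 + x) ^ M" using pos_I[OF x] by (intro power_increasing) (auto simp: M_def)
      also have "\<dots> \<le> Psi M x" by (simp add: Psi_def)
      finally show "(1 + x) ^ M2 \<le> Psi M x" .
    qed (use C C2 pos_I[OF x] in auto)
    finally show "\<bar>v t x\<bar> \<le> C * Psi M x" .
  next
    fix y \<Delta> assume "y \<in> I" "0 < \<Delta>" "\<Delta> \<le> T"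
    from step(1)[OF this] show "expect (\<lambda>s. Psi M) y (\<sigma> y * sqrt \<Delta>) \<le> exp (C * \<Delta>) * Psi M y" by simp
  next
    fix y t \<Delta> assume "y \<in> I" "0 \<le> t" "0 < \<Delta>" "t + \<Delta> \<le> T"
    then show "\<bar>exp (\<Delta> * ((\<sigma> y)\<^sup>2 * \<kappa> y)) * expect (\<lambda>s. v (t + \<Delta>)) y (\<sigma> y * sqrt \<Delta>) - v t y\<bar> \<le>
        C * \<Delta> * (exp (C * \<Delta>) * Psi M y - expect (\<lambda>s. Psi M) y (\<sigma> y * sqrt \<Delta>))"
      by (intro step(2)) auto
  qed
qed

end

section \<open>Conditioning on the past through joint laws\<close>

lemma (in prob_space) gauss_joint_nn_integral:
  assumes rv: "A \<in> measurable M S" "\<xi> \<in> borel_measurable M"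
    and eq: "distr M (S \<Otimes>\<^sub>M borel) (\<lambda>\<omega>. (A \<omega>, \<xi> \<omega>)) = distr M S A \<Otimes>\<^sub>M gauss"
    and f: "f \<in> borel_measurable (S \<Otimes>\<^sub>M borel)"
  shows "(\<integral>\<^sup>+\<omega>. f (A \<omega>, \<xi> \<omega>) \<partial>M) = (\<integral>\<^sup>+\<omega>. (\<integral>\<^sup>+x. f (A \<omega>, x) \<partial>gauss) \<partial>M)"
proof -
  interpret DA: prob_space "distr M S A" using rv(1) by (rule prob_space_distr)
  have f': "f \<in> borel_measurable (distr M S A \<Otimes>\<^sub>M gauss)"
    using f by (simp cong: measurable_cong_sets sets_pair_measure_cong)
  have f'': "(\<lambda>a. \<integral>\<^sup>+x. f (a, x) \<partial>gauss) \<in> borel_measurable S"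
    by (rule gauss.borel_measurable_nn_integral) (use f in \<open>simp cong: measurable_cong_sets sets_pair_measure_cong\<close>)
  have "(\<integral>\<^sup>+\<omega>. f (A \<omega>, \<xi> \<omega>) \<partial>M) = (\<integral>\<^sup>+w. f w \<partial>(distr M S A \<Otimes>\<^sub>M gauss))"
    unfolding eq[symmetric] by (rule nn_integral_distr[symmetric]) (use rv f in auto)
  also have "\<dots> = (\<integral>\<^sup>+a. (\<integral>\<^sup>+x. f (a, x) \<partial>gauss) \<partial>distr M S A)"
    by (rule gauss.nn_integral_fst[symmetric, OF f'])
  also have "\<dots> = (\<integral>\<^sup>+\<omega>. (\<integral>\<^sup>+x. f (A \<omega>, x) \<partial>gauss) \<partial>M)"
    by (rule nn_integral_distr) (use rv f'' in auto)
  finally show ?thesis .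
qed

lemma (in prob_space) gauss_joint_integral:
  fixes f :: "'b \<times> real \<Rightarrow> real"
  assumes rv: "A \<in> measurable M S" "\<xi> \<in> borel_measurable M"
    and eq: "distr M (S \<Otimes>\<^sub>M borel) (\<lambda>\<omega>. (A \<omega>, \<xi> \<omega>)) = distr M S A \<Otimes>\<^sub>M gauss"
    and f: "f \<in> borel_measurable (S \<Otimes>\<^sub>M borel)" and int: "integrable M (\<lambda>\<omega>. f (A \<omega>, \<xi> \<omega>))"
  shows "(\<integral>\<omega>. f (A \<omega>, \<xi> \<omega>) \<partial>M) = (\<integral>\<omega>. (\<integral>x. f (A \<omega>, x) \<partial>gauss) \<partial>M)"
    and "integrable M (\<lambda>\<omega>. \<integral>x. f (A \<omega>, x) \<partial>gauss)"
proof -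
  interpret DA: prob_space "distr M S A" using rv(1) by (rule prob_space_distr)
  interpret pair_sigma_finite "distr M S A" gauss by standard
  have pm: "(\<lambda>\<omega>. (A \<omega>, \<xi> \<omega>)) \<in> measurable M (S \<Otimes>\<^sub>M borel)" using rv by measurable
  have f': "integrable (distr M S A \<Otimes>\<^sub>M gauss) f"
    unfolding eq[symmetric] using int pm f by (subst integrable_distr_eq) auto
  have f'': "(\<lambda>a. \<integral>x. f (a, x) \<partial>gauss) \<in> borel_measurable S"
    by (rule gauss.borel_measurable_lebesgue_integral)
       (use f in \<open>simp cong: measurable_cong_sets sets_pair_measure_cong\<close>)
  have "(\<integral>\<omega>. f (A \<omega>, \<xi> \<omega>) \<partial>M) = (\<integral>w. f w \<partial>(distr M S A \<Otimes>\<^sub>M gauss))"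
    unfolding eq[symmetric] by (rule integral_distr[symmetric]) (use pm f in auto)
  also have "\<dots> = (\<integral>a. (\<integral>x. f (a, x) \<partial>gauss) \<partial>distr M S A)"
    by (rule integral_fst'[symmetric, OF f'])
  also have "\<dots> = (\<integral>\<omega>. (\<integral>x. f (A \<omega>, x) \<partial>gauss) \<partial>M)"
    by (rule integral_distr) (use rv f'' in auto)
  finally show "(\<integral>\<omega>. f (A \<omega>, \<xi> \<omega>) \<partial>M) = (\<integral>\<omega>. (\<integral>x. f (A \<omega>, x) \<partial>gauss) \<partial>M)" .
  have "integrable (distr M S A) (\<lambda>a. \<integral>x. f (a, x) \<partial>gauss)" by (rule integrable_fst'[OF f'])
  then show "integrable M (\<lambda>\<omega>. \<integral>x. f (A \<omega>, x) \<partial>gauss)"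
    using rv f'' by (subst (asm) integrable_distr_eq) auto
qed

text \<open>Independence of the increment from \<open>F s\<close> yields the product formula on
  rectangles, and these determine the joint law. \<open>A\<close> may be any random element known at
  time \<open>s\<close>, so that the state and an accumulated weight can be conditioned on
  together.\<close>

lemma brownian_increment_joint:
  assumes "filtered_prob M \<Omega> F" "brownian_motion M F W" "0 \<le> s" "s < t"
    and A: "A \<in> measurable (F s) S"
  defines "\<xi> \<equiv> \<lambda>\<omega>. (W t \<omega> - W s \<omega>) / sqrt (t - s)"
  shows "A \<in> measurable M S" "\<xi> \<in> borel_measurable M"
    and "distr M (S \<Otimes>\<^sub>M borel) (\<lambda>\<omega>. (A \<omega>, \<xi> \<omega>)) = distr M S A \<Otimes>\<^sub>M gauss"
proof -
  interpret prob_space M using assms(1) by (simp add: filtered_prob_def)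
  have sub: "space (F s) = space M" "sets (F s) \<subseteq> sets M"
    using assms(1) by (auto simp: filtered_prob_def subalgebra_def)
  let ?D = "\<lambda>\<omega>. W t \<omega> - W s \<omega>"
  let ?V = "vimage_algebra (space M) ?D borel"
  have bm: "distributed M lborel ?D (\<lambda>x. ennreal (normal_density 0 (sqrt (t - s)) x))"
    "indep_set (sets (F s)) (sets ?V)"
    using assms(2-4) by (auto simp: brownian_motion_def)
  have "distributed M lborel (\<lambda>\<omega>. (?D \<omega> - 0) / sqrt (t - s)) (\<lambda>x. ennreal (std_normal_density x))"
    using normal_standard_normal_convert[of "sqrt (t - s)" ?D 0] bm(1) assms(4) by simp
  then have d: "distributed M lborel \<xi> (\<lambda>x. ennreal (std_normal_density x))" by (simp add: \<xi>_def)
  then show m\<xi>: "\<xi> \<in> borel_measurable M" by (simp add: distributed_def)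
  have "distr M lborel \<xi> = gauss" using d by (simp add: distributed_def gauss_def)
  then have law: "distr M borel \<xi> = gauss" by (simp cong: distr_cong)
  show mA: "A \<in> measurable M S"
    by (rule measurable_from_subalg[OF _ A]) (use sub in \<open>auto simp: subalgebra_def\<close>)
  have m\<xi>V: "\<xi> \<in> borel_measurable ?V"
    unfolding \<xi>_def by (intro borel_measurable_divide borel_measurable_const measurable_vimage_algebra1) auto
  have pm: "(\<lambda>\<omega>. (A \<omega>, \<xi> \<omega>)) \<in> measurable M (S \<Otimes>\<^sub>M borel)" using mA m\<xi> by measurable
  interpret DA: prob_space "distr M S A" using mA by (rule prob_space_distr)
  show "distr M (S \<Otimes>\<^sub>M borel) (\<lambda>\<omega>. (A \<omega>, \<xi> \<omega>)) = distr M S A \<Otimes>\<^sub>M gauss"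
  proof (rule pair_measure_eqI[symmetric])
    show "sigma_finite_measure (distr M S A)" "sigma_finite_measure gauss" by unfold_locales
    show "sets (distr M S A \<Otimes>\<^sub>M gauss) = sets (distr M (S \<Otimes>\<^sub>M borel) (\<lambda>\<omega>. (A \<omega>, \<xi> \<omega>)))"
      by (simp cong: sets_pair_measure_cong)
    fix U R assume U: "U \<in> sets (distr M S A)" and R: "R \<in> sets gauss"
    let ?a = "A -` U \<inter> space M" and ?b = "\<xi> -` R \<inter> space M"
    have a: "?a \<in> sets (F s)" using measurable_sets[OF A, of U] U sub by simp
    have b: "?b \<in> sets ?V" using measurable_sets[OF m\<xi>V, of R] R by simp
    have "emeasure (distr M (S \<Otimes>\<^sub>M borel) (\<lambda>\<omega>. (A \<omega>, \<xi> \<omega>))) (U \<times> R) = emeasure M (?a \<inter> ?b)"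
      using U R pm by (subst emeasure_distr) (auto intro!: arg_cong[where f = "emeasure M"])
    also have "\<dots> = emeasure M ?a * emeasure M ?b"
      using indep_setD[OF bm(2) a b] by (simp add: emeasure_eq_measure ennreal_mult')
    also have "\<dots> = emeasure (distr M S A) U * emeasure gauss R"
      unfolding law[symmetric] using U R mA m\<xi> by (simp add: emeasure_distr)
    finally show "emeasure (distr M S A) U * emeasure gauss R =
      emeasure (distr M (S \<Otimes>\<^sub>M borel) (\<lambda>\<omega>. (A \<omega>, \<xi> \<omega>))) (U \<times> R)" by simp
  qed
qed

text \<open>\<open>X N n\<close> is the value at the grid point \<open>n\<close> of the scheme with
  \<open>N\<close> steps. Recursion and initial value hold for every outcome, so the scheme lies in
  \<open>I\<close> everywhere and no exceptional null set has to be carried along.\<close>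

locale bem_scheme = bem_coefficients +
  fixes Q :: "'w measure" and \<Omega> :: "'w set" and F :: "real \<Rightarrow> 'w measure" and W :: "real \<Rightarrow> 'w \<Rightarrow> real"
    and x0 :: real and X :: "nat \<Rightarrow> nat \<Rightarrow> 'w \<Rightarrow> real"
  assumes filtered: "filtered_prob Q \<Omega> F" and filtration: "filtration \<Omega> F" and bm: "brownian_motion Q F W"
    and x0: "x0 \<in> I"
    and X_0: "X N 0 \<omega> = x0"
    and X_Suc: "1 \<le> N \<Longrightarrow> X N (Suc n) \<omega> = J ((\<sigma> (X N n \<omega>))\<^sup>2 * (T / N))
      (X N n \<omega> + \<sigma> (X N n \<omega>) * (W (real (Suc n) * T / real N) \<omega> - W (real n * T / real N) \<omega>))"
begin

sublocale Q: prob_space Q using filtered by (simp add: filtered_prob_def)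

lemma X_in: "1 \<le> N \<Longrightarrow> X N n \<omega> \<in> I"
proof (induction n)
  case (Suc n)
  have "0 < (\<sigma> (X N n \<omega>))\<^sup>2 * (T / N)" using \<sigma>_pos[OF Suc.IH[OF Suc.prems]] T_pos Suc.prems by simp
  then show ?case unfolding X_Suc[OF Suc.prems] by (intro J_in) (simp add: V_def)
qed (use X_0 x0 in simp)

definition \<xi> :: "nat \<Rightarrow> nat \<Rightarrow> 'w \<Rightarrow> real" where
  "\<xi> N n \<omega> = (W (real (Suc n) * T / real N) \<omega> - W (real n * T / real N) \<omega>) /
     sqrt (real (Suc n) * T / real N - real n * T / real N)"

lemma X_Suc_Y:
  assumes "1 \<le> N"
  shows "X N (Suc n) \<omega> = Y (X N n \<omega>) (\<sigma> (X N n \<omega>) * sqrt (T / N)) (\<xi> N n \<omega>)"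
proof -
  have e: "real (Suc n) * T / real N - real n * T / real N = T / N"
    by (simp add: distrib_right add_divide_distrib)
  have p: "0 < T / N" using T_pos assms by simp
  show ?thesis
    unfolding X_Suc[OF assms] Y_def \<xi>_def e using p
    by (simp add: power_mult_distrib)
qed

lemma cont_\<sigma>: "continuous_on I \<sigma>"
proof -
  have "continuous_on I (\<lambda>x. sqrt (1 / \<rho> x))"
  proof (intro continuous_intros cont_imp[OF d\<rho>] ballI)
    show "\<rho> x \<noteq> 0" if "x \<in> I" for x using \<rho>_eq[OF that] \<sigma>_pos[OF that] by simp
  qed
  then show ?thesis
    by (rule continuous_on_cong[THEN iffD1, rotated 2]) (use \<rho>_eq \<sigma>_pos in \<open>auto simp: less_imp_le\<close>)
qed

text \<open>The coefficients are arbitrary outside the interval; cutting them off by 0 gives Borel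
  functions on the line, which agree with the original ones along the scheme.\<close>

lemma ext_measurable:
  fixes f :: "real \<Rightarrow> real"
  assumes "continuous_on I f"
  shows "(\<lambda>x. indicator I x *\<^sub>R f x) \<in> borel_measurable borel"
  by (rule borel_measurable_continuous_on_indicator[OF _ assms]) (use open_I in simp)

lemma compose_measurable:
  fixes f :: "real \<Rightarrow> real"
  assumes "continuous_on I f" "g \<in> borel_measurable M" "\<And>\<omega>. \<omega> \<in> space M \<Longrightarrow> g \<omega> \<in> I"
  shows "(\<lambda>\<omega>. f (g \<omega>)) \<in> borel_measurable M"
proof -
  have "(\<lambda>\<omega>. indicator I (g \<omega>) *\<^sub>R f (g \<omega>)) \<in> borel_measurable M"
    by (rule measurable_compose[OF assms(2) ext_measurable[OF assms(1)]])
  then show ?thesis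
    by (rule measurable_cong[THEN iffD1, rotated]) (use assms(3) in simp)
qed

definition step :: "real \<Rightarrow> real \<times> real \<Rightarrow> real" where
  "step \<Delta> w = indicator (I \<times> UNIV) w *\<^sub>R Y (fst w) (\<sigma> (fst w) * sqrt \<Delta>) (snd w)"

lemma step_measurable:
  assumes "0 < \<Delta>"
  shows "step \<Delta> \<in> borel_measurable borel"
  unfolding step_def [abs_def]
proof (rule borel_measurable_continuous_on_indicator)
  show "I \<times> (UNIV :: real set) \<in> sets borel"
    by (intro borel_open open_Times open_I open_UNIV)
  have c\<sigma>: "continuous_on (I \<times> UNIV) (\<lambda>w. \<sigma> (fst w))"
    by (rule continuous_on_compose2[OF cont_\<sigma>]) (auto intro!: continuous_intros)
  have "continuous_on (I \<times> UNIV) (\<lambda>w. (\<lambda>(s, z). J s z) ((\<sigma> (fst w) * sqrt \<Delta>)\<^sup>2, fst w + \<sigma> (fst w) * sqrt \<Delta> * snd w))"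
    by (rule continuous_on_compose2[OF continuous_on_J])
       (use assms \<sigma>_pos in \<open>force intro!: continuous_intros c\<sigma> simp: V_def\<close>)+
  then show "continuous_on (I \<times> UNIV) (\<lambda>w. Y (fst w) (\<sigma> (fst w) * sqrt \<Delta>) (snd w))"
    by (simp add: Y_def)
qed

lemma subalgebra_F: "subalgebra Q (F t)" using filtered by (simp add: filtered_prob_def)

lemma measurable_F_mono:
  assumes "f \<in> borel_measurable (F s)" "s \<le> t"
  shows "f \<in> borel_measurable (F t)"
proof (rule measurable_from_subalg[OF _ assms(1)])
  show "subalgebra (F t) (F s)"
    using filtration.space_F[OF filtration] filtration.sets_F_mono[OF filtration assms(2)]
    by (simp add: subalgebra_def)
qed

lemma X_step: "1 \<le> N \<Longrightarrow> X N (Suc n) \<omega> = step (T / N) (X N n \<omega>, \<xi> N n \<omega>)"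
  using X_in[of N n \<omega>] by (simp add: X_Suc_Y step_def)

lemma grid_less: "1 \<le> N \<Longrightarrow> real n * T / real N < real (Suc n) * T / real N"
  using T_pos by (simp add: divide_strict_right_mono)

lemma X_measurable_F: "1 \<le> N \<Longrightarrow> X N n \<in> borel_measurable (F (real n * T / real N))"
proof (induction n)
  case 0
  then show ?case using X_0[of N] by (simp cong: measurable_cong)
next
  case (Suc n)
  let ?F = "F (real (Suc n) * T / real N)"
  have le: "real n * T / real N \<le> real (Suc n) * T / real N" using grid_less[OF Suc.prems, of n] by simp
  have W: "W t \<in> borel_measurable (F t)" if "0 \<le> t" for t
    using bm that by (simp add: brownian_motion_def)
  have W1: "W (real n * T / real N) \<in> borel_measurable ?F"
    by (rule measurable_F_mono[OF W le]) (use T_pos in simp)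
  have W2: "W (real (Suc n) * T / real N) \<in> borel_measurable ?F" by (rule W) (use T_pos in simp)
  have X: "X N n \<in> borel_measurable ?F" by (rule measurable_F_mono[OF Suc.IH[OF Suc.prems] le])
  have \<xi>: "\<xi> N n \<in> borel_measurable ?F"
    unfolding \<xi>_def by (intro borel_measurable_divide borel_measurable_diff W1 W2 borel_measurable_const)
  have st: "step (T / N) \<in> borel_measurable (borel \<Otimes>\<^sub>M borel)"
    unfolding borel_prod by (rule step_measurable) (use T_pos Suc.prems in simp)
  have "(\<lambda>\<omega>. step (T / N) (X N n \<omega>, \<xi> N n \<omega>)) \<in> borel_measurable ?F"
    by (rule measurable_compose[OF measurable_Pair[OF X \<xi>] st])
  then show ?case using X_step[OF Suc.prems, of n] by (simp cong: measurable_cong)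
qed

lemma X_measurable: "1 \<le> N \<Longrightarrow> X N n \<in> borel_measurable Q"
  by (rule measurable_from_subalg[OF subalgebra_F X_measurable_F])

definition rate :: "real \<Rightarrow> real" where "rate x = (\<sigma> x)\<^sup>2 * \<kappa> x"

text \<open>An upper bound is all that the exponential weight asks for; because of
  \<open>h'' / h\<close> the rate may tend to minus infinity at the boundary.\<close>

lemma rate_le: "x \<in> I \<Longrightarrow> rate x \<le> B\<^sup>2"
proof -
  assume x: "x \<in> I"
  have B: "0 \<le> B" using B_nonneg x by auto
  have "rate x \<le> (\<sigma> x)\<^sup>2 * B" unfolding rate_def using \<kappa>_upper[OF x] by (intro mult_left_mono) auto
  also have "\<dots> \<le> B * B" using \<sigma>_bound[OF x] B by (intro mult_right_mono)
  finally show ?thesis by (simp add: power2_eq_square)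
qed

definition weight :: "nat \<Rightarrow> nat \<Rightarrow> 'w \<Rightarrow> real" where
  "weight N n \<omega> = exp (\<Sum>j<n. T / N * rate (X N j \<omega>))"

lemma weight_le:
  assumes "1 \<le> N" "n \<le> N"
  shows "weight N n \<omega> \<le> exp (T * B\<^sup>2)"
proof -
  have "(\<Sum>j<n. T / N * rate (X N j \<omega>)) \<le> (\<Sum>j<n. T / N * B\<^sup>2)"
    using T_pos rate_le[OF X_in[OF assms(1)]] by (intro sum_mono mult_left_mono) auto
  also have "\<dots> = (real n / N) * (T * B\<^sup>2)" by simp
  also have "\<dots> \<le> 1 * (T * B\<^sup>2)" using assms T_pos by (intro mult_right_mono) auto
  finally show ?thesis by (simp add: weight_def)
qed

lemma weight_pos: "0 < weight N n \<omega>" by (simp add: weight_def)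

lemma cont_rate: "continuous_on I rate"
  unfolding rate_def [abs_def] by (intro continuous_intros cont_\<sigma> cont_imp[OF d\<kappa>])

lemma weight_measurable_F:
  assumes "1 \<le> N"
  shows "weight N n \<in> borel_measurable (F (real n * T / real N))"
proof -
  have "(\<lambda>\<omega>. rate (X N j \<omega>)) \<in> borel_measurable (F (real n * T / real N))" if "j < n" for j
  proof (rule compose_measurable[OF cont_rate _ X_in[OF assms]])
    show "X N j \<in> borel_measurable (F (real n * T / real N))"
      by (rule measurable_F_mono[OF X_measurable_F[OF assms]])
         (use that T_pos in \<open>auto intro!: divide_right_mono\<close>)
  qed
  then show ?thesis unfolding weight_def [abs_def] by measurable
qed

lemma \<xi>_joint:
  assumes "1 \<le> N" "Z \<in> measurable (F (real n * T / real N)) S"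
  shows "Z \<in> measurable Q S" "\<xi> N n \<in> borel_measurable Q"
    "distr Q (S \<Otimes>\<^sub>M borel) (\<lambda>\<omega>. (Z \<omega>, \<xi> N n \<omega>)) = distr Q S Z \<Otimes>\<^sub>M gauss"
proof -
  have "0 \<le> real n * T / real N" using T_pos by simp
  from brownian_increment_joint[OF filtered bm this grid_less[OF assms(1)] assms(2)]
  show "Z \<in> measurable Q S" "\<xi> N n \<in> borel_measurable Q"
    "distr Q (S \<Otimes>\<^sub>M borel) (\<lambda>\<omega>. (Z \<omega>, \<xi> N n \<omega>)) = distr Q S Z \<Otimes>\<^sub>M gauss"
    by (simp_all only: \<xi>_def [abs_def])
qed

lemma cont_Psi: "continuous_on I (Psi M)"
  using cont_imp[OF d_Psi] .

lemma theta_pos: "1 \<le> (N::nat) \<Longrightarrow> y \<in> I \<Longrightarrow> 0 \<le> \<sigma> y * sqrt (T / N)"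
  using \<sigma>_pos[of y] T_pos by simp

text \<open>The Markov property without an integrability assumption, as needed to prove that
  \<open>Psi\<close> is integrable along the scheme in the first place.\<close>

lemma step_nn_integral:
  assumes N: "1 \<le> N" and f: "continuous_on I f" "\<And>x. x \<in> I \<Longrightarrow> 0 \<le> f x"
  shows "(\<integral>\<^sup>+\<omega>. ennreal (f (X N (Suc n) \<omega>)) \<partial>Q) =
    (\<integral>\<^sup>+\<omega>. (\<integral>\<^sup>+x. ennreal (f (Y (X N n \<omega>) (\<sigma> (X N n \<omega>) * sqrt (T / N)) x)) \<partial>gauss) \<partial>Q)"
proof -
  let ?f = "\<lambda>x. indicator I x *\<^sub>R f x"
  have st: "step (T / N) \<in> borel_measurable (borel \<Otimes>\<^sub>M borel)"
    unfolding borel_prod by (rule step_measurable) (use T_pos N in simp)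
  have m: "(\<lambda>w. ennreal (?f (step (T / N) w))) \<in> borel_measurable (borel \<Otimes>\<^sub>M borel)"
    using measurable_compose[OF st ext_measurable[OF f(1)]] by measurable
  have "(\<integral>\<^sup>+\<omega>. ennreal (?f (step (T / N) (X N n \<omega>, \<xi> N n \<omega>))) \<partial>Q) =
    (\<integral>\<^sup>+\<omega>. (\<integral>\<^sup>+x. ennreal (?f (step (T / N) (X N n \<omega>, x))) \<partial>gauss) \<partial>Q)"
    by (rule Q.gauss_joint_nn_integral[OF \<xi>_joint[OF N X_measurable_F[OF N]] m])
  moreover have "?f (step (T / N) (X N n \<omega>, \<xi> N n \<omega>)) = f (X N (Suc n) \<omega>)" for \<omega>
    using X_in[OF N, of "Suc n" \<omega>] by (simp add: X_step[OF N, symmetric])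
  moreover have "?f (step (T / N) (X N n \<omega>, x)) = f (Y (X N n \<omega>) (\<sigma> (X N n \<omega>) * sqrt (T / N)) x)" for \<omega> x
    using X_in[OF N, of n \<omega>] Y_in[OF X_in[OF N] theta_pos[OF N X_in[OF N]]] by (simp add: step_def)
  ultimately show ?thesis by simp
qed

text \<open>The increment over the next step is independent of everything known at the grid point
  \<open>n\<close>, so it may be integrated out first. The factor \<open>Z\<close> is there to carry
  the exponential weight accumulated so far.\<close>

lemma step_integral:
  assumes N: "1 \<le> N" and f: "continuous_on I f"
    and Z: "Z \<in> borel_measurable (F (real n * T / real N))"
    and int: "integrable Q (\<lambda>\<omega>. Z \<omega> * f (X N (Suc n) \<omega>))"
  shows "(\<integral>\<omega>. Z \<omega> * f (X N (Suc n) \<omega>) \<partial>Q) =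
      (\<integral>\<omega>. Z \<omega> * expect (\<lambda>s. f) (X N n \<omega>) (\<sigma> (X N n \<omega>) * sqrt (T / N)) \<partial>Q)"
    and "integrable Q (\<lambda>\<omega>. Z \<omega> * expect (\<lambda>s. f) (X N n \<omega>) (\<sigma> (X N n \<omega>) * sqrt (T / N)))"
proof -
  let ?f = "\<lambda>x. indicator I x *\<^sub>R f x"
  define V where "V \<omega> = (Z \<omega>, X N n \<omega>)" for \<omega>
  define g where "g w = fst (fst w) * ?f (step (T / N) (snd (fst w), snd w))"
    for w :: "(real \<times> real) \<times> real"
  have V: "V \<in> measurable (F (real n * T / real N)) (borel \<Otimes>\<^sub>M borel)"
    unfolding V_def [abs_def] by (intro measurable_Pair Z X_measurable_F N)
  have st: "step (T / N) \<in> borel_measurable (borel \<Otimes>\<^sub>M borel)"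
    unfolding borel_prod by (rule step_measurable) (use T_pos N in simp)
  note [measurable] = st ext_measurable[OF f]
  have m: "g \<in> borel_measurable ((borel \<Otimes>\<^sub>M borel) \<Otimes>\<^sub>M borel)" unfolding g_def [abs_def] by measurable
  have g1: "g (V \<omega>, \<xi> N n \<omega>) = Z \<omega> * f (X N (Suc n) \<omega>)" for \<omega>
    using X_in[OF N, of "Suc n" \<omega>] by (simp add: g_def V_def X_step[OF N, symmetric])
  have g2: "g (V \<omega>, x) = Z \<omega> * f (Y (X N n \<omega>) (\<sigma> (X N n \<omega>) * sqrt (T / N)) x)" for \<omega> x
    using X_in[OF N, of n \<omega>] Y_in[OF X_in[OF N] theta_pos[OF N X_in[OF N]]] by (simp add: g_def V_def step_def)
  have int': "integrable Q (\<lambda>\<omega>. g (V \<omega>, \<xi> N n \<omega>))" unfolding g1 by (rule int)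
  note r = Q.gauss_joint_integral[OF \<xi>_joint[OF N V] m int', unfolded g1 g2]
  show "(\<integral>\<omega>. Z \<omega> * f (X N (Suc n) \<omega>) \<partial>Q) =
      (\<integral>\<omega>. Z \<omega> * expect (\<lambda>s. f) (X N n \<omega>) (\<sigma> (X N n \<omega>) * sqrt (T / N)) \<partial>Q)"
    using r(1) by (simp add: X_Suc_Y[OF N])
  show "integrable Q (\<lambda>\<omega>. Z \<omega> * expect (\<lambda>s. f) (X N n \<omega>) (\<sigma> (X N n \<omega>) * sqrt (T / N)))"
    using r(2) by simp
qed

text \<open>The mean of \<open>u n\<close>, the weight times \<open>v\<close> at the grid point
  \<open>n\<close>, changes per step at most by
  \<open>E * C * \<Delta> * (exp (C * \<Delta>) * a n - a (Suc n))\<close>, where \<open>a n\<close>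
  is the mean of \<open>Psi\<close>. The sum over \<open>n\<close> of the brackets is bounded
  independently of \<open>N\<close>, which leaves one factor \<Delta>.\<close>

lemma weak_error:
  obtains K where "\<And>N. 1 \<le> N \<Longrightarrow> integrable Q (\<lambda>\<omega>. weight N N \<omega> * v T (X N N \<omega>))"
    "\<And>N. 1 \<le> N \<Longrightarrow> \<bar>(\<integral>\<omega>. weight N N \<omega> * v T (X N N \<omega>) \<partial>Q) - v 0 x0\<bar> \<le> K * T / N"
proof -
  have I: "I \<noteq> {}" using x0 by auto
  obtain C M where C: "0 \<le> C"
    and v_le: "\<And>t x. t \<in> {0..T} \<Longrightarrow> x \<in> I \<Longrightarrow> \<bar>v t x\<bar> \<le> C * Psi M x"
    and Psi_step: "\<And>y \<Delta>. y \<in> I \<Longrightarrow> 0 < \<Delta> \<Longrightarrow> \<Delta> \<le> T \<Longrightarrow>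
      expect (\<lambda>s. Psi M) y (\<sigma> y * sqrt \<Delta>) \<le> exp (C * \<Delta>) * Psi M y"
    and v_step: "\<And>y t \<Delta>. y \<in> I \<Longrightarrow> 0 \<le> t \<Longrightarrow> 0 < \<Delta> \<Longrightarrow> t + \<Delta> \<le> T \<Longrightarrow>
      \<bar>exp (\<Delta> * ((\<sigma> y)\<^sup>2 * \<kappa> y)) * expect (\<lambda>s. v (t + \<Delta>)) y (\<sigma> y * sqrt \<Delta>) - v t y\<bar> \<le>
        C * \<Delta> * (exp (C * \<Delta>) * Psi M y - expect (\<lambda>s. Psi M) y (\<sigma> y * sqrt \<Delta>))"
    using one_step[OF I] by metis
  define E where "E = exp (T * B\<^sup>2)"
  define K where "K = E * (C * (C * T * exp (C * T) * (exp (C * T) * Psi M x0) + Psi M x0))"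
  have main: "integrable Q (\<lambda>\<omega>. weight N N \<omega> * v T (X N N \<omega>)) \<and>
     \<bar>(\<integral>\<omega>. weight N N \<omega> * v T (X N N \<omega>) \<partial>Q) - v 0 x0\<bar> \<le> K * T / N" if N: "1 \<le> N" for N
  proof -
    define \<Delta> where "\<Delta> = T / N"
    have \<Delta>: "0 < \<Delta>" "\<Delta> \<le> T" using N T_pos by (auto simp: \<Delta>_def divide_le_eq)
    have N\<Delta>: "real N * \<Delta> = T" using N by (simp add: \<Delta>_def)
    note Xm = X_measurable[OF N] and Xin = X_in[OF N]
    define t where "t n = real n * \<Delta>" for n
    have t_Suc: "t (Suc n) = t n + \<Delta>" for n by (simp add: t_def algebra_simps)
    have t_in: "t n \<in> {0..T}" if "n \<le> N" for n
    proof -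
      have "real n * \<Delta> \<le> real N * \<Delta>" using that \<Delta> by (intro mult_right_mono) auto
      then show ?thesis using \<Delta> by (simp add: t_def N\<Delta>)
    qed
    define P where "P y = expect (\<lambda>s. Psi M) y (\<sigma> y * sqrt \<Delta>)" for y
    have P_nonneg: "0 \<le> P y" if "y \<in> I" for y
    proof -
      have "0 \<le> Psi M (Y y (\<sigma> y * sqrt \<Delta>) x)" for x
        using Psi_ge[OF Y_in[OF that theta_pos[OF N that]], of M x] by (simp add: \<Delta>_def)
      then show ?thesis unfolding P_def by (intro integral_nonneg_AE) auto
    qed
    \<comment> \<open>Bochner integrals of non-integrable functions are 0, so integrability has to
      come before any use of means; the induction runs through nonnegative integrals.\<close>
    have Psi_int: "integrable Q (\<lambda>\<omega>. Psi M (X N n \<omega>))" for n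
    proof (induction n)
      case 0
      then show ?case by (simp add: X_0)
    next
      case (Suc n)
      have meas: "(\<lambda>\<omega>. Psi M (X N m \<omega>)) \<in> borel_measurable Q" for m
        by (rule compose_measurable[OF cont_Psi Xm Xin])
      have nn: "0 \<le> Psi M (X N m \<omega>)" for m \<omega> using Psi_ge[OF Xin, of M m \<omega>] by simp
      have "(\<integral>\<^sup>+\<omega>. ennreal (Psi M (X N (Suc n) \<omega>)) \<partial>Q) =
        (\<integral>\<^sup>+\<omega>. (\<integral>\<^sup>+x. ennreal (Psi M (Y (X N n \<omega>) (\<sigma> (X N n \<omega>) * sqrt (T / N)) x)) \<partial>gauss) \<partial>Q)"
        by (rule step_nn_integral[OF N cont_Psi]) (rule order_trans[OF zero_le_one Psi_ge])
      also have "\<dots> \<le> (\<integral>\<^sup>+\<omega>. ennreal (exp (C * \<Delta>) * Psi M (X N n \<omega>)) \<partial>Q)"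
      proof (rule nn_integral_mono)
        fix \<omega>
        have y: "X N n \<omega> \<in> I" by (rule Xin)
        have "(\<integral>\<^sup>+x. ennreal (Psi M (Y (X N n \<omega>) (\<sigma> (X N n \<omega>) * sqrt (T / N)) x)) \<partial>gauss) = ennreal (P (X N n \<omega>))"
          unfolding P_def \<Delta>_def
        proof (rule nn_integral_eq_integral)
          show "integrable gauss (\<lambda>x. Psi M (Y (X N n \<omega>) (\<sigma> (X N n \<omega>) * sqrt (T / real N)) x))"
            using expect_integrable[OF y tempered_Psi, of "\<sigma> (X N n \<omega>) * sqrt (T / real N)" "\<sigma> (X N n \<omega>) * sqrt (T / real N)" M]
              theta_pos[OF N y] by simp
          show "AE x in gauss. 0 \<le> Psi M (Y (X N n \<omega>) (\<sigma> (X N n \<omega>) * sqrt (T / real N)) x)"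
            using Psi_ge[OF Y_in[OF y theta_pos[OF N y]], of M] by (auto intro: order_trans[OF zero_le_one])
        qed
        also have "\<dots> \<le> ennreal (exp (C * \<Delta>) * Psi M (X N n \<omega>))"
          unfolding P_def by (intro ennreal_leI Psi_step y \<Delta>)
        finally show "(\<integral>\<^sup>+x. ennreal (Psi M (Y (X N n \<omega>) (\<sigma> (X N n \<omega>) * sqrt (T / N)) x)) \<partial>gauss) \<le>
           ennreal (exp (C * \<Delta>) * Psi M (X N n \<omega>))" .
      qed
      also have "\<dots> = ennreal (\<integral>\<omega>. exp (C * \<Delta>) * Psi M (X N n \<omega>) \<partial>Q)"
        by (rule nn_integral_eq_integral) (use Suc nn in auto)
      also have "\<dots> < \<infinity>" by simp
      finally show ?case by (intro integrableI_nonneg meas) (use nn in auto)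
    qed
    define a where "a n = (\<integral>\<omega>. Psi M (X N n \<omega>) \<partial>Q)" for n
    have P_int: "integrable Q (\<lambda>\<omega>. P (X N n \<omega>))" and a_Suc: "a (Suc n) = (\<integral>\<omega>. P (X N n \<omega>) \<partial>Q)" for n
      using step_integral[OF N cont_Psi, of "\<lambda>_. 1" n M] Psi_int[of "Suc n"]
      by (simp_all add: P_def a_def \<Delta>_def)
    \<comment> \<open>A discrete Gronwall estimate; the growth rate depends on the elapsed time
      \<open>t n\<close> only, hence is uniform in \<open>N\<close>.\<close>
    have a_le: "a n \<le> exp (C * t n) * Psi M x0" for n
    proof (induction n)
      case 0
      then show ?case by (simp add: a_def X_0 t_def Q.prob_space)
    next
      case (Suc n)
      have "a (Suc n) \<le> (\<integral>\<omega>. exp (C * \<Delta>) * Psi M (X N n \<omega>) \<partial>Q)"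
        unfolding a_Suc by (intro integral_mono P_int integrable_mult_right Psi_int)
           (use Psi_step[OF Xin \<Delta>] in \<open>simp add: P_def\<close>)
      also have "\<dots> = exp (C * \<Delta>) * a n" by (simp add: a_def)
      also have "\<dots> \<le> exp (C * \<Delta>) * (exp (C * t n) * Psi M x0)" using Suc by simp
      also have "\<dots> = exp (C * t (Suc n)) * Psi M x0" by (simp add: t_Suc exp_add algebra_simps)
      finally show ?case .
    qed
    have a_nonneg: "0 \<le> a n" for n
      unfolding a_def by (intro Bochner_Integration.integral_nonneg order_trans[OF zero_le_one Psi_ge[OF Xin]])
    define u where "u n \<omega> = weight N n \<omega> * v (t n) (X N n \<omega>)" for n \<omega>
    have cont_vt: "continuous_on I (v (t n))" if "n \<le> N" for n
      by (rule cont_imp[OF dvx[OF t_in[OF that]]])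
    have w_meas: "weight N n \<in> borel_measurable Q" for n
      by (rule measurable_from_subalg[OF subalgebra_F weight_measurable_F[OF N]])
    have w_le: "weight N n \<omega> \<le> E" if "n \<le> N" for n \<omega>
      using weight_le[OF N that] by (simp add: E_def)
    have u_int: "integrable Q (u n)" if "n \<le> N" for n
    proof (rule Bochner_Integration.integrable_bound)
      show "integrable Q (\<lambda>\<omega>. E * (C * Psi M (X N n \<omega>)))" by (intro integrable_mult_right Psi_int)
      show "u n \<in> borel_measurable Q" unfolding u_def [abs_def]
        by (intro borel_measurable_times w_meas compose_measurable[OF cont_vt[OF that] Xm Xin])
      show "AE \<omega> in Q. norm (u n \<omega>) \<le> norm (E * (C * Psi M (X N n \<omega>)))"
      proof (intro AE_I2)
        fix \<omega>
        have "norm (u n \<omega>) = weight N n \<omega> * \<bar>v (t n) (X N n \<omega>)\<bar>"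
          using weight_pos[of N n \<omega>] by (simp add: u_def abs_mult)
        also have "\<dots> \<le> E * (C * Psi M (X N n \<omega>))"
          using weight_pos[of N n \<omega>] w_le[OF that] v_le[OF t_in[OF that] Xin]
          by (intro mult_mono) (auto simp: E_def)
        finally show "norm (u n \<omega>) \<le> norm (E * (C * Psi M (X N n \<omega>)))" by simp
      qed
    qed
    have incr: "\<bar>(\<integral>\<omega>. u (Suc n) \<omega> \<partial>Q) - (\<integral>\<omega>. u n \<omega> \<partial>Q)\<bar> \<le>
        E * (C * \<Delta> * (exp (C * \<Delta>) * a n - a (Suc n)))" if n: "n < N" for n
    proof -
      define d where "d y = exp (\<Delta> * rate y)" for y
      have cd: "continuous_on I d" unfolding d_def by (intro continuous_intros cont_rate)
      have u_Suc: "u (Suc n) \<omega> = weight N n \<omega> * d (X N n \<omega>) * v (t (Suc n)) (X N (Suc n) \<omega>)" for \<omega>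
        by (simp add: u_def weight_def d_def exp_add \<Delta>_def)
      define R where "R y = expect (\<lambda>s. v (t (Suc n))) y (\<sigma> y * sqrt \<Delta>)" for y
      have i1: "integrable Q (\<lambda>\<omega>. weight N n \<omega> * d (X N n \<omega>) * v (t (Suc n)) (X N (Suc n) \<omega>))"
        using u_int[of "Suc n"] n unfolding u_Suc [abs_def] by simp
      have ct: "continuous_on I (v (t (Suc n)))" using n by (intro cont_vt) simp
      \<comment> \<open>The new weight factor is evaluated at the left grid point, so it is known
        before the step and belongs to \<open>Z\<close>.\<close>
      have "(\<lambda>\<omega>. weight N n \<omega> * d (X N n \<omega>)) \<in> borel_measurable (F (real n * T / real N))"
        by (intro borel_measurable_times weight_measurable_F[OF N] compose_measurable[OF cd X_measurable_F[OF N] Xin])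
      note r = step_integral[OF N ct this i1]
      have i2: "integrable Q (\<lambda>\<omega>. weight N n \<omega> * d (X N n \<omega>) * R (X N n \<omega>))"
        using r(2) by (simp add: R_def \<Delta>_def)
      have "(\<integral>\<omega>. u (Suc n) \<omega> \<partial>Q) - (\<integral>\<omega>. u n \<omega> \<partial>Q) =
          (\<integral>\<omega>. weight N n \<omega> * d (X N n \<omega>) * R (X N n \<omega>) \<partial>Q) - (\<integral>\<omega>. u n \<omega> \<partial>Q)"
        using r(1) by (simp add: u_Suc R_def \<Delta>_def)
      also have "\<dots> = (\<integral>\<omega>. weight N n \<omega> * (d (X N n \<omega>) * R (X N n \<omega>) - v (t n) (X N n \<omega>)) \<partial>Q)"
        using i2 u_int[of n] n
        by (subst Bochner_Integration.integral_diff[symmetric]) (auto simp: u_def algebra_simps)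
      finally have eq: "(\<integral>\<omega>. u (Suc n) \<omega> \<partial>Q) - (\<integral>\<omega>. u n \<omega> \<partial>Q) =
        (\<integral>\<omega>. weight N n \<omega> * (d (X N n \<omega>) * R (X N n \<omega>) - v (t n) (X N n \<omega>)) \<partial>Q)" .
      have "\<bar>(\<integral>\<omega>. u (Suc n) \<omega> \<partial>Q) - (\<integral>\<omega>. u n \<omega> \<partial>Q)\<bar> \<le> (\<integral>\<omega>. E * (C * \<Delta> * (exp (C * \<Delta>) * Psi M (X N n \<omega>) - P (X N n \<omega>))) \<partial>Q)"
        unfolding eq
      proof (rule order_trans[OF integral_abs_bound integral_mono[OF integrable_abs]])
        show "integrable Q (\<lambda>\<omega>. weight N n \<omega> * (d (X N n \<omega>) * R (X N n \<omega>) - v (t n) (X N n \<omega>)))"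
          using Bochner_Integration.integrable_diff[OF i2 u_int[of n]] n by (simp add: u_def [abs_def] algebra_simps)
        show "integrable Q (\<lambda>\<omega>. E * (C * \<Delta> * (exp (C * \<Delta>) * Psi M (X N n \<omega>) - P (X N n \<omega>))))"
          by (intro integrable_mult_right Bochner_Integration.integrable_diff Psi_int P_int)
        fix \<omega>
        have y: "X N n \<omega> \<in> I" by (rule Xin)
        have "\<bar>d (X N n \<omega>) * R (X N n \<omega>) - v (t n) (X N n \<omega>)\<bar> \<le>
            C * \<Delta> * (exp (C * \<Delta>) * Psi M (X N n \<omega>) - P (X N n \<omega>))"
          unfolding d_def R_def P_def rate_def t_Suc
          using t_in[of n] t_in[of "Suc n"] n by (intro v_step y \<Delta>) (auto simp: t_Suc)
        then show "\<bar>weight N n \<omega> * (d (X N n \<omega>) * R (X N n \<omega>) - v (t n) (X N n \<omega>))\<bar> \<le>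
            E * (C * \<Delta> * (exp (C * \<Delta>) * Psi M (X N n \<omega>) - P (X N n \<omega>)))"
          unfolding abs_mult using weight_pos[of N n \<omega>] w_le[of n \<omega>] n by (intro mult_mono) (auto simp: E_def)
      qed
      also have "\<dots> = E * (C * \<Delta> * (exp (C * \<Delta>) * a n - a (Suc n)))"
        unfolding a_Suc a_def[of n] using Psi_int[of n] P_int[of n] by simp
      finally show ?thesis .
    qed
    have "(\<integral>\<omega>. u N \<omega> \<partial>Q) - (\<integral>\<omega>. u 0 \<omega> \<partial>Q) = (\<Sum>n<N. (\<integral>\<omega>. u (Suc n) \<omega> \<partial>Q) - (\<integral>\<omega>. u n \<omega> \<partial>Q))"
      by (rule sum_lessThan_telescope[symmetric])
    then have "\<bar>(\<integral>\<omega>. u N \<omega> \<partial>Q) - (\<integral>\<omega>. u 0 \<omega> \<partial>Q)\<bar> = \<bar>\<Sum>n<N. (\<integral>\<omega>. u (Suc n) \<omega> \<partial>Q) - (\<integral>\<omega>. u n \<omega> \<partial>Q)\<bar>"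
      by (rule arg_cong)
    also have "\<dots> \<le> (\<Sum>n<N. E * (C * \<Delta> * (exp (C * \<Delta>) * a n - a (Suc n))))"
      by (rule order_trans[OF sum_abs sum_mono]) (use incr in auto)
    \<comment> \<open>The differences of \<open>a\<close> telescope to \<open>a 0 - a N\<close>, at
      most \<open>Psi M x0\<close>; the remaining summands are of size \<Delta> each and there are
      \<open>N\<close> of them.\<close>
    also have "\<dots> = E * (C * \<Delta> * (\<Sum>n<N. (exp (C * \<Delta>) - 1) * a n - (a (Suc n) - a n)))"
      by (simp add: sum_distrib_left algebra_simps)
    also have "(\<Sum>n<N. (exp (C * \<Delta>) - 1) * a n - (a (Suc n) - a n)) = (\<Sum>n<N. (exp (C * \<Delta>) - 1) * a n) - (a N - a 0)"
      by (subst sum_subtractf) (simp only: sum_lessThan_telescope)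
    also have "E * (C * \<Delta> * ((\<Sum>n<N. (exp (C * \<Delta>) - 1) * a n) - (a N - a 0))) \<le> K * T / N"
    proof -
      have ex: "exp (C * \<Delta>) - 1 \<le> C * \<Delta> * exp (C * T)"
      proof -
        have "1 + - (C * \<Delta>) \<le> exp (- (C * \<Delta>))" by (rule exp_ge_add_one_self)
        then have "exp (C * \<Delta>) * (1 + - (C * \<Delta>)) \<le> exp (C * \<Delta>) * exp (- (C * \<Delta>))" by (intro mult_left_mono) auto
        then have "exp (C * \<Delta>) - 1 \<le> C * \<Delta> * exp (C * \<Delta>)" by (simp add: exp_minus algebra_simps)
        also have "\<dots> \<le> C * \<Delta> * exp (C * T)" using C \<Delta> by (intro mult_left_mono) (auto intro: mult_left_mono)
        finally show ?thesis .
      qed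
      have "(\<Sum>n<N. (exp (C * \<Delta>) - 1) * a n) \<le> (\<Sum>n<N. C * \<Delta> * exp (C * T) * (exp (C * T) * Psi M x0))"
      proof (rule sum_mono)
        fix n assume "n \<in> {..<N}"
        then have "t n \<le> T" using t_in[of n] by simp
        then have "exp (C * t n) * Psi M x0 \<le> exp (C * T) * Psi M x0"
          using C Psi_ge[OF x0, of M] by (intro mult_right_mono) (auto intro: mult_left_mono)
        then have "a n \<le> exp (C * T) * Psi M x0" using a_le[of n] by linarith
        then show "(exp (C * \<Delta>) - 1) * a n \<le> C * \<Delta> * exp (C * T) * (exp (C * T) * Psi M x0)"
          using ex a_nonneg[of n] C \<Delta> by (intro mult_mono) auto
      qed
      also have "\<dots> = C * (real N * \<Delta>) * exp (C * T) * (exp (C * T) * Psi M x0)" by simp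
      also have "\<dots> = C * T * exp (C * T) * (exp (C * T) * Psi M x0)" by (simp only: N\<Delta>)
      finally have s: "(\<Sum>n<N. (exp (C * \<Delta>) - 1) * a n) - (a N - a 0) \<le>
          C * T * exp (C * T) * (exp (C * T) * Psi M x0) + Psi M x0"
        using a_nonneg[of N] by (simp add: a_def X_0 Q.prob_space)
      have "E * (C * \<Delta> * ((\<Sum>n<N. (exp (C * \<Delta>) - 1) * a n) - (a N - a 0))) \<le>
          E * (C * \<Delta> * (C * T * exp (C * T) * (exp (C * T) * Psi M x0) + Psi M x0))"
        using s C \<Delta> by (intro mult_left_mono) (auto simp: E_def)
      also have "\<dots> = K * T / N" by (simp add: K_def \<Delta>_def)
      finally show ?thesis .
    qed
    finally have err: "\<bar>(\<integral>\<omega>. u N \<omega> \<partial>Q) - (\<integral>\<omega>. u 0 \<omega> \<partial>Q)\<bar> \<le> K * T / N" .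
    have "(\<integral>\<omega>. u 0 \<omega> \<partial>Q) = v 0 x0" by (simp add: u_def weight_def X_0 t_def Q.prob_space)
    moreover have "u N \<omega> = weight N N \<omega> * v T (X N N \<omega>)" for \<omega> by (simp add: u_def t_def N\<Delta>)
    ultimately show ?thesis using err u_int[of N] by (simp add: u_def [abs_def] t_def N\<Delta>)
  qed
  show thesis by (rule that[of K]) (use main in auto)
qed

end

section \<open>Boundary behaviour of functions of the class H\<close>

lemma ival_infinity: "ival \<infinity> = {0<..}"
  by (auto simp: ival_def)

lemma ival_real: "ival (ereal R) = {0<..<R}"
  by (auto simp: ival_def)

lemma ival_cases:
  assumes "0 < r"
  obtains "r = \<infinity>" "ival r = {0<..}" | R where "r = ereal R" "0 < R" "ival r = {0<..<R}"
  using assms by (cases r) (auto simp: ival_infinity ival_real)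

lemma open_ival: "0 < r \<Longrightarrow> open (ival r)" and convex_ival: "0 < r \<Longrightarrow> convex (ival r)"
  by (cases r rule: ival_cases; simp)+

lemma Ck_on_deriv:
  assumes "Ck_on k S f" "open S" "j < k" "x \<in> S"
  shows "((deriv ^^ j) f has_real_derivative (deriv ^^ Suc j) f x) (at x)"
proof -
  have "(deriv ^^ j) f differentiable (at x)"
    using assms by (auto simp: Ck_on_def differentiable_on_eq_differentiable_at)
  then show ?thesis by (simp add: DERIV_deriv_iff_real_differentiable)
qed

lemma Ck_on_cont: "Ck_on k S f \<Longrightarrow> j \<le> k \<Longrightarrow> continuous_on S ((deriv ^^ j) f)"
  by (simp add: Ck_on_def)

text \<open>On \<open>(0,r)\<close> the potential density is \<open>min x y - x y / r\<close>, which is visibly concave in \<open>x\<close>.\<close>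

lemma class_H_concave:
  assumes r: "0 < r" and H: "class_H r \<sigma> h"
  shows "convex_on (ival r) (\<lambda>x. - h x)"
    and "\<exists>c. \<forall>x\<in>ival r. h x \<le> c * x \<and> (r < \<infinity> \<longrightarrow> h x \<le> c * (real_of_ereal r - x))"
proof -
  have "convex_on (ival r) (\<lambda>x. - h x) \<and>
    (\<exists>c. \<forall>x\<in>ival r. h x \<le> c * x \<and> (r < \<infinity> \<longrightarrow> h x \<le> c * (real_of_ereal r - x)))"
  proof (cases "class_H0 r \<sigma> h")
    case False
    then have "r = \<infinity>" and h: "\<And>x. x \<in> ival r \<Longrightarrow> h x = x" using H by (auto simp: class_H_def)
    moreover have "convex_on (ival r) (\<lambda>x. - h x)"
    proof (rule convex_onI)
      fix t x y :: real assume a: "0 < t" "t < 1" "x \<in> ival r" "y \<in> ival r"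
      have "(1 - t) *\<^sub>R x + t *\<^sub>R y \<in> ival r" using a convex_ival[OF r] by (simp add: convex_def)
      then show "- h ((1 - t) *\<^sub>R x + t *\<^sub>R y) \<le> (1 - t) * - h x + t * - h y"
        using a by (simp add: h)
    qed (rule convex_ival[OF r])
    ultimately show ?thesis by (auto intro!: exI[of _ 1])
  next
    case True
    define m where "m = speed_measure r \<sigma>"
    define I where "I = ival r"
    define k where "k = potential_density r"
    obtain f where f: "continuous_on I f" "\<And>y. y \<in> I \<Longrightarrow> 0 < f y"
      "set_integrable m I f" "set_integrable m I (\<lambda>y. y * f y)"
      and h: "\<And>x. x \<in> I \<Longrightarrow> h x = (LINT y:I|m. k x y * f y)"
      using True unfolding class_H0_def m_def I_def k_def by blast
    have kk: "(0 \<le> k x y \<and> k x y \<le> x \<and> k x y \<le> y \<and> (r < \<infinity> \<longrightarrow> k x y \<le> (real_of_ereal r - x) * (y / real_of_ereal r))) \<and>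
        (\<forall>t x'. 0 < t \<and> t < 1 \<and> x' \<in> I \<longrightarrow> (1 - t) * k x y + t * k x' y \<le> k ((1 - t) * x + t * x') y)"
        if xy: "x \<in> I" "y \<in> I" for x y
        using r
      proof (cases r rule: ival_cases)
        case 1
        have "(1 - t) * min x y + t * min x' y \<le> min ((1 - t) * x + t * x') y" if "0 < t" "t < 1" for t x'
        proof -
          have "(1 - t) * min x y \<le> (1 - t) * x" "(1 - t) * min x y \<le> (1 - t) * y"
            "t * min x' y \<le> t * x'" "t * min x' y \<le> t * y" using that by (auto intro!: mult_left_mono)
          then show ?thesis by (auto simp: algebra_simps)
        qed
        then show ?thesis using xy 1 by (auto simp: k_def potential_density_def I_def)
      next
        case (2 R)
        have k_eq: "k u y = min u y - u * y / R" if "u \<in> I" for u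
        proof -
          have "min u y * max u y = u * y" by (auto simp: min_def max_def)
          then show ?thesis using 2 by (simp add: k_def potential_density_def algebra_simps)
        qed
        have b: "0 < x" "x < R" "0 < y" "y < R" using xy 2 by (auto simp: I_def)
        have s1: "x * y / R \<le> x" "x * y / R \<le> y" "0 \<le> x * y / R" using b 2 by (auto simp: field_simps)
        have "min x y - x * y / R \<le> (R - x) * (y / R)" using 2 by (simp add: field_simps min_def)
        moreover have "(1 - t) * k x y + t * k x' y \<le> k ((1 - t) * x + t * x') y"
          if t: "0 < t" "t < 1" "x' \<in> I" for t x'
        proof -
          have "(1 - t) * min x y \<le> (1 - t) * x" "(1 - t) * min x y \<le> (1 - t) * y"
            "t * min x' y \<le> t * x'" "t * min x' y \<le> t * y" using t by (auto intro!: mult_left_mono)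
          then have 1: "(1 - t) * min x y + t * min x' y \<le> min ((1 - t) * x + t * x') y" by (auto simp: algebra_simps)
          have in_I: "(1 - t) * x + t * x' \<in> I"
            using xy t convex_ival[OF r] unfolding I_def convex_def by (metis (no_types, lifting) I_def diff_add_cancel
                diff_gt_0_iff_gt less_imp_le real_scaleR_def)
          have "((1 - t) * x + t * x') * y / R = (1 - t) * (x * y / R) + t * (x' * y / R)"
            by (simp add: distrib_right add_divide_distrib)
          then show ?thesis
            unfolding k_eq[OF xy(1)] k_eq[OF t(3)] k_eq[OF in_I] right_diff_distrib using 1 by linarith
        qed
        ultimately show ?thesis using k_eq[OF xy(1)] s1 2 by (auto simp: min_def)
      qed
    have k_bounds: "0 \<le> k x y" "k x y \<le> x" "k x y \<le> y" if "x \<in> I" "y \<in> I" for x y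
      using kk[OF that] by blast+
    have k_upper: "k x y \<le> (real_of_ereal r - x) * (y / real_of_ereal r)" if "x \<in> I" "y \<in> I" "r < \<infinity>" for x y
      using kk[OF that(1,2)] that(3) by blast
    have k_concave: "(1 - t) * k x y + t * k x' y \<le> k ((1 - t) * x + t * x') y"
      if "0 < t" "t < 1" "x \<in> I" "x' \<in> I" "y \<in> I" for t x x' y
      using kk[OF that(3,5)] that by blast
    have k_meas: "k x \<in> borel_measurable borel" for x
      unfolding k_def potential_density_def [abs_def] by measurable
    have sets_m: "sets m = sets borel" by (simp add: m_def speed_measure_def)
    have int: "set_integrable m I (\<lambda>y. k x y * f y)" if x: "x \<in> I" for x
      unfolding set_integrable_def
    proof (rule Bochner_Integration.integrable_bound[OF f(4)[unfolded set_integrable_def]])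
      have "(\<lambda>y. indicator I y *\<^sub>R f y) \<in> borel_measurable m"
        using f(3) unfolding set_integrable_def by (rule borel_measurable_integrable)
      moreover have "k x \<in> borel_measurable m" using k_meas sets_m by (simp cong: measurable_cong_sets)
      ultimately have "(\<lambda>y. k x y * (indicator I y *\<^sub>R f y)) \<in> borel_measurable m" by measurable
      then show "(\<lambda>y. indicator I y *\<^sub>R (k x y * f y)) \<in> borel_measurable m" by (simp add: mult_ac)
      show "AE y in m. norm (indicator I y *\<^sub>R (k x y * f y)) \<le> norm (indicator I y *\<^sub>R (y * f y))"
      proof (rule AE_I2)
        fix y
        show "norm (indicator I y *\<^sub>R (k x y * f y)) \<le> norm (indicator I y *\<^sub>R (y * f y))"
        proof (cases "y \<in> I")
          case True
          then have "\<bar>k x y\<bar> \<le> \<bar>y\<bar>" using k_bounds[OF x True] by simp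
          with True show ?thesis by (simp add: abs_mult mult_right_mono)
        qed simp
      qed
    qed
    have conv: "convex_on I (\<lambda>x. - h x)"
    proof (rule convex_onI)
      fix t x y :: real assume a: "0 < t" "t < 1" "x \<in> I" "y \<in> I"
      have z: "(1 - t) * x + t * y \<in> I"
        using a convexD[OF convex_ival[OF r], of x y "1 - t" t] by (simp add: I_def)
      have "(1 - t) * h x + t * h y = (LINT w:I|m. (1 - t) * (k x w * f w)) + (LINT w:I|m. t * (k y w * f w))"
        using h a by simp
      also have "\<dots> = (LINT w:I|m. (1 - t) * (k x w * f w) + t * (k y w * f w))"
        using int a by (intro set_integral_add(2)[symmetric] set_integrable_mult_right) auto
      also have "\<dots> \<le> (LINT w:I|m. k ((1 - t) * x + t * y) w * f w)"
      proof (rule set_integral_mono)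
        fix w assume w: "w \<in> I"
        have "((1 - t) * k x w + t * k y w) * f w \<le> k ((1 - t) * x + t * y) w * f w"
          using k_concave[OF a w] f(2)[OF w] by (intro mult_right_mono) auto
        then show "(1 - t) * (k x w * f w) + t * (k y w * f w) \<le> k ((1 - t) * x + t * y) w * f w"
          by (simp add: algebra_simps)
      qed (use int a z in \<open>auto intro!: set_integral_add(1) set_integrable_mult_right\<close>)
      also have "\<dots> = h ((1 - t) * x + t * y)" using h z by simp
      finally show "- h ((1 - t) *\<^sub>R x + t *\<^sub>R y) \<le> (1 - t) * - h x + t * - h y" by simp
    qed (use convex_ival[OF r] in \<open>simp add: I_def\<close>)
    \<comment> \<open>\<open>k x y \<le> x\<close> gives the slope \<open>c1\<close> at 0, and the
      bound of \<open>k x y\<close> by \<open>r - x\<close> times \<open>y / r\<close> gives the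
      slope \<open>c2\<close> at a finite \<open>r\<close>. The two integrals are those that
      membership in the class makes finite. For \<open>r = \<infinity>\<close> the divisor is 0, so
      \<open>c2\<close> is 0.\<close>
    define c1 c2 c where "c1 = (LINT y:I|m. f y)" and "c2 = (LINT y:I|m. y * f y) / real_of_ereal r"
      and "c = max c1 c2"
    have "h x \<le> c * x \<and> (r < \<infinity> \<longrightarrow> h x \<le> c * (real_of_ereal r - x))" if x: "x \<in> I" for x
    proof
      have x0: "0 < x" using x by (simp add: I_def ival_def)
      have "h x \<le> (LINT y:I|m. x * f y)" unfolding h[OF x]
      proof (rule set_integral_mono[OF int[OF x]])
        show "k x y * f y \<le> x * f y" if "y \<in> I" for y
          using k_bounds(2)[OF x that] f(2)[OF that] by (intro mult_right_mono) auto
      qed (use f(3) in auto)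
      also have "\<dots> = c1 * x" by (simp add: c1_def)
      also have "\<dots> \<le> c * x" using x0 by (intro mult_right_mono) (auto simp: c_def)
      finally show "h x \<le> c * x" .
      show "r < \<infinity> \<longrightarrow> h x \<le> c * (real_of_ereal r - x)"
      proof
        assume fin: "r < \<infinity>"
        have xr: "x < real_of_ereal r" using x fin r by (cases r) (auto simp: I_def ival_def)
        have "h x \<le> (LINT y:I|m. ((real_of_ereal r - x) / real_of_ereal r) * (y * f y))" unfolding h[OF x]
        proof (rule set_integral_mono[OF int[OF x]])
          show "k x y * f y \<le> ((real_of_ereal r - x) / real_of_ereal r) * (y * f y)" if "y \<in> I" for y
            using mult_right_mono[OF k_upper[OF x that fin], of "f y"] f(2)[OF that] by simp
        qed (use f(4) in auto)
        also have "\<dots> = c2 * (real_of_ereal r - x)" by (simp only: set_integral_mult_right) (simp add: c2_def)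
        also have "\<dots> \<le> c * (real_of_ereal r - x)" using xr by (intro mult_right_mono) (auto simp: c_def)
        finally show "h x \<le> c * (real_of_ereal r - x)" .
      qed
    qed
    then show ?thesis using conv unfolding I_def by blast
  qed
  then show "convex_on (ival r) (\<lambda>x. - h x)"
    and "\<exists>c. \<forall>x\<in>ival r. h x \<le> c * x \<and> (r < \<infinity> \<longrightarrow> h x \<le> c * (real_of_ereal r - x))" by blast+
qed

section \<open>Slopes and boundary behaviour of positive concave functions\<close>

locale positive_concave =
  fixes r :: ereal and h h1 h2 :: "real \<Rightarrow> real" and c x1 :: real
  assumes r_pos: "0 < r" and x1: "x1 \<in> ival r"
    and dh: "x \<in> ival r \<Longrightarrow> (h has_real_derivative h1 x) (at x)"
    and dh1: "x \<in> ival r \<Longrightarrow> (h1 has_real_derivative h2 x) (at x)"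
    and h_pos: "x \<in> ival r \<Longrightarrow> 0 < h x"
    and concave: "convex_on (ival r) (\<lambda>x. - h x)"
    and h_left: "x \<in> ival r \<Longrightarrow> h x \<le> c * x"
    and h_right: "x \<in> ival r \<Longrightarrow> r < \<infinity> \<Longrightarrow> h x \<le> c * (real_of_ereal r - x)"
begin

lemma tangent:
  assumes "x \<in> ival r" "y \<in> ival r"
  shows "h y - h x \<le> h1 x * (y - x)"
proof -
  have "- h y - - h x \<ge> - h1 x * (y - x)"
  proof (rule convex_on_imp_above_tangent[OF concave])
    show "connected (ival r)" using convex_ival[OF r_pos] by (rule convex_connected)
    show "x \<in> interior (ival r)" using assms open_ival[OF r_pos] by (simp add: interior_open)
    show "((\<lambda>x. - h x) has_real_derivative - h1 x) (at x within ival r)"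
      by (rule has_field_derivative_at_within[OF DERIV_minus[OF dh[OF assms(1)]]])
  qed (rule assms)
  then show ?thesis by simp
qed

lemma h1_antimono:
  assumes "x \<in> ival r" "y \<in> ival r" "x \<le> y"
  shows "h1 y \<le> h1 x"
proof (cases "x = y")
  case False
  have "h1 y * (y - x) \<le> h1 x * (y - x)" using tangent[OF assms(1,2)] tangent[OF assms(2,1)]
    by (simp add: algebra_simps)
  then show ?thesis using False assms(3) by simp
qed simp

lemma h2_nonpos: "x \<in> ival r \<Longrightarrow> h2 x \<le> 0"
proof -
  assume x: "x \<in> ival r"
  have "0 \<le> - h2 x"
  proof (rule mono_on_imp_deriv_nonneg)
    show "mono_on (ival r) (\<lambda>x. - h1 x)" by (auto intro!: mono_onI h1_antimono)
    show "((\<lambda>x. - h1 x) has_real_derivative - h2 x) (at x)" by (rule DERIV_minus[OF dh1[OF x]])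
    show "x \<in> interior (ival r)" using x open_ival[OF r_pos] by (simp add: interior_open)
  qed
  then show ?thesis by simp
qed

lemma ival_pos: "x \<in> ival r \<Longrightarrow> 0 < x" by (simp add: ival_def)

lemma ival_smaller: "x \<in> ival r \<Longrightarrow> 0 < y \<Longrightarrow> y \<le> x \<Longrightarrow> y \<in> ival r"
  using order.strict_trans1[of "ereal y" "ereal x" r] by (simp add: ival_def)

text \<open>The tangent at \<open>x\<close> lies above \<open>h\<close>, which is positive near 0,
  so its value at 0 is nonnegative. As 0 is outside the interval, it is approached with an error
  \<open>e\<close>.\<close>

lemma x_h1_le:
  assumes x: "x \<in> ival r"
  shows "x * h1 x \<le> h x"
proof (rule field_le_epsilon)
  fix e :: real assume e: "0 < e"
  have x0: "0 < x" by (rule ival_pos[OF x])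
  define y where "y = min x (e / (1 + \<bar>h1 x\<bar>))"
  have y0: "0 < y" using x0 e by (simp add: y_def)
  have y: "y \<in> ival r" by (rule ival_smaller[OF x y0]) (simp add: y_def)
  have "y * \<bar>h1 x\<bar> \<le> e / (1 + \<bar>h1 x\<bar>) * \<bar>h1 x\<bar>" by (intro mult_right_mono) (auto simp: y_def)
  also have "\<dots> \<le> e" using e by (simp add: field_simps)
  finally have "y * h1 x \<le> e" using y0 by (smt (verit, best) mult_left_mono)
  moreover have "- h x \<le> h1 x * (y - x)" using tangent[OF x y] h_pos[OF y] by linarith
  ultimately show "x * h1 x \<le> h x + e" by (simp add: algebra_simps)
qed

text \<open>On an unbounded interval a tangent of negative slope would reach 0 at a finite point of
  the interval, where \<open>h\<close> is positive. On a bounded one the tangent is nonnegative at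
  the right end point, as in \<open>x_h1_le\<close> at the left.\<close>

lemma h1_lower:
  assumes x: "x \<in> ival r"
  shows "r = \<infinity> \<Longrightarrow> 0 \<le> h1 x" "r < \<infinity> \<Longrightarrow> (real_of_ereal r - x) * - h1 x \<le> h x"
proof -
  have x0: "0 < x" by (rule ival_pos[OF x])
  show "0 \<le> h1 x" if inf: "r = \<infinity>"
  proof (rule ccontr)
    assume neg: "\<not> 0 \<le> h1 x"
    define y where "y = x + h x / - h1 x"
    have "0 < h x / - h1 x" using neg h_pos[OF x] by (intro divide_pos_pos) auto
    then have y: "y \<in> ival r" using x0 by (simp add: inf ival_infinity y_def)
    have "h1 x * (y - x) = - h x" using neg by (simp add: y_def)
    then show False using tangent[OF x y] h_pos[OF y] by linarith
  qed
  show "(real_of_ereal r - x) * - h1 x \<le> h x" if fin: "r < \<infinity>"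
  proof (rule field_le_epsilon)
    fix e :: real assume e: "0 < e"
    obtain R where R: "r = ereal R" using fin r_pos by (cases r) auto
    have xR: "x < R" using x by (simp add: R ival_real)
    define d where "d = min ((R - x) / 2) (e / (1 + \<bar>h1 x\<bar>))"
    have "d \<le> (R - x) / 2" unfolding d_def by (rule min.cobounded1)
    moreover have "(R - x) / 2 < R - x" using xR by (simp add: field_simps)
    ultimately have d: "d < R - x" by (rule order.strict_trans1)
    have d0: "0 < d" using xR e by (simp add: d_def)
    have y: "R - d \<in> ival r" using d d0 x0 by (simp add: R ival_real)
    have "d * \<bar>h1 x\<bar> \<le> e / (1 + \<bar>h1 x\<bar>) * \<bar>h1 x\<bar>" by (intro mult_right_mono) (auto simp: d_def)
    also have "\<dots> \<le> e" using e by (simp add: field_simps)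
    finally have "- (d * h1 x) \<le> e" using d0 by (smt (verit, best) mult_left_mono mult_minus_right)
    moreover have "- h x \<le> h1 x * (R - d - x)" using tangent[OF x y] h_pos[OF y] by linarith
    ultimately show "(real_of_ereal r - x) * - h1 x \<le> h x + e" by (simp add: R algebra_simps)
  qed
qed

lemma c_pos: "0 < c"
  using h_left[OF x1] h_pos[OF x1] ival_pos[OF x1] by (smt (verit) mult_nonpos_nonneg)

lemma h1_abs: "x \<in> ival r \<Longrightarrow> \<bar>h1 x\<bar> \<le> c"
proof -
  assume x: "x \<in> ival r"
  have x0: "0 < x" by (rule ival_pos[OF x])
  have "x * h1 x \<le> x * c" using x_h1_le[OF x] h_left[OF x] by (simp add: mult.commute)
  then have u: "h1 x \<le> c" using x0 by simp
  have "- h1 x \<le> c"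
    using r_pos
  proof (cases r rule: ival_cases)
    case 1
    then show ?thesis using h1_lower(1)[OF x] c_pos by simp
  next
    case (2 R)
    have "(R - x) * - h1 x \<le> (R - x) * c"
      using h1_lower(2)[OF x] h_right[OF x] 2 by (simp add: mult.commute)
    moreover have "0 < R - x" using x 2 by simp
    ultimately show ?thesis by (simp only: mult_le_cancel_left_pos)
  qed
  then show ?thesis using u by simp
qed

text \<open>The tangent at \<open>x\<close> must climb by at least \<open>h x1 / 2\<close> up to the
  reference point \<open>x1\<close>, over a distance of at most \<open>l\<close>. If
  \<open>r = \<infinity>\<close>, such an \<open>x\<close> lies to the left of \<open>x1\<close>, as
  \<open>h\<close> is then nondecreasing.\<close>

lemma steep_near_boundary:
  obtains l where "0 < l" "\<And>x. x \<in> ival r \<Longrightarrow> h x \<le> h x1 / 2 \<Longrightarrow> h x1 / (2 * l) \<le> \<bar>h1 x\<bar>"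
proof -
  define l where "l = (if r = \<infinity> then x1 else real_of_ereal r)"
  have e: "0 < h x1" "0 < x1" using h_pos[OF x1] ival_pos[OF x1] by auto
  have l: "0 < l" using e r_pos by (cases r) (auto simp: l_def)
  have "h x1 / (2 * l) \<le> \<bar>h1 x\<bar>" if x: "x \<in> ival r" and small: "h x \<le> h x1 / 2" for x
  proof -
    have t: "h x1 / 2 \<le> h1 x * (x1 - x)" using tangent[OF x x1] small by linarith
    have "\<bar>x1 - x\<bar> \<le> l"
      using r_pos
    proof (cases r rule: ival_cases)
      case 1
      have "x \<le> x1"
      proof (rule ccontr)
        assume "\<not> x \<le> x1"
        then have "h1 x * (x1 - x) \<le> 0" using h1_lower(1)[OF x 1(1)] by (intro mult_nonneg_nonpos) auto
        then show False using t e by linarith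
      qed
      then show ?thesis using 1 ival_pos[OF x] by (simp add: l_def)
    next
      case (2 R)
      then show ?thesis using x x1 by (auto simp: l_def abs_le_iff)
    qed
    then have "\<bar>h1 x\<bar> * \<bar>x1 - x\<bar> \<le> \<bar>h1 x\<bar> * l" by (intro mult_left_mono) auto
    moreover have "h1 x * (x1 - x) \<le> \<bar>h1 x\<bar> * \<bar>x1 - x\<bar>" by (metis abs_ge_self abs_mult)
    ultimately have "h x1 / 2 \<le> \<bar>h1 x\<bar> * l" using t by linarith
    then show ?thesis using l by (simp add: field_simps)
  qed
  then show thesis using that l by blast
qed

lemma nondegenerate:
  obtains K where "0 < K" "\<And>x. x \<in> ival r \<Longrightarrow> 1 \<le> K * ((h x)\<^sup>2 + (h1 x)\<^sup>2)"
proof -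
  obtain l where l: "0 < l" "\<And>x. x \<in> ival r \<Longrightarrow> h x \<le> h x1 / 2 \<Longrightarrow> h x1 / (2 * l) \<le> \<bar>h1 x\<bar>"
    using steep_near_boundary by blast
  have e: "0 < h x1" by (rule h_pos[OF x1])
  define d where "d = min (h x1 / 2) (h x1 / (2 * l))"
  have d: "0 < d" using e l by (simp add: d_def)
  show thesis
  proof (rule that[of "1 / d\<^sup>2"])
    fix x assume x: "x \<in> ival r"
    have "d\<^sup>2 \<le> (h x)\<^sup>2 + (h1 x)\<^sup>2"
    proof (cases "h x \<le> h x1 / 2")
      case True
      then have "d \<le> \<bar>h1 x\<bar>" using l(2)[OF x] by (simp add: d_def)
      then have "d\<^sup>2 \<le> \<bar>h1 x\<bar>\<^sup>2" using d by (intro power_mono) auto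
      then show ?thesis by (simp add: add_increasing)
    next
      case False
      then have "d\<^sup>2 \<le> (h x)\<^sup>2" using d by (intro power_mono) (auto simp: d_def)
      then show ?thesis by (simp add: add_increasing2)
    qed
    then show "1 \<le> 1 / d\<^sup>2 * ((h x)\<^sup>2 + (h1 x)\<^sup>2)" using d by simp
  qed (use d in simp)
qed

text \<open>On an unbounded interval \<open>h\<close> is nondecreasing, so beyond \<open>x1\<close>
  it stays above \<open>h x1\<close>. On a bounded one \<open>R\<close> is the right end point, and
  no point of the interval lies beyond it.\<close>

lemma h_far:
  obtains R \<delta> where "0 \<le> R" "0 < \<delta>" "\<And>x. x \<in> ival r \<Longrightarrow> R < x \<Longrightarrow> \<delta> \<le> h x"
  using r_pos
proof (cases r rule: ival_cases)
  case 1
  have "h x1 \<le> h x" if "x \<in> ival r" "x1 < x" for x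
  proof -
    have "h1 x * (x1 - x) \<le> 0" using h1_lower(1)[OF that(1) 1(1)] that(2) by (intro mult_nonneg_nonpos) auto
    then show ?thesis using tangent[OF that(1) x1] by linarith
  qed
  then show thesis using that[of x1 "h x1"] h_pos[OF x1] ival_pos[OF x1] by auto
next
  case (2 R)
  then show thesis using that[of R 1] by auto
qed

text \<open>At both ends the drift \<open>h1 / h\<close> has the size of the inverse distance to the boundary.\<close>

lemma resolvent_surj:
  assumes s: "0 < s"
  shows "\<exists>x\<in>ival r. x - s * (h1 x / h x) = z"
proof -
  have e: "0 < h x1" "0 < x1" using h_pos[OF x1] ival_pos[OF x1] by auto
  have half: "h x \<le> h x1 / 2" if "x \<in> ival r" "h x \<le> c * d" "d \<le> h x1 / (2 * c)" for x d
  proof -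
    have "c * d \<le> c * (h x1 / (2 * c))" using that c_pos by (intro mult_left_mono) auto
    then show ?thesis using that c_pos by simp
  qed
  define f where "f x = x - s * (h1 x / h x)" for x
  have low: "\<exists>a\<in>ival r. f a \<le> z \<and> a \<le> x1"
  proof -
    \<comment> \<open>Near 0 the slope is at least \<open>h x1 / (2 * x1)\<close> and
      \<open>h x \<le> c * x\<close>, so the drift is at least \<open>k / x\<close>. The bounds in
      the minimum keep \<open>x\<close> in the interval, make \<open>h x\<close> small, make
      \<open>x\<close> itself at most 1, and make \<open>s * k / x\<close> at least
      \<open>1 + \<bar>z\<bar>\<close>.\<close>
    define k where "k = h x1 / (2 * x1) / c"
    have k: "0 < k" using e c_pos by (simp add: k_def)
    define x where "x = Min {x1, h x1 / (2 * c), 1, s * k / (1 + \<bar>z\<bar>)}"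
    have x0: "0 < x" using e c_pos s k by (simp add: x_def)
    have xle: "x \<le> x1" "x \<le> h x1 / (2 * c)" "x \<le> 1" "x \<le> s * k / (1 + \<bar>z\<bar>)" by (simp_all add: x_def)
    have x: "x \<in> ival r" by (rule ival_smaller[OF x1 x0 xle(1)])
    have hx: "0 < h x" "h x \<le> c * x" using h_pos[OF x] h_left[OF x] by auto
    have "h x1 / 2 \<le> h1 x * (x1 - x)" using tangent[OF x x1] half[OF x hx(2) xle(2)] by linarith
    moreover have "0 \<le> h1 x"
      using calculation e xle(1) by (smt (verit, best) divide_pos_pos mult_nonpos_nonneg)
    then have "h1 x * (x1 - x) \<le> h1 x * x1" using x0 by (intro mult_left_mono) auto
    ultimately have "h x1 / (2 * x1) \<le> h1 x" using e by (simp add: field_simps)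
    moreover have "0 \<le> h x1 / (2 * x1)" using e by simp
    ultimately have "h x1 / (2 * x1) / (c * x) \<le> h1 x / h x" using hx by (intro frac_le) linarith+
    then have L: "k / x \<le> h1 x / h x" by (simp add: k_def)
    have "(1 + \<bar>z\<bar>) * x \<le> s * k" using xle(4) by (simp add: field_simps)
    then have "1 + \<bar>z\<bar> \<le> s * (k / x)" using x0 by (simp add: field_simps)
    also have "\<dots> \<le> s * (h1 x / h x)" using L s by (intro mult_left_mono) auto
    finally have "f x \<le> z" using xle(3) by (simp add: f_def)
    then show ?thesis using x xle(1) by blast
  qed
  have high: "\<exists>b\<in>ival r. z \<le> f b \<and> x1 \<le> b"
    using r_pos
  proof (cases r rule: ival_cases)
    case 1
    \<comment> \<open>Beyond 1 the inequality \<open>x * h1 x \<le> h x\<close> bounds the drift by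
      1, so the resolvent equation shifts \<open>x\<close> by at most \<open>s\<close>.\<close>
    define x where "x = Max {x1, 1, z + s}"
    have xge: "x1 \<le> x" "1 \<le> x" "z + s \<le> x" by (simp_all add: x_def)
    have x: "x \<in> ival r" using xge 1 by simp
    have "1 * h1 x \<le> x * h1 x" using xge(2) h1_lower(1)[OF x 1(1)] by (rule mult_right_mono)
    then have "h1 x / h x \<le> 1" using x_h1_le[OF x] h_pos[OF x] by (simp add: divide_le_eq_1)
    then have "s * (h1 x / h x) \<le> s * 1" using s by (intro mult_left_mono) auto
    then have "z \<le> f x" using xge(3) by (simp add: f_def)
    then show ?thesis using x xge by blast
  next
    case (2 R)
    have x1R: "x1 < R" using x1 2 by simp
    define k where "k = h x1 / (2 * (R - x1)) / c"
    have k: "0 < k" using e c_pos x1R by (simp add: k_def)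
    define d where "d = Min {R - x1, h x1 / (2 * c), s * k / (1 + \<bar>z\<bar>)}"
    have d0: "0 < d" using e c_pos s k x1R by (simp add: d_def)
    have dle: "d \<le> R - x1" "d \<le> h x1 / (2 * c)" "d \<le> s * k / (1 + \<bar>z\<bar>)" by (simp_all add: d_def)
    define x where "x = R - d"
    have x: "x \<in> ival r" using d0 dle e 2 by (simp add: x_def)
    have hx: "0 < h x" "h x \<le> c * d" using h_pos[OF x] h_right[OF x] 2 by (auto simp: x_def)
    have t: "h x1 / 2 \<le> - h1 x * (x - x1)"
      using tangent[OF x x1] half[OF x hx(2) dle(2)] by (simp add: algebra_simps)
    moreover have n: "0 \<le> - h1 x"
      using t e dle(1) by (smt (verit, best) divide_pos_pos mult_nonpos_nonneg x_def)
    then have "- h1 x * (x - x1) \<le> - h1 x * (R - x1)" using d0 by (intro mult_left_mono) (auto simp: x_def)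
    ultimately have "h x1 / (2 * (R - x1)) \<le> - h1 x" using x1R by (simp add: field_simps)
    then have "h x1 / (2 * (R - x1)) / (c * d) \<le> - h1 x / h x" using hx n by (intro frac_le) linarith+
    then have L: "k / d \<le> - h1 x / h x" by (simp add: k_def)
    have "(1 + \<bar>z\<bar>) * d \<le> s * k" using dle(3) by (simp add: field_simps)
    then have "1 + \<bar>z\<bar> \<le> s * (k / d)" using d0 by (simp add: field_simps)
    also have "\<dots> \<le> s * (- h1 x / h x)" using L s by (intro mult_left_mono) auto
    finally have "z \<le> f x" using ival_pos[OF x] by (simp add: f_def)
    then show ?thesis using x dle(1) by (auto simp: x_def)
  qed
  obtain a b where ab: "a \<in> ival r" "b \<in> ival r" "f a \<le> z" "z \<le> f b" "a \<le> b"
    using low high by (meson order_trans)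
  have sub: "{a..b} \<subseteq> ival r"
    using connected_contains_Icc[OF convex_connected[OF convex_ival[OF r_pos]] ab(1,2)] .
  have "continuous_on (ival r) f"
    unfolding f_def
    by (intro continuous_intros DERIV_continuous_on[of _ h h1] DERIV_continuous_on[of _ h1 h2])
       (use h_pos dh dh1 in \<open>auto intro: has_field_derivative_at_within simp: less_imp_neq[symmetric]\<close>)
  then have "continuous_on {a..b} f" using sub by (rule continuous_on_subset)
  from IVT'[OF ab(3-5) this] obtain x where "a \<le> x" "x \<le> b" "f x = z" by blast
  then show ?thesis using sub by (auto simp: f_def)
qed

end

section \<open>Regularity of the coefficients\<close>

text \<open>With the derivatives hidden behind quantifiers, regularity passes through sums and
  products without computing them. \<open>C2_on_derivs\<close> returns to iterated
  \<open>deriv\<close> on open sets.\<close>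

definition C2_on :: "real set \<Rightarrow> (real \<Rightarrow> real) \<Rightarrow> bool" where
  "C2_on S f \<longleftrightarrow> (\<exists>f1 f2. (\<forall>x\<in>S. (f has_real_derivative f1 x) (at x)) \<and>
     (\<forall>x\<in>S. (f1 has_real_derivative f2 x) (at x)) \<and> continuous_on S f2)"

lemma C2_onI:
  assumes "\<And>x. x \<in> S \<Longrightarrow> (f has_real_derivative f1 x) (at x)"
    "\<And>x. x \<in> S \<Longrightarrow> (f1 has_real_derivative f2 x) (at x)" "continuous_on S f2"
  shows "C2_on S f"
  using assms unfolding C2_on_def by blast

lemma C2_onE:
  assumes "C2_on S f"
  obtains f1 f2 where "\<forall>x\<in>S. (f has_real_derivative f1 x) (at x)"
    "\<forall>x\<in>S. (f1 has_real_derivative f2 x) (at x)" "continuous_on S f2"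
    "continuous_on S f1" "continuous_on S f"
proof -
  obtain f1 f2 where f: "\<forall>x\<in>S. (f has_real_derivative f1 x) (at x)"
    "\<forall>x\<in>S. (f1 has_real_derivative f2 x) (at x)" "continuous_on S f2"
    using assms unfolding C2_on_def by blast
  moreover have "continuous_on S f1" "continuous_on S f"
    using f by (auto intro!: DERIV_continuous_on intro: has_field_derivative_at_within)
  ultimately show thesis using that by blast
qed

lemma C2_on_mult:
  assumes "C2_on S f" "C2_on S g"
  shows "C2_on S (\<lambda>x. f x * g x)"
proof -
  obtain f1 f2 where f: "\<forall>x\<in>S. (f has_real_derivative f1 x) (at x)"
    "\<forall>x\<in>S. (f1 has_real_derivative f2 x) (at x)" "continuous_on S f2"
    "continuous_on S f1" "continuous_on S f" by (rule C2_onE[OF assms(1)])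
  obtain g1 g2 where g: "\<forall>x\<in>S. (g has_real_derivative g1 x) (at x)"
    "\<forall>x\<in>S. (g1 has_real_derivative g2 x) (at x)" "continuous_on S g2"
    "continuous_on S g1" "continuous_on S g" by (rule C2_onE[OF assms(2)])
  show ?thesis
  proof (rule C2_onI)
    fix x assume x: "x \<in> S"
    show "((\<lambda>x. f x * g x) has_real_derivative f1 x * g x + f x * g1 x) (at x)"
      by (auto intro!: derivative_eq_intros f(1)[rule_format, OF x] g(1)[rule_format, OF x])
    show "((\<lambda>x. f1 x * g x + f x * g1 x) has_real_derivative f2 x * g x + 2 * (f1 x * g1 x) + f x * g2 x) (at x)"
      by (auto intro!: derivative_eq_intros f(1,2)[rule_format, OF x] g(1,2)[rule_format, OF x])
  qed (intro continuous_intros f g)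
qed

lemma C2_on_add:
  assumes "C2_on S f" "C2_on S g"
  shows "C2_on S (\<lambda>x. f x + g x)"
proof -
  obtain f1 f2 where f: "\<forall>x\<in>S. (f has_real_derivative f1 x) (at x)"
    "\<forall>x\<in>S. (f1 has_real_derivative f2 x) (at x)" "continuous_on S f2"
    "continuous_on S f1" "continuous_on S f" by (rule C2_onE[OF assms(1)])
  obtain g1 g2 where g: "\<forall>x\<in>S. (g has_real_derivative g1 x) (at x)"
    "\<forall>x\<in>S. (g1 has_real_derivative g2 x) (at x)" "continuous_on S g2"
    "continuous_on S g1" "continuous_on S g" by (rule C2_onE[OF assms(2)])
  show ?thesis
    by (rule C2_onI[where ?f1.0 = "\<lambda>x. f1 x + g1 x" and ?f2.0 = "\<lambda>x. f2 x + g2 x"])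
       (use f g in \<open>auto intro!: DERIV_add continuous_intros\<close>)
qed

lemma C2_on_const: "C2_on S (\<lambda>x. c)"
  by (rule C2_onI[where ?f1.0 = "\<lambda>x. 0" and ?f2.0 = "\<lambda>x. 0"]) auto

lemma C2_on_cong:
  assumes "C2_on S f" "open S" "\<And>x. x \<in> S \<Longrightarrow> g x = f x"
  shows "C2_on S g"
proof -
  obtain f1 f2 where f: "\<forall>x\<in>S. (f has_real_derivative f1 x) (at x)"
    "\<forall>x\<in>S. (f1 has_real_derivative f2 x) (at x)" "continuous_on S f2"
    "continuous_on S f1" "continuous_on S f" by (rule C2_onE[OF assms(1)])
  have "(g has_real_derivative f1 x) (at x)" if "x \<in> S" for x
    by (rule has_field_derivative_transform_within_open[OF f(1)[rule_format, OF that] assms(2) that])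
       (simp add: assms(3))
  then show ?thesis using f by (intro C2_onI[of S g f1 f2]) auto
qed

lemma C2_on_derivs:
  assumes "C2_on S f" "open S"
  shows "x \<in> S \<Longrightarrow> (f has_real_derivative deriv f x) (at x)"
    and "x \<in> S \<Longrightarrow> (deriv f has_real_derivative (deriv ^^ 2) f x) (at x)"
    and "continuous_on S ((deriv ^^ 2) f)"
proof -
  obtain f1 f2 where f: "\<forall>x\<in>S. (f has_real_derivative f1 x) (at x)"
    "\<forall>x\<in>S. (f1 has_real_derivative f2 x) (at x)" "continuous_on S f2"
    "continuous_on S f1" "continuous_on S f" by (rule C2_onE[OF assms(1)])
  have d1: "deriv f x = f1 x" if "x \<in> S" for x using f(1)[rule_format, OF that] by (rule DERIV_imp_deriv)
  have D2: "(deriv f has_real_derivative f2 x) (at x)" if "x \<in> S" for x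
    by (rule has_field_derivative_transform_within_open[OF f(2)[rule_format, OF that] assms(2) that])
       (simp add: d1)
  have d2: "(deriv ^^ 2) f x = f2 x" if "x \<in> S" for x
    using DERIV_imp_deriv[OF D2[OF that]] by (simp add: numeral_2_eq_2)
  show "x \<in> S \<Longrightarrow> (f has_real_derivative deriv f x) (at x)" using f(1) d1 by simp
  show "x \<in> S \<Longrightarrow> (deriv f has_real_derivative (deriv ^^ 2) f x) (at x)" using D2 d2 by simp
  show "continuous_on S ((deriv ^^ 2) f)"
    using f(3) by (rule continuous_on_cong[THEN iffD1, rotated 2]) (simp_all add: d2)
qed

lemma Ck_on_C2_on:
  assumes "Ck_on k S f" "open S" "j + 2 \<le> k"
  shows "C2_on S ((deriv ^^ j) f)"
proof (rule C2_onI)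
  show "x \<in> S \<Longrightarrow> ((deriv ^^ j) f has_real_derivative (deriv ^^ Suc j) f x) (at x)" for x
    by (rule Ck_on_deriv[OF assms(1,2)]) (use assms in auto)
  show "x \<in> S \<Longrightarrow> ((deriv ^^ Suc j) f has_real_derivative (deriv ^^ Suc (Suc j)) f x) (at x)" for x
    by (rule Ck_on_deriv[OF assms(1,2)]) (use assms in auto)
  show "continuous_on S ((deriv ^^ Suc (Suc j)) f)"
    by (rule Ck_on_cont[OF assms(1)]) (use assms in auto)
qed

section \<open>Orders of \<open>v\<close> and of the potential\<close>

context concave_weight
begin

text \<open>Derivatives of order 0 have only polynomial growth, so integrating from a fixed interior
  point raises the degree by one and creates no singularity. This recovers bounds for
  \<open>v\<close> and \<open>vt\<close> from those for their first space derivatives.\<close>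

lemma orders_primitive:
  assumes d: "\<And>a x. a \<in> P \<Longrightarrow> x \<in> I \<Longrightarrow> (g a has_real_derivative g' a x) (at x)"
    and g': "orders P 0 g'" and x1: "x1 \<in> I" and K: "\<And>a. a \<in> P \<Longrightarrow> \<bar>g a x1\<bar> \<le> K"
  shows "orders P 0 g"
proof -
  obtain C M where C: "0 \<le> C" "\<And>a x. a \<in> P \<Longrightarrow> x \<in> I \<Longrightarrow> \<bar>g' a x\<bar> \<le> C * (1 + x) ^ M * h x powr (- 0)"
    using ordersE[OF g'] by metis
  have C': "\<bar>g' a x\<bar> \<le> C * (1 + x) ^ M" if "a \<in> P" "x \<in> I" for a x
    using C(2)[OF that] h_nz[OF that(2)] by simp
  show ?thesis
  proof (rule ordersI[where C = "K + C * (1 + x1) ^ Suc M" and M = "Suc M"])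
    fix a x assume a: "a \<in> P" and x: "x \<in> I"
    have x0: "0 < x" "0 < x1" using pos_I x x1 by auto
    have K0: "0 \<le> K" using K[OF a] by linarith
    define B where "B = C * ((1 + x1) * (1 + x)) ^ M"
    have sub: "closed_segment x1 x \<subseteq> I"
      using closed_segment_subset[OF x1 x convex_I] .
    have "norm (g a x - g a x1) \<le> B * norm (x - x1)"
    proof (rule field_differentiable_bound[of "closed_segment x1 x" _ "g' a"])
      fix y assume y: "y \<in> closed_segment x1 x"
      then have yI: "y \<in> I" using sub by blast
      show "(g a has_field_derivative g' a y) (at y within closed_segment x1 x)"
        by (rule has_field_derivative_at_within[OF d[OF a yI]])
      have "1 + y \<le> (1 + x1) * (1 + x)"
      proof -
        have "y \<le> x1 + x" using y x0 by (auto simp: closed_segment_eq_real_ivl split: if_splits)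
        also have "\<dots> \<le> x1 + x + x1 * x" using x0 by simp
        finally show ?thesis by (simp add: algebra_simps)
      qed
      then have "(1 + y) ^ M \<le> ((1 + x1) * (1 + x)) ^ M" using pos_I[OF yI] by (intro power_mono) auto
      then have "C * (1 + y) ^ M \<le> B" using C(1) by (simp add: B_def mult_left_mono)
      then show "norm (g' a y) \<le> B" using C'[OF a yI] by simp
    qed auto
    then have "\<bar>g a x - g a x1\<bar> \<le> B * \<bar>x - x1\<bar>" by simp
    also have "\<dots> \<le> B * ((1 + x1) * (1 + x))"
      using x0 C(1) by (intro mult_left_mono) (auto simp: B_def abs_le_iff algebra_simps intro: add_nonneg_nonneg)
    also have "\<dots> = C * (1 + x1) ^ Suc M * (1 + x) ^ Suc M" by (simp add: B_def power_mult_distrib)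
    finally have "\<bar>g a x\<bar> \<le> K * 1 + C * (1 + x1) ^ Suc M * (1 + x) ^ Suc M" using K[OF a] by linarith
    also have "\<dots> \<le> K * (1 + x) ^ Suc M + C * (1 + x1) ^ Suc M * (1 + x) ^ Suc M"
      using K0 one_le_1x[OF x, of "Suc M"] by (intro add_right_mono mult_left_mono)
    finally show "\<bar>g a x\<bar> \<le> (K + C * (1 + x1) ^ Suc M) * (1 + x) ^ Suc M * h x powr (- 0)"
      using h_nz[OF x] by (simp add: distrib_right)
  qed
qed

lemma orders_h_quots:
  "orders P p (\<lambda>a x. h2 x / h x)" "orders P (1 + p) (\<lambda>a x. h3 x / h x)" "orders P (2 + p) (\<lambda>a x. h4 x / h x)"
  by (rule ordersI[where C = A and M = 0], use h2_quot h3_quot h4_quot in simp)+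

lemma d_h2_quot: "x \<in> I \<Longrightarrow> ((\<lambda>x. h2 x / h x) has_real_derivative h3 x / h x - L x * (h2 x / h x)) (at x)"
  using h_nz[of x] by (auto intro!: derivative_eq_intros dh dh2 simp: L_def field_simps)

lemma d_h3_quot: "x \<in> I \<Longrightarrow> ((\<lambda>x. h3 x / h x) has_real_derivative h4 x / h x - L x * (h3 x / h x)) (at x)"
  using h_nz[of x] by (auto intro!: derivative_eq_intros dh dh3 simp: L_def field_simps)

definition potential :: "(real \<Rightarrow> real) \<Rightarrow> real \<Rightarrow> real" where
  "potential b x = b x + h2 x / (2 * h x)"
definition potential1 :: "(real \<Rightarrow> real) \<Rightarrow> real \<Rightarrow> real" where
  "potential1 b1 x = b1 x + (1/2) * (h3 x / h x - L x * (h2 x / h x))"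
definition potential2 :: "(real \<Rightarrow> real) \<Rightarrow> real \<Rightarrow> real" where
  "potential2 b2 x = b2 x + (1/2) * (h4 x / h x - L x * (h3 x / h x)
     - (L1 x * (h2 x / h x) + L x * (h3 x / h x - L x * (h2 x / h x))))"

lemma d_potential:
  assumes x: "x \<in> I" and b: "(b has_real_derivative b1 x) (at x)"
  shows "(potential b has_real_derivative potential1 b1 x) (at x)"
proof -
  have eq: "potential b = (\<lambda>x. b x + (1/2) * (h2 x / h x))" by (simp add: potential_def fun_eq_iff)
  show ?thesis unfolding eq potential1_def by (intro DERIV_add b DERIV_cmult d_h2_quot x)
qed

lemma d_potential1:
  assumes x: "x \<in> I" and b: "(b1 has_real_derivative b2 x) (at x)"
  shows "(potential1 b1 has_real_derivative potential2 b2 x) (at x)"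
  unfolding potential1_def [abs_def] potential2_def
  by (intro DERIV_add b DERIV_cmult DERIV_diff DERIV_cong[OF DERIV_mult[OF dL[OF x] d_h2_quot[OF x]]] d_h3_quot x)
     (simp add: algebra_simps)

lemma cont_potential2: "continuous_on I b2 \<Longrightarrow> continuous_on I (potential2 b2)"
  unfolding potential2_def [abs_def]
  by (intro continuous_intros cont_h cont_h2 cont_h3 cont_h4 cont_L cont_L1) (use h_nz in auto)

lemma orders_potential1:
  assumes "\<And>x. x \<in> I \<Longrightarrow> \<bar>b1 x\<bar> \<le> K"
  shows "orders P (p + 1) (\<lambda>a. potential1 b1)"
proof -
  have b: "orders P 0 (\<lambda>a. b1)" by (rule orders_bounded) (rule assms)
  show ?thesis unfolding potential1_def [abs_def] using p
    by (intro orders_add orders_mono[OF b] orders_cmult orders_diff orders_mono[OF orders_h_quots(2)]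
        orders_mult[OF orders_L orders_h_quots(1)]) auto
qed

lemma orders_potential2:
  assumes "\<And>x. x \<in> I \<Longrightarrow> \<bar>b2 x\<bar> \<le> K"
  shows "orders P (p + 2) (\<lambda>a. potential2 b2)"
proof -
  have b: "orders P 0 (\<lambda>a. b2)" by (rule orders_bounded) (rule assms)
  have i: "orders P (1 + p) (\<lambda>a x. h3 x / h x - L x * (h2 x / h x))"
    by (intro orders_diff orders_h_quots orders_mult[OF orders_L orders_h_quots(1)]) auto
  show ?thesis unfolding potential2_def [abs_def] using p
    by (intro orders_add orders_mono[OF b] orders_cmult orders_diff orders_mono[OF orders_h_quots(3)]
        orders_mult[OF orders_L orders_h_quots(2)] orders_mult[OF orders_L1 orders_h_quots(1)]
        orders_mult[OF orders_L i]) auto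
qed

lemma potential_upper: "x \<in> I \<Longrightarrow> potential b x \<le> b x"
  using h2_nonpos[of x] h_pos[of x] by (simp add: potential_def divide_nonpos_pos)

lemma potential_abs: "x \<in> I \<Longrightarrow> \<bar>potential b x\<bar> \<le> \<bar>b x\<bar> + A * h x powr (- p)"
proof -
  assume x: "x \<in> I"
  have "\<bar>h2 x / (2 * h x)\<bar> \<le> \<bar>h2 x / h x\<bar>" using h_pos[OF x] by (simp add: divide_left_mono)
  then show ?thesis using h2_quot[OF x] by (simp add: potential_def)
qed

text \<open>The two definite descriptions have equivalent defining predicates, so they agree for all
  arguments and existence or uniqueness need not be discussed here.\<close>

lemma bem_step_eq:
  assumes I: "I = ival r" and h1: "\<And>x. x \<in> I \<Longrightarrow> h1 x = deriv h x"
  shows "bem_step r \<sigma> h y d s = J ((\<sigma> y)\<^sup>2 * s) (y + \<sigma> y * d)"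
proof -
  have "(x \<in> ival r \<and> x = y + \<sigma> y * d + s * (\<sigma> y)\<^sup>2 * (deriv h x / h x)) \<longleftrightarrow>
      (x \<in> I \<and> x - (\<sigma> y)\<^sup>2 * s * L x = y + \<sigma> y * d)" for x
    using h1[of x] by (auto simp: I L_def algebra_simps)
  then show ?thesis unfolding bem_step_def J_def by simp
qed

end

lemma inverse_square_derivs:
  fixes \<sigma> \<sigma>1 \<sigma>2 :: "real \<Rightarrow> real"
  assumes "0 < \<sigma> x" "(\<sigma> has_real_derivative \<sigma>1 x) (at x)" "(\<sigma>1 has_real_derivative \<sigma>2 x) (at x)"
  shows "((\<lambda>x. 1 / (\<sigma> x)\<^sup>2) has_real_derivative - 2 * \<sigma>1 x / (\<sigma> x) ^ 3) (at x)"
    and "((\<lambda>x. - 2 * \<sigma>1 x / (\<sigma> x) ^ 3) has_real_derivative 6 * (\<sigma>1 x)\<^sup>2 / (\<sigma> x) ^ 4 - 2 * \<sigma>2 x / (\<sigma> x) ^ 3) (at x)"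
  using assms by (auto intro!: derivative_eq_intros simp: field_simps eval_nat_numeral)

text \<open>Both suprema dominate nonnegative values, so each term is bounded by the sum. Since they
  are taken in \<open>ereal\<close>, finiteness is part of the assumed bound.\<close>

lemma sup_bounds_split:
  fixes f g :: "real \<Rightarrow> real"
  assumes "(SUP t\<in>S. ereal \<bar>f t\<bar>) + (SUP t\<in>S. ereal \<bar>g t\<bar>) \<le> ereal c" "t \<in> S"
  shows "\<bar>f t\<bar> \<le> c" "\<bar>g t\<bar> \<le> c"
proof -
  have f: "ereal \<bar>f t\<bar> \<le> (SUP t\<in>S. ereal \<bar>f t\<bar>)" and g: "ereal \<bar>g t\<bar> \<le> (SUP t\<in>S. ereal \<bar>g t\<bar>)"
    using assms(2) by (auto intro: SUP_upper)
  have "ereal \<bar>f t\<bar> + ereal \<bar>g t\<bar> \<le> ereal c"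
    using add_mono[OF f g] assms(1) by (rule order_trans)
  then show "\<bar>f t\<bar> \<le> c" "\<bar>g t\<bar> \<le> c" by auto
qed

section \<open>The weak error of the BEM scheme\<close>

lemma Ckb_on_2E:
  assumes "Ckb_on 2 S f" "open S"
  obtains K where "0 \<le> K" "\<forall>x\<in>S. \<bar>f x\<bar> \<le> K" "\<forall>x\<in>S. \<bar>deriv f x\<bar> \<le> K"
    "\<forall>x\<in>S. \<bar>(deriv ^^ 2) f x\<bar> \<le> K"
proof -
  have "\<exists>B. \<forall>x\<in>S. \<bar>(deriv ^^ j) f x\<bar> \<le> B" if "j \<le> 2" for j
    using assms(1) that unfolding Ckb_on_def bounded_iff by auto
  from this[of 0] this[of 1] this[of 2] obtain B0 B1 B2 where
    "\<forall>x\<in>S. \<bar>f x\<bar> \<le> B0" "\<forall>x\<in>S. \<bar>deriv f x\<bar> \<le> B1" "\<forall>x\<in>S. \<bar>(deriv ^^ 2) f x\<bar> \<le> B2"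
    by (auto simp: numeral_2_eq_2)
  then show thesis
    by (intro that[of "\<bar>B0\<bar> + \<bar>B1\<bar> + \<bar>B2\<bar>"]) fastforce+
qed

lemma one_plus_power_le: "0 \<le> x \<Longrightarrow> 1 + x ^ m \<le> 2 * (1 + x :: real) ^ m"
proof -
  assume "0 \<le> x"
  then have "1 \<le> (1 + x) ^ m" "x ^ m \<le> (1 + x) ^ m" by (auto intro: one_le_power power_mono)
  then show ?thesis by linarith
qed

theorem theorem4p1:
  fixes r :: ereal
    and \<sigma> b h g :: "real \<Rightarrow> real"
    and \<Omega> :: "'w set"
    and F :: "real \<Rightarrow> 'w measure"
    and X :: "real \<Rightarrow> 'w \<Rightarrow> real"
    and P Q :: "real \<Rightarrow> 'w measure"
    and B W :: "real \<Rightarrow> real \<Rightarrow> 'w \<Rightarrow> real"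
    and T x0 p Kh Kv :: real
    and m :: nat
    and v vt :: "real \<Rightarrow> real \<Rightarrow> real"
  assumes setting: "standing_setting r \<sigma> \<Omega> F X P B"
    and h_class: "class_H r \<sigma> h"
    and Q: "\<And>x. x \<in> ival r \<Longrightarrow> transformed_diffusion r \<sigma> h x \<Omega> F X (Q x) (W x)"
    and T: "0 < T"
    and x0: "x0 \<in> ival r"
    \<comment> \<open>(1)\<close>
    and h_C4: "Ck_on 4 (ival r) h"
    and h_pos: "\<And>x. x \<in> ival r \<Longrightarrow> 0 < h x"
    and p: "0 \<le> p" "p \<le> 1/2"
    and h_bounds: "\<And>k x. k \<in> {2, 3, 4::nat} \<Longrightarrow> x \<in> ival r \<Longrightarrow>
          \<bar>(deriv ^^ k) h x\<bar> / h x < Kh / h x powr (p + real k - 2)"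
    \<comment> \<open>(2)\<close>
    and \<sigma>_C2b: "Ckb_on 2 (ival r) \<sigma>"
    and \<sigma>_away: "\<exists>c>0. \<forall>x\<in>ival r. c \<le> \<sigma> x"
    \<comment> \<open>(3)\<close>
    and b_C2b: "Ckb_on 2 (ival r) b"
    \<comment> \<open>(4)\<close>
    and g_cont: "continuous_on (ival r) g"
    and g_growth: "poly_growth_on (ival r) g"
    and g_0: "(g \<longlongrightarrow> 0) (at_right 0)"
    and g_r: "r < \<infinity> \<Longrightarrow> (g \<longlongrightarrow> 0) (at_left (real_of_ereal r))"
    \<comment> \<open>(5)\<close>
    and v_integrable: "\<And>t x. t \<in> {0..T} \<Longrightarrow> x \<in> ival r \<Longrightarrow>
          integrable (Q x) (fk_functional \<sigma> b h g X t)"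
    and v_def: "\<And>t x. t \<in> {0..T} \<Longrightarrow> x \<in> ival r \<Longrightarrow>
          v (T - t) x = (\<integral>\<omega>. fk_functional \<sigma> b h g X t \<omega> \<partial>Q x)"
    and v_C14: "C14_on T (ival r) v vt"
    and v_pde: "\<And>t x. t \<in> {0..T} \<Longrightarrow> x \<in> ival r \<Longrightarrow>
          vt t x + (\<sigma> x)\<^sup>2 / 2 * (deriv ^^ 2) (v t) x
            + (\<sigma> x)\<^sup>2 * (deriv h x / h x) * deriv (v t) x
          = - (\<sigma> x)\<^sup>2 * v t x * (b x + (deriv ^^ 2) h x / (2 * h x))"
    and v_bounds: "\<And>k x. k \<in> {1, 2::nat} \<Longrightarrow> x \<in> ival r \<Longrightarrow>
          (SUP t\<in>{0..T}. ereal \<bar>(deriv ^^ k) (vt t) x\<bar>)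
            + (SUP t\<in>{0..T}. ereal \<bar>(deriv ^^ k) (v t) x\<bar>)
          \<le> ereal (Kv * (1 + x ^ m) * h x powr (2 - p - real k))"
  shows "\<exists>K::real. \<forall>N::nat. 1 < N \<longrightarrow>
           integrable (Q x0) (bem_error r \<sigma> b h g T x0 X (W x0) N) \<and>
           \<bar>\<integral>\<omega>. bem_error r \<sigma> b h g T x0 X (W x0) N \<omega> \<partial>Q x0\<bar> \<le> K * T / real N"
proof -
  let ?I = "ival r"
  have r: "0 < r" and filt: "filtration \<Omega> F"
    using setting unfolding standing_setting_def path_space_def by blast+

  \<comment> \<open>The function \<open>h\<close>\<close>
  note op = open_ival[OF r]
  have s: "Suc 0 = 1" "Suc 1 = 2" "Suc 2 = (3::nat)" "Suc 3 = (4::nat)" "(deriv ^^ 0) = (\<lambda>f. f)" "(deriv ^^ 1) = deriv"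
    by (simp_all add: fun_eq_iff)
  have dh: "(h has_real_derivative deriv h x) (at x)" "(deriv h has_real_derivative (deriv ^^ 2) h x) (at x)"
    "((deriv ^^ 2) h has_real_derivative (deriv ^^ 3) h x) (at x)"
    "((deriv ^^ 3) h has_real_derivative (deriv ^^ 4) h x) (at x)" if "x \<in> ?I" for x
    using Ck_on_deriv[OF h_C4 op, of 0 x, unfolded s] Ck_on_deriv[OF h_C4 op, of 1 x, unfolded s]
      Ck_on_deriv[OF h_C4 op, of 2 x, unfolded s] Ck_on_deriv[OF h_C4 op, of 3 x, unfolded s] that by simp_all
  obtain c where c: "\<forall>x\<in>?I. h x \<le> c * x \<and> (r < \<infinity> \<longrightarrow> h x \<le> c * (real_of_ereal r - x))"
    using class_H_concave(2)[OF r h_class] by blast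
  interpret PC: positive_concave r h "deriv h" "(deriv ^^ 2) h" c x0
    by unfold_locales (use r x0 dh h_pos c class_H_concave(1)[OF r h_class] in auto)
  obtain K0 where K0: "0 < K0" "\<And>x. x \<in> ?I \<Longrightarrow> 1 \<le> K0 * ((h x)\<^sup>2 + (deriv h x)\<^sup>2)"
    using PC.nondegenerate by blast
  obtain R \<delta> where R: "0 \<le> R" "0 < \<delta>" "\<And>x. x \<in> ?I \<Longrightarrow> R < x \<Longrightarrow> \<delta> \<le> h x"
    using PC.h_far by blast
  define A where "A = max K0 (max c \<bar>Kh\<bar>)"
  have A: "K0 \<le> A" "c \<le> A" "Kh \<le> A" "0 < A" using K0 by (auto simp: A_def)
  have h_bound: "\<bar>(deriv ^^ k) h x\<bar> \<le> A * h x powr (1 - (p + real k - 2))" if k: "k \<in> {2, 3, 4}" and x: "x \<in> ?I" for k x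
  proof -
    have hx: "0 < h x" by (rule h_pos[OF x])
    have "\<bar>(deriv ^^ k) h x\<bar> < Kh / h x powr (p + real k - 2) * h x"
      using h_bounds[OF k x] hx by (simp add: divide_less_eq)
    also have "\<dots> = Kh * h x powr (1 - (p + real k - 2))"
      using hx powr_diff[of "h x" 1 "p + real k - 2"] by simp
    also have "\<dots> \<le> A * h x powr (1 - (p + real k - 2))" using A by (intro mult_right_mono) auto
    finally show ?thesis by simp
  qed
  interpret CW: concave_weight ?I h "deriv h" "(deriv ^^ 2) h" "(deriv ^^ 3) h" "(deriv ^^ 4) h" A p R \<delta>
  proof
    show "continuous_on ?I ((deriv ^^ 4) h)" by (rule Ck_on_cont[OF h_C4]) simp
    fix x assume x: "x \<in> ?I"
    have x0: "0 < x" by (rule PC.ival_pos[OF x])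
    show "\<bar>deriv h x\<bar> \<le> A" using PC.h1_abs[OF x] A by simp
    show "1 \<le> A * ((h x)\<^sup>2 + (deriv h x)\<^sup>2)"
      using K0(2)[OF x] mult_right_mono[OF A(1), of "(h x)\<^sup>2 + (deriv h x)\<^sup>2"] by simp
    have "c * x \<le> A * (1 + x)" using A x0 by (intro mult_mono) auto
    then show "h x \<le> A * (1 + x)" using PC.h_left[OF x] by simp
    show "\<bar>(deriv ^^ 2) h x\<bar> \<le> A * h x powr (1 - p)" using h_bound[of 2 x] x by simp
    show "\<bar>(deriv ^^ 3) h x\<bar> \<le> A * h x powr (- p)" using h_bound[of 3 x] x by simp
    show "\<bar>(deriv ^^ 4) h x\<bar> \<le> A * h x powr (- 1 - p)" using h_bound[of 4 x] x by simp
  qed (use op convex_ival[OF r] PC.ival_pos dh h_pos PC.h2_nonpos PC.x_h1_le R p PC.resolvent_surj in auto)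

  \<comment> \<open>The coefficients \<sigma> and \<open>b\<close>\<close>
  obtain K\<sigma> where K\<sigma>: "0 \<le> K\<sigma>" "\<forall>x\<in>?I. \<bar>\<sigma> x\<bar> \<le> K\<sigma>" "\<forall>x\<in>?I. \<bar>deriv \<sigma> x\<bar> \<le> K\<sigma>"
    "\<forall>x\<in>?I. \<bar>(deriv ^^ 2) \<sigma> x\<bar> \<le> K\<sigma>" using Ckb_on_2E[OF \<sigma>_C2b op] by blast
  obtain Kb where Kb: "0 \<le> Kb" "\<forall>x\<in>?I. \<bar>b x\<bar> \<le> Kb" "\<forall>x\<in>?I. \<bar>deriv b x\<bar> \<le> Kb"
    "\<forall>x\<in>?I. \<bar>(deriv ^^ 2) b x\<bar> \<le> Kb" using Ckb_on_2E[OF b_C2b op] by blast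
  obtain c0 where c0: "0 < c0" "\<forall>x\<in>?I. c0 \<le> \<sigma> x" using \<sigma>_away by blast
  have Ck2: "Ck_on 2 ?I \<sigma>" "Ck_on 2 ?I b" using \<sigma>_C2b b_C2b by (auto simp: Ckb_on_def)
  have d\<sigma>: "(\<sigma> has_real_derivative deriv \<sigma> x) (at x)" "(deriv \<sigma> has_real_derivative (deriv ^^ 2) \<sigma> x) (at x)"
    and db: "(b has_real_derivative deriv b x) (at x)" "(deriv b has_real_derivative (deriv ^^ 2) b x) (at x)"
    if "x \<in> ?I" for x
    using Ck_on_deriv[OF Ck2(1) op, of 0 x, unfolded s] Ck_on_deriv[OF Ck2(1) op, of 1 x, unfolded s]
      Ck_on_deriv[OF Ck2(2) op, of 0 x, unfolded s] Ck_on_deriv[OF Ck2(2) op, of 1 x, unfolded s] that by simp_all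
  have \<sigma>_pos: "0 < \<sigma> x" if "x \<in> ?I" for x using c0 that by fastforce
  define \<rho> \<rho>1 \<rho>2 where "\<rho> = (\<lambda>x. 1 / (\<sigma> x)\<^sup>2)" and "\<rho>1 = (\<lambda>x. - 2 * deriv \<sigma> x / (\<sigma> x) ^ 3)"
    and "\<rho>2 = (\<lambda>x. 6 * (deriv \<sigma> x)\<^sup>2 / (\<sigma> x) ^ 4 - 2 * (deriv ^^ 2) \<sigma> x / (\<sigma> x) ^ 3)"
  define B1 where "B1 = 1 / c0\<^sup>2 + 2 * K\<sigma> / c0 ^ 3 + (6 * K\<sigma>\<^sup>2 / c0 ^ 4 + 2 * K\<sigma> / c0 ^ 3)"
  define B where "B = K\<sigma>\<^sup>2 + B1 + Kb + A"
  have pieces: "0 \<le> 1 / c0\<^sup>2" "0 \<le> 2 * K\<sigma> / c0 ^ 3" "0 \<le> 6 * K\<sigma>\<^sup>2 / c0 ^ 4" using c0 K\<sigma>(1) by auto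
  then have B1: "0 \<le> B1" by (simp add: B1_def)
  have B: "K\<sigma>\<^sup>2 \<le> B" "B1 \<le> B" "Kb \<le> B" "A \<le> B" "Kb + A \<le> B" using B1 Kb A by (auto simp: B_def)
  have \<rho>_bd: "\<bar>\<rho> x\<bar> \<le> B1" "\<bar>\<rho>1 x\<bar> \<le> B1" "\<bar>\<rho>2 x\<bar> \<le> B1" if x: "x \<in> ?I" for x
  proof -
    have sx: "0 < \<sigma> x" "c0 \<le> \<sigma> x" using \<sigma>_pos c0 x by auto
    have q: "c0 ^ n \<le> \<sigma> x ^ n" for n using c0 sx by (intro power_mono) auto
    have fr: "\<bar>a / \<sigma> x ^ n\<bar> \<le> a' / c0 ^ n" if "\<bar>a\<bar> \<le> a'" for a a' n
    proof -
      have "\<bar>a / \<sigma> x ^ n\<bar> = \<bar>a\<bar> / \<sigma> x ^ n" using sx by (simp add: abs_divide)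
      also have "\<dots> \<le> a' / c0 ^ n" using that q[of n] c0 by (intro frac_le) auto
      finally show ?thesis .
    qed
    have f0: "\<bar>\<rho> x\<bar> \<le> 1 / c0\<^sup>2" unfolding \<rho>_def by (rule fr) simp
    have f1: "\<bar>2 * deriv \<sigma> x / \<sigma> x ^ 3\<bar> \<le> 2 * K\<sigma> / c0 ^ 3"
      by (rule fr) (use K\<sigma> x in \<open>simp add: abs_mult\<close>)
    have f2: "\<bar>2 * (deriv ^^ 2) \<sigma> x / \<sigma> x ^ 3\<bar> \<le> 2 * K\<sigma> / c0 ^ 3"
      by (rule fr) (use K\<sigma> x in \<open>simp add: abs_mult\<close>)
    have f3: "\<bar>6 * (deriv \<sigma> x)\<^sup>2 / \<sigma> x ^ 4\<bar> \<le> 6 * K\<sigma>\<^sup>2 / c0 ^ 4"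
    proof (rule fr)
      have "\<bar>deriv \<sigma> x\<bar>\<^sup>2 \<le> K\<sigma>\<^sup>2" using K\<sigma> x by (intro power_mono) auto
      then show "\<bar>6 * (deriv \<sigma> x)\<^sup>2\<bar> \<le> 6 * K\<sigma>\<^sup>2" by simp
    qed
    have e: "\<rho>1 x = - (2 * deriv \<sigma> x / \<sigma> x ^ 3)" by (simp add: \<rho>1_def)
    show "\<bar>\<rho> x\<bar> \<le> B1" using f0 pieces unfolding B1_def by linarith
    show "\<bar>\<rho>1 x\<bar> \<le> B1" using f1 pieces unfolding B1_def e by linarith
    show "\<bar>\<rho>2 x\<bar> \<le> B1" using f2 f3 pieces unfolding B1_def \<rho>2_def by linarith
  qed

  \<comment> \<open>Regularity and growth of \<open>v\<close> and its time derivative\<close>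
  define \<kappa> where "\<kappa> = CW.potential b"
  have C14: "((\<lambda>s. v s x) has_real_derivative vt t x) (at t within {0..T})" if "t \<in> {0..T}" "x \<in> ?I" for t x
    using v_C14 that unfolding C14_on_def by blast
  have cvt: "continuous_on ({0..T} \<times> ?I) (\<lambda>(t, x). vt t x)"
    and cv: "j \<le> 4 \<Longrightarrow> continuous_on ({0..T} \<times> ?I) (\<lambda>(t, x). (deriv ^^ j) (v t) x)" for j
    using v_C14 unfolding C14_on_def by blast+
  have slice: "continuous_on ?I (f t)" if "continuous_on ({0..T} \<times> ?I) (\<lambda>(t, x). f t x)" "t \<in> {0..T}"
    for f :: "real \<Rightarrow> real \<Rightarrow> real" and t
  proof -
    have "continuous_on ?I (\<lambda>x. (\<lambda>(t, x). f t x) (t, x))"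
      by (rule continuous_on_compose2[OF that(1)]) (use that(2) in \<open>auto intro!: continuous_intros\<close>)
    then show ?thesis by simp
  qed
  have v_Ck: "Ck_on 4 ?I (v t)" if "t \<in> {0..T}" for t
    unfolding Ck_on_def
  proof (intro conjI allI impI)
    show "(deriv ^^ j) (v t) differentiable_on ?I" if "j < 4" for j
      using v_C14 \<open>t \<in> {0..T}\<close> that unfolding C14_on_def by blast
    show "continuous_on ?I ((deriv ^^ j) (v t))" if "j \<le> 4" for j
      by (rule slice[OF cv[OF that] \<open>t \<in> {0..T}\<close>])
  qed
  have dvx: "(v t has_real_derivative deriv (v t) x) (at x)" "(deriv (v t) has_real_derivative (deriv ^^ 2) (v t) x) (at x)"
    if "t \<in> {0..T}" "x \<in> ?I" for t x
    using Ck_on_deriv[OF v_Ck[OF that(1)] op, of 0 x, unfolded s]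
      Ck_on_deriv[OF v_Ck[OF that(1)] op, of 1 x, unfolded s] that by simp_all
  \<comment> \<open>\<open>vt\<close> inherits two space derivatives from the four of \<open>v\<close> through the equation\<close>
  have vt_C2: "C2_on ?I (vt t)" if t: "t \<in> {0..T}" for t
  proof (rule C2_on_cong[OF _ op])
    have "C2_on ?I CW.L"
    proof (rule C2_onI)
      show "(CW.L has_real_derivative CW.L1 x) (at x)" if "x \<in> ?I" for x by (rule CW.dL[OF that])
      show "(CW.L1 has_real_derivative CW.L2 x) (at x)" if "x \<in> ?I" for x by (rule CW.dL1[OF that])
      show "continuous_on ?I CW.L2" by (rule CW.cont_L2)
    qed
    moreover have "C2_on ?I \<sigma>" using Ck_on_C2_on[OF Ck2(1) op, of 0, unfolded s] by simp
    moreover have "C2_on ?I \<kappa>"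
    proof (rule C2_onI)
      show "(\<kappa> has_real_derivative CW.potential1 (deriv b) x) (at x)" if "x \<in> ?I" for x
        unfolding \<kappa>_def by (intro CW.d_potential db(1) that)
      show "(CW.potential1 (deriv b) has_real_derivative CW.potential2 ((deriv ^^ 2) b) x) (at x)"
        if "x \<in> ?I" for x
        by (intro CW.d_potential1 db(2) that)
      show "continuous_on ?I (CW.potential2 ((deriv ^^ 2) b))"
        by (rule CW.cont_potential2[OF Ck_on_cont[OF Ck2(2)]]) simp
    qed
    moreover have "C2_on ?I (v t)" "C2_on ?I (deriv (v t))" "C2_on ?I ((deriv ^^ 2) (v t))"
      using Ck_on_C2_on[OF v_Ck[OF t] op, of 0, unfolded s] Ck_on_C2_on[OF v_Ck[OF t] op, of 1, unfolded s]
        Ck_on_C2_on[OF v_Ck[OF t] op, of 2] by simp_all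
    ultimately show "C2_on ?I (\<lambda>x. (- 1) * ((\<sigma> x * \<sigma> x) *
        ((1/2) * (deriv ^^ 2) (v t) x + (CW.L x * deriv (v t) x + \<kappa> x * v t x))))"
      by (intro C2_on_mult C2_on_add C2_on_const)
    show "vt t x = (- 1) * ((\<sigma> x * \<sigma> x) *
        ((1/2) * (deriv ^^ 2) (v t) x + (CW.L x * deriv (v t) x + \<kappa> x * v t x)))" if "x \<in> ?I" for x
      using v_pde[OF t that] by (simp add: \<kappa>_def CW.potential_def CW.L_def power2_eq_square algebra_simps)
  qed
  have vb: "\<bar>(deriv ^^ k) (vt t) x\<bar> \<le> 2 * \<bar>Kv\<bar> * (1 + x) ^ m * h x powr (- (p + real k - 2))"
    "\<bar>(deriv ^^ k) (v t) x\<bar> \<le> 2 * \<bar>Kv\<bar> * (1 + x) ^ m * h x powr (- (p + real k - 2))"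
    if k: "k \<in> {1, 2}" and t: "t \<in> {0..T}" and x: "x \<in> ?I" for k t x
  proof -
    have x0: "0 < x" by (rule PC.ival_pos[OF x])
    have "Kv * (1 + x ^ m) * h x powr (2 - p - real k) \<le> \<bar>Kv\<bar> * (2 * (1 + x) ^ m) * h x powr (2 - p - real k)"
      using one_plus_power_le[of x m] x0 by (intro mult_right_mono mult_mono) auto
    also have "\<dots> = 2 * \<bar>Kv\<bar> * (1 + x) ^ m * h x powr (- (p + real k - 2))" by (simp add: algebra_simps)
    finally show "\<bar>(deriv ^^ k) (vt t) x\<bar> \<le> 2 * \<bar>Kv\<bar> * (1 + x) ^ m * h x powr (- (p + real k - 2))"
      "\<bar>(deriv ^^ k) (v t) x\<bar> \<le> 2 * \<bar>Kv\<bar> * (1 + x) ^ m * h x powr (- (p + real k - 2))"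
      using sup_bounds_split[OF v_bounds[OF k x] t] by linarith+
  qed
  have o1: "CW.orders {0..T} (p - 1) (\<lambda>t. deriv (vt t))" "CW.orders {0..T} (p - 1) (\<lambda>t. deriv (v t))"
    by (rule CW.ordersI[where C = "2 * \<bar>Kv\<bar>" and M = m], use vb[of 1] in simp)+
  have o2: "CW.orders {0..T} p (\<lambda>t. (deriv ^^ 2) (vt t))" "CW.orders {0..T} p (\<lambda>t. (deriv ^^ 2) (v t))"
    by (rule CW.ordersI[where C = "2 * \<bar>Kv\<bar>" and M = m], use vb[of 2] in simp)+
  have bounded_at_x0: "\<exists>K. \<forall>t\<in>{0..T}. \<bar>f t x0\<bar> \<le> K" if "continuous_on ({0..T} \<times> ?I) (\<lambda>(t, x). f t x)"
    for f :: "real \<Rightarrow> real \<Rightarrow> real"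
  proof -
    have "continuous_on {0..T} (\<lambda>t. (\<lambda>(t, x). f t x) (t, x0))"
      by (rule continuous_on_compose2[OF that]) (use x0 in \<open>auto intro!: continuous_intros\<close>)
    then have "bounded ((\<lambda>t. f t x0) ` {0..T})"
      by (intro compact_imp_bounded compact_continuous_image) auto
    then show ?thesis by (auto simp: bounded_iff)
  qed
  have cv0: "continuous_on ({0..T} \<times> ?I) (\<lambda>(t, x). v t x)" using cv[of 0] by simp
  have o0: "CW.orders {0..T} 0 vt" "CW.orders {0..T} 0 v"
  proof -
    \<comment> \<open>The assumed bounds concern the first two space derivatives. The first has
      order \<open>p - 1\<close>, which may be raised to 0, and integration from \<open>x0\<close>
      then bounds \<open>v\<close> and \<open>vt\<close> themselves.\<close>
    have p1: "p - 1 \<le> 0" using p by simp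
    obtain K1 K2 where "\<forall>t\<in>{0..T}. \<bar>vt t x0\<bar> \<le> K1" "\<forall>t\<in>{0..T}. \<bar>v t x0\<bar> \<le> K2"
      using bounded_at_x0[OF cvt] bounded_at_x0[OF cv0] by blast
    then show "CW.orders {0..T} 0 vt" "CW.orders {0..T} 0 v"
      using CW.orders_primitive[OF C2_on_derivs(1)[OF vt_C2 op] CW.orders_mono[OF o1(1) p1] x0, of K1]
        CW.orders_primitive[OF dvx(1) CW.orders_mono[OF o1(2) p1] x0, of K2] by blast+
  qed
  interpret BC: bem_coefficients ?I h "deriv h" "(deriv ^^ 2) h" "(deriv ^^ 3) h" "(deriv ^^ 4) h" A p R \<delta>
    \<sigma> \<rho> \<rho>1 \<rho>2 \<kappa> "CW.potential1 (deriv b)" "CW.potential2 ((deriv ^^ 2) b)"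
    v vt "\<lambda>t. deriv (v t)" "\<lambda>t. (deriv ^^ 2) (v t)" "\<lambda>t. deriv (vt t)" "\<lambda>t. (deriv ^^ 2) (vt t)" T B
  proof
    show "0 < T" by (rule T)
    show "continuous_on ({0..T} \<times> ?I) (\<lambda>(t, x). v t x)" "continuous_on ({0..T} \<times> ?I) (\<lambda>(t, x). vt t x)"
      "continuous_on ({0..T} \<times> ?I) (\<lambda>(t, x). deriv (v t) x)" "continuous_on ({0..T} \<times> ?I) (\<lambda>(t, x). (deriv ^^ 2) (v t) x)"
      using cv0 cvt cv[of 1, unfolded s] cv[of 2] by simp_all
    show "CW.orders (UNIV :: unit set) (p + 1) (\<lambda>_. CW.potential1 (deriv b))"
      by (rule CW.orders_potential1[where K = Kb]) (use Kb in auto)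
    show "CW.orders (UNIV :: unit set) (p + 2) (\<lambda>_. CW.potential2 ((deriv ^^ 2) b))"
      by (rule CW.orders_potential2[where K = Kb]) (use Kb in auto)
    show "continuous_on ?I (CW.potential2 ((deriv ^^ 2) b))"
      by (rule CW.cont_potential2[OF Ck_on_cont[OF Ck2(2)]]) simp
    show "continuous_on ?I \<rho>2" unfolding \<rho>2_def
      using Ck_on_cont[OF Ck2(1), of 0, unfolded s] Ck_on_cont[OF Ck2(1), of 1, unfolded s]
        Ck_on_cont[OF Ck2(1), of 2] \<sigma>_pos
      by (intro continuous_intros) (auto simp: less_imp_neq[symmetric])
    show "CW.orders {0..T} 0 v" "CW.orders {0..T} 0 vt"
      "CW.orders {0..T} (p - 1) (\<lambda>t. deriv (v t))" "CW.orders {0..T} p (\<lambda>t. (deriv ^^ 2) (v t))"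
      "CW.orders {0..T} (p - 1) (\<lambda>t. deriv (vt t))" "CW.orders {0..T} p (\<lambda>t. (deriv ^^ 2) (vt t))"
      using o0 o1 o2 by blast+
    fix x assume x: "x \<in> ?I"
    show "0 < \<sigma> x" by (rule \<sigma>_pos[OF x])
    have "\<bar>\<sigma> x\<bar>\<^sup>2 \<le> K\<sigma>\<^sup>2" using K\<sigma> x by (intro power_mono) auto
    then show "(\<sigma> x)\<^sup>2 \<le> B" using B by simp
    show "\<rho> x = 1 / (\<sigma> x)\<^sup>2" by (simp add: \<rho>_def)
    show "(\<rho> has_real_derivative \<rho>1 x) (at x)" "(\<rho>1 has_real_derivative \<rho>2 x) (at x)"
      unfolding \<rho>_def \<rho>1_def \<rho>2_def
      using inverse_square_derivs[where \<sigma> = \<sigma> and ?\<sigma>1.0 = "deriv \<sigma>" and ?\<sigma>2.0 = "(deriv ^^ 2) \<sigma>"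
          and x = x, OF \<sigma>_pos[OF x] d\<sigma>[OF x]] by blast+
    show "\<bar>\<rho> x\<bar> \<le> B" "\<bar>\<rho>1 x\<bar> \<le> B" "\<bar>\<rho>2 x\<bar> \<le> B" using \<rho>_bd[OF x] B by auto
    show "(\<kappa> has_real_derivative CW.potential1 (deriv b) x) (at x)"
      unfolding \<kappa>_def by (intro CW.d_potential db(1) x)
    show "(CW.potential1 (deriv b) has_real_derivative CW.potential2 ((deriv ^^ 2) b) x) (at x)"
      by (intro CW.d_potential1 db(2) x)
    have bx: "\<bar>b x\<bar> \<le> Kb" using Kb x by auto
    show "\<kappa> x \<le> B" using CW.potential_upper[OF x, of b] bx B by (simp add: \<kappa>_def)
    have "\<bar>\<kappa> x\<bar> \<le> Kb + A * h x powr (- p)" using CW.potential_abs[OF x, of b] bx by (simp add: \<kappa>_def)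
    also have "\<dots> \<le> B * 1 + B * h x powr (- p)" using B by (intro add_mono mult_right_mono) auto
    finally show "\<bar>\<kappa> x\<bar> \<le> B * (1 + h x powr (- p))" by (simp add: algebra_simps)
    fix t assume t: "t \<in> {0..T}"
    show "((\<lambda>t. v t x) has_real_derivative vt t x) (at t within {0..T})" by (rule C14[OF t x])
    show "(v t has_real_derivative deriv (v t) x) (at x)" "(deriv (v t) has_real_derivative (deriv ^^ 2) (v t) x) (at x)"
      by (rule dvx[OF t x])+
    show "(vt t has_real_derivative deriv (vt t) x) (at x)" "(deriv (vt t) has_real_derivative (deriv ^^ 2) (vt t) x) (at x)"
      by (rule C2_on_derivs(1,2)[OF vt_C2[OF t] op x])+
    have s2: "(\<sigma> x)\<^sup>2 \<noteq> 0" using \<sigma>_pos[OF x] by simp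
    show "CW.L x * deriv (v t) x + (deriv ^^ 2) (v t) x / 2 = - \<rho> x * vt t x - \<kappa> x * v t x"
      using v_pde[OF t x] s2 by (simp add: \<rho>_def \<kappa>_def CW.potential_def CW.L_def field_simps)
  next
    fix t assume t: "t \<in> {0..T}"
    show "continuous_on ?I ((deriv ^^ 2) (vt t))" by (rule C2_on_derivs(3)[OF vt_C2[OF t] op])
  qed

  \<comment> \<open>The scheme, the terminal condition and the error\<close>
  have TD: "transformed_diffusion r \<sigma> h x0 \<Omega> F X (Q x0) (W x0)" by (rule Q[OF x0])
  define Xh where "Xh N n \<omega> = bem_grid r \<sigma> h T N x0 (\<lambda>s. W x0 s \<omega>) n" for N n \<omega>
  interpret BS: bem_scheme ?I h "deriv h" "(deriv ^^ 2) h" "(deriv ^^ 3) h" "(deriv ^^ 4) h" A p R \<delta>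
    \<sigma> \<rho> \<rho>1 \<rho>2 \<kappa> "CW.potential1 (deriv b)" "CW.potential2 ((deriv ^^ 2) b)"
    v vt "\<lambda>t. deriv (v t)" "\<lambda>t. (deriv ^^ 2) (v t)" "\<lambda>t. deriv (vt t)" "\<lambda>t. (deriv ^^ 2) (vt t)" T B
    "Q x0" \<Omega> F "W x0" x0 Xh
  proof (intro bem_scheme.intro bem_scheme_axioms.intro BC.bem_coefficients_axioms)
    show "filtered_prob (Q x0) \<Omega> F" "brownian_motion (Q x0) F (W x0)"
      using TD by (auto simp: transformed_diffusion_def)
    show "filtration \<Omega> F" by (rule filt)
    show "x0 \<in> ?I" by (rule x0)
    show "Xh N 0 \<omega> = x0" for N \<omega> by (simp add: Xh_def)
    show "Xh N (Suc n) \<omega> = CW.J ((\<sigma> (Xh N n \<omega>))\<^sup>2 * (T / N))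
      (Xh N n \<omega> + \<sigma> (Xh N n \<omega>) * (W x0 (real (Suc n) * T / real N) \<omega> - W x0 (real n * T / real N) \<omega>))"
      if "1 \<le> N" for N n \<omega>
    proof -
      have "real (Suc n) * T / real N - real n * T / real N = T / N"
        by (simp add: distrib_right add_divide_distrib)
      then show ?thesis unfolding Xh_def bem_grid.simps by (simp only: CW.bem_step_eq[OF refl refl])
    qed
  qed
  obtain K where K: "\<And>N. 1 \<le> N \<Longrightarrow> integrable (Q x0) (\<lambda>\<omega>. BS.weight N N \<omega> * v T (Xh N N \<omega>))"
    "\<And>N. 1 \<le> N \<Longrightarrow> \<bar>(\<integral>\<omega>. BS.weight N N \<omega> * v T (Xh N N \<omega>) \<partial>Q x0) - v 0 x0\<bar> \<le> K * T / N"
    using BS.weak_error by blast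
  have vT: "v T x = g x / h x" if x: "x \<in> ?I" for x
  proof -
    have td: "transformed_diffusion r \<sigma> h x \<Omega> F X (Q x) (W x)" by (rule Q[OF x])
    then interpret Qx: prob_space "Q x" by (auto simp: transformed_diffusion_def filtered_prob_def)
    have 0: "0 \<in> {0..T}" using T by simp
    have "v T x = (\<integral>\<omega>. fk_functional \<sigma> b h g X 0 \<omega> \<partial>Q x)" using v_def[OF 0 x] by simp
    \<comment> \<open>The initial value is attained only almost surely, so the two integrands agree
      almost everywhere; the time integral over a single point vanishes.\<close>
    also have "\<dots> = (\<integral>\<omega>. g x / h x \<partial>Q x)"
    proof (rule integral_cong_AE)
      show "fk_functional \<sigma> b h g X 0 \<in> borel_measurable (Q x)"
        using v_integrable[OF 0 x] by (rule borel_measurable_integrable)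
      have "AE \<omega> in Q x. X 0 \<omega> = x" using td by (simp add: transformed_diffusion_def)
      then show "AE \<omega> in Q x. fk_functional \<sigma> b h g X 0 \<omega> = g x / h x"
      proof eventually_elim
        case (elim \<omega>)
        have "AE s in lborel. indicator {0::real} s *\<^sub>R fk_rate \<sigma> b h (X s \<omega>) = 0"
          using AE_lborel_singleton[of 0] by eventually_elim auto
        then have "(LBINT s:{0..0}. fk_rate \<sigma> b h (X s \<omega>)) = 0"
          unfolding set_lebesgue_integral_def by (simp add: integral_eq_zero_AE)
        then show ?case using elim by (simp add: fk_functional_def)
      qed
    qed simp
    also have "\<dots> = g x / h x" by (simp add: Qx.prob_space)
    finally show ?thesis .
  qed
  have TT: "T \<in> {0..T}" using T by simp
  have err: "bem_error r \<sigma> b h g T x0 X (W x0) N \<omega> =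
      fk_functional \<sigma> b h g X T \<omega> - BS.weight N N \<omega> * v T (Xh N N \<omega>)" if N: "1 \<le> N" for N \<omega>
  proof -
    have Np: "0 < N" using N by simp
    have g: "bem r \<sigma> h T N x0 (\<lambda>s. W x0 s \<omega>) (real n * T / real N) = Xh N n \<omega>" for n
      unfolding Xh_def by (rule bem_at_grid[OF T Np])
    have gT: "bem r \<sigma> h T N x0 (\<lambda>s. W x0 s \<omega>) T = Xh N N \<omega>"
      using g[of N] Np by simp
    have rate: "fk_rate \<sigma> b h x = BS.rate x" for x
      unfolding fk_rate_def BS.rate_def by (simp add: \<kappa>_def CW.potential_def)
    show ?thesis
      unfolding bem_error_def fk_functional_discrete_def g gT rate BS.weight_def vT[OF BS.X_in[OF N]]
      by (simp add: mult.commute)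
  qed
  show ?thesis
  proof (intro exI allI impI conjI)
    fix N :: nat assume "1 < N"
    then have N: "1 \<le> N" by simp
    note i1 = v_integrable[OF TT x0] and i2 = K(1)[OF N]
    show "integrable (Q x0) (bem_error r \<sigma> b h g T x0 X (W x0) N)"
      unfolding err[OF N, abs_def] by (rule Bochner_Integration.integrable_diff[OF i1 i2])
    have "(\<integral>\<omega>. bem_error r \<sigma> b h g T x0 X (W x0) N \<omega> \<partial>Q x0) =
        v 0 x0 - (\<integral>\<omega>. BS.weight N N \<omega> * v T (Xh N N \<omega>) \<partial>Q x0)"
      unfolding err[OF N] using Bochner_Integration.integral_diff[OF i1 i2] v_def[OF TT x0] by simp
    then show "\<bar>\<integral>\<omega>. bem_error r \<sigma> b h g T x0 X (W x0) N \<omega> \<partial>Q x0\<bar> \<le> K * T / real N"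
      using K(2)[OF N] by (simp add: abs_minus_commute)
  qed
qed

end
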